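(* Let $H$ be a Hopf algebra with twist $\mathcal F\in H\otimes H$, $\mathcal F^{-1}=\bar f^\alpha\otimes\bar f_\alpha$, let $A$ be a left $H$-module algebra, $(\Omega^\bullet,\wedge,\mathrm d)$ a left $H$-covariant differential calculus over $A$ with module of one-forms $\Omega=\Omega^1$, and let $V$ be a left $H$-module $A$-bimodule. The left $H^{\mathcal F}$-module $A_\star$-bimodule isomorphism $$\widetilde D_{\mathcal F}:=\varphi^{-1}\circ D_{\mathcal F}:\mathrm{Hom}_{\mathbb K}(V,V\otimes_A\Omega)_\star\longrightarrow\mathrm{Hom}_{\mathbb K}(V_\star,V_\star\otimes_{A_\star}\Omega_\star)$$ restricts to the left $H^{\mathcal F}$-module $A_\star$-bimodule isomorphism $$\widetilde D_{\mathcal F}:\mathrm{Hom}_A(V,V\otimes_A\Omega)_\star\longrightarrow\mathrm{Hom}_{A_\star}(V_\star,V_\star\otimes_{A_\star}\Omega_\star),\qquad P\longmapsto\varphi^{-1}\circ(\bar f^\alpha\blacktriangleright P)\circ\bar f_\alpha\triangleright,$$ and to the affine space isomorphism $$\widetilde D_{\mathcal F}:\mathrm{Con}_A(V)\longrightarrow\mathrm{Con}_{A_\star}(V_\star),\qquad \nabla\longmapsto\varphi^{-1}\circ(\bar f^\alpha\blacktriangleright\nabla)\circ\bar f_\alpha\triangleright,$$ where $\mathrm{Con}_A(V)$ and $\mathrm{Con}_{A_\star}(V_\star)$ are respectively affine spaces over the isomorphic modules $\mathrm{Hom}_A(V,V\otimes_A\Omega)_\star$ and $\mathrm{Hom}_{A_\star}(V_\star,V_\star\otimes_{A_\star}\Omega_\star)$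 of right $A$-linear, respectively right $A_\star$-linear, morphisms.
   Context: $\mathbb K$ is a commutative ring with unit; modules, algebras (associative, unital) and unadorned tensor products are over $\mathbb K$. For a Hopf algebra $H$ with coproduct $\Delta$, counit $\varepsilon$, antipode $S$, write $\Delta(\xi)=\xi_1\otimes\xi_2$ (sum understood). A left $H$-module algebra is an algebra $A$ with left $H$-action satisfying $\xi\triangleright(ab)=(\xi_1\triangleright a)(\xi_2\triangleright b)$, $\xi\triangleright1=\varepsilon(\xi)1$. A left $H$-module $A$-bimodule is an $A$-bimodule $V$ with left $H$-action satisfying $\xi\triangleright(a\cdot v)=(\xi_1\triangleright a)\cdot(\xi_2\triangleright v)$, $\xi\triangleright(v\cdot a)=(\xi_1\triangleright v)\cdot(\xi_2\triangleright a)$. A twist of $H$ is an invertible $\mathcal F\in H\otimes H$ with $(\mathcal F\otimes 1)(\Delta\otimes\mathrm{id})\mathcal F=(1\otimes\mathcal F)(\mathrm{id}\otimes\Delta)\mathcal F$ and $(\varepsilon\otimes\mathrm{id})\mathcal F=1=(\mathrm{id}\otimes\varepsilon)\mathcal F$. Write $\mathcal F=f^\alpha\otimes f_\alpha$. $H^{\mathcal F}$ is the Hopf algebra with the same algebra structure and counit as $H$, coproduct $\Delta^{\mathcal F}(\xi)=\mathcal F\Delta(\xi)\mathcal F^{-1}=\xi_{1_{\mathcal F}}\otimes\xi_{2_{\mathcal F}}$, antipode $S^{\mathcal F}(\xi)=\chi S(\xi)\chi^{-1}$, $\chi=f^\alpha S(f_\alpha)$. $A_\star$ is the left $H^{\mathcal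 F}$-module algebra equal to $A$ as an $H$-module, with product $a\star b=(\bar f^\alpha\triangleright a)(\bar f_\alpha\triangleright b)$; for a left $H$-module $A$-bimodule $V$, $V_\star$ is the left $H^{\mathcal F}$-module $A_\star$-bimodule equal to $V$ as an $H$-module with $a\star v=(\bar f^\alpha\triangleright a)\cdot(\bar f_\alpha\triangleright v)$, $v\star a=(\bar f^\alpha\triangleright v)\cdot(\bar f_\alpha\triangleright a)$. A differential calculus over $A$ is a graded algebra $(\Omega^\bullet=\bigoplus_{n\ge0}\Omega^n,\wedge)$ with $\Omega^0=A$ and $\mathbb K$-linear maps $\mathrm d:\Omega^n\to\Omega^{n+1}$ with $\mathrm d\circ\mathrm d=0$ and $\mathrm d(\theta\wedge\theta')=(\mathrm d\theta)\wedge\theta'+(-1)^{\deg\theta}\theta\wedge\mathrm d\theta'$, such that every $\theta\in\Omega:=\Omega^1$ is of the form $\sum_ia_i\,\mathrm db_i$ with $a_i,b_i\in A$. It is left $H$-covariant if $A$ and $\Omega^\bullet$ are left $H$-module algebras, the $H$-action preserves degree, and $\xi\triangleright\mathrm d\theta=\mathrm d(\xi\triangleright\theta)$. Then $(\Omega_\star^\bullet,\wedge_\star,\mathrm d)$, with $\theta\wedge_\star\theta'=(\bar f^\alpha\triangleright\theta)\wedge(\bar f_\alpha\triangleright\theta')$, is a left $H^{\mathcal F}$-covariant differential calculus over $A_\star$. A (right) connection on $V$ is a $\mathbb K$-linear map $\nabla:V\to V\otimes_A\Omega$ with $\nabla(v\cdot a)=(\nabla v)\cdot a+v\otimes_A\mathrm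 da$; $\mathrm{Con}_A(V)$ is the set of these. $\mathrm{Con}_{A_\star}(V_\star)$ is defined likewise using $\Omega_\star$. Tensor products over $A$ carry the $H$-action through $\Delta$, those over $A_\star$ the $H^{\mathcal F}$-action through $\Delta^{\mathcal F}$. $\varphi:V_\star\otimes_{A_\star}\Omega_\star\to(V\otimes_A\Omega)_\star$ is the isomorphism $v\otimes_{A_\star}\theta\mapsto(\bar f^\alpha\triangleright v)\otimes_A(\bar f_\alpha\triangleright\theta)$. For left $H$-module $A$-bimodules $V,W$, $\mathrm{Hom}_{\mathbb K}(V,W)$ (all $\mathbb K$-linear maps) and $\mathrm{Hom}_A(V,W)$ (right $A$-linear maps) are left $H$-module $A$-bimodules with $\xi\blacktriangleright P:=\xi_1\triangleright\circ P\circ S(\xi_2)\triangleright$, $a\cdot P=l_a\circ P$, $P\cdot a=P\circ l_a$, where $l_a(v)=a\cdot v$; the subscript $\star$ on Hom denotes the deformed left $H^{\mathcal F}$-module $A_\star$-bimodule that has the same underlying $\mathbb K$-module and the same action $\blacktriangleright$ (now regarded as an $H^{\mathcal F}$-action), with $A_\star$-actions $a\star P=(\bar f^\alpha\triangleright a)\cdot(\bar f_\alpha\blacktriangleright P)$ and $P\star a=(\bar f^\alpha\blacktriangleright P)\cdot(\bar f_\alpha\triangleright a)$. $\mathrm{Hom}_{\mathbb K}(V_\star,W_\star)$ and $\mathrm{Hom}_{A_\star}(V_\star,W_\star)$ are left $H^{\mathcal F}$-module $A_\star$-bimodules with $\xi\blacktriangleright_{\mathcal F}P:=\xi_{1_{\mathcal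 F}}\triangleright\circ P\circ S^{\mathcal F}(\xi_{2_{\mathcal F}})\triangleright$, $a\cdot P=l^\star_a\circ P$, $P\cdot a=P\circ l^\star_a$, $l^\star_a(v)=a\star v$. The quantization map $D_{\mathcal F}:\mathrm{Hom}_{\mathbb K}(V,W)_\star\to\mathrm{Hom}_{\mathbb K}(V_\star,W_\star)$ is $D_{\mathcal F}(P)=(\bar f^\alpha\blacktriangleright P)\circ\bar f_\alpha\triangleright$. *)

theory Defs
  imports "HOL-Algebra.Module" "HOL-Algebra.Generated_Groups" "HOL-Algebra.Free_Abelian_Groups"
begin

text \<open>
  Everything is carrier based, in the style of HOL-Algebra: \<open>K\<close> is a commutative ring, and modules,
  algebras, and so on are records extending \<open>('k, 'v) module\<close>.  As usual there, the fields
  \<open>mult\<close> and \<open>one\<close> of a record that is only used as a module carry no information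
  (they are set to \<open>undefined\<close> when such a record is constructed).
\<close>

section \<open>Linear maps and algebras\<close>

definition linear_map ::
    "'k ring \<Rightarrow> ('k, 'v, 'm) module_scheme \<Rightarrow> ('k, 'w, 'n) module_scheme \<Rightarrow> ('v \<Rightarrow> 'w) \<Rightarrow> bool" where
  "linear_map K V W f \<longleftrightarrow>
     f \<in> carrier V \<rightarrow> carrier W \<and>
     (\<forall>v\<in>carrier V. \<forall>v'\<in>carrier V. f (v \<oplus>\<^bsub>V\<^esub> v') = f v \<oplus>\<^bsub>W\<^esub> f v') \<and>
     (\<forall>k\<in>carrier K. \<forall>v\<in>carrier V. f (k \<odot>\<^bsub>V\<^esub> v) = k \<odot>\<^bsub>W\<^esub> f v)"

text \<open>Associative unital, not necessarily commutative (the library's \<open>algebra\<close> is commutative).\<close>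

locale K_algebra = module K A + ring A
  for K :: "'k ring" and A :: "('k, 'a, 'm) module_scheme" (structure) +
  assumes smult_mult_left:
      "\<lbrakk>k \<in> carrier K; a \<in> carrier A; b \<in> carrier A\<rbrakk> \<Longrightarrow> (k \<odot> a) \<otimes> b = k \<odot> (a \<otimes> b)"
    and smult_mult_right:
      "\<lbrakk>k \<in> carrier K; a \<in> carrier A; b \<in> carrier A\<rbrakk> \<Longrightarrow> a \<otimes> (k \<odot> b) = k \<odot> (a \<otimes> b)"


section \<open>Tensor products\<close>

text \<open>
  The tensor product of a right module \<open>V\<close> and a left module \<open>W\<close> over a set \<open>S\<close> of scalars acting by
  \<open>r\<close> and \<open>l\<close> is the free abelian group on \<open>V \<times> W\<close> modulo the subgroup generated by the
  biadditivity and balancing relations.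
\<close>

type_synonym ('v, 'w) tensor = "('v \<times> 'w \<Rightarrow>\<^sub>0 int) set"

definition tensor_relators ::
    "'s set \<Rightarrow> ('v \<Rightarrow> 's \<Rightarrow> 'v) \<Rightarrow> ('s \<Rightarrow> 'w \<Rightarrow> 'w) \<Rightarrow>
     ('v, 'm) ring_scheme \<Rightarrow> ('w, 'n) ring_scheme \<Rightarrow> ('v \<times> 'w \<Rightarrow>\<^sub>0 int) set" where
  "tensor_relators S r l V W =
     {frag_of (v \<oplus>\<^bsub>V\<^esub> v', w) - frag_of (v, w) - frag_of (v', w) | v v' w.
        v \<in> carrier V \<and> v' \<in> carrier V \<and> w \<in> carrier W} \<union>
     {frag_of (v, w \<oplus>\<^bsub>W\<^esub> w') - frag_of (v, w) - frag_of (v, w') | v w w'.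
        v \<in> carrier V \<and> w \<in> carrier W \<and> w' \<in> carrier W} \<union>
     {frag_of (r v s, w) - frag_of (v, l s w) | v s w.
        v \<in> carrier V \<and> s \<in> S \<and> w \<in> carrier W}"

definition tensor_null ::
    "'s set \<Rightarrow> ('v \<Rightarrow> 's \<Rightarrow> 'v) \<Rightarrow> ('s \<Rightarrow> 'w \<Rightarrow> 'w) \<Rightarrow>
     ('v, 'm) ring_scheme \<Rightarrow> ('w, 'n) ring_scheme \<Rightarrow> ('v, 'w) tensor" where
  "tensor_null S r l V W =
     generate (free_Abelian_group (carrier V \<times> carrier W)) (tensor_relators S r l V W)"

definition tensor_group ::
    "'s set \<Rightarrow> ('v \<Rightarrow> 's \<Rightarrow> 'v) \<Rightarrow> ('s \<Rightarrow> 'w \<Rightarrow> 'w) \<Rightarrow>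
     ('v, 'm) ring_scheme \<Rightarrow> ('w, 'n) ring_scheme \<Rightarrow> ('v, 'w) tensor ring" where
  "tensor_group S r l V W =
     (let Q = free_Abelian_group (carrier V \<times> carrier W) Mod tensor_null S r l V W
      in \<lparr>carrier = carrier Q, mult = undefined, one = undefined,
          ring.zero = \<one>\<^bsub>Q\<^esub>, add = (\<otimes>\<^bsub>Q\<^esub>)\<rparr>)"

definition pure_tensor ::
    "'s set \<Rightarrow> ('v \<Rightarrow> 's \<Rightarrow> 'v) \<Rightarrow> ('s \<Rightarrow> 'w \<Rightarrow> 'w) \<Rightarrow>
     ('v, 'm) ring_scheme \<Rightarrow> ('w, 'n) ring_scheme \<Rightarrow> 'v \<Rightarrow> 'w \<Rightarrow> ('v, 'w) tensor" where
  "pure_tensor S r l V W v w =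
     tensor_null S r l V W #>\<^bsub>free_Abelian_group (carrier V \<times> carrier W)\<^esub> frag_of (v, w)"

text \<open>
  \<open>tensor_lift G b t\<close> is the value at \<open>t\<close> of the additive map into \<open>G\<close> induced by a balanced
  biadditive map \<open>b\<close>, that is, by \<open>v \<otimes> w \<mapsto> b v w\<close>.  This is how all formulas with suppressed
  summation are rendered: with \<open>t = t\<^sup>\<alpha> \<otimes> t\<^sub>\<alpha>\<close>, it is the sum of the \<open>b t\<^sup>\<alpha> t\<^sub>\<alpha>\<close> in \<open>G\<close>.
  The image under \<open>the_elem\<close> is a singleton because \<open>b\<close> kills the relators.
\<close>

definition frag_eval ::
    "('u, 'm) ring_scheme \<Rightarrow> ('v \<Rightarrow> 'w \<Rightarrow> 'u) \<Rightarrow> ('v \<times> 'w \<Rightarrow>\<^sub>0 int) \<Rightarrow> 'u" where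
  "frag_eval G b p =
     (\<Oplus>\<^bsub>G\<^esub>x\<in>Poly_Mapping.keys p. [Poly_Mapping.lookup p x] \<cdot>\<^bsub>G\<^esub> b (fst x) (snd x))"

definition tensor_lift ::
    "('u, 'm) ring_scheme \<Rightarrow> ('v \<Rightarrow> 'w \<Rightarrow> 'u) \<Rightarrow> ('v, 'w) tensor \<Rightarrow> 'u" where
  "tensor_lift G b t = the_elem (frag_eval G b ` t)"


subsection \<open>Over the ground ring\<close>

definition kpure ::
    "'k ring \<Rightarrow> ('k, 'v, 'm) module_scheme \<Rightarrow> ('k, 'w, 'n) module_scheme \<Rightarrow>
     'v \<Rightarrow> 'w \<Rightarrow> ('v, 'w) tensor" where
  "kpure K V W = pure_tensor (carrier K) (\<lambda>v k. k \<odot>\<^bsub>V\<^esub> v) (smult W) V W"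

text \<open>The ring structure is the usual one when \<open>V\<close> and \<open>W\<close> are algebras.\<close>

definition ktensor ::
    "'k ring \<Rightarrow> ('k, 'v, 'm) module_scheme \<Rightarrow> ('k, 'w, 'n) module_scheme \<Rightarrow>
     ('k, ('v, 'w) tensor) module" where
  "ktensor K V W =
     (let T = tensor_group (carrier K) (\<lambda>v k. k \<odot>\<^bsub>V\<^esub> v) (smult W) V W
      in \<lparr>carrier = carrier T,
          mult = (\<lambda>s t. tensor_lift T (\<lambda>v w. tensor_lift T (\<lambda>v' w'.
                     kpure K V W (v \<otimes>\<^bsub>V\<^esub> v') (w \<otimes>\<^bsub>W\<^esub> w')) t) s),
          one = kpure K V W \<one>\<^bsub>V\<^esub> \<one>\<^bsub>W\<^esub>,
          ring.zero = \<zero>\<^bsub>T\<^esub>, add = (\<oplus>\<^bsub>T\<^esub>),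
          smult = (\<lambda>k. tensor_lift T (\<lambda>v w. kpure K V W (k \<odot>\<^bsub>V\<^esub> v) w))\<rparr>)"

abbreviation ktensor3 ::
    "'k ring \<Rightarrow> ('k, 'v, 'm) module_scheme \<Rightarrow> ('k, (('v, 'v) tensor, 'v) tensor) module" where
  "ktensor3 K V \<equiv> ktensor K (ktensor K V V) V"

abbreviation kpure3 ::
    "'k ring \<Rightarrow> ('k, 'v, 'm) module_scheme \<Rightarrow> 'v \<Rightarrow> 'v \<Rightarrow> 'v \<Rightarrow> (('v, 'v) tensor, 'v) tensor" where
  "kpure3 K V x y z \<equiv> kpure K (ktensor K V V) V (kpure K V V x y) z"


section \<open>Hopf algebras and twists\<close>

record ('k, 'h) hopf_algebra = "('k, 'h) module" +
  comult :: "'h \<Rightarrow> ('h, 'h) tensor"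
  counit :: "'h \<Rightarrow> 'k"
  antipode :: "'h \<Rightarrow> 'h"

locale hopf_algebra = K_algebra K H
  for K :: "'k ring" and H :: "('k, 'h, 'm) hopf_algebra_scheme" (structure) +
  assumes comult_linear: "linear_map K H (ktensor K H H) (comult H)"
    and comult_mult: "\<lbrakk>\<xi> \<in> carrier H; \<zeta> \<in> carrier H\<rbrakk> \<Longrightarrow>
      comult H (\<xi> \<otimes> \<zeta>) = comult H \<xi> \<otimes>\<^bsub>ktensor K H H\<^esub> comult H \<zeta>"
    and comult_one: "comult H \<one> = \<one>\<^bsub>ktensor K H H\<^esub>"
    and counit_closed: "\<xi> \<in> carrier H \<Longrightarrow> counit H \<xi> \<in> carrier K"
    and counit_add: "\<lbrakk>\<xi> \<in> carrier H; \<zeta> \<in> carrier H\<rbrakk> \<Longrightarrow>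
      counit H (\<xi> \<oplus> \<zeta>) = counit H \<xi> \<oplus>\<^bsub>K\<^esub> counit H \<zeta>"
    and counit_smult: "\<lbrakk>k \<in> carrier K; \<xi> \<in> carrier H\<rbrakk> \<Longrightarrow>
      counit H (k \<odot> \<xi>) = k \<otimes>\<^bsub>K\<^esub> counit H \<xi>"
    and counit_mult: "\<lbrakk>\<xi> \<in> carrier H; \<zeta> \<in> carrier H\<rbrakk> \<Longrightarrow>
      counit H (\<xi> \<otimes> \<zeta>) = counit H \<xi> \<otimes>\<^bsub>K\<^esub> counit H \<zeta>"
    and counit_one: "counit H \<one> = \<one>\<^bsub>K\<^esub>"
    and coassoc: "\<xi> \<in> carrier H \<Longrightarrow>
      tensor_lift (ktensor3 K H) (\<lambda>x y. kpure K (ktensor K H H) H (comult H x) y) (comult H \<xi>) =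
      tensor_lift (ktensor3 K H)
        (\<lambda>x y. tensor_lift (ktensor3 K H) (\<lambda>y' y''. kpure3 K H x y' y'') (comult H y)) (comult H \<xi>)"
    and counit_left: "\<xi> \<in> carrier H \<Longrightarrow> tensor_lift H (\<lambda>x y. counit H x \<odot> y) (comult H \<xi>) = \<xi>"
    and counit_right: "\<xi> \<in> carrier H \<Longrightarrow> tensor_lift H (\<lambda>x y. counit H y \<odot> x) (comult H \<xi>) = \<xi>"
    and antipode_linear: "linear_map K H H (antipode H)"
    and antipode_left: "\<xi> \<in> carrier H \<Longrightarrow>
      tensor_lift H (\<lambda>x y. antipode H x \<otimes> y) (comult H \<xi>) = counit H \<xi> \<odot> \<one>"
    and antipode_right: "\<xi> \<in> carrier H \<Longrightarrow>
      tensor_lift H (\<lambda>x y. x \<otimes> antipode H y) (comult H \<xi>) = counit H \<xi> \<odot> \<one>"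

text \<open>
  In the cocycle condition the triple tensor product is bracketed to the left, which makes
  \<open>1 \<otimes> F\<close> and \<open>(id \<otimes> \<Delta>) F\<close> the two lifts on the right-hand side.
\<close>

definition twist ::
    "'k ring \<Rightarrow> ('k, 'h, 'm) hopf_algebra_scheme \<Rightarrow> ('h, 'h) tensor \<Rightarrow> bool" where
  "twist K H F \<longleftrightarrow>
     F \<in> Units (ktensor K H H) \<and>
     kpure K (ktensor K H H) H F \<one>\<^bsub>H\<^esub> \<otimes>\<^bsub>ktensor3 K H\<^esub>
       tensor_lift (ktensor3 K H) (\<lambda>x y. kpure K (ktensor K H H) H (comult H x) y) F =
     tensor_lift (ktensor3 K H) (\<lambda>x y. kpure3 K H \<one>\<^bsub>H\<^esub> x y) F \<otimes>\<^bsub>ktensor3 K H\<^esub>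
       tensor_lift (ktensor3 K H)
         (\<lambda>x y. tensor_lift (ktensor3 K H) (\<lambda>y' y''. kpure3 K H x y' y'') (comult H y)) F \<and>
     tensor_lift H (\<lambda>x y. counit H x \<odot>\<^bsub>H\<^esub> y) F = \<one>\<^bsub>H\<^esub> \<and>
     tensor_lift H (\<lambda>x y. counit H y \<odot>\<^bsub>H\<^esub> x) F = \<one>\<^bsub>H\<^esub>"

abbreviation twist_inv ::
    "'k ring \<Rightarrow> ('k, 'h, 'm) hopf_algebra_scheme \<Rightarrow> ('h, 'h) tensor \<Rightarrow> ('h, 'h) tensor" where
  "twist_inv K H F \<equiv> inv\<^bsub>ktensor K H H\<^esub> F"

definition twist_chi :: "('k, 'h, 'm) hopf_algebra_scheme \<Rightarrow> ('h, 'h) tensor \<Rightarrow> 'h" where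
  "twist_chi H F = tensor_lift H (\<lambda>x y. x \<otimes>\<^bsub>H\<^esub> antipode H y) F"

definition twisted_hopf ::
    "'k ring \<Rightarrow> ('k, 'h, 'm) hopf_algebra_scheme \<Rightarrow> ('h, 'h) tensor \<Rightarrow>
     ('k, 'h, 'm) hopf_algebra_scheme" where
  "twisted_hopf K H F =
     H\<lparr>comult := (\<lambda>\<xi>. F \<otimes>\<^bsub>ktensor K H H\<^esub> comult H \<xi> \<otimes>\<^bsub>ktensor K H H\<^esub> twist_inv K H F),
       antipode := (\<lambda>\<xi>. twist_chi H F \<otimes>\<^bsub>H\<^esub> antipode H \<xi> \<otimes>\<^bsub>H\<^esub> inv\<^bsub>H\<^esub> (twist_chi H F))\<rparr>"


section \<open>Module algebras and equivariant bimodules\<close>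

record ('k, 'v, 'h) hmodule = "('k, 'v) module" +
  act :: "'h \<Rightarrow> 'v \<Rightarrow> 'v"

record ('k, 'v, 'h, 'a) hbimodule = "('k, 'v, 'h) hmodule" +
  lact :: "'a \<Rightarrow> 'v \<Rightarrow> 'v"
  ract :: "'v \<Rightarrow> 'a \<Rightarrow> 'v"

locale H_module = module K V
  for K :: "'k ring" and H :: "('k, 'h, 'm) hopf_algebra_scheme"
    and V :: "('k, 'v, 'h, 'n) hmodule_scheme" (structure) +
  assumes act_closed: "\<lbrakk>\<xi> \<in> carrier H; v \<in> carrier V\<rbrakk> \<Longrightarrow> act V \<xi> v \<in> carrier V"
    and act_add_left: "\<lbrakk>\<xi> \<in> carrier H; \<zeta> \<in> carrier H; v \<in> carrier V\<rbrakk> \<Longrightarrow>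
      act V (\<xi> \<oplus>\<^bsub>H\<^esub> \<zeta>) v = act V \<xi> v \<oplus> act V \<zeta> v"
    and act_smult_left: "\<lbrakk>k \<in> carrier K; \<xi> \<in> carrier H; v \<in> carrier V\<rbrakk> \<Longrightarrow>
      act V (k \<odot>\<^bsub>H\<^esub> \<xi>) v = k \<odot> act V \<xi> v"
    and act_add_right: "\<lbrakk>\<xi> \<in> carrier H; v \<in> carrier V; w \<in> carrier V\<rbrakk> \<Longrightarrow>
      act V \<xi> (v \<oplus> w) = act V \<xi> v \<oplus> act V \<xi> w"
    and act_smult_right: "\<lbrakk>k \<in> carrier K; \<xi> \<in> carrier H; v \<in> carrier V\<rbrakk> \<Longrightarrow>
      act V \<xi> (k \<odot> v) = k \<odot> act V \<xi> v"
    and act_assoc: "\<lbrakk>\<xi> \<in> carrier H; \<zeta> \<in> carrier H; v \<in> carrier V\<rbrakk> \<Longrightarrow>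
      act V (\<xi> \<otimes>\<^bsub>H\<^esub> \<zeta>) v = act V \<xi> (act V \<zeta> v)"
    and act_unit: "v \<in> carrier V \<Longrightarrow> act V \<one>\<^bsub>H\<^esub> v = v"

locale H_module_algebra = K_algebra K A + H_module K H A
  for K :: "'k ring" and H :: "('k, 'h, 'm) hopf_algebra_scheme"
    and A :: "('k, 'a, 'h, 'n) hmodule_scheme" (structure) +
  assumes act_mult: "\<lbrakk>\<xi> \<in> carrier H; a \<in> carrier A; b \<in> carrier A\<rbrakk> \<Longrightarrow>
      act A \<xi> (a \<otimes> b) = tensor_lift A (\<lambda>x y. act A x a \<otimes> act A y b) (comult H \<xi>)"
    and act_one: "\<xi> \<in> carrier H \<Longrightarrow> act A \<xi> \<one> = counit H \<xi> \<odot> \<one>"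

text \<open>
  A left \<open>H\<close>-module \<open>A\<close>-bimodule.  Only the operations of \<open>A\<close> and \<open>H\<close> enter; that these satisfy
  their own axioms is stated separately by \<open>H_module_algebra\<close> and \<open>hopf_algebra\<close>.
\<close>

locale H_bimodule = H_module K H V
  for K :: "'k ring" and H :: "('k, 'h, 'm) hopf_algebra_scheme"
    and A :: "('k, 'a, 'h, 'l) hmodule_scheme"
    and V :: "('k, 'v, 'h, 'a, 'n) hbimodule_scheme" (structure) +
  assumes lact_closed: "\<lbrakk>a \<in> carrier A; v \<in> carrier V\<rbrakk> \<Longrightarrow> lact V a v \<in> carrier V"
    and lact_add_left: "\<lbrakk>a \<in> carrier A; b \<in> carrier A; v \<in> carrier V\<rbrakk> \<Longrightarrow>
      lact V (a \<oplus>\<^bsub>A\<^esub> b) v = lact V a v \<oplus> lact V b v"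
    and lact_smult_left: "\<lbrakk>k \<in> carrier K; a \<in> carrier A; v \<in> carrier V\<rbrakk> \<Longrightarrow>
      lact V (k \<odot>\<^bsub>A\<^esub> a) v = k \<odot> lact V a v"
    and lact_add_right: "\<lbrakk>a \<in> carrier A; v \<in> carrier V; w \<in> carrier V\<rbrakk> \<Longrightarrow>
      lact V a (v \<oplus> w) = lact V a v \<oplus> lact V a w"
    and lact_smult_right: "\<lbrakk>k \<in> carrier K; a \<in> carrier A; v \<in> carrier V\<rbrakk> \<Longrightarrow>
      lact V a (k \<odot> v) = k \<odot> lact V a v"
    and lact_assoc: "\<lbrakk>a \<in> carrier A; b \<in> carrier A; v \<in> carrier V\<rbrakk> \<Longrightarrow>
      lact V (a \<otimes>\<^bsub>A\<^esub> b) v = lact V a (lact V b v)"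
    and lact_unit: "v \<in> carrier V \<Longrightarrow> lact V \<one>\<^bsub>A\<^esub> v = v"
    and ract_closed: "\<lbrakk>a \<in> carrier A; v \<in> carrier V\<rbrakk> \<Longrightarrow> ract V v a \<in> carrier V"
    and ract_add_right: "\<lbrakk>a \<in> carrier A; b \<in> carrier A; v \<in> carrier V\<rbrakk> \<Longrightarrow>
      ract V v (a \<oplus>\<^bsub>A\<^esub> b) = ract V v a \<oplus> ract V v b"
    and ract_smult_right: "\<lbrakk>k \<in> carrier K; a \<in> carrier A; v \<in> carrier V\<rbrakk> \<Longrightarrow>
      ract V v (k \<odot>\<^bsub>A\<^esub> a) = k \<odot> ract V v a"
    and ract_add_left: "\<lbrakk>a \<in> carrier A; v \<in> carrier V; w \<in> carrier V\<rbrakk> \<Longrightarrow>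
      ract V (v \<oplus> w) a = ract V v a \<oplus> ract V w a"
    and ract_smult_left: "\<lbrakk>k \<in> carrier K; a \<in> carrier A; v \<in> carrier V\<rbrakk> \<Longrightarrow>
      ract V (k \<odot> v) a = k \<odot> ract V v a"
    and ract_assoc: "\<lbrakk>a \<in> carrier A; b \<in> carrier A; v \<in> carrier V\<rbrakk> \<Longrightarrow>
      ract V v (a \<otimes>\<^bsub>A\<^esub> b) = ract V (ract V v a) b"
    and ract_unit: "v \<in> carrier V \<Longrightarrow> ract V v \<one>\<^bsub>A\<^esub> = v"
    and lact_ract: "\<lbrakk>a \<in> carrier A; b \<in> carrier A; v \<in> carrier V\<rbrakk> \<Longrightarrow>
      ract V (lact V a v) b = lact V a (ract V v b)"
    and act_lact: "\<lbrakk>\<xi> \<in> carrier H; a \<in> carrier A; v \<in> carrier V\<rbrakk> \<Longrightarrow>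
      act V \<xi> (lact V a v) = tensor_lift V (\<lambda>x y. lact V (act A x a) (act V y v)) (comult H \<xi>)"
    and act_ract: "\<lbrakk>\<xi> \<in> carrier H; a \<in> carrier A; v \<in> carrier V\<rbrakk> \<Longrightarrow>
      act V \<xi> (ract V v a) = tensor_lift V (\<lambda>x y. ract V (act V x v) (act A y a)) (comult H \<xi>)"

definition H_bimodule_iso ::
    "'k ring \<Rightarrow> ('k, 'h, 'm) hopf_algebra_scheme \<Rightarrow> ('k, 'a, 'h, 'l) hmodule_scheme \<Rightarrow>
     ('k, 'v, 'h, 'a, 'n) hbimodule_scheme \<Rightarrow> ('k, 'w, 'h, 'a, 'o) hbimodule_scheme \<Rightarrow>
     ('v \<Rightarrow> 'w) \<Rightarrow> bool" where
  "H_bimodule_iso K H A V W f \<longleftrightarrow>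
     H_bimodule K H A V \<and> H_bimodule K H A W \<and>
     bij_betw f (carrier V) (carrier W) \<and> linear_map K V W f \<and>
     (\<forall>\<xi>\<in>carrier H. \<forall>v\<in>carrier V. f (act V \<xi> v) = act W \<xi> (f v)) \<and>
     (\<forall>a\<in>carrier A. \<forall>v\<in>carrier V. f (lact V a v) = lact W a (f v)) \<and>
     (\<forall>a\<in>carrier A. \<forall>v\<in>carrier V. f (ract V v a) = ract W (f v) a)"


subsection \<open>Deformation by a twist\<close>

text \<open>Polymorphic in the record extension, so that it also deforms a differential calculus.\<close>

definition star_algebra ::
    "'k ring \<Rightarrow> ('k, 'h, 'm) hopf_algebra_scheme \<Rightarrow> ('h, 'h) tensor \<Rightarrow>
     ('k, 'a, 'h, 'n) hmodule_scheme \<Rightarrow> ('k, 'a, 'h, 'n) hmodule_scheme" where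
  "star_algebra K H F A =
     A\<lparr>mult := (\<lambda>a b. tensor_lift A (\<lambda>x y. act A x a \<otimes>\<^bsub>A\<^esub> act A y b) (twist_inv K H F))\<rparr>"

definition star_bimodule ::
    "'k ring \<Rightarrow> ('k, 'h, 'm) hopf_algebra_scheme \<Rightarrow> ('h, 'h) tensor \<Rightarrow>
     ('k, 'a, 'h, 'l) hmodule_scheme \<Rightarrow> ('k, 'v, 'h, 'a, 'n) hbimodule_scheme \<Rightarrow>
     ('k, 'v, 'h, 'a, 'n) hbimodule_scheme" where
  "star_bimodule K H F A V =
     V\<lparr>lact := (\<lambda>a v. tensor_lift V (\<lambda>x y. lact V (act A x a) (act V y v)) (twist_inv K H F)),
       ract := (\<lambda>v a. tensor_lift V (\<lambda>x y. ract V (act V x v) (act A y a)) (twist_inv K H F))\<rparr>"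


subsection \<open>Tensor products over the algebra\<close>

text \<open>
  For \<open>K\<close>-bilinear unital actions the \<open>A\<close>-balancing relation implies the \<open>K\<close>-balancing one.
\<close>

definition apure ::
    "('k, 'a, 'h, 'l) hmodule_scheme \<Rightarrow> ('k, 'v, 'h, 'a, 'm) hbimodule_scheme \<Rightarrow>
     ('k, 'w, 'h, 'a, 'n) hbimodule_scheme \<Rightarrow> 'v \<Rightarrow> 'w \<Rightarrow> ('v, 'w) tensor" where
  "apure A V W = pure_tensor (carrier A) (ract V) (lact W) V W"

definition atensor ::
    "('k, 'h, 'o) hopf_algebra_scheme \<Rightarrow> ('k, 'a, 'h, 'l) hmodule_scheme \<Rightarrow>
     ('k, 'v, 'h, 'a, 'm) hbimodule_scheme \<Rightarrow> ('k, 'w, 'h, 'a, 'n) hbimodule_scheme \<Rightarrow>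
     ('k, ('v, 'w) tensor, 'h, 'a) hbimodule" where
  "atensor H A V W =
     (let T = tensor_group (carrier A) (ract V) (lact W) V W
      in \<lparr>carrier = carrier T, mult = undefined, one = undefined,
          ring.zero = \<zero>\<^bsub>T\<^esub>, add = (\<oplus>\<^bsub>T\<^esub>),
          smult = (\<lambda>k. tensor_lift T (\<lambda>v w. apure A V W (k \<odot>\<^bsub>V\<^esub> v) w)),
          act = (\<lambda>\<xi>. tensor_lift T (\<lambda>v w.
                   tensor_lift T (\<lambda>x y. apure A V W (act V x v) (act W y w)) (comult H \<xi>))),
          lact = (\<lambda>a. tensor_lift T (\<lambda>v w. apure A V W (lact V a v) w)),
          ract = (\<lambda>t a. tensor_lift T (\<lambda>v w. apure A V W v (ract W w a)) t)\<rparr>)"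


subsection \<open>Hom bimodules\<close>

text \<open>Maps are extensional, i.e. \<open>undefined\<close> outside \<open>carrier V\<close>, so that equality is equality on \<open>V\<close>.\<close>

definition hom_K ::
    "'k ring \<Rightarrow> ('k, 'h, 'o) hopf_algebra_scheme \<Rightarrow>
     ('k, 'v, 'h, 'a, 'm) hbimodule_scheme \<Rightarrow> ('k, 'w, 'h, 'a, 'n) hbimodule_scheme \<Rightarrow>
     ('k, 'v \<Rightarrow> 'w, 'h, 'a) hbimodule" where
  "hom_K K H V W =
     \<lparr>carrier = {P \<in> carrier V \<rightarrow>\<^sub>E carrier W. linear_map K V W P},
      mult = undefined, one = undefined,
      ring.zero = (\<lambda>v\<in>carrier V. \<zero>\<^bsub>W\<^esub>),
      add = (\<lambda>P Q. \<lambda>v\<in>carrier V. P v \<oplus>\<^bsub>W\<^esub> Q v),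
      smult = (\<lambda>k P. \<lambda>v\<in>carrier V. k \<odot>\<^bsub>W\<^esub> P v),
      act = (\<lambda>\<xi> P. \<lambda>v\<in>carrier V.
               tensor_lift W (\<lambda>x y. act W x (P (act V (antipode H y) v))) (comult H \<xi>)),
      lact = (\<lambda>a P. \<lambda>v\<in>carrier V. lact W a (P v)),
      ract = (\<lambda>P a. \<lambda>v\<in>carrier V. P (lact V a v))\<rparr>"

definition hom_A ::
    "'k ring \<Rightarrow> ('k, 'h, 'o) hopf_algebra_scheme \<Rightarrow> ('k, 'a, 'h, 'l) hmodule_scheme \<Rightarrow>
     ('k, 'v, 'h, 'a, 'm) hbimodule_scheme \<Rightarrow> ('k, 'w, 'h, 'a, 'n) hbimodule_scheme \<Rightarrow>
     ('k, 'v \<Rightarrow> 'w, 'h, 'a) hbimodule" where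
  "hom_A K H A V W =
     (hom_K K H V W)\<lparr>carrier := {P \<in> carrier (hom_K K H V W).
        \<forall>v\<in>carrier V. \<forall>a\<in>carrier A. P (ract V v a) = ract W (P v) a}\<rparr>"


section \<open>Differential calculi and connections\<close>

text \<open>
  The graded algebra is given with its internal grading; only the values of the differential on
  homogeneous elements matter.
\<close>

record ('k, 'w, 'h) calculus = "('k, 'w, 'h) hmodule" +
  grade :: "nat \<Rightarrow> 'w set"
  differential :: "'w \<Rightarrow> 'w"

locale differential_calculus = K_algebra K C
  for K :: "'k ring" and A :: "('k, 'w, 'h, 'l) hmodule_scheme"
    and C :: "('k, 'w, 'h, 'm) calculus_scheme" (structure) +
  assumes grade_submodule: "submodule (grade C n) K C"
    and direct_sum: "\<omega> \<in> carrier C \<Longrightarrow>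
      \<exists>!f. (\<forall>n. f n \<in> grade C n) \<and> finite {n. f n \<noteq> \<zero>} \<and> \<omega> = (\<Oplus>n\<in>{n. f n \<noteq> \<zero>}. f n)"
    and grade_mult: "\<lbrakk>\<theta> \<in> grade C m; \<theta>' \<in> grade C n\<rbrakk> \<Longrightarrow> \<theta> \<otimes> \<theta>' \<in> grade C (m + n)"
    and grade_0: "grade C 0 = carrier A"
    and grade_0_one: "\<one> = \<one>\<^bsub>A\<^esub>"
    and grade_0_mult: "\<lbrakk>a \<in> carrier A; b \<in> carrier A\<rbrakk> \<Longrightarrow> a \<otimes> b = a \<otimes>\<^bsub>A\<^esub> b"
    and grade_0_add: "\<lbrakk>a \<in> carrier A; b \<in> carrier A\<rbrakk> \<Longrightarrow> a \<oplus> b = a \<oplus>\<^bsub>A\<^esub> b"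
    and grade_0_smult: "\<lbrakk>k \<in> carrier K; a \<in> carrier A\<rbrakk> \<Longrightarrow> k \<odot> a = k \<odot>\<^bsub>A\<^esub> a"
    and differential_linear:
      "linear_map K (C\<lparr>carrier := grade C n\<rparr>) (C\<lparr>carrier := grade C (Suc n)\<rparr>) (differential C)"
    and differential_square: "\<theta> \<in> grade C n \<Longrightarrow> differential C (differential C \<theta>) = \<zero>"
    and leibniz: "\<lbrakk>\<theta> \<in> grade C m; \<theta>' \<in> grade C n\<rbrakk> \<Longrightarrow>
      differential C (\<theta> \<otimes> \<theta>') = differential C \<theta> \<otimes> \<theta>' \<oplus>
        (if even m then \<theta> \<otimes> differential C \<theta>' else \<ominus> (\<theta> \<otimes> differential C \<theta>'))"
    and generated: "\<theta> \<in> grade C 1 \<Longrightarrow>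
      \<exists>(n::nat) a b. a \<in> {..<n} \<rightarrow> carrier A \<and> b \<in> {..<n} \<rightarrow> carrier A \<and>
        \<theta> = (\<Oplus>i\<in>{..<n}. a i \<otimes> differential C (b i))"

locale H_covariant_calculus =
  differential_calculus K A C + A: H_module_algebra K H A + H_module_algebra K H C
  for K :: "'k ring" and H :: "('k, 'h, 'o) hopf_algebra_scheme"
    and A :: "('k, 'w, 'h, 'l) hmodule_scheme"
    and C :: "('k, 'w, 'h, 'm) calculus_scheme" (structure) +
  assumes act_grade: "\<lbrakk>\<xi> \<in> carrier H; \<theta> \<in> grade C n\<rbrakk> \<Longrightarrow> act C \<xi> \<theta> \<in> grade C n"
    and act_grade_0: "\<lbrakk>\<xi> \<in> carrier H; a \<in> carrier A\<rbrakk> \<Longrightarrow> act C \<xi> a = act A \<xi> a"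
    and act_differential: "\<lbrakk>\<xi> \<in> carrier H; \<theta> \<in> grade C n\<rbrakk> \<Longrightarrow>
      act C \<xi> (differential C \<theta>) = differential C (act C \<xi> \<theta>)"

definition one_forms ::
    "('k, 'w, 'h, 'm) calculus_scheme \<Rightarrow> ('k, 'w, 'h, 'w) hbimodule" where
  "one_forms C =
     \<lparr>carrier = grade C 1, mult = undefined, one = undefined,
      ring.zero = \<zero>\<^bsub>C\<^esub>, add = (\<oplus>\<^bsub>C\<^esub>), smult = (\<odot>\<^bsub>C\<^esub>), act = act C,
      lact = (\<otimes>\<^bsub>C\<^esub>), ract = (\<otimes>\<^bsub>C\<^esub>)\<rparr>"

definition connections ::
    "'k ring \<Rightarrow> ('k, 'h, 'o) hopf_algebra_scheme \<Rightarrow> ('k, 'w, 'h, 'l) hmodule_scheme \<Rightarrow>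
     ('k, 'w, 'h, 'm) calculus_scheme \<Rightarrow> ('k, 'v, 'h, 'w, 'n) hbimodule_scheme \<Rightarrow>
     ('v \<Rightarrow> ('v, 'w) tensor) set" where
  "connections K H A C V =
     (let W = atensor H A V (one_forms C)
      in {N \<in> carrier (hom_K K H V W). \<forall>v\<in>carrier V. \<forall>a\<in>carrier A.
            N (ract V v a) = ract W (N v) a \<oplus>\<^bsub>W\<^esub> apure A V (one_forms C) v (differential C a)})"


section \<open>Quantization maps\<close>

text \<open>
  On \<open>V\<^sub>\<star> \<otimes> W\<^sub>\<star>\<close> over \<open>A\<^sub>\<star>\<close>; the sum over the twist is taken in the target \<open>V \<otimes> W\<close> over \<open>A\<close>.
\<close>

definition phi ::
    "'k ring \<Rightarrow> ('k, 'h, 'o) hopf_algebra_scheme \<Rightarrow> ('h, 'h) tensor \<Rightarrow>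
     ('k, 'a, 'h, 'l) hmodule_scheme \<Rightarrow> ('k, 'v, 'h, 'a, 'm) hbimodule_scheme \<Rightarrow>
     ('k, 'w, 'h, 'a, 'n) hbimodule_scheme \<Rightarrow> ('v, 'w) tensor \<Rightarrow> ('v, 'w) tensor" where
  "phi K H F A V W =
     tensor_lift (atensor H A V W) (\<lambda>v w.
       tensor_lift (atensor H A V W) (\<lambda>x y. apure A V W (act V x v) (act W y w)) (twist_inv K H F))"

definition quant_map ::
    "'k ring \<Rightarrow> ('k, 'h, 'o) hopf_algebra_scheme \<Rightarrow> ('h, 'h) tensor \<Rightarrow>
     ('k, 'v, 'h, 'a, 'm) hbimodule_scheme \<Rightarrow> ('k, 'w, 'h, 'a, 'n) hbimodule_scheme \<Rightarrow>
     ('v \<Rightarrow> 'w) \<Rightarrow> ('v \<Rightarrow> 'w)" where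
  "quant_map K H F V W P =
     (\<lambda>v\<in>carrier V.
        tensor_lift W (\<lambda>x y. act (hom_K K H V W) x P (act V y v)) (twist_inv K H F))"

definition quant_map_tilde ::
    "'k ring \<Rightarrow> ('k, 'h, 'o) hopf_algebra_scheme \<Rightarrow> ('h, 'h) tensor \<Rightarrow>
     ('k, 'w, 'h, 'l) hmodule_scheme \<Rightarrow> ('k, 'w, 'h, 'm) calculus_scheme \<Rightarrow>
     ('k, 'v, 'h, 'w, 'n) hbimodule_scheme \<Rightarrow>
     ('v \<Rightarrow> ('v, 'w) tensor) \<Rightarrow> ('v \<Rightarrow> ('v, 'w) tensor)" where
  "quant_map_tilde K H F A C V P =
     (let As = star_algebra K H F A;
          Vs = star_bimodule K H F A V;
          Ws = atensor (twisted_hopf K H F) As Vs (one_forms (star_algebra K H F C))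
      in compose (carrier V)
           (inv_into (carrier Ws) (phi K H F A V (one_forms C)))
           (quant_map K H F V (atensor H A V (one_forms C)) P))"


section \<open>Affine spaces\<close>

text \<open>Possibly empty, since a bimodule need not admit a connection.\<close>

definition affine_space_over ::
    "'k ring \<Rightarrow> ('k, 'v, 'm) module_scheme \<Rightarrow> 'c set \<Rightarrow> ('c \<Rightarrow> 'v \<Rightarrow> 'c) \<Rightarrow> bool" where
  "affine_space_over K M X tr \<longleftrightarrow>
     module K M \<and>
     (\<forall>x\<in>X. \<forall>p\<in>carrier M. tr x p \<in> X) \<and>
     (\<forall>x\<in>X. tr x \<zero>\<^bsub>M\<^esub> = x) \<and>
     (\<forall>x\<in>X. \<forall>p\<in>carrier M. \<forall>q\<in>carrier M. tr (tr x p) q = tr x (p \<oplus>\<^bsub>M\<^esub> q)) \<and>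
     (\<forall>x\<in>X. \<forall>y\<in>X. \<exists>!p. p \<in> carrier M \<and> tr x p = y)"

text \<open>\<open>g\<close> is the linear part of \<open>f\<close>.\<close>

definition affine_iso ::
    "'k ring \<Rightarrow> ('k, 'v, 'm) module_scheme \<Rightarrow> 'c set \<Rightarrow> ('c \<Rightarrow> 'v \<Rightarrow> 'c) \<Rightarrow>
     ('k, 'w, 'n) module_scheme \<Rightarrow> 'd set \<Rightarrow> ('d \<Rightarrow> 'w \<Rightarrow> 'd) \<Rightarrow> ('c \<Rightarrow> 'd) \<Rightarrow> ('v \<Rightarrow> 'w) \<Rightarrow> bool" where
  "affine_iso K M X tr N Y tr' f g \<longleftrightarrow>
     affine_space_over K M X tr \<and> affine_space_over K N Y tr' \<and>
     bij_betw g (carrier M) (carrier N) \<and> linear_map K M N g \<and>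
     bij_betw f X Y \<and>
     (\<forall>x\<in>X. \<forall>p\<in>carrier M. f (tr x p) = tr' (f x) (g p))"

end

theory Submission
  imports Defs
begin

text \<open>
  Evaluation \<open>P \<otimes> v \<mapsto> P v\<close> is equivariant, and the quantization map is its deformation:
  \<open>D(P)(v)\<close> is \<open>P v\<close> with the two factors first acted on by the inverse twist.  All other structure maps
  (products, module actions, \<open>v \<otimes> w\<close>) are equivariant bilinear maps deformed in the same way.  By the
  cocycle identity the two bracketings of a deformed double product are the undeformed ones
  evaluated on one and the same element of \<open>H \<otimes> H \<otimes> H\<close>.  Hence identities such as
  \<open>(a P) v = a (P v)\<close>, \<open>(P a) v = P (a v)\<close>, \<open>v a \<otimes> w = v \<otimes> a w\<close>, \<open>P (v a) = (P v) a\<close> and the Leibniz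
  rule \<open>N (v a) = (N v) a + v \<otimes> d a\<close> survive deformation; they say that \<open>\<phi>\<close> is well defined, that \<open>\<phi>\<close>
  and \<open>D\<close> respect the bimodule structures, and that \<open>D\<close> preserves right linear maps and connections.
  Finally the inverse of the twist is a twist of the deformed Hopf algebra and deforms everything
  back, so the same argument applies to the maps in the opposite direction, which are the inverses.
\<close>

section \<open>The universal property of tensor products\<close>

text \<open>Two obstacles shape the proof. The action on linear maps contains the antipode, and the
  twisted antipode contains \<chi>, so a direct comparison of the actions on Hom before and after
  deformation would mix antipodes, coproducts and \<chi>. Instead, the action on Hom is
  characterised as the only one that makes evaluation equivariant (\<open>lift_cancel\<close>,
  \<open>hom_act_unique\<close>); \<chi> then matters only for showing that the twisted structure is
  a Hopf algebra. Connections, on the other hand, are not stable under the action: if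
  \<open>N\<close> obeys the Leibniz rule, then \<open>\<xi>\<close> acting on \<open>N\<close>
  obeys it with the term \<open>v \<otimes> d a\<close> multiplied by the counit of
  \<open>\<xi>\<close>. The quantized \<open>N\<close> nevertheless obeys the deformed rule with
  factor 1, because the inverse twist is normalised by the counit. Right linear maps are the case
  where the extra term is zero, so one argument about maps with a prescribed defect treats both
  restrictions. Finally, deforming back recovers the original operations only on the carriers, which
  is why deformed records are handled through relations rather than equations.\<close>

lemma foldSetD_cong_imp:
  assumes "(A, y) \<in> foldSetD D f e" "\<And>x z. x \<in> A \<Longrightarrow> f x z = g x z"
  shows "(A, y) \<in> foldSetD D g e"
  using assms
proof (induction rule: foldSetD.induct)
  case (insertI x A y)
  have "(A, y) \<in> foldSetD D g e"
    using insertI by auto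
  moreover have "g x y \<in> D" "f x y = g x y"
    using insertI.hyps(2) insertI.prems[of x] by auto
  ultimately show ?case
    using foldSetD.insertI[of x A g y D e] insertI.hyps(1) by simp
next
  case emptyI
  show ?case by (rule foldSetD.emptyI) fact
qed

lemma foldD_cong_fun:
  assumes "\<And>x z. x \<in> A \<Longrightarrow> f x z = g x z"
  shows "foldD D f e A = foldD D g e A"
proof -
  have "(A, y) \<in> foldSetD D f e \<longleftrightarrow> (A, y) \<in> foldSetD D g e" for y
    using foldSetD_cong_imp[of A y D f e g] foldSetD_cong_imp[of A y D g e f] assms by auto
  then show ?thesis unfolding foldD_def by simp
qed

text \<open>Free of closure conditions on the terms, since folding applies the function only to
  members of the index set. This is what later permits rewriting under a lift before anything is
  known about the values.\<close>

lemma finsum_cong_fun: "(\<And>x. x \<in> A \<Longrightarrow> f x = g x) \<Longrightarrow> finsum G f A = finsum G g A"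
  unfolding finsum_def finprod_def by (auto intro: foldD_cong_fun)

lemma frag_eval_cong:
  assumes "\<And>x. x \<in> Poly_Mapping.keys p \<Longrightarrow> b (fst x) (snd x) = b' (fst x) (snd x)"
  shows "frag_eval G b p = frag_eval G b' p"
  unfolding frag_eval_def using assms by (intro finsum_cong_fun) simp

lemma frag_eval_cong_group:
  assumes "carrier G = carrier G'" "add G = add G'" "\<zero>\<^bsub>G\<^esub> = \<zero>\<^bsub>G'\<^esub>"
  shows "frag_eval G = frag_eval G'"
  unfolding frag_eval_def finsum_def finprod_def add_pow_def int_pow_def nat_pow_def m_inv_def
  by (intro ext) (simp add: assms Let_def cong: if_cong)

text \<open>Evaluation reads only the additive structure of the target. Hence a record and a
  deformation of it that changes products or actions share one and the same lift.\<close>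

lemma tensor_lift_cong_group:
  assumes "carrier G = carrier G'" "add G = add G'" "\<zero>\<^bsub>G\<^esub> = \<zero>\<^bsub>G'\<^esub>"
  shows "tensor_lift G = tensor_lift G'"
  by (intro ext) (simp add: tensor_lift_def frag_eval_cong_group[OF assms])

section \<open>Evaluation of formal integer combinations in an abelian group\<close>

context abelian_group
begin

lemma frag_eval_superset:
  assumes "finite S" "Poly_Mapping.keys p \<subseteq> S"
    and "\<And>x. x \<in> S \<Longrightarrow> b (fst x) (snd x) \<in> carrier G"
  shows "frag_eval G b p = (\<Oplus>x\<in>S. [Poly_Mapping.lookup p x] \<cdot> b (fst x) (snd x))"
  unfolding frag_eval_def using assms
  by (intro add.finprod_mono_neutral_cong_left) (auto simp: in_keys_iff add_pow_def[of _ "0::int"])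

lemma frag_eval_closed:
  assumes "\<And>x. x \<in> Poly_Mapping.keys p \<Longrightarrow> b (fst x) (snd x) \<in> carrier G"
  shows "frag_eval G b p \<in> carrier G"
  unfolding frag_eval_def using assms by (intro finsum_closed) auto

lemma frag_eval_add:
  assumes "\<And>x. x \<in> Poly_Mapping.keys p \<union> Poly_Mapping.keys q \<Longrightarrow> b (fst x) (snd x) \<in> carrier G"
  shows "frag_eval G b (p + q) = frag_eval G b p \<oplus> frag_eval G b q"
proof -
  let ?S = "Poly_Mapping.keys p \<union> Poly_Mapping.keys q"
  have "frag_eval G b (p + q) = (\<Oplus>x\<in>?S. [Poly_Mapping.lookup (p + q) x] \<cdot> b (fst x) (snd x))"
    using assms Poly_Mapping.keys_add[of p q] by (intro frag_eval_superset) auto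
  also have "\<dots> = (\<Oplus>x\<in>?S. [Poly_Mapping.lookup p x] \<cdot> b (fst x) (snd x) \<oplus>
      [Poly_Mapping.lookup q x] \<cdot> b (fst x) (snd x))"
    using assms by (intro finsum_cong') (auto simp: lookup_add add.int_pow_mult)
  also have "\<dots> = (\<Oplus>x\<in>?S. [Poly_Mapping.lookup p x] \<cdot> b (fst x) (snd x)) \<oplus>
      (\<Oplus>x\<in>?S. [Poly_Mapping.lookup q x] \<cdot> b (fst x) (snd x))"
    using assms by (intro finsum_addf) auto
  finally show ?thesis
    using assms frag_eval_superset[of ?S p b] frag_eval_superset[of ?S q b] by auto
qed

lemma frag_eval_frag_of:
  "b v w \<in> carrier G \<Longrightarrow> frag_eval G b (frag_of (v, w)) = b v w"
  using add.int_pow_1 by (subst frag_eval_superset[of "{(v, w)}"]) auto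

lemma frag_eval_0: "frag_eval G b 0 = \<zero>"
  unfolding frag_eval_def by simp

lemma frag_eval_minus:
  assumes "\<And>x. x \<in> Poly_Mapping.keys p \<Longrightarrow> b (fst x) (snd x) \<in> carrier G"
  shows "frag_eval G b (- p) = \<ominus> frag_eval G b p"
proof -
  have "frag_eval G b (p + - p) = frag_eval G b p \<oplus> frag_eval G b (- p)"
    using assms by (intro frag_eval_add) auto
  moreover have "frag_eval G b (- p) \<in> carrier G" "frag_eval G b p \<in> carrier G"
    using assms by (auto intro: frag_eval_closed)
  ultimately show ?thesis
    by (metis add.inv_comm add.inv_equality frag_eval_0 right_minus)
qed

end

lemma (in abelian_group) frag_eval_minus_frag_of:
  "b v w \<in> carrier G \<Longrightarrow> frag_eval G b (- frag_of (v, w)) = \<ominus> b v w"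
  by (subst frag_eval_minus) (auto simp: frag_eval_frag_of)

text \<open>Covers tensor products over the ground ring and over the algebra at once: the scalars
  are a bare set acting by two maps that preserve the carriers.\<close>

locale balanced_pair = V: abelian_group V + W: abelian_group W
  for S :: "'s set" and r :: "'v \<Rightarrow> 's \<Rightarrow> 'v" and l :: "'s \<Rightarrow> 'w \<Rightarrow> 'w"
    and V :: "('v, 'm) ring_scheme" and W :: "('w, 'n) ring_scheme" +
  assumes r_closed: "\<lbrakk>v \<in> carrier V; s \<in> S\<rbrakk> \<Longrightarrow> r v s \<in> carrier V"
    and l_closed: "\<lbrakk>w \<in> carrier W; s \<in> S\<rbrakk> \<Longrightarrow> l s w \<in> carrier W"

definition balanced ::
    "'s set \<Rightarrow> ('v \<Rightarrow> 's \<Rightarrow> 'v) \<Rightarrow> ('s \<Rightarrow> 'w \<Rightarrow> 'w) \<Rightarrow> ('v, 'm) ring_scheme \<Rightarrow>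
     ('w, 'n) ring_scheme \<Rightarrow> ('u, 'p) ring_scheme \<Rightarrow> ('v \<Rightarrow> 'w \<Rightarrow> 'u) \<Rightarrow> bool" where
  "balanced S r l V W G b \<longleftrightarrow>
     (\<forall>v\<in>carrier V. \<forall>w\<in>carrier W. b v w \<in> carrier G) \<and>
     (\<forall>v\<in>carrier V. \<forall>v'\<in>carrier V. \<forall>w\<in>carrier W. b (v \<oplus>\<^bsub>V\<^esub> v') w = b v w \<oplus>\<^bsub>G\<^esub> b v' w) \<and>
     (\<forall>v\<in>carrier V. \<forall>w\<in>carrier W. \<forall>w'\<in>carrier W. b v (w \<oplus>\<^bsub>W\<^esub> w') = b v w \<oplus>\<^bsub>G\<^esub> b v w') \<and>
     (\<forall>v\<in>carrier V. \<forall>s\<in>S. \<forall>w\<in>carrier W. b (r v s) w = b v (l s w))"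

context balanced_pair
begin

abbreviation "FG \<equiv> free_Abelian_group (carrier V \<times> carrier W)"
abbreviation "N \<equiv> tensor_null S r l V W"
abbreviation "T \<equiv> tensor_group S r l V W"
abbreviation "pure \<equiv> pure_tensor S r l V W"

lemma frag_of_closed: "\<lbrakk>v \<in> carrier V; w \<in> carrier W\<rbrakk> \<Longrightarrow> frag_of (v, w) \<in> carrier FG"
  by simp

lemma frag_diff_closed: "\<lbrakk>p \<in> carrier FG; q \<in> carrier FG\<rbrakk> \<Longrightarrow> p - q \<in> carrier FG"
  using keys_diff[of p q] by auto

lemma relators_closed: "tensor_relators S r l V W \<subseteq> carrier FG"
proof
  fix x assume "x \<in> tensor_relators S r l V W"
  then show "x \<in> carrier FG"
    unfolding tensor_relators_def
    by (elim UnE CollectE exE conjE; hypsubst)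
      (intro frag_diff_closed frag_of_closed V.a_closed W.a_closed r_closed l_closed; assumption)+
qed

lemma null_subgroup: "subgroup N FG"
  unfolding tensor_null_def
  by (intro group.generate_is_subgroup group_free_Abelian_group relators_closed)

lemma null_normal: "N \<lhd> FG"
  by (intro comm_group.subgroup_imp_normal abelian_free_Abelian_group null_subgroup)

lemma comm_group_quotient: "comm_group (FG Mod N)"
  by (intro comm_group.abelian_FactGroup abelian_free_Abelian_group null_subgroup)

lemma abelian_group_tensor: "abelian_group T"
proof -
  interpret Q: comm_group "FG Mod N" by (rule comm_group_quotient)
  show ?thesis
    unfolding tensor_group_def Let_def
    by (rule abelian_groupI)
      (use Q.l_inv_ex in \<open>simp_all add: Q.m_ac del: mult_FactGroup one_FactGroup\<close>)
qed

sublocale T: abelian_group T by (rule abelian_group_tensor)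

lemma carrier_tensor: "carrier T = {N #>\<^bsub>FG\<^esub> p | p. p \<in> carrier FG}"
  by (auto simp: tensor_group_def FactGroup_def RCOSETS_def)

lemma add_tensor:
  "\<lbrakk>p \<in> carrier FG; q \<in> carrier FG\<rbrakk> \<Longrightarrow> (N #>\<^bsub>FG\<^esub> p) \<oplus>\<^bsub>T\<^esub> (N #>\<^bsub>FG\<^esub> q) = N #>\<^bsub>FG\<^esub> (p + q)"
  using normal.rcos_sum[OF null_normal, of p q]
  by (simp add: tensor_group_def FactGroup_def)

lemma zero_tensor: "\<zero>\<^bsub>T\<^esub> = N #>\<^bsub>FG\<^esub> 0"
  using group.coset_mult_one[OF group_free_Abelian_group, of N]
  by (metis tensor_group_def FactGroup_def monoid.simps(2) ring.simps(1) one_free_Abelian_group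
      subgroup.subset null_subgroup)

lemma pure_closed [simp, intro]: "\<lbrakk>v \<in> carrier V; w \<in> carrier W\<rbrakk> \<Longrightarrow> pure v w \<in> carrier T"
  unfolding carrier_tensor pure_tensor_def by (auto intro!: exI[of _ "frag_of (v, w)"])

lemma coset_eqI:
  assumes "p \<in> carrier FG" "q \<in> carrier FG" "p - q \<in> N"
  shows "N #>\<^bsub>FG\<^esub> p = N #>\<^bsub>FG\<^esub> q"
proof -
  have "p \<in> N #>\<^bsub>FG\<^esub> q"
    unfolding r_coset_def using assms by (auto intro!: bexI[of _ "p - q"])
  then show ?thesis
    using group.repr_independence[OF group_free_Abelian_group _ assms(2) null_subgroup] by simp
qed

lemma relator_null: "x \<in> tensor_relators S r l V W \<Longrightarrow> x \<in> N"
  unfolding tensor_null_def by (rule generate.incl)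

lemma pure_add_left:
  assumes "v \<in> carrier V" "v' \<in> carrier V" "w \<in> carrier W"
  shows "pure (v \<oplus>\<^bsub>V\<^esub> v') w = pure v w \<oplus>\<^bsub>T\<^esub> pure v' w"
proof -
  have "frag_of (v \<oplus>\<^bsub>V\<^esub> v', w) - (frag_of (v, w) + frag_of (v', w)) \<in> N"
    using assms by (intro relator_null) (auto simp: tensor_relators_def diff_diff_eq)
  then show ?thesis
    unfolding pure_tensor_def using assms keys_add[of "frag_of (v, w)" "frag_of (v', w)"]
    by (simp add: add_tensor) (rule coset_eqI; force)
qed

lemma pure_add_right:
  assumes "v \<in> carrier V" "w \<in> carrier W" "w' \<in> carrier W"
  shows "pure v (w \<oplus>\<^bsub>W\<^esub> w') = pure v w \<oplus>\<^bsub>T\<^esub> pure v w'"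
proof -
  have "frag_of (v, w \<oplus>\<^bsub>W\<^esub> w') - (frag_of (v, w) + frag_of (v, w')) \<in> N"
    using assms by (intro relator_null) (auto simp: tensor_relators_def diff_diff_eq)
  then show ?thesis
    unfolding pure_tensor_def using assms keys_add[of "frag_of (v, w)" "frag_of (v, w')"]
    by (simp add: add_tensor) (rule coset_eqI; force)
qed

lemma pure_balanced:
  assumes "v \<in> carrier V" "s \<in> S" "w \<in> carrier W"
  shows "pure (r v s) w = pure v (l s w)"
proof -
  have "frag_of (r v s, w) - frag_of (v, l s w) \<in> N"
    using assms by (intro relator_null) (auto simp: tensor_relators_def)
  then show ?thesis
    unfolding pure_tensor_def using assms r_closed l_closed
    by (intro coset_eqI) simp_all
qed

lemma pure_zero_left: "w \<in> carrier W \<Longrightarrow> pure \<zero>\<^bsub>V\<^esub> w = \<zero>\<^bsub>T\<^esub>"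
  using pure_add_left[of "\<zero>\<^bsub>V\<^esub>" "\<zero>\<^bsub>V\<^esub>" w] by (simp add: T.add.l_cancel_one)

lemma pure_minus_left: "\<lbrakk>v \<in> carrier V; w \<in> carrier W\<rbrakk> \<Longrightarrow> pure (\<ominus>\<^bsub>V\<^esub> v) w = \<ominus>\<^bsub>T\<^esub> pure v w"
  using pure_add_left[of "\<ominus>\<^bsub>V\<^esub> v" v w]
  by (simp add: pure_zero_left V.l_neg T.add.inv_equality)

lemma minus_coset:
  assumes "p \<in> carrier FG"
  shows "N #>\<^bsub>FG\<^esub> (- p) = \<ominus>\<^bsub>T\<^esub> (N #>\<^bsub>FG\<^esub> p)"
proof -
  have "(N #>\<^bsub>FG\<^esub> (- p)) \<oplus>\<^bsub>T\<^esub> (N #>\<^bsub>FG\<^esub> p) = \<zero>\<^bsub>T\<^esub>"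
    using assms by (simp add: add_tensor zero_tensor)
  moreover have "N #>\<^bsub>FG\<^esub> p \<in> carrier T" "N #>\<^bsub>FG\<^esub> (- p) \<in> carrier T"
    unfolding carrier_tensor using assms by (blast, fastforce)
  ultimately show ?thesis
    by (simp add: T.minus_equality)
qed

text \<open>Pure tensors generate the tensor product already under addition, because a sign can be
  moved into the left factor. The induction on the free abelian group passes to differences, so
  \<open>P\<close> is carried for the classes of \<open>p\<close> and \<open>- p\<close>
  simultaneously.\<close>

lemma tensor_induct [consumes 1, case_names pure add]:
  assumes t: "t \<in> carrier T"
    and pure: "\<And>v w. \<lbrakk>v \<in> carrier V; w \<in> carrier W\<rbrakk> \<Longrightarrow> P (pure v w)"
    and add: "\<And>s t. \<lbrakk>s \<in> carrier T; t \<in> carrier T; P s; P t\<rbrakk> \<Longrightarrow> P (s \<oplus>\<^bsub>T\<^esub> t)"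
  shows "P t"
proof -
  obtain p where p: "p \<in> carrier FG" "t = N #>\<^bsub>FG\<^esub> p"
    using t carrier_tensor by auto
  have closed: "N #>\<^bsub>FG\<^esub> q \<in> carrier T" if "q \<in> carrier FG" for q
    using that carrier_tensor by auto
  have "Poly_Mapping.keys p \<subseteq> carrier V \<times> carrier W" using p by simp
  then have "P (N #>\<^bsub>FG\<^esub> p) \<and> P (N #>\<^bsub>FG\<^esub> (- p))"
  proof (induction p rule: free_Abelian_group_induct[consumes 1, case_names zero diff gen])
    case zero
    have "P (pure \<zero>\<^bsub>V\<^esub> \<zero>\<^bsub>W\<^esub>)" by (intro pure) auto
    then show ?case by (simp add: pure_zero_left zero_tensor)
  next
    case (diff x y)
    have "P ((N #>\<^bsub>FG\<^esub> x) \<oplus>\<^bsub>T\<^esub> (N #>\<^bsub>FG\<^esub> (- y)))"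
      using diff by (intro add closed) auto
    moreover have "P ((N #>\<^bsub>FG\<^esub> (- x)) \<oplus>\<^bsub>T\<^esub> (N #>\<^bsub>FG\<^esub> y))"
      using diff by (intro add closed) auto
    ultimately show ?case using diff by (simp add: add_tensor)
  next
    case (gen a)
    obtain v w where a: "a = (v, w)" "v \<in> carrier V" "w \<in> carrier W" using gen by auto
    have "P (pure (\<ominus>\<^bsub>V\<^esub> v) w)" "P (pure v w)" using a by (auto intro: pure)
    then show ?case
      using a pure_minus_left[OF a(2,3)] minus_coset[of "frag_of a"]
      by (simp add: pure_tensor_def)
  qed
  then show ?thesis using p by simp
qed

text \<open>The formal sums on which evaluation vanishes form a subgroup; it contains the relators
  because \<open>b\<close> is balanced, hence also the subgroup they generate.\<close>

lemma frag_eval_null: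
  assumes G: "abelian_group G" and b: "balanced S r l V W G b" and x: "x \<in> N"
  shows "frag_eval G b x = \<zero>\<^bsub>G\<^esub>"
proof -
  interpret G: abelian_group G by (rule G)
  let ?Z = "{p \<in> carrier FG. frag_eval G b p = \<zero>\<^bsub>G\<^esub>}"
  have closed: "b (fst x) (snd x) \<in> carrier G" if "x \<in> Poly_Mapping.keys p" "p \<in> carrier FG" for x p
    using that b unfolding balanced_def by auto
  have bc: "b v w \<in> carrier G" if "v \<in> carrier V" "w \<in> carrier W" for v w
    using that b unfolding balanced_def by auto
  have "subgroup ?Z FG"
  proof (rule group.subgroupI[OF group_free_Abelian_group])
    show "?Z \<noteq> {}" using G.frag_eval_0 by (auto intro!: exI[of _ 0])
    show "inv\<^bsub>FG\<^esub> a \<in> ?Z" if "a \<in> ?Z" for a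
      using that closed by (simp add: G.frag_eval_minus)
    show "a \<otimes>\<^bsub>FG\<^esub> a' \<in> ?Z" if "a \<in> ?Z" "a' \<in> ?Z" for a a'
    proof -
      have "frag_eval G b (a + a') = frag_eval G b a \<oplus>\<^bsub>G\<^esub> frag_eval G b a'"
        using that closed[of _ a] closed[of _ a'] by (intro G.frag_eval_add) blast
      then show ?thesis using that keys_add[of a a'] by auto
    qed
  qed auto
  moreover have "tensor_relators S r l V W \<subseteq> ?Z"
  proof -
    have ev3: "frag_eval G b (frag_of (v, w) - frag_of (v', w') - frag_of (v'', w'')) =
        b v w \<ominus>\<^bsub>G\<^esub> b v' w' \<ominus>\<^bsub>G\<^esub> b v'' w''"
      if "v \<in> carrier V" "w \<in> carrier W" "v' \<in> carrier V" "w' \<in> carrier W"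
        "v'' \<in> carrier V" "w'' \<in> carrier W" for v w v' w' v'' w''
    proof -
      have "frag_eval G b (frag_of (v, w) + - frag_of (v', w') + - frag_of (v'', w'')) =
        frag_eval G b (frag_of (v, w) + - frag_of (v', w')) \<oplus>\<^bsub>G\<^esub> frag_eval G b (- frag_of (v'', w''))"
        by (rule G.frag_eval_add) (use that bc keys_add[of "frag_of (v,w)" "- frag_of (v',w')"] in auto)
      also have "frag_eval G b (frag_of (v, w) + - frag_of (v', w')) =
         frag_eval G b (frag_of (v, w)) \<oplus>\<^bsub>G\<^esub> frag_eval G b (- frag_of (v', w'))"
        by (rule G.frag_eval_add) (use that bc in auto)
      finally show ?thesis
        using that bc
        by (simp add: G.frag_eval_minus_frag_of G.frag_eval_frag_of G.minus_eq)
    qed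
    have ev2: "frag_eval G b (frag_of (v, w) - frag_of (v', w')) = b v w \<ominus>\<^bsub>G\<^esub> b v' w'"
      if "v \<in> carrier V" "w \<in> carrier W" "v' \<in> carrier V" "w' \<in> carrier W" for v w v' w'
    proof -
      have "frag_eval G b (frag_of (v, w) + - frag_of (v', w')) =
         frag_eval G b (frag_of (v, w)) \<oplus>\<^bsub>G\<^esub> frag_eval G b (- frag_of (v', w'))"
        by (rule G.frag_eval_add) (use that bc in auto)
      then show ?thesis
        using that bc by (simp add: G.frag_eval_minus_frag_of G.frag_eval_frag_of G.minus_eq)
    qed
    have can: "x \<oplus>\<^bsub>G\<^esub> y \<ominus>\<^bsub>G\<^esub> x \<ominus>\<^bsub>G\<^esub> y = \<zero>\<^bsub>G\<^esub>" if "x \<in> carrier G" "y \<in> carrier G" for x y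
      using that by (metis G.add.m_closed G.add.inv_mult_group G.a_ac(1) G.a_comm G.minus_eq
          G.r_neg G.a_inv_closed)
    have "frag_eval G b x = \<zero>\<^bsub>G\<^esub>" if "x \<in> tensor_relators S r l V W" for x
      using that unfolding tensor_relators_def
    proof (elim UnE CollectE exE conjE)
      fix v v' w
      assume "x = frag_of (v \<oplus>\<^bsub>V\<^esub> v', w) - frag_of (v, w) - frag_of (v', w)"
        and a: "v \<in> carrier V" "v' \<in> carrier V" "w \<in> carrier W"
      then have "frag_eval G b x = b (v \<oplus>\<^bsub>V\<^esub> v') w \<ominus>\<^bsub>G\<^esub> b v w \<ominus>\<^bsub>G\<^esub> b v' w"
        by (simp add: ev3)
      also have "b (v \<oplus>\<^bsub>V\<^esub> v') w = b v w \<oplus>\<^bsub>G\<^esub> b v' w"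
        using a b unfolding balanced_def by blast
      finally show ?thesis using can bc a by simp
    next
      fix v w w'
      assume "x = frag_of (v, w \<oplus>\<^bsub>W\<^esub> w') - frag_of (v, w) - frag_of (v, w')"
        and a: "v \<in> carrier V" "w' \<in> carrier W" "w \<in> carrier W"
      then have "frag_eval G b x = b v (w \<oplus>\<^bsub>W\<^esub> w') \<ominus>\<^bsub>G\<^esub> b v w \<ominus>\<^bsub>G\<^esub> b v w'"
        by (simp add: ev3)
      also have "b v (w \<oplus>\<^bsub>W\<^esub> w') = b v w \<oplus>\<^bsub>G\<^esub> b v w'"
        using a b unfolding balanced_def by blast
      finally show ?thesis using can bc a by simp
    next
      fix v s w
      assume "x = frag_of (r v s, w) - frag_of (v, l s w)"
        and a: "v \<in> carrier V" "s \<in> S" "w \<in> carrier W"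
      moreover have "b (r v s) w = b v (l s w)"
        using a b unfolding balanced_def by blast
      ultimately show ?thesis using bc a r_closed l_closed
        by (simp add: ev2 G.r_neg G.minus_eq)
    qed
    then show ?thesis using relators_closed by blast
  qed
  ultimately have "N \<subseteq> ?Z"
    unfolding tensor_null_def
    by (intro group.generate_subgroup_incl[OF group_free_Abelian_group])
  then show ?thesis using x by auto
qed

text \<open>The coset of \<open>p\<close> consists of the sums \<open>n + p\<close> with
  \<open>n\<close> in the null subgroup, on which evaluation vanishes. All representatives therefore
  have one value, and \<open>the_elem\<close> returns it.\<close>

lemma tensor_lift_coset:
  assumes G: "abelian_group G" and b: "balanced S r l V W G b" and p: "p \<in> carrier FG"
  shows "tensor_lift G b (N #>\<^bsub>FG\<^esub> p) = frag_eval G b p"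
proof -
  interpret G: abelian_group G by (rule G)
  have closed: "b (fst x) (snd x) \<in> carrier G" if "x \<in> Poly_Mapping.keys q" "q \<in> carrier FG" for x q
    using that b unfolding balanced_def by auto
  have NF: "n \<in> carrier FG" if "n \<in> N" for n
    using that null_subgroup subgroup.subset by blast
  have ev: "frag_eval G b (n + p) = frag_eval G b p" if "n \<in> N" for n
  proof -
    have "frag_eval G b (n + p) = frag_eval G b n \<oplus>\<^bsub>G\<^esub> frag_eval G b p"
      using p NF[OF that] closed by (intro G.frag_eval_add) auto
    then show ?thesis
      using frag_eval_null[OF G b that] G.frag_eval_closed[of p b] closed p by simp
  qed
  have "frag_eval G b ` (N #>\<^bsub>FG\<^esub> p) = {frag_eval G b p}"
    using ev subgroup.one_closed[OF null_subgroup]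
    unfolding r_coset_def by (auto simp: image_iff)
  then show ?thesis unfolding tensor_lift_def by simp
qed

lemma tensor_lift_pure:
  assumes "abelian_group G" "balanced S r l V W G b" "v \<in> carrier V" "w \<in> carrier W"
  shows "tensor_lift G b (pure v w) = b v w"
proof -
  have "b v w \<in> carrier G" using assms unfolding balanced_def by auto
  then show ?thesis
    unfolding pure_tensor_def using assms
    by (simp add: tensor_lift_coset abelian_group.frag_eval_frag_of)
qed

lemma tensor_lift_add:
  assumes G: "abelian_group G" and b: "balanced S r l V W G b" and st: "s \<in> carrier T" "t \<in> carrier T"
  shows "tensor_lift G b (s \<oplus>\<^bsub>T\<^esub> t) = tensor_lift G b s \<oplus>\<^bsub>G\<^esub> tensor_lift G b t"
proof -
  interpret G: abelian_group G by (rule G)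
  obtain p q where pq: "p \<in> carrier FG" "s = N #>\<^bsub>FG\<^esub> p" "q \<in> carrier FG" "t = N #>\<^bsub>FG\<^esub> q"
    using st carrier_tensor by auto
  have closed: "b (fst x) (snd x) \<in> carrier G" if "x \<in> Poly_Mapping.keys q" "q \<in> carrier FG" for x q
    using that b unfolding balanced_def by auto
  have "p + q \<in> carrier FG" using pq keys_add[of p q] by auto
  then have "tensor_lift G b (s \<oplus>\<^bsub>T\<^esub> t) = frag_eval G b (p + q)"
    using pq tensor_lift_coset[OF G b] by (simp add: add_tensor)
  also have "\<dots> = frag_eval G b p \<oplus>\<^bsub>G\<^esub> frag_eval G b q"
    using pq closed by (intro G.frag_eval_add) auto
  finally show ?thesis using pq tensor_lift_coset[OF G b] by simp
qed

lemma tensor_lift_closed: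
  assumes G: "abelian_group G" and b: "balanced S r l V W G b" and t: "t \<in> carrier T"
  shows "tensor_lift G b t \<in> carrier G"
  using t
proof (induction t rule: tensor_induct)
  case (pure v w)
  then show ?case using tensor_lift_pure[OF G b pure] b unfolding balanced_def by simp
next
  case (add s t)
  then show ?case using tensor_lift_add[OF G b] abelian_group.axioms(1)[OF G]
    by (simp add: abelian_monoid.a_closed)
qed

text \<open>Every representative in the coset is supported on
  \<open>carrier V \<times> carrier W\<close>, so agreement there is enough. Integrands can thus be
  rewritten before their bilinearity is established.\<close>

lemma tensor_lift_cong:
  assumes "\<And>v w. \<lbrakk>v \<in> carrier V; w \<in> carrier W\<rbrakk> \<Longrightarrow> b v w = b' v w" "t \<in> carrier T"
  shows "tensor_lift G b t = tensor_lift G b' t"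
proof -
  have "frag_eval G b p = frag_eval G b' p" if "p \<in> t" for p
  proof (rule frag_eval_cong)
    obtain q where q: "q \<in> carrier FG" "t = N #>\<^bsub>FG\<^esub> q"
      using assms(2) carrier_tensor by auto
    have "p \<in> carrier FG"
      using monoid.r_coset_subset_G[OF group.is_monoid[OF group_free_Abelian_group] subgroup.subset[OF null_subgroup] q(1)] q that
      by (simp add: subset_iff)
    then show "b (fst x) (snd x) = b' (fst x) (snd x)" if "x \<in> Poly_Mapping.keys p" for x
      using that assms(1) by auto
  qed
  then show ?thesis unfolding tensor_lift_def by simp
qed

end


section \<open>Multilinear calculus\<close>

text \<open>
  Multilinearity side conditions are discharged by iterating \<open>assumption | rule lin\<close>.  Plain
  \<open>intro\<close> would not do: in \<open>klinear_lift_param\<close> the tensor factors occur in the premises only, and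
  have to be instantiated by solving the first premise.
\<close>

named_theorems lin

text \<open>The module axioms are part of the judgement, so that the side conditions of the lifting
  rules can be read off from a linearity fact.\<close>

definition klinear ::
    "'k ring \<Rightarrow> ('k, 'v, 'm) module_scheme \<Rightarrow> ('k, 'w, 'n) module_scheme \<Rightarrow> ('v \<Rightarrow> 'w) \<Rightarrow> bool" where
  "klinear K V W f \<longleftrightarrow> module K V \<and> module K W \<and> linear_map K V W f"

definition kbilinear ::
    "'k ring \<Rightarrow> ('k, 'v, 'm) module_scheme \<Rightarrow> ('k, 'w, 'n) module_scheme \<Rightarrow>
     ('k, 'u, 'o) module_scheme \<Rightarrow> ('v \<Rightarrow> 'w \<Rightarrow> 'u) \<Rightarrow> bool" where
  "kbilinear K V W G b \<longleftrightarrow> module K V \<and> module K W \<and> module K G \<and>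
     (\<forall>v\<in>carrier V. klinear K W G (b v)) \<and> (\<forall>w\<in>carrier W. klinear K V G (\<lambda>v. b v w))"

lemma klinearI:
  assumes "module K V" "module K W" "\<And>v. v \<in> carrier V \<Longrightarrow> f v \<in> carrier W"
    "\<And>v v'. \<lbrakk>v \<in> carrier V; v' \<in> carrier V\<rbrakk> \<Longrightarrow> f (v \<oplus>\<^bsub>V\<^esub> v') = f v \<oplus>\<^bsub>W\<^esub> f v'"
    "\<And>k v. \<lbrakk>k \<in> carrier K; v \<in> carrier V\<rbrakk> \<Longrightarrow> f (k \<odot>\<^bsub>V\<^esub> v) = k \<odot>\<^bsub>W\<^esub> f v"
  shows "klinear K V W f"
  using assms unfolding klinear_def linear_map_def by auto

lemma klinear_module:
  assumes "klinear K V W f" shows "module K V" "module K W"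
  using assms unfolding klinear_def by auto

lemma klinearD:
  assumes "klinear K V W f"
  shows klinear_closed: "v \<in> carrier V \<Longrightarrow> f v \<in> carrier W"
    and klinear_add: "\<lbrakk>v \<in> carrier V; v' \<in> carrier V\<rbrakk> \<Longrightarrow> f (v \<oplus>\<^bsub>V\<^esub> v') = f v \<oplus>\<^bsub>W\<^esub> f v'"
    and klinear_smult: "\<lbrakk>k \<in> carrier K; v \<in> carrier V\<rbrakk> \<Longrightarrow> f (k \<odot>\<^bsub>V\<^esub> v) = k \<odot>\<^bsub>W\<^esub> f v"
  using assms unfolding klinear_def linear_map_def by auto

lemma kbilinearI [lin]:
  assumes "module K V" "module K W" "module K G"
    "\<And>v. v \<in> carrier V \<Longrightarrow> klinear K W G (\<lambda>w. b v w)"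
    "\<And>w. w \<in> carrier W \<Longrightarrow> klinear K V G (\<lambda>v. b v w)"
  shows "kbilinear K V W G (\<lambda>v w. b v w)"
  unfolding kbilinear_def by (intro conjI ballI assms)

lemma kbilinear_module:
  assumes "kbilinear K V W G b" shows "module K V" "module K W" "module K G"
  using assms unfolding kbilinear_def by auto

lemma kbilinear_left:
  "\<lbrakk>kbilinear K V W G b; w \<in> carrier W\<rbrakk> \<Longrightarrow> klinear K V G (\<lambda>v. b v w)"
  unfolding kbilinear_def by blast

lemma kbilinear_right:
  "\<lbrakk>kbilinear K V W G b; v \<in> carrier V\<rbrakk> \<Longrightarrow> klinear K W G (b v)"
  unfolding kbilinear_def by blast

lemma kbilinear_closed:
  "\<lbrakk>kbilinear K V W G b; v \<in> carrier V; w \<in> carrier W\<rbrakk> \<Longrightarrow> b v w \<in> carrier G"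
  by (rule klinear_closed[OF kbilinear_right])

lemma klinear_comp: "\<lbrakk>klinear K V W f; klinear K X V g\<rbrakk> \<Longrightarrow> klinear K X W (\<lambda>x. f (g x))"
  by (rule klinearI) (auto simp: klinear_module klinearD)

lemma kbilinear_comp_left:
  "\<lbrakk>kbilinear K V W G b; klinear K X V f; w \<in> carrier W\<rbrakk> \<Longrightarrow> klinear K X G (\<lambda>x. b (f x) w)"
  using klinear_comp[OF kbilinear_left] .

lemma kbilinear_comp_right:
  "\<lbrakk>kbilinear K V W G b; klinear K X W f; v \<in> carrier V\<rbrakk> \<Longrightarrow> klinear K X G (\<lambda>x. b v (f x))"
  using klinear_comp[OF kbilinear_right] .

lemma klinear_id [lin]: "module K V \<Longrightarrow> klinear K V V (\<lambda>v. v)"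
  by (rule klinearI) auto

lemma klinear_zero_fun: "\<lbrakk>module K V; module K W\<rbrakk> \<Longrightarrow> klinear K V W (\<lambda>v. \<zero>\<^bsub>W\<^esub>)"
  by (rule klinearI) (auto simp: module.smult_r_null abelian_group.axioms abelian_monoid.zero_closed
      abelian_monoid.l_zero module.axioms)

lemma module_abelian: "module K V \<Longrightarrow> abelian_group V"
  by (rule module.axioms)

lemma module_smult_closed: "\<lbrakk>module K G; k \<in> carrier K; y \<in> carrier G\<rbrakk> \<Longrightarrow> k \<odot>\<^bsub>G\<^esub> y \<in> carrier G"
  by (rule module.smult_closed)

lemma klinear_add_fun [lin]:
  assumes "klinear K V W f" "klinear K V W g"
  shows "klinear K V W (\<lambda>v. f v \<oplus>\<^bsub>W\<^esub> g v)"
proof -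
  interpret W: module K W using klinear_module(2)[OF assms(1)] .
  show ?thesis
    using assms klinear_module[OF assms(1)]
    by (intro klinearI) (auto simp: klinearD W.M.a_ac W.smult_r_distr)
qed

lemma klinear_smult_fun [lin]:
  assumes "klinear K V W f" "k \<in> carrier K"
  shows "klinear K V W (\<lambda>v. k \<odot>\<^bsub>W\<^esub> f v)"
proof -
  interpret W: module K W using klinear_module(2)[OF assms(1)] .
  \<comment> \<open>Commutativity of \<open>K\<close> is what makes a scalar multiple of a linear
    map linear again.\<close>
  have swap: "k \<odot>\<^bsub>W\<^esub> (k' \<odot>\<^bsub>W\<^esub> w) = k' \<odot>\<^bsub>W\<^esub> (k \<odot>\<^bsub>W\<^esub> w)" if "k' \<in> carrier K" "w \<in> carrier W" for k' w
    using that assms(2) by (simp flip: W.smult_assoc1 add: W.R.m_comm)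
  show ?thesis
    using assms klinear_module[OF assms(1)]
    by (intro klinearI) (auto simp: klinearD W.smult_r_distr swap)
qed

lemma klinear_zero: "klinear K V W f \<Longrightarrow> f \<zero>\<^bsub>V\<^esub> = \<zero>\<^bsub>W\<^esub>"
proof -
  assume f: "klinear K V W f"
  interpret V: module K V using klinear_module(1)[OF f] .
  interpret W: module K W using klinear_module(2)[OF f] .
  have "f (\<zero>\<^bsub>V\<^esub> \<oplus>\<^bsub>V\<^esub> \<zero>\<^bsub>V\<^esub>) = f \<zero>\<^bsub>V\<^esub> \<oplus>\<^bsub>W\<^esub> f \<zero>\<^bsub>V\<^esub>" using f by (intro klinear_add) auto
  then show ?thesis using klinear_closed[OF f, of "\<zero>\<^bsub>V\<^esub>"] by simp
qed


subsection \<open>Tensor products over the ground ring\<close>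

lemma ktensor_sel [simp]:
  "carrier (ktensor K V W) = carrier (tensor_group (carrier K) (\<lambda>v k. k \<odot>\<^bsub>V\<^esub> v) (smult W) V W)"
  "add (ktensor K V W) = add (tensor_group (carrier K) (\<lambda>v k. k \<odot>\<^bsub>V\<^esub> v) (smult W) V W)"
  "\<zero>\<^bsub>ktensor K V W\<^esub> = \<zero>\<^bsub>tensor_group (carrier K) (\<lambda>v k. k \<odot>\<^bsub>V\<^esub> v) (smult W) V W\<^esub>"
  by (simp_all add: ktensor_def Let_def)

lemma tensor_lift_ktensor:
  "tensor_lift (tensor_group (carrier K) (\<lambda>v k. k \<odot>\<^bsub>V\<^esub> v) (smult W) V W) =
   tensor_lift (ktensor K V W)"
  by (rule tensor_lift_cong_group) simp_all

lemma ktensor_smult: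
  "k \<odot>\<^bsub>ktensor K V W\<^esub> t = tensor_lift (ktensor K V W) (\<lambda>v w. kpure K V W (k \<odot>\<^bsub>V\<^esub> v) w) t"
  unfolding tensor_lift_ktensor[symmetric] by (simp add: ktensor_def Let_def)

lemma ktensor_mult:
  "s \<otimes>\<^bsub>ktensor K V W\<^esub> t = tensor_lift (ktensor K V W) (\<lambda>v w.
     tensor_lift (ktensor K V W) (\<lambda>v' w'. kpure K V W (v \<otimes>\<^bsub>V\<^esub> v') (w \<otimes>\<^bsub>W\<^esub> w')) t) s"
  unfolding tensor_lift_ktensor[symmetric] by (simp add: ktensor_def Let_def)

lemma ktensor_one: "\<one>\<^bsub>ktensor K V W\<^esub> = kpure K V W \<one>\<^bsub>V\<^esub> \<one>\<^bsub>W\<^esub>"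
  by (simp add: ktensor_def Let_def)

lemma balanced_pair_K:
  "\<lbrakk>module K V; module K W\<rbrakk> \<Longrightarrow> balanced_pair (carrier K) (\<lambda>v k. k \<odot>\<^bsub>V\<^esub> v) (smult W) V W"
  unfolding balanced_pair_def balanced_pair_axioms_def
  by (auto simp: module_abelian module.smult_closed)

lemma balanced_kbilinear:
  assumes "kbilinear K V W G b"
  shows "balanced (carrier K) (\<lambda>v k. k \<odot>\<^bsub>V\<^esub> v) (smult W) V W G b"
  unfolding balanced_def
  using klinear_add[OF kbilinear_left[OF assms]] klinear_add[OF kbilinear_right[OF assms]]
    klinear_smult[OF kbilinear_left[OF assms]] klinear_smult[OF kbilinear_right[OF assms]]
  by (auto simp: kbilinear_closed[OF assms])

lemma kpure_closed:
  "\<lbrakk>module K V; module K W; v \<in> carrier V; w \<in> carrier W\<rbrakk> \<Longrightarrow> kpure K V W v w \<in> carrier (ktensor K V W)"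
  unfolding kpure_def using balanced_pair.pure_closed[OF balanced_pair_K] by simp

lemma kpure_add_left:
  "\<lbrakk>module K V; module K W; v \<in> carrier V; v' \<in> carrier V; w \<in> carrier W\<rbrakk> \<Longrightarrow>
   kpure K V W (v \<oplus>\<^bsub>V\<^esub> v') w = kpure K V W v w \<oplus>\<^bsub>ktensor K V W\<^esub> kpure K V W v' w"
  unfolding kpure_def using balanced_pair.pure_add_left[OF balanced_pair_K] by simp

lemma kpure_add_right:
  "\<lbrakk>module K V; module K W; v \<in> carrier V; w \<in> carrier W; w' \<in> carrier W\<rbrakk> \<Longrightarrow>
   kpure K V W v (w \<oplus>\<^bsub>W\<^esub> w') = kpure K V W v w \<oplus>\<^bsub>ktensor K V W\<^esub> kpure K V W v w'"
  unfolding kpure_def using balanced_pair.pure_add_right[OF balanced_pair_K] by simp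

lemma kpure_balanced:
  "\<lbrakk>module K V; module K W; v \<in> carrier V; w \<in> carrier W; k \<in> carrier K\<rbrakk> \<Longrightarrow>
   kpure K V W (k \<odot>\<^bsub>V\<^esub> v) w = kpure K V W v (k \<odot>\<^bsub>W\<^esub> w)"
  unfolding kpure_def by (rule balanced_pair.pure_balanced[OF balanced_pair_K])

lemma ktensor_induct [consumes 3, case_names pure add]:
  assumes "module K V" "module K W" "t \<in> carrier (ktensor K V W)"
    and "\<And>v w. \<lbrakk>v \<in> carrier V; w \<in> carrier W\<rbrakk> \<Longrightarrow> P (kpure K V W v w)"
    and "\<And>s t. \<lbrakk>s \<in> carrier (ktensor K V W); t \<in> carrier (ktensor K V W); P s; P t\<rbrakk> \<Longrightarrow>
      P (s \<oplus>\<^bsub>ktensor K V W\<^esub> t)"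
  shows "P t"
  using balanced_pair.tensor_induct[OF balanced_pair_K[OF assms(1,2)], of t P] assms(3-)
  unfolding kpure_def by simp

lemma lift_closed:
  "\<lbrakk>kbilinear K V W G b; t \<in> carrier (ktensor K V W)\<rbrakk> \<Longrightarrow> tensor_lift G b t \<in> carrier G"
  using balanced_pair.tensor_lift_closed[OF balanced_pair_K _ balanced_kbilinear]
  by (metis kbilinear_module ktensor_sel(1) module_abelian)

lemma lift_kpure:
  "\<lbrakk>kbilinear K V W G b; v \<in> carrier V; w \<in> carrier W\<rbrakk> \<Longrightarrow> tensor_lift G b (kpure K V W v w) = b v w"
  unfolding kpure_def
  using balanced_pair.tensor_lift_pure[OF balanced_pair_K _ balanced_kbilinear]
  by (metis kbilinear_module module_abelian)

lemma lift_add: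
  "\<lbrakk>kbilinear K V W G b; s \<in> carrier (ktensor K V W); t \<in> carrier (ktensor K V W)\<rbrakk> \<Longrightarrow>
   tensor_lift G b (s \<oplus>\<^bsub>ktensor K V W\<^esub> t) = tensor_lift G b s \<oplus>\<^bsub>G\<^esub> tensor_lift G b t"
  using balanced_pair.tensor_lift_add[OF balanced_pair_K _ balanced_kbilinear]
  by (metis kbilinear_module ktensor_sel(1,2) module_abelian)

lemma lift_cong:
  assumes "module K V" "module K W" "t \<in> carrier (ktensor K V W)"
    "\<And>v w. \<lbrakk>v \<in> carrier V; w \<in> carrier W\<rbrakk> \<Longrightarrow> b v w = b' v w"
  shows "tensor_lift G b t = tensor_lift G b' t"
  by (rule balanced_pair.tensor_lift_cong[OF balanced_pair_K[OF assms(1,2)]])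
    (use assms(3,4) in simp_all)

lemma ktensor_abelian_group: "\<lbrakk>module K V; module K W\<rbrakk> \<Longrightarrow> abelian_group (ktensor K V W)"
proof -
  assume VW: "module K V" "module K W"
  interpret balanced_pair "carrier K" "\<lambda>v k. k \<odot>\<^bsub>V\<^esub> v" "smult W" V W
    using balanced_pair_K[OF VW] .
  show ?thesis
    using T.a_closed T.zero_closed T.l_neg
    by (intro abelian_groupI) (auto simp: T.a_ac intro!: bexI[of _ "\<ominus>\<^bsub>T\<^esub> _"])
qed

text \<open>Scalar multiplication is put on the left factor. Commutativity of \<open>K\<close> lets
  it pass the scalar that balancing moves across, so it is well defined on the tensor
  product.\<close>

lemma balanced_kpure_smult:
  assumes V: "module K V" and W: "module K W" and k: "k \<in> carrier K"
  shows "balanced (carrier K) (\<lambda>v k. k \<odot>\<^bsub>V\<^esub> v) (smult W) V W (ktensor K V W)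
    (\<lambda>v w. kpure K V W (k \<odot>\<^bsub>V\<^esub> v) w)"
proof -
  interpret V: module K V by (rule V)
  note [simp del] = ktensor_sel
  have "kpure K V W (k \<odot>\<^bsub>V\<^esub> (l \<odot>\<^bsub>V\<^esub> v)) w = kpure K V W (k \<odot>\<^bsub>V\<^esub> v) (l \<odot>\<^bsub>W\<^esub> w)"
    if "v \<in> carrier V" "w \<in> carrier W" "l \<in> carrier K" for v w l
  proof -
    have "k \<odot>\<^bsub>V\<^esub> (l \<odot>\<^bsub>V\<^esub> v) = l \<odot>\<^bsub>V\<^esub> (k \<odot>\<^bsub>V\<^esub> v)"
      using that k by (simp add: V.smult_assoc1[symmetric] V.R.m_comm)
    then show ?thesis using that k kpure_balanced[OF V W, of "k \<odot>\<^bsub>V\<^esub> v" w l] by simp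
  qed
  then show ?thesis
    unfolding balanced_def
    by (intro conjI ballI)
      (simp_all add: k V.smult_r_distr kpure_closed V W kpure_add_left kpure_add_right)
qed

lemma ktensor_module [lin]:
  assumes V: "module K V" and W: "module K W"
  shows "module K (ktensor K V W)"
proof -
  interpret V: module K V by (rule V)
  interpret W: module K W by (rule W)
  let ?T = "ktensor K V W"
  interpret T: abelian_group ?T by (rule ktensor_abelian_group[OF V W])
  note b = balanced_kpure_smult[OF V W]
  note bp = balanced_pair_K[OF V W]
  have ab: "abelian_group ?T" ..
  have cl: "k \<odot>\<^bsub>?T\<^esub> t \<in> carrier ?T" if "k \<in> carrier K" "t \<in> carrier ?T" for k t
    using balanced_pair.tensor_lift_closed[OF bp ab b[OF that(1)]] that(2)
    by (simp add: ktensor_smult)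
  have pu: "k \<odot>\<^bsub>?T\<^esub> kpure K V W v w = kpure K V W (k \<odot>\<^bsub>V\<^esub> v) w"
    if "k \<in> carrier K" "v \<in> carrier V" "w \<in> carrier W" for k v w
    using balanced_pair.tensor_lift_pure[OF bp ab b[OF that(1)] that(2,3)]
    by (simp add: ktensor_smult kpure_def)
  have ad: "k \<odot>\<^bsub>?T\<^esub> (s \<oplus>\<^bsub>?T\<^esub> t) = k \<odot>\<^bsub>?T\<^esub> s \<oplus>\<^bsub>?T\<^esub> k \<odot>\<^bsub>?T\<^esub> t"
    if "k \<in> carrier K" "s \<in> carrier ?T" "t \<in> carrier ?T" for k s t
    using balanced_pair.tensor_lift_add[OF bp ab b[OF that(1)]] that(2,3)
    by (simp add: ktensor_smult)
  show ?thesis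
  proof (rule moduleI)
    show "cring K" ..
    show "abelian_group ?T" ..
    fix k l t assume kl: "k \<in> carrier K" "l \<in> carrier K"
    show "(k \<oplus>\<^bsub>K\<^esub> l) \<odot>\<^bsub>?T\<^esub> t = k \<odot>\<^bsub>?T\<^esub> t \<oplus>\<^bsub>?T\<^esub> l \<odot>\<^bsub>?T\<^esub> t" if "t \<in> carrier ?T"
      using V W that
    proof (induction t rule: ktensor_induct)
      case (pure v w)
      then show ?case using kl by (simp add: pu V.smult_l_distr kpure_add_left V W del: ktensor_sel)
    next
      case (add s t)
      have "(k \<oplus>\<^bsub>K\<^esub> l) \<odot>\<^bsub>?T\<^esub> (s \<oplus>\<^bsub>?T\<^esub> t) = (k \<odot>\<^bsub>?T\<^esub> s \<oplus>\<^bsub>?T\<^esub> l \<odot>\<^bsub>?T\<^esub> s) \<oplus>\<^bsub>?T\<^esub> (k \<odot>\<^bsub>?T\<^esub> t \<oplus>\<^bsub>?T\<^esub> l \<odot>\<^bsub>?T\<^esub> t)"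
        using add kl by (simp add: ad del: ktensor_sel)
      then show ?case using add kl by (simp add: ad cl T.a_ac del: ktensor_sel)
    qed
    show "(k \<otimes>\<^bsub>K\<^esub> l) \<odot>\<^bsub>?T\<^esub> t = k \<odot>\<^bsub>?T\<^esub> (l \<odot>\<^bsub>?T\<^esub> t)" if "t \<in> carrier ?T"
      using V W that
    proof (induction t rule: ktensor_induct)
      case (pure v w)
      then show ?case using kl by (simp add: pu V.smult_assoc1 del: ktensor_sel)
    next
      case (add s t)
      then show ?case using kl by (simp add: ad cl del: ktensor_sel)
    qed
  next
    show "\<one>\<^bsub>K\<^esub> \<odot>\<^bsub>?T\<^esub> t = t" if "t \<in> carrier ?T" for t
      using V W that
    proof (induction t rule: ktensor_induct)
      case (pure v w)
      then show ?case by (simp add: pu del: ktensor_sel)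
    next
      case (add s t)
      then show ?case by (simp add: ad del: ktensor_sel)
    qed
  qed (rule cl ad; assumption)+
qed

lemma ktensor_smult_kpure:
  assumes V: "module K V" and W: "module K W" and k: "k \<in> carrier K" and vw: "v \<in> carrier V" "w \<in> carrier W"
  shows "k \<odot>\<^bsub>ktensor K V W\<^esub> kpure K V W v w = kpure K V W (k \<odot>\<^bsub>V\<^esub> v) w"
proof -
  interpret V: module K V by (rule V)
  note b = balanced_kpure_smult[OF V W k]
  show ?thesis
    using balanced_pair.tensor_lift_pure[OF balanced_pair_K[OF V W] ktensor_abelian_group[OF V W] b vw]
    by (simp add: ktensor_smult kpure_def)
qed

lemma kbilinear_kpure:
  assumes V: "module K V" and W: "module K W"
  shows "kbilinear K V W (ktensor K V W) (kpure K V W)"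
  using assms
  by (intro kbilinearI klinearI ktensor_module)
    (auto simp: kpure_closed kpure_add_left kpure_add_right ktensor_smult_kpure kpure_balanced
      simp del: ktensor_sel)

lemma klinear_kpure_left [lin]:
  "\<lbrakk>module K W; klinear K X V f; w \<in> carrier W\<rbrakk> \<Longrightarrow> klinear K X (ktensor K V W) (\<lambda>x. kpure K V W (f x) w)"
  by (blast intro: kbilinear_comp_left kbilinear_kpure klinear_module)

lemma klinear_kpure_right [lin]:
  "\<lbrakk>module K V; klinear K X W f; v \<in> carrier V\<rbrakk> \<Longrightarrow> klinear K X (ktensor K V W) (\<lambda>x. kpure K V W v (f x))"
  by (blast intro: kbilinear_comp_right kbilinear_kpure klinear_module)

lemma lift_smult:
  assumes b: "kbilinear K V W G b" and k: "k \<in> carrier K" and t: "t \<in> carrier (ktensor K V W)"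
  shows "tensor_lift G b (k \<odot>\<^bsub>ktensor K V W\<^esub> t) = k \<odot>\<^bsub>G\<^esub> tensor_lift G b t"
  using kbilinear_module(1,2)[OF b] t
proof (induction t rule: ktensor_induct)
  case (pure v w)
  then show ?case
    using b k klinear_smult[OF kbilinear_left[OF b]] kbilinear_module[OF b]
    by (simp add: ktensor_smult_kpure lift_kpure module.smult_closed del: ktensor_sel)
next
  case (add s t)
  interpret G: module K G using kbilinear_module(3)[OF b] .
  interpret T: module K "ktensor K V W"
    by (intro ktensor_module kbilinear_module[OF b])
  show ?case
    using add b k
    by (simp add: T.smult_r_distr lift_add[OF b] G.smult_r_distr lift_closed[OF b] del: ktensor_sel)
qed

lemma klinear_lift:
  "kbilinear K V W G b \<Longrightarrow> klinear K (ktensor K V W) G (tensor_lift G b)"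
  using kbilinear_module
  by (intro klinearI ktensor_module) (auto simp: lift_closed lift_add lift_smult simp del: ktensor_sel)

lemma klinear_lift_comp [lin]:
  "\<lbrakk>klinear K X (ktensor K V W) f; kbilinear K V W G b\<rbrakk> \<Longrightarrow> klinear K X G (\<lambda>x. tensor_lift G b (f x))"
  by (rule klinear_comp[OF klinear_lift])

lemma klinear_ktensor_eqI:
  assumes "klinear K (ktensor K V W) G f" "klinear K (ktensor K V W) G g" "module K V" "module K W"
    "\<And>v w. \<lbrakk>v \<in> carrier V; w \<in> carrier W\<rbrakk> \<Longrightarrow> f (kpure K V W v w) = g (kpure K V W v w)"
    "t \<in> carrier (ktensor K V W)"
  shows "f t = g t"
  using assms(3,4,6)
  by (induction t rule: ktensor_induct)
    (simp_all add: assms(5) klinear_add[OF assms(1)] klinear_add[OF assms(2)] del: ktensor_sel)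

text \<open>The workhorse for pulling a linear operation through a suppressed summation; both sides
  are linear in \<open>t\<close>, so pure tensors decide.\<close>

lemma lift_hom:
  assumes f: "klinear K G G' f" and b: "kbilinear K V W G b" and t: "t \<in> carrier (ktensor K V W)"
  shows "f (tensor_lift G b t) = tensor_lift G' (\<lambda>v w. f (b v w)) t"
proof -
  have fb: "kbilinear K V W G' (\<lambda>v w. f (b v w))"
    by (intro kbilinearI klinear_comp[OF f] kbilinear_left[OF b] kbilinear_right[OF b]
        kbilinear_module[OF b] klinear_module[OF f])
  show ?thesis
    by (rule klinear_ktensor_eqI[OF klinear_comp[OF f klinear_lift[OF b]] klinear_lift[OF fb] _ _ _ t])
      (simp_all add: lift_kpure[OF b] lift_kpure[OF fb] kbilinear_module[OF b])
qed

lemma lift_add_fun: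
  assumes b: "kbilinear K V W G b" and b': "kbilinear K V W G b'" and t: "t \<in> carrier (ktensor K V W)"
  shows "tensor_lift G (\<lambda>v w. b v w \<oplus>\<^bsub>G\<^esub> b' v w) t = tensor_lift G b t \<oplus>\<^bsub>G\<^esub> tensor_lift G b' t"
proof -
  have bb: "kbilinear K V W G (\<lambda>v w. b v w \<oplus>\<^bsub>G\<^esub> b' v w)"
    by (intro kbilinearI klinear_add_fun kbilinear_left[OF b] kbilinear_right[OF b]
        kbilinear_left[OF b'] kbilinear_right[OF b'] kbilinear_module[OF b])
  show ?thesis
    by (rule klinear_ktensor_eqI[OF klinear_lift[OF bb]
          klinear_add_fun[OF klinear_lift[OF b] klinear_lift[OF b']] _ _ _ t])
      (simp_all add: lift_kpure[OF b] lift_kpure[OF b'] lift_kpure[OF bb] kbilinear_module[OF b])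
qed

lemma lift_smult_fun:
  assumes b: "kbilinear K V W G b" and k: "k \<in> carrier K" and t: "t \<in> carrier (ktensor K V W)"
  shows "tensor_lift G (\<lambda>v w. k \<odot>\<^bsub>G\<^esub> b v w) t = k \<odot>\<^bsub>G\<^esub> tensor_lift G b t"
  using lift_hom[OF klinear_smult_fun[OF klinear_id[OF kbilinear_module(3)[OF b]] k] b t] by simp

lemma lift_zero_fun:
  assumes "module K V" "module K W" "module K G" "t \<in> carrier (ktensor K V W)"
  shows "tensor_lift G (\<lambda>v w. \<zero>\<^bsub>G\<^esub>) t = \<zero>\<^bsub>G\<^esub>"
proof -
  have b: "kbilinear K V W G (\<lambda>v w. \<zero>\<^bsub>G\<^esub>)"
    using assms by (intro kbilinearI klinear_zero_fun)
  show ?thesis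
    using lift_hom[OF klinear_zero_fun[OF assms(3,3)] b assms(4)] by simp
qed

text \<open>Counterpart of \<open>klinear_lift_comp\<close>: there the tensor varies and the
  integrand is fixed, here the integrand depends linearly on a parameter and the tensor is
  fixed.\<close>

lemma klinear_lift_param [lin]:
  assumes t: "t \<in> carrier (ktensor K V W)"
    and X: "module K X"
    and b: "\<And>x. x \<in> carrier X \<Longrightarrow> kbilinear K V W G (b x)"
    and x: "\<And>v w. \<lbrakk>v \<in> carrier V; w \<in> carrier W\<rbrakk> \<Longrightarrow> klinear K X G (\<lambda>x. b x v w)"
  shows "klinear K X G (\<lambda>x. tensor_lift G (b x) t)"
proof -
  interpret X: module K X by (rule X)
  note m = kbilinear_module[OF b[OF X.M.zero_closed]]
  show ?thesis
  proof (rule klinearI[OF X m(3)])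
    show "tensor_lift G (b v) t \<in> carrier G" if "v \<in> carrier X" for v
      using lift_closed[OF b[OF that] t] .
    show "tensor_lift G (b (v \<oplus>\<^bsub>X\<^esub> v')) t = tensor_lift G (b v) t \<oplus>\<^bsub>G\<^esub> tensor_lift G (b v') t"
      if "v \<in> carrier X" "v' \<in> carrier X" for v v'
      unfolding lift_add_fun[OF b[OF that(1)] b[OF that(2)] t, symmetric]
      by (rule lift_cong[OF m(1,2) t]) (simp add: klinear_add[OF x] that)
    show "tensor_lift G (b (k \<odot>\<^bsub>X\<^esub> v)) t = k \<odot>\<^bsub>G\<^esub> tensor_lift G (b v) t"
      if "k \<in> carrier K" "v \<in> carrier X" for k v
      unfolding lift_smult_fun[OF b[OF that(2)] that(1) t, symmetric]
      by (rule lift_cong[OF m(1,2) t]) (simp add: klinear_smult[OF x] that)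
  qed
qed

text \<open>Fubini for suppressed sums. Both sides are linear in \<open>s\<close>, and for a pure
  \<open>s\<close> either side is a single sum over \<open>t\<close>.\<close>

lemma lift_swap:
  assumes s: "s \<in> carrier (ktensor K V W)" and t: "t \<in> carrier (ktensor K X Y)"
    and m: "module K V" "module K W" "module K X" "module K Y"
    and vw: "\<And>v w. \<lbrakk>v \<in> carrier V; w \<in> carrier W\<rbrakk> \<Longrightarrow> kbilinear K X Y G (\<lambda>x y. b v w x y)"
    and xy: "\<And>x y. \<lbrakk>x \<in> carrier X; y \<in> carrier Y\<rbrakk> \<Longrightarrow> kbilinear K V W G (\<lambda>v w. b v w x y)"
  shows "tensor_lift G (\<lambda>v w. tensor_lift G (\<lambda>x y. b v w x y) t) s =
    tensor_lift G (\<lambda>x y. tensor_lift G (\<lambda>v w. b v w x y) s) t"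
proof -
  interpret V: module K V by (rule m)
  interpret W: module K W by (rule m)
  \<comment> \<open>Bilinearity is available only for arguments in the carriers; the zero vectors
    serve as such arguments.\<close>
  have G: "module K G" using vw[of "\<zero>\<^bsub>V\<^esub>" "\<zero>\<^bsub>W\<^esub>"] kbilinear_module(3) by auto
  have b1: "kbilinear K V W G (\<lambda>v w. tensor_lift G (\<lambda>x y. b v w x y) t)"
    by (intro kbilinearI klinear_lift_param[OF t] m G vw kbilinear_left[OF xy] kbilinear_right[OF xy])
  have b2: "kbilinear K X Y G (\<lambda>x y. tensor_lift G (\<lambda>v w. b v w x y) s)"
    if s: "s \<in> carrier (ktensor K V W)" for s
    by (intro kbilinearI klinear_lift_param[OF s] m G xy kbilinear_left[OF vw] kbilinear_right[OF vw])
  have l2: "klinear K (ktensor K V W) G (\<lambda>s. tensor_lift G (\<lambda>x y. tensor_lift G (\<lambda>v w. b v w x y) s) t)"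
    by (intro klinear_lift_param[OF t] ktensor_module m b2 klinear_lift[OF xy])
  show ?thesis
  proof (rule klinear_ktensor_eqI[OF klinear_lift[OF b1] l2 m(1,2) _ s])
    fix v w assume v: "v \<in> carrier V" "w \<in> carrier W"
    show "tensor_lift G (\<lambda>v w. tensor_lift G (\<lambda>x y. b v w x y) t) (kpure K V W v w) =
         tensor_lift G (\<lambda>x y. tensor_lift G (\<lambda>v w. b v w x y) (kpure K V W v w)) t"
      using v by (simp add: lift_kpure[OF b1])
        (intro lift_cong[OF m(3,4) t], simp add: lift_kpure[OF xy])
  qed
qed


subsection \<open>Algebra structure on tensor products\<close>

lemma klinear_mult_left:
  assumes "K_algebra K A" "klinear K X A f" "a \<in> carrier A"
  shows "klinear K X A (\<lambda>x. f x \<otimes>\<^bsub>A\<^esub> a)"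
proof -
  interpret K_algebra K A by fact
  have "klinear K A A (\<lambda>x. x \<otimes>\<^bsub>A\<^esub> a)"
    using assms(3) by (intro klinearI) (auto simp: l_distr smult_mult_left intro: module_axioms)
  from klinear_comp[OF this assms(2)] show ?thesis .
qed

lemma klinear_mult_right:
  assumes "K_algebra K A" "klinear K X A f" "a \<in> carrier A"
  shows "klinear K X A (\<lambda>x. a \<otimes>\<^bsub>A\<^esub> f x)"
proof -
  interpret K_algebra K A by fact
  have "klinear K A A (\<lambda>x. a \<otimes>\<^bsub>A\<^esub> x)"
    using assms(3) by (intro klinearI) (auto simp: r_distr smult_mult_right intro: module_axioms)
  from klinear_comp[OF this assms(2)] show ?thesis .
qed

lemma K_algebra_mult_closed:
  "\<lbrakk>K_algebra K A; a \<in> carrier A; b \<in> carrier A\<rbrakk> \<Longrightarrow> a \<otimes>\<^bsub>A\<^esub> b \<in> carrier A"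
  by (simp add: K_algebra_def ring_def monoid.m_closed)

lemma K_algebra_one_closed: "K_algebra K A \<Longrightarrow> \<one>\<^bsub>A\<^esub> \<in> carrier A"
  by (simp add: K_algebra_def ring_def monoid.one_closed)

locale algebra_pair = V: K_algebra K V + W: K_algebra K W
  for K :: "'k ring" and V :: "('k, 'v, 'm) module_scheme" and W :: "('k, 'w, 'n) module_scheme"
begin

lemmas modules = V.module_axioms W.module_axioms ktensor_module[OF V.module_axioms W.module_axioms]
lemmas alg_lin = lin klinear_mult_left[OF V.K_algebra_axioms] klinear_mult_right[OF V.K_algebra_axioms]
  klinear_mult_left[OF W.K_algebra_axioms] klinear_mult_right[OF W.K_algebra_axioms]
  kpure_closed V.m_closed W.m_closed modules

lemma mult_kpure:
  assumes "v \<in> carrier V" "w \<in> carrier W" "v' \<in> carrier V" "w' \<in> carrier W"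
  shows "kpure K V W v w \<otimes>\<^bsub>ktensor K V W\<^esub> kpure K V W v' w' =
    kpure K V W (v \<otimes>\<^bsub>V\<^esub> v') (w \<otimes>\<^bsub>W\<^esub> w')"
proof -
  have 1: "kbilinear K V W (ktensor K V W) (\<lambda>v w.
     tensor_lift (ktensor K V W) (\<lambda>v' w'. kpure K V W (v \<otimes>\<^bsub>V\<^esub> v') (w \<otimes>\<^bsub>W\<^esub> w')) (kpure K V W v' w'))"
    by (assumption | rule alg_lin assms)+
  have 2: "kbilinear K V W (ktensor K V W) (\<lambda>v' w'. kpure K V W (v \<otimes>\<^bsub>V\<^esub> v') (w \<otimes>\<^bsub>W\<^esub> w'))"
    by (assumption | rule alg_lin assms)+
  show ?thesis
    unfolding ktensor_mult using lift_kpure[OF 1] lift_kpure[OF 2] assms by simp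
qed

lemma kbilinear_mult:
  "kbilinear K (ktensor K V W) (ktensor K V W) (ktensor K V W) (\<lambda>s t. s \<otimes>\<^bsub>ktensor K V W\<^esub> t)"
  unfolding ktensor_mult
  by (assumption | rule alg_lin)+

lemma tensor_algebra: "K_algebra K (ktensor K V W)"
proof -
  let ?T = "ktensor K V W"
  interpret T: module K ?T by (rule modules)
  have lin1: "klinear K X ?T (\<lambda>x. f x \<otimes>\<^bsub>?T\<^esub> t)"
    if "klinear K X ?T f" "t \<in> carrier ?T" for X :: "('k, 'z, 'y) module_scheme" and f t
    using kbilinear_comp_left[OF kbilinear_mult that] .
  have lin2: "klinear K X ?T (\<lambda>x. t \<otimes>\<^bsub>?T\<^esub> f x)"
    if "klinear K X ?T f" "t \<in> carrier ?T" for X :: "('k, 'z, 'y) module_scheme" and f t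
    using kbilinear_comp_right[OF kbilinear_mult that] .
  have cl: "s \<otimes>\<^bsub>?T\<^esub> t \<in> carrier ?T" if "s \<in> carrier ?T" "t \<in> carrier ?T" for s t
    using kbilinear_closed[OF kbilinear_mult that] .
  have pc: "kpure K V W v w \<in> carrier ?T" if "v \<in> carrier V" "w \<in> carrier W" for v w
    using that by (intro kpure_closed modules)
  have one: "\<one>\<^bsub>?T\<^esub> \<in> carrier ?T" unfolding ktensor_one by (intro pc) auto
  note [simp del] = ktensor_sel
  \<comment> \<open>Both bracketings are linear in each argument, so the arguments are made pure one
    after another; on pure tensors associativity is that of the two factors.\<close>
  have assoc: "(s \<otimes>\<^bsub>?T\<^esub> t) \<otimes>\<^bsub>?T\<^esub> u = s \<otimes>\<^bsub>?T\<^esub> (t \<otimes>\<^bsub>?T\<^esub> u)"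
    if stu: "s \<in> carrier ?T" "t \<in> carrier ?T" "u \<in> carrier ?T" for s t u
  proof (rule klinear_ktensor_eqI[where G="ktensor K V W" and f="\<lambda>s. (s \<otimes>\<^bsub>?T\<^esub> t) \<otimes>\<^bsub>?T\<^esub> u" and g="\<lambda>s. s \<otimes>\<^bsub>?T\<^esub> (t \<otimes>\<^bsub>?T\<^esub> u)"])
    fix v w assume v: "v \<in> carrier V" "w \<in> carrier W"
    show "(kpure K V W v w \<otimes>\<^bsub>?T\<^esub> t) \<otimes>\<^bsub>?T\<^esub> u = kpure K V W v w \<otimes>\<^bsub>?T\<^esub> (t \<otimes>\<^bsub>?T\<^esub> u)"
    proof (rule klinear_ktensor_eqI[where G="ktensor K V W" and f="\<lambda>t. (kpure K V W v w \<otimes>\<^bsub>?T\<^esub> t) \<otimes>\<^bsub>?T\<^esub> u" and g="\<lambda>t. kpure K V W v w \<otimes>\<^bsub>?T\<^esub> (t \<otimes>\<^bsub>?T\<^esub> u)"])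
      fix v' w' assume v': "v' \<in> carrier V" "w' \<in> carrier W"
      show "(kpure K V W v w \<otimes>\<^bsub>?T\<^esub> kpure K V W v' w') \<otimes>\<^bsub>?T\<^esub> u = kpure K V W v w \<otimes>\<^bsub>?T\<^esub> (kpure K V W v' w' \<otimes>\<^bsub>?T\<^esub> u)"
      proof (rule klinear_ktensor_eqI[where G="ktensor K V W" and f="\<lambda>u. (kpure K V W v w \<otimes>\<^bsub>?T\<^esub> kpure K V W v' w') \<otimes>\<^bsub>?T\<^esub> u" and g="\<lambda>u. kpure K V W v w \<otimes>\<^bsub>?T\<^esub> (kpure K V W v' w' \<otimes>\<^bsub>?T\<^esub> u)"])
        fix v'' w'' assume v'': "v'' \<in> carrier V" "w'' \<in> carrier W"
        show "(kpure K V W v w \<otimes>\<^bsub>?T\<^esub> kpure K V W v' w') \<otimes>\<^bsub>?T\<^esub> kpure K V W v'' w'' =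
          kpure K V W v w \<otimes>\<^bsub>?T\<^esub> (kpure K V W v' w' \<otimes>\<^bsub>?T\<^esub> kpure K V W v'' w'')"
          using v v' v'' by (simp add: mult_kpure V.m_assoc W.m_assoc)
      qed (intro lin1 lin2 cl lin modules stu pc v v')+
    qed (intro lin1 lin2 cl lin modules stu pc v)+
  qed (intro lin1 lin2 cl lin modules stu pc)+
  have unit1: "\<one>\<^bsub>?T\<^esub> \<otimes>\<^bsub>?T\<^esub> t = t" if "t \<in> carrier ?T" for t
    using modules(1,2) that
    by (induction t rule: ktensor_induct)
      (simp_all add: ktensor_one mult_kpure klinear_add[OF lin2[OF klinear_id[OF modules(3)] one[unfolded ktensor_one]]])
  have unit2: "t \<otimes>\<^bsub>?T\<^esub> \<one>\<^bsub>?T\<^esub> = t" if "t \<in> carrier ?T" for t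
    using modules(1,2) that
    by (induction t rule: ktensor_induct)
      (simp_all add: ktensor_one mult_kpure klinear_add[OF lin1[OF klinear_id[OF modules(3)] one[unfolded ktensor_one]]])
  have "ring ?T"
    using klinear_add[OF kbilinear_left[OF kbilinear_mult]] klinear_add[OF kbilinear_right[OF kbilinear_mult]]
    by (intro ringI T.M.abelian_group_axioms monoidI) (auto simp: cl one assoc unit1 unit2)
  then show ?thesis
    unfolding K_algebra_def K_algebra_axioms_def
    using klinear_smult[OF kbilinear_left[OF kbilinear_mult]]
      klinear_smult[OF kbilinear_right[OF kbilinear_mult]] modules(3)
    by auto
qed

text \<open>The product of tensors is itself a double lift, so evaluating on a product becomes an
  iterated sum over the legs of both factors. This converts every algebraic identity between twists
  and coproducts into an identity of sums.\<close>

lemma lift_mult: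
  assumes s: "s \<in> carrier (ktensor K V W)" and t: "t \<in> carrier (ktensor K V W)"
    and b: "kbilinear K V W G b"
  shows "tensor_lift G b (s \<otimes>\<^bsub>ktensor K V W\<^esub> t) =
    tensor_lift G (\<lambda>v w. tensor_lift G (\<lambda>v' w'. b (v \<otimes>\<^bsub>V\<^esub> v') (w \<otimes>\<^bsub>W\<^esub> w')) t) s"
proof -
  note bl = kbilinear_comp_left[OF b] kbilinear_comp_right[OF b]
  have "tensor_lift G b (s \<otimes>\<^bsub>ktensor K V W\<^esub> t) = tensor_lift G (\<lambda>v w. tensor_lift G b
     (tensor_lift (ktensor K V W) (\<lambda>v' w'. kpure K V W (v \<otimes>\<^bsub>V\<^esub> v') (w \<otimes>\<^bsub>W\<^esub> w')) t)) s"
    unfolding ktensor_mult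
    by (rule lift_hom[OF klinear_lift[OF b] _ s]) ((assumption | rule alg_lin t)+)
  also have "\<dots> = tensor_lift G (\<lambda>v w. tensor_lift G (\<lambda>v' w'. b (v \<otimes>\<^bsub>V\<^esub> v') (w \<otimes>\<^bsub>W\<^esub> w')) t) s"
  proof (rule lift_cong[OF modules(1,2) s])
    fix v w assume vw: "v \<in> carrier V" "w \<in> carrier W"
    have "tensor_lift G b (tensor_lift (ktensor K V W) (\<lambda>v' w'. kpure K V W (v \<otimes>\<^bsub>V\<^esub> v') (w \<otimes>\<^bsub>W\<^esub> w')) t) =
        tensor_lift G (\<lambda>v' w'. tensor_lift G b (kpure K V W (v \<otimes>\<^bsub>V\<^esub> v') (w \<otimes>\<^bsub>W\<^esub> w'))) t"
      by (rule lift_hom[OF klinear_lift[OF b] _ t]) ((assumption | rule alg_lin vw)+)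
    also have "\<dots> = tensor_lift G (\<lambda>v' w'. b (v \<otimes>\<^bsub>V\<^esub> v') (w \<otimes>\<^bsub>W\<^esub> w')) t"
      by (rule lift_cong[OF modules(1,2) t]) (simp add: lift_kpure[OF b] vw)
    finally show "tensor_lift G b (tensor_lift (ktensor K V W) (\<lambda>v' w'. kpure K V W (v \<otimes>\<^bsub>V\<^esub> v') (w \<otimes>\<^bsub>W\<^esub> w')) t) =
        tensor_lift G (\<lambda>v' w'. b (v \<otimes>\<^bsub>V\<^esub> v') (w \<otimes>\<^bsub>W\<^esub> w')) t" .
  qed
  finally show ?thesis .
qed

end

declare ktensor_sel [simp del]


subsection \<open>Threefold tensor products\<close>

definition ktrilinear ::
    "'k ring \<Rightarrow> ('k, 'x, 'm) module_scheme \<Rightarrow> ('k, 'y, 'n) module_scheme \<Rightarrow> ('k, 'z, 'o) module_scheme \<Rightarrow>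
     ('k, 'u, 'p) module_scheme \<Rightarrow> ('x \<Rightarrow> 'y \<Rightarrow> 'z \<Rightarrow> 'u) \<Rightarrow> bool" where
  "ktrilinear K X Y Z G b \<longleftrightarrow> module K X \<and> module K Y \<and> module K Z \<and> module K G \<and>
     (\<forall>y\<in>carrier Y. \<forall>z\<in>carrier Z. klinear K X G (\<lambda>x. b x y z)) \<and>
     (\<forall>x\<in>carrier X. \<forall>z\<in>carrier Z. klinear K Y G (\<lambda>y. b x y z)) \<and>
     (\<forall>x\<in>carrier X. \<forall>y\<in>carrier Y. klinear K Z G (\<lambda>z. b x y z))"

lemma ktrilinearI [lin]:
  assumes "module K X" "module K Y" "module K Z" "module K G"
    "\<And>y z. \<lbrakk>y \<in> carrier Y; z \<in> carrier Z\<rbrakk> \<Longrightarrow> klinear K X G (\<lambda>x. b x y z)"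
    "\<And>x z. \<lbrakk>x \<in> carrier X; z \<in> carrier Z\<rbrakk> \<Longrightarrow> klinear K Y G (\<lambda>y. b x y z)"
    "\<And>x y. \<lbrakk>x \<in> carrier X; y \<in> carrier Y\<rbrakk> \<Longrightarrow> klinear K Z G (\<lambda>z. b x y z)"
  shows "ktrilinear K X Y Z G (\<lambda>x y z. b x y z)"
  unfolding ktrilinear_def by (intro conjI ballI assms)

lemma ktrilinear_module:
  assumes "ktrilinear K X Y Z G b"
  shows "module K X" "module K Y" "module K Z" "module K G"
  using assms unfolding ktrilinear_def by auto

lemma ktrilinearD:
  assumes "ktrilinear K X Y Z G b"
  shows "\<lbrakk>y \<in> carrier Y; z \<in> carrier Z\<rbrakk> \<Longrightarrow> klinear K X G (\<lambda>x. b x y z)"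
    "\<lbrakk>x \<in> carrier X; z \<in> carrier Z\<rbrakk> \<Longrightarrow> klinear K Y G (\<lambda>y. b x y z)"
    "\<lbrakk>x \<in> carrier X; y \<in> carrier Y\<rbrakk> \<Longrightarrow> klinear K Z G (\<lambda>z. b x y z)"
  using assms unfolding ktrilinear_def by auto

lemma ktrilinear_kbilinear:
  assumes "ktrilinear K X Y Z G b"
  shows "z \<in> carrier Z \<Longrightarrow> kbilinear K X Y G (\<lambda>x y. b x y z)"
    "y \<in> carrier Y \<Longrightarrow> kbilinear K X Z G (\<lambda>x z. b x y z)"
    "x \<in> carrier X \<Longrightarrow> kbilinear K Y Z G (\<lambda>y z. b x y z)"
  by (intro kbilinearI ktrilinear_module[OF assms] ktrilinearD[OF assms]; assumption)+

definition lift3 ::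
    "('u, 'm) ring_scheme \<Rightarrow> ('x \<Rightarrow> 'y \<Rightarrow> 'z \<Rightarrow> 'u) \<Rightarrow> (('x, 'y) tensor, 'z) tensor \<Rightarrow> 'u" where
  "lift3 G b t = tensor_lift G (\<lambda>s z. tensor_lift G (\<lambda>x y. b x y z) s) t"

lemma kbilinear_lift3:
  assumes b: "ktrilinear K X Y Z G b"
  shows "kbilinear K (ktensor K X Y) Z G (\<lambda>s z. tensor_lift G (\<lambda>x y. b x y z) s)"
  by (assumption | rule kbilinearI ktrilinear_module[OF b] ktensor_module klinear_lift
      klinear_lift_param ktrilinear_kbilinear[OF b] ktrilinearD[OF b])+

lemma klinear_lift3: "ktrilinear K X Y Z G b \<Longrightarrow> klinear K (ktensor K (ktensor K X Y) Z) G (lift3 G b)"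
  unfolding lift3_def by (rule klinear_lift[OF kbilinear_lift3])

lemma lift3_kpure:
  "\<lbrakk>ktrilinear K X Y Z G b; s \<in> carrier (ktensor K X Y); z \<in> carrier Z\<rbrakk> \<Longrightarrow>
   lift3 G b (kpure K (ktensor K X Y) Z s z) = tensor_lift G (\<lambda>x y. b x y z) s"
  unfolding lift3_def by (rule lift_kpure[OF kbilinear_lift3])

lemma lift3_pure3:
  assumes b: "ktrilinear K X Y Z G b" and xyz: "x \<in> carrier X" "y \<in> carrier Y" "z \<in> carrier Z"
  shows "lift3 G b (kpure K (ktensor K X Y) Z (kpure K X Y x y) z) = b x y z"
  by (simp add: lift3_kpure[OF b] kpure_closed ktrilinear_module[OF b] xyz
      lift_kpure[OF ktrilinear_kbilinear(1)[OF b]])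

lemma lift3_lift:
  assumes b: "ktrilinear K X Y Z G b"
    and c: "kbilinear K V W (ktensor K (ktensor K X Y) Z) c" and t: "t \<in> carrier (ktensor K V W)"
  shows "lift3 G b (tensor_lift (ktensor K (ktensor K X Y) Z) c t) = tensor_lift G (\<lambda>v w. lift3 G b (c v w)) t"
  by (rule lift_hom[OF klinear_lift3[OF b] c t])

locale algebra_triple = X: K_algebra K X + Y: K_algebra K Y + Z: K_algebra K Z
  for K :: "'k ring" and X :: "('k, 'x, 'm) module_scheme" and Y :: "('k, 'y, 'n) module_scheme"
    and Z :: "('k, 'z, 'o) module_scheme"
begin

sublocale XY: algebra_pair K X Y ..
sublocale XY_alg: K_algebra K "ktensor K X Y" by (rule XY.tensor_algebra)
sublocale XYZ: algebra_pair K "ktensor K X Y" Z ..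

text \<open>\<open>lift_mult\<close> is used for the outer tensor product and then for the inner
  one. The sums then come in mixed order, and \<open>lift_swap\<close> brings those over
  \<open>s\<close> outside those over \<open>t\<close>.\<close>

lemma lift3_mult:
  assumes s: "s \<in> carrier (ktensor K (ktensor K X Y) Z)" and t: "t \<in> carrier (ktensor K (ktensor K X Y) Z)"
    and b: "ktrilinear K X Y Z G b"
  shows "lift3 G b (s \<otimes>\<^bsub>ktensor K (ktensor K X Y) Z\<^esub> t) =
    lift3 G (\<lambda>x y z. lift3 G (\<lambda>x' y' z'. b (x \<otimes>\<^bsub>X\<^esub> x') (y \<otimes>\<^bsub>Y\<^esub> y') (z \<otimes>\<^bsub>Z\<^esub> z')) t) s"
proof -
  note cmp = klinear_comp[OF ktrilinearD(1)[OF b]] klinear_comp[OF ktrilinearD(2)[OF b]]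
    klinear_comp[OF ktrilinearD(3)[OF b]]
  note rules = cmp ktrilinearI XY.alg_lin XYZ.alg_lin ktrilinear_module[OF b]
  have 1: "ktrilinear K X Y Z G (\<lambda>x' y' z'. b (x \<otimes>\<^bsub>X\<^esub> x') (y \<otimes>\<^bsub>Y\<^esub> y') (z \<otimes>\<^bsub>Z\<^esub> z'))"
    if "x \<in> carrier X" "y \<in> carrier Y" "z \<in> carrier Z" for x y z
    by (assumption | rule rules that)+
  have 2: "ktrilinear K X Y Z G (\<lambda>x y z. lift3 G (\<lambda>x' y' z'. b (x \<otimes>\<^bsub>X\<^esub> x') (y \<otimes>\<^bsub>Y\<^esub> y') (z \<otimes>\<^bsub>Z\<^esub> z')) t)"
    if t: "t \<in> carrier (ktensor K (ktensor K X Y) Z)" for t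
    unfolding lift3_def by (assumption | rule rules t)+
  let ?L = "\<lambda>s t. lift3 G b (s \<otimes>\<^bsub>ktensor K (ktensor K X Y) Z\<^esub> t)"
  let ?R = "\<lambda>s t. lift3 G (\<lambda>x y z. lift3 G (\<lambda>x' y' z'. b (x \<otimes>\<^bsub>X\<^esub> x') (y \<otimes>\<^bsub>Y\<^esub> y') (z \<otimes>\<^bsub>Z\<^esub> z')) t) s"
  have "?L s t = tensor_lift G (\<lambda>u z. tensor_lift G (\<lambda>u' z'.
      tensor_lift G (\<lambda>x y. b x y (z \<otimes>\<^bsub>Z\<^esub> z')) (u \<otimes>\<^bsub>ktensor K X Y\<^esub> u')) t) s"
    unfolding lift3_def by (rule XYZ.lift_mult[OF s t kbilinear_lift3[OF b]])
  also have "\<dots> = tensor_lift G (\<lambda>u z. tensor_lift G (\<lambda>u' z'.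
      tensor_lift G (\<lambda>x y. tensor_lift G (\<lambda>x' y'. b (x \<otimes>\<^bsub>X\<^esub> x') (y \<otimes>\<^bsub>Y\<^esub> y') (z \<otimes>\<^bsub>Z\<^esub> z')) u') u) t) s"
    by (intro lift_cong[OF XYZ.modules(1,2)] s t XY.lift_mult ktrilinear_kbilinear[OF b] Z.m_closed)
  also have "\<dots> = ?R s t"
    unfolding lift3_def
  proof (rule lift_cong[OF XYZ.modules(1,2) s])
    fix u z assume u: "u \<in> carrier (ktensor K X Y)" "z \<in> carrier Z"
    show "tensor_lift G (\<lambda>u' z'. tensor_lift G (\<lambda>x y. tensor_lift G
           (\<lambda>x' y'. b (x \<otimes>\<^bsub>X\<^esub> x') (y \<otimes>\<^bsub>Y\<^esub> y') (z \<otimes>\<^bsub>Z\<^esub> z')) u') u) t =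
      tensor_lift G (\<lambda>x y. tensor_lift G (\<lambda>u' z'. tensor_lift G
           (\<lambda>x' y'. b (x \<otimes>\<^bsub>X\<^esub> x') (y \<otimes>\<^bsub>Y\<^esub> y') (z \<otimes>\<^bsub>Z\<^esub> z')) u') t) u"
      by (rule lift_swap[OF t u(1)]) (assumption | rule rules u)+
  qed
  finally show ?thesis .
qed

end


section \<open>Hopf algebras\<close>

context hopf_algebra
begin

sublocale HH: algebra_pair K H H ..
sublocale HH_alg: K_algebra K "ktensor K H H" by (rule HH.tensor_algebra)
sublocale H3: algebra_triple K H H H ..

lemma comult_klinear: "klinear K H (ktensor K H H) (comult H)"
  unfolding klinear_def using comult_linear HH.modules by blast

lemma antipode_klinear: "klinear K H H (antipode H)"
  unfolding klinear_def using antipode_linear HH.modules by blast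

lemmas comult_closed = klinear_closed[OF comult_klinear]
lemmas antipode_closed = klinear_closed[OF antipode_klinear]

lemma klinear_counit:
  assumes "klinear K X H f" "module K G" "g \<in> carrier G"
  shows "klinear K X G (\<lambda>x. counit H (f x) \<odot>\<^bsub>G\<^esub> g)"
proof -
  interpret G: module K G by fact
  have "klinear K H G (\<lambda>h. counit H h \<odot>\<^bsub>G\<^esub> g)"
    using assms(3)
    by (intro klinearI module_axioms G.module_axioms)
      (simp_all add: counit_closed counit_add counit_smult G.smult_l_distr G.smult_assoc1)
  from klinear_comp[OF this assms(1)] show ?thesis .
qed

lemmas hopf_lin = lin klinear_mult_left[OF K_algebra_axioms] klinear_mult_right[OF K_algebra_axioms]
  klinear_mult_left[OF HH.tensor_algebra] klinear_mult_right[OF HH.tensor_algebra]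
  klinear_comp[OF comult_klinear] klinear_comp[OF antipode_klinear] klinear_counit
  module_axioms HH.modules(3) comult_closed antipode_closed counit_closed m_closed one_closed
  K_algebra_mult_closed[OF HH.tensor_algebra] K_algebra_one_closed[OF HH.tensor_algebra]
  kpure_closed smult_closed module_smult_closed

lemmas liftH_cong = lift_cong[OF module_axioms module_axioms]

text \<open>Coassociativity is an equation between two elements of the triple tensor product;
  applying \<open>lift3 G b\<close> to it yields the form in which it can be used inside a larger
  expression.\<close>

lemma lift_coassoc:
  assumes xi: "\<xi> \<in> carrier H" and b: "ktrilinear K H H H G b"
  shows "tensor_lift G (\<lambda>x y. tensor_lift G (\<lambda>x' x''. b x' x'' y) (comult H x)) (comult H \<xi>) =
    tensor_lift G (\<lambda>x y. tensor_lift G (\<lambda>y' y''. b x y' y'') (comult H y)) (comult H \<xi>)"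
proof -
  let ?K3 = "ktensor3 K H"
  have xi': "comult H \<xi> \<in> carrier (ktensor K H H)" using xi by (rule comult_closed)
  have "lift3 G b (tensor_lift ?K3 (\<lambda>x y. kpure K (ktensor K H H) H (comult H x) y) (comult H \<xi>)) =
    tensor_lift G (\<lambda>x y. lift3 G b (kpure K (ktensor K H H) H (comult H x) y)) (comult H \<xi>)"
    by (rule lift3_lift[OF b _ xi']) (assumption | rule hopf_lin)+
  also have "\<dots> = tensor_lift G (\<lambda>x y. tensor_lift G (\<lambda>x' x''. b x' x'' y) (comult H x)) (comult H \<xi>)"
    by (rule liftH_cong[OF xi']) (simp add: lift3_kpure[OF b] comult_closed)
  finally have 1: "lift3 G b (tensor_lift ?K3 (\<lambda>x y. kpure K (ktensor K H H) H (comult H x) y) (comult H \<xi>)) =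
    tensor_lift G (\<lambda>x y. tensor_lift G (\<lambda>x' x''. b x' x'' y) (comult H x)) (comult H \<xi>)" .
  have "lift3 G b (tensor_lift ?K3 (\<lambda>x y. tensor_lift ?K3 (\<lambda>y' y''. kpure3 K H x y' y'') (comult H y)) (comult H \<xi>)) =
     tensor_lift G (\<lambda>x y. lift3 G b (tensor_lift ?K3 (\<lambda>y' y''. kpure3 K H x y' y'') (comult H y))) (comult H \<xi>)"
    by (rule lift3_lift[OF b _ xi']) (assumption | rule hopf_lin)+
  also have "\<dots> = tensor_lift G (\<lambda>x y. tensor_lift G (\<lambda>y' y''. b x y' y'') (comult H y)) (comult H \<xi>)"
  proof (rule liftH_cong[OF xi'])
    fix x y assume xy: "x \<in> carrier H" "y \<in> carrier H"
    have "lift3 G b (tensor_lift ?K3 (\<lambda>y' y''. kpure3 K H x y' y'') (comult H y)) =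
      tensor_lift G (\<lambda>y' y''. lift3 G b (kpure3 K H x y' y'')) (comult H y)"
      by (rule lift3_lift[OF b _ comult_closed[OF xy(2)]]) (assumption | rule hopf_lin xy)+
    also have "\<dots> = tensor_lift G (\<lambda>y' y''. b x y' y'') (comult H y)"
      by (rule liftH_cong[OF comult_closed[OF xy(2)]]) (simp add: lift3_pure3[OF b] xy)
    finally show "lift3 G b (tensor_lift ?K3 (\<lambda>y' y''. kpure3 K H x y' y'') (comult H y)) =
      tensor_lift G (\<lambda>y' y''. b x y' y'') (comult H y)" .
  qed
  finally show ?thesis using 1 coassoc[OF xi] by simp
qed

text \<open>The Hopf axioms speak of elements of \<open>H\<close>. Carrying along a linear
  \<open>g\<close>, here and in the next three lemmas, turns them into rules that apply in the
  middle of a larger sum.\<close>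

lemma lift_counit_left:
  assumes xi: "\<xi> \<in> carrier H" and g: "klinear K H G g"
  shows "tensor_lift G (\<lambda>x y. counit H x \<odot>\<^bsub>G\<^esub> g y) (comult H \<xi>) = g \<xi>"
proof -
  have "g (tensor_lift H (\<lambda>x y. counit H x \<odot> y) (comult H \<xi>)) =
    tensor_lift G (\<lambda>x y. g (counit H x \<odot> y)) (comult H \<xi>)"
    by (rule lift_hom[OF g]) (assumption | rule hopf_lin xi)+
  also have "\<dots> = tensor_lift G (\<lambda>x y. counit H x \<odot>\<^bsub>G\<^esub> g y) (comult H \<xi>)"
    by (rule liftH_cong[OF comult_closed[OF xi]]) (simp add: klinear_smult[OF g] counit_closed)
  finally show ?thesis using counit_left[OF xi] by simp
qed

lemma lift_counit_right:
  assumes xi: "\<xi> \<in> carrier H" and g: "klinear K H G g"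
  shows "tensor_lift G (\<lambda>x y. counit H y \<odot>\<^bsub>G\<^esub> g x) (comult H \<xi>) = g \<xi>"
proof -
  have "g (tensor_lift H (\<lambda>x y. counit H y \<odot> x) (comult H \<xi>)) =
    tensor_lift G (\<lambda>x y. g (counit H y \<odot> x)) (comult H \<xi>)"
    by (rule lift_hom[OF g]) (assumption | rule hopf_lin xi)+
  also have "\<dots> = tensor_lift G (\<lambda>x y. counit H y \<odot>\<^bsub>G\<^esub> g x) (comult H \<xi>)"
    by (rule liftH_cong[OF comult_closed[OF xi]]) (simp add: klinear_smult[OF g] counit_closed)
  finally show ?thesis using counit_right[OF xi] by simp
qed

lemma lift_antipode_left:
  assumes xi: "\<xi> \<in> carrier H" and g: "klinear K H G g"
  shows "tensor_lift G (\<lambda>x y. g (antipode H x \<otimes> y)) (comult H \<xi>) = counit H \<xi> \<odot>\<^bsub>G\<^esub> g \<one>"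
proof -
  have "g (tensor_lift H (\<lambda>x y. antipode H x \<otimes> y) (comult H \<xi>)) =
    tensor_lift G (\<lambda>x y. g (antipode H x \<otimes> y)) (comult H \<xi>)"
    by (rule lift_hom[OF g]) (assumption | rule hopf_lin xi)+
  then show ?thesis using antipode_left[OF xi] klinear_smult[OF g] xi counit_closed by simp
qed

lemma lift_antipode_right:
  assumes xi: "\<xi> \<in> carrier H" and g: "klinear K H G g"
  shows "tensor_lift G (\<lambda>x y. g (x \<otimes> antipode H y)) (comult H \<xi>) = counit H \<xi> \<odot>\<^bsub>G\<^esub> g \<one>"
proof -
  have "g (tensor_lift H (\<lambda>x y. x \<otimes> antipode H y) (comult H \<xi>)) =
    tensor_lift G (\<lambda>x y. g (x \<otimes> antipode H y)) (comult H \<xi>)"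
    by (rule lift_hom[OF g]) (assumption | rule hopf_lin xi)+
  then show ?thesis using antipode_right[OF xi] klinear_smult[OF g] xi counit_closed by simp
qed

text \<open>These are the algebra homomorphisms \<open>counit \<otimes> id\<close> and
  \<open>id \<otimes> counit\<close> from the tensor square to \<open>H\<close>. They carry the
  normalisation of the twist over to its inverse and give the counit axioms of the twisted
  coproduct.\<close>

lemma lift_counit_mult_hom:
  assumes "s \<in> carrier (ktensor K H H)" "t \<in> carrier (ktensor K H H)"
  shows "tensor_lift H (\<lambda>x y. counit H x \<odot> y) (s \<otimes>\<^bsub>ktensor K H H\<^esub> t) =
      tensor_lift H (\<lambda>x y. counit H x \<odot> y) s \<otimes> tensor_lift H (\<lambda>x y. counit H x \<odot> y) t" (is ?L)
    and "tensor_lift H (\<lambda>x y. counit H y \<odot> x) (s \<otimes>\<^bsub>ktensor K H H\<^esub> t) =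
      tensor_lift H (\<lambda>x y. counit H y \<odot> x) s \<otimes> tensor_lift H (\<lambda>x y. counit H y \<odot> x) t" (is ?R)
proof -
  have rearrange: "(k \<otimes>\<^bsub>K\<^esub> l) \<odot> (x \<otimes> y) = (k \<odot> x) \<otimes> (l \<odot> y)"
    if "k \<in> carrier K" "l \<in> carrier K" "x \<in> carrier H" "y \<in> carrier H" for k l x y
    using that by (simp add: smult_mult_left smult_mult_right R.m_comm flip: smult_assoc1)
  have b1: "kbilinear K H H H (\<lambda>x y. counit H x \<odot> y)" by (assumption | rule hopf_lin)+
  have b2: "kbilinear K H H H (\<lambda>x y. counit H y \<odot> x)" by (assumption | rule hopf_lin)+
  have "tensor_lift H (\<lambda>x y. counit H x \<odot> y) (s \<otimes>\<^bsub>ktensor K H H\<^esub> t) =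
    tensor_lift H (\<lambda>x y. tensor_lift H (\<lambda>x' y'. (counit H x \<odot> y) \<otimes> (counit H x' \<odot> y')) t) s"
    unfolding HH.lift_mult[OF assms b1]
    by (intro liftH_cong assms) (simp add: counit_mult counit_closed rearrange)
  also have "\<dots> = tensor_lift H (\<lambda>x y. (counit H x \<odot> y) \<otimes> tensor_lift H (\<lambda>x' y'. counit H x' \<odot> y') t) s"
    by (intro liftH_cong assms lift_hom[OF _ b1, symmetric]) (assumption | rule hopf_lin)+
  also have "\<dots> = tensor_lift H (\<lambda>x y. counit H x \<odot> y) s \<otimes> tensor_lift H (\<lambda>x y. counit H x \<odot> y) t"
    by (rule lift_hom[OF _ b1, symmetric]) (assumption | rule hopf_lin assms lift_closed[OF b1])+
  finally show ?L .
  have "tensor_lift H (\<lambda>x y. counit H y \<odot> x) (s \<otimes>\<^bsub>ktensor K H H\<^esub> t) =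
    tensor_lift H (\<lambda>x y. tensor_lift H (\<lambda>x' y'. (counit H y \<odot> x) \<otimes> (counit H y' \<odot> x')) t) s"
    unfolding HH.lift_mult[OF assms b2]
    by (intro liftH_cong assms) (simp add: counit_mult counit_closed rearrange)
  also have "\<dots> = tensor_lift H (\<lambda>x y. (counit H y \<odot> x) \<otimes> tensor_lift H (\<lambda>x' y'. counit H y' \<odot> x') t) s"
    by (intro liftH_cong assms lift_hom[OF _ b2, symmetric]) (assumption | rule hopf_lin)+
  also have "\<dots> = tensor_lift H (\<lambda>x y. counit H y \<odot> x) s \<otimes> tensor_lift H (\<lambda>x y. counit H y \<odot> x) t"
    by (rule lift_hom[OF _ b2, symmetric]) (assumption | rule hopf_lin assms lift_closed[OF b2])+
  finally show ?R .
qed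

text \<open>
  The map \<open>R \<mapsto> (\<xi> \<otimes> y \<mapsto> R \<xi>\<^sub>1 (\<xi>\<^sub>2 y))\<close> is injective on bilinear maps: it is inverted by the antipode.
\<close>

lemma lift_cancel:
  assumes R: "kbilinear K H Y W R" and R': "kbilinear K H Y W R'"
    and m: "kbilinear K H Y Y m"
    and m_assoc: "\<And>h h' y. \<lbrakk>h \<in> carrier H; h' \<in> carrier H; y \<in> carrier Y\<rbrakk> \<Longrightarrow> m (h \<otimes> h') y = m h (m h' y)"
    and m_one: "\<And>y. y \<in> carrier Y \<Longrightarrow> m \<one> y = y"
    and eq: "\<And>\<xi> y. \<lbrakk>\<xi> \<in> carrier H; y \<in> carrier Y\<rbrakk> \<Longrightarrow>
      tensor_lift W (\<lambda>x x'. R x (m x' y)) (comult H \<xi>) = tensor_lift W (\<lambda>x x'. R' x (m x' y)) (comult H \<xi>)"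
    and xi: "\<xi> \<in> carrier H" and y: "y \<in> carrier Y"
  shows "R \<xi> y = R' \<xi> y"
proof -
  note ml = kbilinear_comp_left[OF m] kbilinear_comp_right[OF m] kbilinear_closed[OF m]
    kbilinear_module(2)[OF m]
  \<comment> \<open>Recovers \<open>R\<close>: put \<open>antipode H x'\<close> in front of
    \<open>y\<close> and apply the transformed map to the first leg. Coassociativity makes the
    second and third legs adjacent, and they cancel by the antipode axiom.\<close>
  have inv: "tensor_lift W (\<lambda>x x'. tensor_lift W (\<lambda>p q. R p (m q (m (antipode H x') y))) (comult H x)) (comult H \<xi>)
      = R \<xi> y" if R: "kbilinear K H Y W R" for R
  proof -
    note rl = kbilinear_comp_left[OF R] kbilinear_comp_right[OF R] kbilinear_closed[OF R]
      kbilinear_module(3)[OF R]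
    have "tensor_lift W (\<lambda>x x'. tensor_lift W (\<lambda>p q. R p (m q (m (antipode H x') y))) (comult H x)) (comult H \<xi>) =
      tensor_lift W (\<lambda>x x'. tensor_lift W (\<lambda>p q. R x (m p (m (antipode H q) y))) (comult H x')) (comult H \<xi>)"
      by (rule lift_coassoc[OF xi]) (assumption | rule rl ml hopf_lin y)+
    also have "\<dots> = tensor_lift W (\<lambda>x x'. tensor_lift W (\<lambda>p q. R x (m (p \<otimes> antipode H q) y)) (comult H x')) (comult H \<xi>)"
      by (intro liftH_cong comult_closed xi) (simp_all add: m_assoc antipode_closed y)
    also have "\<dots> = tensor_lift W (\<lambda>x x'. counit H x' \<odot>\<^bsub>W\<^esub> R x y) (comult H \<xi>)"
    proof (rule liftH_cong[OF comult_closed[OF xi]])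
      fix x x' assume x: "x \<in> carrier H" "x' \<in> carrier H"
      have "klinear K H W (\<lambda>h. R x (m h y))" by (assumption | rule rl ml hopf_lin y x)+
      from lift_antipode_right[OF x(2) this] show "tensor_lift W (\<lambda>p q. R x (m (p \<otimes> antipode H q) y)) (comult H x') =
          counit H x' \<odot>\<^bsub>W\<^esub> R x y" using m_one y by simp
    qed
    also have "\<dots> = R \<xi> y"
      by (rule lift_counit_right[OF xi kbilinear_left[OF R y]])
    finally show ?thesis .
  qed
  show ?thesis
    unfolding inv[OF R, symmetric] inv[OF R', symmetric]
    by (intro liftH_cong comult_closed xi eq) (assumption | rule ml hopf_lin y)+
qed

section \<open>The antipode preserves the unit and reverses products\<close>

lemma antipode_one: "antipode H \<one> = \<one>"
proof -
  have "kbilinear K H H H (\<lambda>x y. antipode H x \<otimes> y)" by (assumption | rule hopf_lin)+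
  from lift_kpure[OF this, of \<one> \<one>] have "antipode H \<one> \<otimes> \<one> = counit H \<one> \<odot> \<one>"
    using antipode_left[of \<one>] by (simp add: comult_one ktensor_one)
  then show ?thesis by (simp add: counit_one antipode_closed)
qed

text \<open>A uniqueness argument. The sum \<open>conv\<close> over both coproducts collapses to
  counits; cancelling the coproduct of \<open>\<zeta>\<close> by \<open>lift_cancel\<close> gives
  \<open>step\<close>, and cancelling that of \<open>\<xi>\<close> gives the claim. The factor
  \<open>h\<close> is the module element on which \<open>lift_cancel\<close> operates and becomes
  \<one> at the end.\<close>

lemma antipode_mult:
  assumes xi: "\<xi> \<in> carrier H" and ze: "\<zeta> \<in> carrier H"
  shows "antipode H (\<xi> \<otimes> \<zeta>) = antipode H \<zeta> \<otimes> antipode H \<xi>"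
proof -
  have conv: "tensor_lift H (\<lambda>z z'. tensor_lift H (\<lambda>x x'. antipode H (x \<otimes> z) \<otimes> (x' \<otimes> (z' \<otimes> h))) (comult H \<xi>)) (comult H \<zeta>) =
      counit H \<xi> \<odot> (counit H \<zeta> \<odot> h)" if "\<xi> \<in> carrier H" "\<zeta> \<in> carrier H" "h \<in> carrier H" for \<xi> \<zeta> h
  proof -
    have "tensor_lift H (\<lambda>z z'. tensor_lift H (\<lambda>x x'. antipode H (x \<otimes> z) \<otimes> (x' \<otimes> (z' \<otimes> h))) (comult H \<xi>)) (comult H \<zeta>) =
      tensor_lift H (\<lambda>x x'. tensor_lift H (\<lambda>z z'. antipode H (x \<otimes> z) \<otimes> (x' \<otimes> (z' \<otimes> h))) (comult H \<zeta>)) (comult H \<xi>)"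
      by (rule lift_swap) (assumption | rule hopf_lin that)+
    also have "\<dots> = tensor_lift H (\<lambda>x x'. tensor_lift H (\<lambda>z z'. (antipode H (x \<otimes> z) \<otimes> (x' \<otimes> z')) \<otimes> h) (comult H \<zeta>)) (comult H \<xi>)"
      by (intro liftH_cong comult_closed that) (simp add: m_assoc antipode_closed that)
    also have "\<dots> = tensor_lift H (\<lambda>p q. (antipode H p \<otimes> q) \<otimes> h) (comult H \<xi> \<otimes>\<^bsub>ktensor K H H\<^esub> comult H \<zeta>)"
      by (rule HH.lift_mult[symmetric]) (assumption | rule hopf_lin that)+
    also have "\<dots> = counit H (\<xi> \<otimes> \<zeta>) \<odot> (\<one> \<otimes> h)"
      unfolding comult_mult[OF that(1,2), symmetric]
      by (rule lift_antipode_left) (assumption | rule hopf_lin that)+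
    finally show ?thesis using that by (simp add: counit_mult smult_assoc1 counit_closed)
  qed
  note lc = lift_cancel[where m="\<lambda>x y. x \<otimes> y" and Y=H and W=H]
  have step: "tensor_lift H (\<lambda>x x'. antipode H (x \<otimes> \<zeta>) \<otimes> (x' \<otimes> h)) (comult H \<xi>) =
      counit H \<xi> \<odot> (antipode H \<zeta> \<otimes> h)" if "\<xi> \<in> carrier H" "\<zeta> \<in> carrier H" "h \<in> carrier H" for \<xi> \<zeta> h
  proof (rule lc[where R="\<lambda>\<zeta> h. tensor_lift H (\<lambda>x x'. antipode H (x \<otimes> \<zeta>) \<otimes> (x' \<otimes> h)) (comult H \<xi>)"
          and R'="\<lambda>\<zeta> h. counit H \<xi> \<odot> (antipode H \<zeta> \<otimes> h)"])
    fix z y assume z: "z \<in> carrier H" "y \<in> carrier H"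
    have "tensor_lift H (\<lambda>x x'. counit H \<xi> \<odot> (antipode H x \<otimes> (x' \<otimes> y))) (comult H z) =
      tensor_lift H (\<lambda>x x'. counit H \<xi> \<odot> ((antipode H x \<otimes> x') \<otimes> y)) (comult H z)"
      by (intro liftH_cong comult_closed z) (simp add: m_assoc antipode_closed z)
    also have "\<dots> = counit H z \<odot> (counit H \<xi> \<odot> (\<one> \<otimes> y))"
      by (rule lift_antipode_left) (assumption | rule hopf_lin that z)+
    also have "\<dots> = counit H \<xi> \<odot> (counit H z \<odot> y)"
      using z that by (simp add: counit_closed R.m_comm flip: smult_assoc1)
    finally show "tensor_lift H (\<lambda>x x'. tensor_lift H (\<lambda>p q. antipode H (p \<otimes> x) \<otimes> (q \<otimes> (x' \<otimes> y))) (comult H \<xi>)) (comult H z) =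
      tensor_lift H (\<lambda>x x'. counit H \<xi> \<odot> (antipode H x \<otimes> (x' \<otimes> y))) (comult H z)"
      using conv[OF that(1) z] by simp
  qed (assumption | rule hopf_lin that m_assoc l_one)+
  have "antipode H (\<xi> \<otimes> \<zeta>) \<otimes> \<one> = (antipode H \<zeta> \<otimes> antipode H \<xi>) \<otimes> \<one>"
  proof (rule lc[where R="\<lambda>\<xi> h. antipode H (\<xi> \<otimes> \<zeta>) \<otimes> h" and R'="\<lambda>\<xi> h. (antipode H \<zeta> \<otimes> antipode H \<xi>) \<otimes> h"])
    fix x y assume x: "x \<in> carrier H" "y \<in> carrier H"
    have "tensor_lift H (\<lambda>p q. (antipode H \<zeta> \<otimes> antipode H p) \<otimes> (q \<otimes> y)) (comult H x) =
       tensor_lift H (\<lambda>p q. antipode H \<zeta> \<otimes> ((antipode H p \<otimes> q) \<otimes> y)) (comult H x)"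
      by (intro liftH_cong comult_closed x) (simp add: m_assoc antipode_closed x ze)
    also have "\<dots> = counit H x \<odot> (antipode H \<zeta> \<otimes> (\<one> \<otimes> y))"
      by (rule lift_antipode_left) (assumption | rule hopf_lin x ze)+
    finally show "tensor_lift H (\<lambda>p q. antipode H (p \<otimes> \<zeta>) \<otimes> (q \<otimes> y)) (comult H x) =
      tensor_lift H (\<lambda>p q. (antipode H \<zeta> \<otimes> antipode H p) \<otimes> (q \<otimes> y)) (comult H x)"
      using step[OF x(1) ze x(2)] x by simp
  qed (assumption | rule hopf_lin xi ze m_assoc l_one)+
  then show ?thesis using xi ze by (simp add: antipode_closed)
qed

end


section \<open>Twisting the Hopf algebra\<close>

lemma kpure_cong:
  assumes "carrier V = carrier V'" "add V = add V'" "smult V = smult V'"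
    "carrier W = carrier W'" "add W = add W'" "smult W = smult W'"
  shows "kpure K V W = kpure K V' W'"
  unfolding kpure_def pure_tensor_def tensor_null_def tensor_relators_def
  by (intro ext) (simp only: assms)

text \<open>The tensor product is built from the module and ring fields alone. Twisting leaves these
  untouched, so a Hopf algebra and its twisted version have literally the same tensor
  powers.\<close>

lemma ktensor_cong:
  assumes "carrier V = carrier V'" "add V = add V'" "smult V = smult V'" "mult V = mult V'" "one V = one V'"
    "carrier W = carrier W'" "add W = add W'" "smult W = smult W'" "mult W = mult W'" "one W = one W'"
  shows "ktensor K V W = ktensor K V' W'"
proof -
  have "tensor_group (carrier K) (\<lambda>v k. k \<odot>\<^bsub>V\<^esub> v) (smult W) V W =
    tensor_group (carrier K) (\<lambda>v k. k \<odot>\<^bsub>V'\<^esub> v) (smult W') V' W'"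
    unfolding tensor_group_def tensor_null_def tensor_relators_def by (simp only: assms)
  then show ?thesis
    unfolding ktensor_def by (simp only: kpure_cong[of V V' W W' K, OF assms(1-3,6-8)] assms)
qed

text \<open>The element (\<Delta> \<otimes> id) t. The coproduct is a parameter so that the original
  and the twisted one can be compared inside one and the same triple tensor product.\<close>

definition left_comult ::
    "'k ring \<Rightarrow> ('k, 'h, 'm) module_scheme \<Rightarrow> ('h \<Rightarrow> ('h, 'h) tensor) \<Rightarrow> ('h, 'h) tensor \<Rightarrow>
     (('h, 'h) tensor, 'h) tensor" where
  "left_comult K H c t = tensor_lift (ktensor3 K H) (\<lambda>x y. kpure K (ktensor K H H) H (c x) y) t"

definition tensor_left ::
    "'k ring \<Rightarrow> ('k, 'h, 'm) module_scheme \<Rightarrow> 'h \<Rightarrow> ('h, 'h) tensor \<Rightarrow> (('h, 'h) tensor, 'h) tensor" where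
  "tensor_left K H x t = tensor_lift (ktensor3 K H) (\<lambda>y z. kpure3 K H x y z) t"

definition right_comult ::
    "'k ring \<Rightarrow> ('k, 'h, 'm) module_scheme \<Rightarrow> ('h \<Rightarrow> ('h, 'h) tensor) \<Rightarrow> ('h, 'h) tensor \<Rightarrow>
     (('h, 'h) tensor, 'h) tensor" where
  "right_comult K H c t = tensor_lift (ktensor3 K H) (\<lambda>x y. tensor_left K H x (c y)) t"

context hopf_algebra
begin

sublocale H3_alg: K_algebra K "ktensor3 K H" by (rule H3.XYZ.tensor_algebra)

abbreviation "mult2 \<equiv> mult (ktensor K H H)"
abbreviation "mult3 \<equiv> mult (ktensor3 K H)"

lemma kbilinear_tensor_left: "kbilinear K H (ktensor K H H) (ktensor3 K H) (tensor_left K H)"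
  unfolding tensor_left_def by (assumption | rule hopf_lin H3_alg.module_axioms)+

lemma kbilinear_left_comult:
  "klinear K H (ktensor K H H) c \<Longrightarrow>
   kbilinear K H H (ktensor3 K H) (\<lambda>x y. kpure K (ktensor K H H) H (c x) y)"
  by (assumption | rule klinear_comp[where f=c] klinear_closed[where f=c] hopf_lin H3_alg.module_axioms)+

lemma kbilinear_right_comult:
  "klinear K H (ktensor K H H) c \<Longrightarrow> kbilinear K H H (ktensor3 K H) (\<lambda>x y. tensor_left K H x (c y))"
  by (assumption | rule klinear_comp[where f=c] klinear_closed[where f=c] hopf_lin H3_alg.module_axioms
      kbilinear_comp_left[OF kbilinear_tensor_left] kbilinear_comp_right[OF kbilinear_tensor_left])+

lemmas tensor_left_closed = kbilinear_closed[OF kbilinear_tensor_left]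

lemma left_comult_closed:
  "\<lbrakk>klinear K H (ktensor K H H) c; t \<in> carrier (ktensor K H H)\<rbrakk> \<Longrightarrow>
   left_comult K H c t \<in> carrier (ktensor3 K H)"
  unfolding left_comult_def by (rule lift_closed[OF kbilinear_left_comult])

lemma right_comult_closed:
  "\<lbrakk>klinear K H (ktensor K H H) c; t \<in> carrier (ktensor K H H)\<rbrakk> \<Longrightarrow>
   right_comult K H c t \<in> carrier (ktensor3 K H)"
  unfolding right_comult_def by (rule lift_closed[OF kbilinear_right_comult])

lemma tensor_left_kpure:
  "\<lbrakk>x \<in> carrier H; y \<in> carrier H; z \<in> carrier H\<rbrakk> \<Longrightarrow> tensor_left K H x (kpure K H H y z) = kpure3 K H x y z"
  unfolding tensor_left_def by (rule lift_kpure) (assumption | rule hopf_lin H3_alg.module_axioms)+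

lemma left_comult_kpure:
  "\<lbrakk>klinear K H (ktensor K H H) c; x \<in> carrier H; y \<in> carrier H\<rbrakk> \<Longrightarrow>
   left_comult K H c (kpure K H H x y) = kpure K (ktensor K H H) H (c x) y"
  unfolding left_comult_def by (rule lift_kpure[OF kbilinear_left_comult])

lemma right_comult_kpure:
  "\<lbrakk>klinear K H (ktensor K H H) c; x \<in> carrier H; y \<in> carrier H\<rbrakk> \<Longrightarrow>
   right_comult K H c (kpure K H H x y) = tensor_left K H x (c y)"
  unfolding right_comult_def by (rule lift_kpure[OF kbilinear_right_comult])

lemma klinear_tensor_left:
  "x \<in> carrier H \<Longrightarrow> klinear K (ktensor K H H) (ktensor3 K H) (tensor_left K H x)"
  by (rule kbilinear_right[OF kbilinear_tensor_left])

lemma klinear_left_comult: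
  "klinear K H (ktensor K H H) c \<Longrightarrow> klinear K (ktensor K H H) (ktensor3 K H) (left_comult K H c)"
  unfolding left_comult_def[abs_def] by (rule klinear_lift[OF kbilinear_left_comult])

lemma klinear_right_comult:
  "klinear K H (ktensor K H H) c \<Longrightarrow> klinear K (ktensor K H H) (ktensor3 K H) (right_comult K H c)"
  unfolding right_comult_def[abs_def] by (rule klinear_lift[OF kbilinear_right_comult])

lemmas lin3 = klinear_mult_left[OF H3_alg.K_algebra_axioms] klinear_mult_right[OF H3_alg.K_algebra_axioms]
  klinear_comp[OF klinear_tensor_left] klinear_comp[OF klinear_left_comult] klinear_comp[OF klinear_right_comult]
  tensor_left_closed left_comult_closed right_comult_closed H3_alg.m_closed H3_alg.one_closed H3_alg.module_axioms
  hopf_lin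

lemma ktensor_eqI2:
  assumes "kbilinear K (ktensor K H H) (ktensor K H H) G f" "kbilinear K (ktensor K H H) (ktensor K H H) G g"
    and "\<And>x y x' y'. \<lbrakk>x \<in> carrier H; y \<in> carrier H; x' \<in> carrier H; y' \<in> carrier H\<rbrakk> \<Longrightarrow>
      f (kpure K H H x y) (kpure K H H x' y') = g (kpure K H H x y) (kpure K H H x' y')"
    and st: "s \<in> carrier (ktensor K H H)" "t \<in> carrier (ktensor K H H)"
  shows "f s t = g s t"
proof (rule klinear_ktensor_eqI[OF kbilinear_left[OF assms(1)] kbilinear_left[OF assms(2)] module_axioms module_axioms])
  fix x y assume x: "x \<in> carrier H" "y \<in> carrier H"
  show "f (kpure K H H x y) t = g (kpure K H H x y) t"
    by (rule klinear_ktensor_eqI[OF kbilinear_right[OF assms(1)] kbilinear_right[OF assms(2)] module_axioms module_axioms])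
      (use x st assms(3) in \<open>simp_all add: kpure_closed module_axioms\<close>)
qed (use st in simp_all)

lemma tensor_left_mult:
  assumes "x \<in> carrier H" "y \<in> carrier H" "s \<in> carrier (ktensor K H H)" "t \<in> carrier (ktensor K H H)"
  shows "mult3 (tensor_left K H x s) (tensor_left K H y t) = tensor_left K H (x \<otimes> y) (mult2 s t)"
proof (rule ktensor_eqI2[where f="\<lambda>s t. mult3 (tensor_left K H x s) (tensor_left K H y t)"
      and g="\<lambda>s t. tensor_left K H (x \<otimes> y) (mult2 s t)"])
  show "kbilinear K (ktensor K H H) (ktensor K H H) (ktensor3 K H) (\<lambda>s t. mult3 (tensor_left K H x s) (tensor_left K H y t))"
    by (assumption | rule lin3 assms)+
  show "kbilinear K (ktensor K H H) (ktensor K H H) (ktensor3 K H) (\<lambda>s t. tensor_left K H (x \<otimes> y) (mult2 s t))"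
    by (assumption | rule lin3 assms)+
qed (use assms in \<open>simp_all add: tensor_left_kpure H3.XYZ.mult_kpure HH.mult_kpure kpure_closed module_axioms\<close>)

text \<open>If \<open>c\<close> is an algebra homomorphism then so is \<open>c \<otimes> id\<close>.
  Together with the analogue for \<open>id \<otimes> c\<close> this sends mutually inverse tensors
  to mutually inverse triple tensors.\<close>

lemma left_comult_mult:
  assumes c: "klinear K H (ktensor K H H) c"
    and cm: "\<And>x y. \<lbrakk>x \<in> carrier H; y \<in> carrier H\<rbrakk> \<Longrightarrow> c (x \<otimes> y) = mult2 (c x) (c y)"
    and "s \<in> carrier (ktensor K H H)" "t \<in> carrier (ktensor K H H)"
  shows "left_comult K H c (mult2 s t) = mult3 (left_comult K H c s) (left_comult K H c t)"
proof (rule ktensor_eqI2[where g="\<lambda>s t. mult3 (left_comult K H c s) (left_comult K H c t)"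
      and f="\<lambda>s t. left_comult K H c (mult2 s t)"])
  show "kbilinear K (ktensor K H H) (ktensor K H H) (ktensor3 K H) (\<lambda>s t. mult3 (left_comult K H c s) (left_comult K H c t))"
    by (assumption | rule lin3 assms)+
  show "kbilinear K (ktensor K H H) (ktensor K H H) (ktensor3 K H) (\<lambda>s t. left_comult K H c (mult2 s t))"
    by (assumption | rule lin3 assms)+
qed (use assms in \<open>simp_all add: left_comult_kpure H3.XYZ.mult_kpure HH.mult_kpure klinear_closed[OF c]\<close>)

lemma right_comult_mult:
  assumes c: "klinear K H (ktensor K H H) c"
    and cm: "\<And>x y. \<lbrakk>x \<in> carrier H; y \<in> carrier H\<rbrakk> \<Longrightarrow> c (x \<otimes> y) = mult2 (c x) (c y)"
    and "s \<in> carrier (ktensor K H H)" "t \<in> carrier (ktensor K H H)"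
  shows "right_comult K H c (mult2 s t) = mult3 (right_comult K H c s) (right_comult K H c t)"
proof (rule ktensor_eqI2[where g="\<lambda>s t. mult3 (right_comult K H c s) (right_comult K H c t)"
      and f="\<lambda>s t. right_comult K H c (mult2 s t)"])
  show "kbilinear K (ktensor K H H) (ktensor K H H) (ktensor3 K H) (\<lambda>s t. mult3 (right_comult K H c s) (right_comult K H c t))"
    by (assumption | rule lin3 assms)+
  show "kbilinear K (ktensor K H H) (ktensor K H H) (ktensor3 K H) (\<lambda>s t. right_comult K H c (mult2 s t))"
    by (assumption | rule lin3 assms)+
qed (use assms in \<open>simp_all add: right_comult_kpure tensor_left_mult HH.mult_kpure klinear_closed[OF c]\<close>)

lemma comult_one_3:
  assumes c: "klinear K H (ktensor K H H) c" and c1: "c \<one> = \<one>\<^bsub>ktensor K H H\<^esub>"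
  shows "left_comult K H c \<one>\<^bsub>ktensor K H H\<^esub> = \<one>\<^bsub>ktensor3 K H\<^esub>"
    "right_comult K H c \<one>\<^bsub>ktensor K H H\<^esub> = \<one>\<^bsub>ktensor3 K H\<^esub>"
  using c1 by (simp_all add: ktensor_one left_comult_kpure[OF c] right_comult_kpure[OF c] tensor_left_kpure)

lemma lift3_left_comult:
  assumes c: "klinear K H (ktensor K H H) c" and b: "ktrilinear K H H H G b" and t: "t \<in> carrier (ktensor K H H)"
  shows "lift3 G b (left_comult K H c t) = tensor_lift G (\<lambda>x y. tensor_lift G (\<lambda>p q. b p q y) (c x)) t"
  unfolding left_comult_def lift3_lift[OF b kbilinear_left_comult[OF c] t]
  by (rule liftH_cong[OF t]) (simp add: lift3_kpure[OF b] klinear_closed[OF c])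

lemma lift3_tensor_left:
  assumes b: "ktrilinear K H H H G b" and x: "x \<in> carrier H" and t: "t \<in> carrier (ktensor K H H)"
  shows "lift3 G b (tensor_left K H x t) = tensor_lift G (\<lambda>p q. b x p q) t"
proof -
  have "kbilinear K H H (ktensor3 K H) (\<lambda>y z. kpure3 K H x y z)"
    by (assumption | rule hopf_lin x H3_alg.module_axioms)+
  then show ?thesis
    unfolding tensor_left_def lift3_lift[OF b \<open>kbilinear K H H _ _\<close> t]
    by (intro liftH_cong t lift3_pure3[OF b] x)
qed

lemma lift3_right_comult:
  assumes c: "klinear K H (ktensor K H H) c" and b: "ktrilinear K H H H G b" and t: "t \<in> carrier (ktensor K H H)"
  shows "lift3 G b (right_comult K H c t) = tensor_lift G (\<lambda>x y. tensor_lift G (\<lambda>p q. b x p q) (c y)) t"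
  unfolding right_comult_def lift3_lift[OF b kbilinear_right_comult[OF c] t]
  by (rule liftH_cong[OF t]) (simp add: lift3_tensor_left[OF b] klinear_closed[OF c])

lemma lift_counit_hom:
  assumes t: "t \<in> carrier (ktensor K H H)" and g: "klinear K H G g"
  shows "tensor_lift G (\<lambda>x y. counit H x \<odot>\<^bsub>G\<^esub> g y) t = g (tensor_lift H (\<lambda>x y. counit H x \<odot> y) t)"
    and "tensor_lift G (\<lambda>x y. counit H y \<odot>\<^bsub>G\<^esub> g x) t = g (tensor_lift H (\<lambda>x y. counit H y \<odot> x) t)"
proof -
  have "g (tensor_lift H (\<lambda>x y. counit H x \<odot> y) t) = tensor_lift G (\<lambda>x y. g (counit H x \<odot> y)) t"
    by (rule lift_hom[OF g _ t]) (assumption | rule hopf_lin)+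
  also have "\<dots> = tensor_lift G (\<lambda>x y. counit H x \<odot>\<^bsub>G\<^esub> g y) t"
    by (rule liftH_cong[OF t]) (simp add: klinear_smult[OF g] counit_closed)
  finally show "tensor_lift G (\<lambda>x y. counit H x \<odot>\<^bsub>G\<^esub> g y) t = g (tensor_lift H (\<lambda>x y. counit H x \<odot> y) t)" ..
  have "g (tensor_lift H (\<lambda>x y. counit H y \<odot> x) t) = tensor_lift G (\<lambda>x y. g (counit H y \<odot> x)) t"
    by (rule lift_hom[OF g _ t]) (assumption | rule hopf_lin)+
  also have "\<dots> = tensor_lift G (\<lambda>x y. counit H y \<odot>\<^bsub>G\<^esub> g x) t"
    by (rule liftH_cong[OF t]) (simp add: klinear_smult[OF g] counit_closed)
  finally show "tensor_lift G (\<lambda>x y. counit H y \<odot>\<^bsub>G\<^esub> g x) t = g (tensor_lift H (\<lambda>x y. counit H y \<odot> x) t)" ..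
qed

text \<open>The algebra \<open>H \<otimes> H\<close> acts on \<open>H\<close> from the left by
  \<open>adl\<close> and from the right by \<open>adr\<close>; that these are actions is due to
  antimultiplicativity of the antipode. On \<one> a coproduct acts by its counit, by the antipode
  axioms, while the twist gives \<chi>.\<close>

definition adl :: "('h, 'h) tensor \<Rightarrow> 'h \<Rightarrow> 'h" where
  "adl t h = tensor_lift H (\<lambda>x y. x \<otimes> (h \<otimes> antipode H y)) t"

definition adr :: "('h, 'h) tensor \<Rightarrow> 'h \<Rightarrow> 'h" where
  "adr t h = tensor_lift H (\<lambda>x y. antipode H x \<otimes> (h \<otimes> y)) t"

lemma kbilinear_adl: "kbilinear K (ktensor K H H) H H adl"
  unfolding adl_def by (assumption | rule hopf_lin)+

lemma kbilinear_adr: "kbilinear K (ktensor K H H) H H adr"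
  unfolding adr_def by (assumption | rule hopf_lin)+

lemma adl_mult:
  assumes "s \<in> carrier (ktensor K H H)" "t \<in> carrier (ktensor K H H)" "h \<in> carrier H"
  shows "adl (mult2 s t) h = adl s (adl t h)"
proof (rule ktensor_eqI2[where f="\<lambda>s t. adl (mult2 s t) h" and g="\<lambda>s t. adl s (adl t h)"])
  show "kbilinear K (ktensor K H H) (ktensor K H H) H (\<lambda>s t. adl (mult2 s t) h)"
    by (assumption | rule kbilinear_comp_left[OF kbilinear_adl] hopf_lin assms)+
  show "kbilinear K (ktensor K H H) (ktensor K H H) H (\<lambda>s t. adl s (adl t h))"
    by (assumption | rule kbilinear_comp_left[OF kbilinear_adl] kbilinear_comp_right[OF kbilinear_adl]
        kbilinear_closed[OF kbilinear_adl] hopf_lin assms)+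
  fix x y x' y' assume x: "x \<in> carrier H" "y \<in> carrier H" "x' \<in> carrier H" "y' \<in> carrier H"
  have p: "adl (kpure K H H x y) h = x \<otimes> (h \<otimes> antipode H y)"
    if "x \<in> carrier H" "y \<in> carrier H" "h \<in> carrier H" for x y h
    unfolding adl_def by (rule lift_kpure) (assumption | rule hopf_lin that)+
  show "adl (mult2 (kpure K H H x y) (kpure K H H x' y')) h = adl (kpure K H H x y) (adl (kpure K H H x' y') h)"
    using x assms by (simp add: p HH.mult_kpure antipode_closed antipode_mult m_assoc )
qed (use assms in simp_all)

lemma adr_mult:
  assumes "s \<in> carrier (ktensor K H H)" "t \<in> carrier (ktensor K H H)" "h \<in> carrier H"
  shows "adr (mult2 s t) h = adr t (adr s h)"
proof (rule ktensor_eqI2[where f="\<lambda>s t. adr (mult2 s t) h" and g="\<lambda>s t. adr t (adr s h)"])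
  show "kbilinear K (ktensor K H H) (ktensor K H H) H (\<lambda>s t. adr (mult2 s t) h)"
    by (assumption | rule kbilinear_comp_left[OF kbilinear_adr] hopf_lin assms)+
  show "kbilinear K (ktensor K H H) (ktensor K H H) H (\<lambda>s t. adr t (adr s h))"
    by (assumption | rule kbilinear_comp_left[OF kbilinear_adr] kbilinear_comp_right[OF kbilinear_adr]
        kbilinear_closed[OF kbilinear_adr] hopf_lin assms)+
  fix x y x' y' assume x: "x \<in> carrier H" "y \<in> carrier H" "x' \<in> carrier H" "y' \<in> carrier H"
  have p: "adr (kpure K H H x y) h = antipode H x \<otimes> (h \<otimes> y)"
    if "x \<in> carrier H" "y \<in> carrier H" "h \<in> carrier H" for x y h
    unfolding adr_def by (rule lift_kpure) (assumption | rule hopf_lin that)+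
  show "adr (mult2 (kpure K H H x y) (kpure K H H x' y')) h = adr (kpure K H H x' y') (adr (kpure K H H x y) h)"
    using x assms by (simp add: p HH.mult_kpure antipode_closed antipode_mult m_assoc)
qed (use assms in simp_all)

lemma adl_comult_one: "\<xi> \<in> carrier H \<Longrightarrow> adl (comult H \<xi>) \<one> = counit H \<xi> \<odot> \<one>"
  unfolding antipode_right[symmetric] adl_def
  by (intro liftH_cong comult_closed) (simp_all add: antipode_closed)

lemma adr_comult_one: "\<xi> \<in> carrier H \<Longrightarrow> adr (comult H \<xi>) \<one> = counit H \<xi> \<odot> \<one>"
  unfolding antipode_left[symmetric] adr_def
  by (intro liftH_cong comult_closed) (simp_all add: antipode_closed)

end

text \<open>The rearrangements of the cocycle identity that occur below: the first two make \<chi>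
  invertible from either side, the third is the cocycle identity for the inverse twist and also
  gives coassociativity.\<close>

lemma (in monoid) cocycle_inverses:
  assumes "a \<otimes> b = c \<otimes> d"
    and "a \<in> carrier G" "b \<in> carrier G" "c \<in> carrier G" "d \<in> carrier G"
      "a' \<in> carrier G" "b' \<in> carrier G" "c' \<in> carrier G" "d' \<in> carrier G"
    and "a' \<otimes> a = \<one>" "a \<otimes> a' = \<one>" "b' \<otimes> b = \<one>" "b \<otimes> b' = \<one>"
      "c' \<otimes> c = \<one>" "c \<otimes> c' = \<one>" "d' \<otimes> d = \<one>" "d \<otimes> d' = \<one>"
  shows "d \<otimes> b' = c' \<otimes> a" "b \<otimes> d' = a' \<otimes> c" "b' \<otimes> a' = d' \<otimes> c'"
proof -
  have "c' \<otimes> (a \<otimes> b) \<otimes> b' = c' \<otimes> (c \<otimes> d) \<otimes> b'" using assms(1) by simp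
  then have "c' \<otimes> a \<otimes> (b \<otimes> b') = (c' \<otimes> c) \<otimes> d \<otimes> b'" using assms(2-9) by (simp add: m_assoc)
  then show 1: "d \<otimes> b' = c' \<otimes> a" using assms(2-) by simp
  have "a' \<otimes> (a \<otimes> b) \<otimes> d' = a' \<otimes> (c \<otimes> d) \<otimes> d'" using assms(1) by simp
  then have "(a' \<otimes> a) \<otimes> b \<otimes> d' = a' \<otimes> c \<otimes> (d \<otimes> d')" using assms(2-9) by (simp add: m_assoc)
  then show "b \<otimes> d' = a' \<otimes> c" using assms(2-) by simp
  have "d' \<otimes> (d \<otimes> b') \<otimes> a' = d' \<otimes> (c' \<otimes> a) \<otimes> a'" using 1 by simp
  then have "(d' \<otimes> d) \<otimes> b' \<otimes> a' = d' \<otimes> c' \<otimes> (a \<otimes> a')" using assms(2-9) by (simp add: m_assoc)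
  then show "b' \<otimes> a' = d' \<otimes> c'" using assms(2-) by simp
qed


text \<open>
  The hypotheses are invariant under exchanging \<open>(H, F)\<close> with \<open>(H', G)\<close>, so that every
  statement about deformation along \<open>G\<close> also yields its inverse.
\<close>

locale twist_pair = H: hopf_algebra K H + H': hopf_algebra K H'
  for K :: "'k ring" and H H' :: "('k, 'h, 'm) hopf_algebra_scheme" +
  fixes F G :: "('h, 'h) tensor"
  assumes same: "carrier H' = carrier H" "mult H' = mult H" "one H' = one H" "\<zero>\<^bsub>H'\<^esub> = \<zero>\<^bsub>H\<^esub>"
      "add H' = add H" "smult H' = smult H" "counit H' = counit H"
    and F_closed: "F \<in> carrier (ktensor K H H)" and G_closed: "G \<in> carrier (ktensor K H H)"
    and FG: "F \<otimes>\<^bsub>ktensor K H H\<^esub> G = \<one>\<^bsub>ktensor K H H\<^esub>"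
    and GF: "G \<otimes>\<^bsub>ktensor K H H\<^esub> F = \<one>\<^bsub>ktensor K H H\<^esub>"
    and comult_twist: "\<xi> \<in> carrier H \<Longrightarrow>
      comult H' \<xi> \<otimes>\<^bsub>ktensor K H H\<^esub> F = F \<otimes>\<^bsub>ktensor K H H\<^esub> comult H \<xi>"
    and cocycle_G:
      "left_comult K H (comult H) G \<otimes>\<^bsub>ktensor3 K H\<^esub> kpure K (ktensor K H H) H G \<one>\<^bsub>H\<^esub> =
       right_comult K H (comult H) G \<otimes>\<^bsub>ktensor3 K H\<^esub> tensor_left K H \<one>\<^bsub>H\<^esub> G"
    and cocycle_F:
      "left_comult K H (comult H') F \<otimes>\<^bsub>ktensor3 K H\<^esub> kpure K (ktensor K H H) H F \<one>\<^bsub>H\<^esub> =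
       right_comult K H (comult H') F \<otimes>\<^bsub>ktensor3 K H\<^esub> tensor_left K H \<one>\<^bsub>H\<^esub> F"
    and counit_G: "tensor_lift H (\<lambda>x y. counit H x \<odot>\<^bsub>H\<^esub> y) G = \<one>\<^bsub>H\<^esub>"
      "tensor_lift H (\<lambda>x y. counit H y \<odot>\<^bsub>H\<^esub> x) G = \<one>\<^bsub>H\<^esub>"
    and counit_F: "tensor_lift H (\<lambda>x y. counit H x \<odot>\<^bsub>H\<^esub> y) F = \<one>\<^bsub>H\<^esub>"
      "tensor_lift H (\<lambda>x y. counit H y \<odot>\<^bsub>H\<^esub> x) F = \<one>\<^bsub>H\<^esub>"
begin

lemma same_tensor: "ktensor K H' H' = ktensor K H H" "kpure K H' H' = kpure K H H"
  "ktensor K (ktensor K H H) H' = ktensor3 K H"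
  "kpure K (ktensor K H H) H' = kpure K (ktensor K H H) H"
proof -
  show 1: "ktensor K H' H' = ktensor K H H" "kpure K H' H' = kpure K H H"
    by (intro ktensor_cong kpure_cong same)+
  show "ktensor K (ktensor K H H) H' = ktensor3 K H"
    by (intro ktensor_cong same refl)
  show "kpure K (ktensor K H H) H' = kpure K (ktensor K H H) H"
    by (intro kpure_cong same refl)
qed

lemma tensor_lift_same: "tensor_lift H' = tensor_lift H"
  by (rule tensor_lift_cong_group) (simp_all add: same)

lemma same_comult:
  "left_comult K H' = left_comult K H" "right_comult K H' = right_comult K H"
  "tensor_left K H' = tensor_left K H"
  unfolding left_comult_def[abs_def] right_comult_def[abs_def] tensor_left_def[abs_def] same_tensor
  by (rule refl)+

lemma comult_twist':
  assumes "\<xi> \<in> carrier H"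
  shows "comult H \<xi> \<otimes>\<^bsub>ktensor K H H\<^esub> G = G \<otimes>\<^bsub>ktensor K H H\<^esub> comult H' \<xi>"
proof -
  have c: "comult H \<xi> \<in> carrier (ktensor K H H)" "comult H' \<xi> \<in> carrier (ktensor K H H)"
    using H.comult_closed[of \<xi>] H'.comult_closed[of \<xi>] assms by (simp_all add: same same_tensor)
  note [simp] = F_closed G_closed c H.HH_alg.m_assoc[symmetric]
  have "G \<otimes>\<^bsub>ktensor K H H\<^esub> (comult H' \<xi> \<otimes>\<^bsub>ktensor K H H\<^esub> F) \<otimes>\<^bsub>ktensor K H H\<^esub> G =
    G \<otimes>\<^bsub>ktensor K H H\<^esub> (F \<otimes>\<^bsub>ktensor K H H\<^esub> comult H \<xi>) \<otimes>\<^bsub>ktensor K H H\<^esub> G"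
    using comult_twist[OF assms] by simp
  then have "G \<otimes>\<^bsub>ktensor K H H\<^esub> comult H' \<xi> \<otimes>\<^bsub>ktensor K H H\<^esub> (F \<otimes>\<^bsub>ktensor K H H\<^esub> G) =
    comult H \<xi> \<otimes>\<^bsub>ktensor K H H\<^esub> G"
    by (simp add: GF del: FG)
  then show ?thesis by (simp add: FG del: H.HH_alg.m_assoc)
qed

text \<open>The axioms come in pairs that are exchanged with each other; only the intertwining
  relation has to be turned around, which is \<open>comult_twist'\<close>.\<close>

lemma swap: "twist_pair K H' H G F"
  unfolding twist_pair_def twist_pair_axioms_def same same_tensor same_comult tensor_lift_same
  by (intro conjI impI allI H.hopf_algebra_axioms H'.hopf_algebra_axioms refl F_closed G_closed FG GF
      comult_twist' cocycle_F cocycle_G counit_F counit_G)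

end


section \<open>The twisted Hopf algebra and its antipode\<close>

locale hopf_twist = hopf_algebra K H
  for K :: "'k ring" and H :: "('k, 'h, 'm) hopf_algebra_scheme" (structure) +
  fixes F :: "('h, 'h) tensor"
  assumes twist: "twist K H F"
begin

definition "G = twist_inv K H F"
abbreviation "H2 \<equiv> ktensor K H H"
definition "comultF \<xi> = mult2 (mult2 F (comult H \<xi>)) G"

lemma F_unit: "F \<in> Units H2"
  using twist unfolding twist_def by simp

lemma F_closed [simp]: "F \<in> carrier H2"
  using F_unit by (rule HH_alg.Units_closed)

lemma G_closed [simp]: "G \<in> carrier H2"
  unfolding G_def using F_unit by (rule HH_alg.Units_inv_closed)

lemma FG: "mult2 F G = \<one>\<^bsub>H2\<^esub>" and GF: "mult2 G F = \<one>\<^bsub>H2\<^esub>"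
  unfolding G_def using F_unit by auto

lemma FGr: "t \<in> carrier H2 \<Longrightarrow> mult2 F (mult2 G t) = t" and GFr: "t \<in> carrier H2 \<Longrightarrow> mult2 G (mult2 F t) = t"
  by (simp_all add: FG GF flip: HH_alg.m_assoc)

lemma counit_F: "tensor_lift H (\<lambda>x y. counit H x \<odot> y) F = \<one>" "tensor_lift H (\<lambda>x y. counit H y \<odot> x) F = \<one>"
  using twist unfolding twist_def by auto

lemma counit_one2:
  "tensor_lift H (\<lambda>x y. counit H x \<odot> y) \<one>\<^bsub>H2\<^esub> = \<one>" "tensor_lift H (\<lambda>x y. counit H y \<odot> x) \<one>\<^bsub>H2\<^esub> = \<one>"
proof -
  have b1: "kbilinear K H H H (\<lambda>x y. counit H x \<odot> y)" by (assumption | rule hopf_lin)+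
  have b2: "kbilinear K H H H (\<lambda>x y. counit H y \<odot> x)" by (assumption | rule hopf_lin)+
  show "tensor_lift H (\<lambda>x y. counit H x \<odot> y) \<one>\<^bsub>H2\<^esub> = \<one>" "tensor_lift H (\<lambda>x y. counit H y \<odot> x) \<one>\<^bsub>H2\<^esub> = \<one>"
    unfolding ktensor_one by (simp_all add: lift_kpure[OF b1] lift_kpure[OF b2] counit_one)
qed

lemma counit_lift_closed:
  assumes "t \<in> carrier H2"
  shows "tensor_lift H (\<lambda>x y. counit H x \<odot> y) t \<in> carrier H" "tensor_lift H (\<lambda>x y. counit H y \<odot> x) t \<in> carrier H"
  by (rule lift_closed[OF _ assms]; (assumption | rule hopf_lin)+)+

text \<open>The maps \<open>counit \<otimes> id\<close> and \<open>id \<otimes> counit\<close> are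
  multiplicative and send both \<open>F\<close> and \<open>F G = 1\<close> to \<one>, which leaves
  only \<one> as the image of \<open>G\<close>.\<close>

lemma counit_G: "tensor_lift H (\<lambda>x y. counit H x \<odot> y) G = \<one>" "tensor_lift H (\<lambda>x y. counit H y \<odot> x) G = \<one>"
proof -
  note hom = lift_counit_mult_hom[OF F_closed G_closed]
  show "tensor_lift H (\<lambda>x y. counit H x \<odot> y) G = \<one>"
    using hom(1) counit_lift_closed(1)[OF G_closed] unfolding FG counit_one2 counit_F by simp
  show "tensor_lift H (\<lambda>x y. counit H y \<odot> x) G = \<one>"
    using hom(2) counit_lift_closed(2)[OF G_closed] unfolding FG counit_one2 counit_F by simp
qed

text \<open>In this notation the cocycle condition is \<open>a b = c d\<close>; the primed elements
  replace the twist by its inverse and are the inverses of the unprimed ones.\<close>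

definition "a = kpure K H2 H F \<one>"
definition "b = left_comult K H (comult H) F"
definition "c = tensor_left K H \<one> F"
definition "d = right_comult K H (comult H) F"
definition "a' = kpure K H2 H G \<one>"
definition "b' = left_comult K H (comult H) G"
definition "c' = tensor_left K H \<one> G"
definition "d' = right_comult K H (comult H) G"

lemma cocycle: "mult3 a b = mult3 c d"
  using twist unfolding twist_def a_def b_def c_def d_def left_comult_def right_comult_def tensor_left_def
  by simp

lemma abcd_closed [simp]:
  "a \<in> carrier (ktensor3 K H)" "b \<in> carrier (ktensor3 K H)" "c \<in> carrier (ktensor3 K H)"
  "d \<in> carrier (ktensor3 K H)" "a' \<in> carrier (ktensor3 K H)" "b' \<in> carrier (ktensor3 K H)"
  "c' \<in> carrier (ktensor3 K H)" "d' \<in> carrier (ktensor3 K H)"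
  unfolding a_def b_def c_def d_def a'_def b'_def c'_def d'_def
  by (rule lin3 F_closed G_closed comult_klinear)+

lemma abcd_inverse:
  "mult3 a' a = \<one>\<^bsub>ktensor3 K H\<^esub>" "mult3 a a' = \<one>\<^bsub>ktensor3 K H\<^esub>"
  "mult3 b' b = \<one>\<^bsub>ktensor3 K H\<^esub>" "mult3 b b' = \<one>\<^bsub>ktensor3 K H\<^esub>"
  "mult3 c' c = \<one>\<^bsub>ktensor3 K H\<^esub>" "mult3 c c' = \<one>\<^bsub>ktensor3 K H\<^esub>"
  "mult3 d' d = \<one>\<^bsub>ktensor3 K H\<^esub>" "mult3 d d' = \<one>\<^bsub>ktensor3 K H\<^esub>"
  unfolding a_def b_def c_def d_def a'_def b'_def c'_def d'_def
  by (simp_all add: H3.XYZ.mult_kpure FG GF tensor_left_mult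
      left_comult_mult[OF comult_klinear comult_mult, symmetric]
      right_comult_mult[OF comult_klinear comult_mult, symmetric]
      comult_one_3[OF comult_klinear comult_one] flip: ktensor_one[of K "ktensor K H H" H])
    (simp_all add: ktensor_one tensor_left_kpure)

lemmas cocycle' = H3_alg.cocycle_inverses[OF cocycle abcd_closed abcd_inverse]

lemma comultF_klinear: "klinear K H H2 comultF"
  unfolding comultF_def[abs_def] by (assumption | rule hopf_lin F_closed G_closed)+

lemma comultF_mult: "\<lbrakk>x \<in> carrier H; y \<in> carrier H\<rbrakk> \<Longrightarrow> comultF (x \<otimes> y) = mult2 (comultF x) (comultF y)"
  unfolding comultF_def by (simp add: comult_mult comult_closed HH_alg.m_assoc GFr)

lemma comultF_one: "comultF \<one> = \<one>\<^bsub>H2\<^esub>"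
  unfolding comultF_def by (simp add: comult_one FG)

text \<open>The twisted coproduct is the original one conjugated by \<open>F\<close>, and placing
  \<one> in the third leg turns this into conjugation by \<open>a\<close>. The analogue for the
  other side conjugates by \<open>c\<close>.\<close>

lemma left_comultF:
  assumes "t \<in> carrier H2"
  shows "left_comult K H comultF t = mult3 (mult3 a (left_comult K H (comult H) t)) a'"
proof (rule klinear_ktensor_eqI[OF klinear_left_comult[OF comultF_klinear] _ module_axioms module_axioms _ assms,
      where g="\<lambda>t. mult3 (mult3 a (left_comult K H (comult H) t)) a'"])
  show "klinear K H2 (ktensor3 K H) (\<lambda>t. mult3 (mult3 a (left_comult K H (comult H) t)) a')"
    by (assumption | rule lin3 abcd_closed comult_klinear)+
qed (simp add: left_comult_kpure[OF comultF_klinear] left_comult_kpure[OF comult_klinear] a_def a'_def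
      H3.XYZ.mult_kpure comult_closed comultF_def)

lemma right_comultF:
  assumes "t \<in> carrier H2"
  shows "right_comult K H comultF t = mult3 (mult3 c (right_comult K H (comult H) t)) c'"
proof (rule klinear_ktensor_eqI[OF klinear_right_comult[OF comultF_klinear] _ module_axioms module_axioms _ assms,
      where g="\<lambda>t. mult3 (mult3 c (right_comult K H (comult H) t)) c'"])
  show "klinear K H2 (ktensor3 K H) (\<lambda>t. mult3 (mult3 c (right_comult K H (comult H) t)) c')"
    by (assumption | rule lin3 abcd_closed comult_klinear)+
qed (simp add: right_comult_kpure[OF comultF_klinear] right_comult_kpure[OF comult_klinear] c_def c'_def
      tensor_left_mult comult_closed comultF_def)

lemma coassoc_comult: "\<xi> \<in> carrier H \<Longrightarrow>
    left_comult K H (comult H) (comult H \<xi>) = right_comult K H (comult H) (comult H \<xi>)"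
  using coassoc unfolding left_comult_def right_comult_def tensor_left_def by simp

text \<open>Both sides are the same iterated coproduct conjugated in the triple tensor product, on
  the left by \<open>a b\<close> and on the right by \<open>c d\<close>; the cocycle condition
  identifies the conjugating elements.\<close>

lemma coassoc_comultF:
  assumes "\<xi> \<in> carrier H"
  shows "left_comult K H comultF (comultF \<xi>) = right_comult K H comultF (comultF \<xi>)"
proof -
  let ?L = "left_comult K H (comult H) (comult H \<xi>)"
  have L: "?L \<in> carrier (ktensor3 K H)" using assms by (intro left_comult_closed comult_klinear comult_closed)
  have "left_comult K H (comult H) (comultF \<xi>) = mult3 (mult3 b ?L) b'"
    unfolding comultF_def b_def b'_def using assms
    by (simp add: left_comult_mult[OF comult_klinear comult_mult] comult_closed)
  then have "left_comult K H comultF (comultF \<xi>) = mult3 (mult3 a (mult3 (mult3 b ?L) b')) a'"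
    using left_comultF klinear_closed[OF comultF_klinear assms] by simp
  also have "\<dots> = mult3 (mult3 (mult3 a b) ?L) (mult3 b' a')"
    using L by (simp add: H3_alg.m_assoc)
  also have "\<dots> = mult3 (mult3 (mult3 c d) ?L) (mult3 d' c')"
    unfolding cocycle cocycle'(3) ..
  also have "\<dots> = mult3 (mult3 c (mult3 (mult3 d ?L) d')) c'"
    using L by (simp add: H3_alg.m_assoc)
  also have "mult3 (mult3 d ?L) d' = right_comult K H (comult H) (comultF \<xi>)"
    unfolding comultF_def d_def d'_def coassoc_comult[OF assms] using assms
    by (simp add: right_comult_mult[OF comult_klinear comult_mult] comult_closed)
  also have "mult3 (mult3 c (right_comult K H (comult H) (comultF \<xi>))) c' = right_comult K H comultF (comultF \<xi>)"
    using right_comultF klinear_closed[OF comultF_klinear assms] by simp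
  finally show ?thesis .
qed

definition "chi = adl F \<one>"
text \<open>The classical closed formula for the inverse of \<chi>: the sum of the products
  \<open>S(p) q\<close> over \<open>p \<otimes> q\<close> in the inverse twist.\<close>

definition "chi' = adr G \<one>"

lemma chi_closed [simp]: "chi \<in> carrier H" "chi' \<in> carrier H"
  unfolding chi_def chi'_def
  by (auto intro: kbilinear_closed[OF kbilinear_adl] kbilinear_closed[OF kbilinear_adr])

lemma chi_chi': "chi \<otimes> chi' = \<one>"
proof -
  \<comment> \<open>Apply \<open>x \<otimes> y \<otimes> z \<mapsto> x S(y) z\<close> to \<open>c' a = d b'\<close>.\<close>
  let ?\<beta> = "\<lambda>x y z. x \<otimes> (antipode H y \<otimes> z)"
  have tri: "ktrilinear K H H H H (\<lambda>x' y' z'. ?\<beta> (x \<otimes> x') (y \<otimes> y') (z \<otimes> z'))"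
    if "x \<in> carrier H" "y \<in> carrier H" "z \<in> carrier H" for x y z
    by (assumption | rule hopf_lin that)+
  have tri0: "ktrilinear K H H H H ?\<beta>"
    by (assumption | rule hopf_lin)+
  have triG: "ktrilinear K H H H H (\<lambda>x y z. lift3 H (\<lambda>x' y' z'. ?\<beta> (x \<otimes> x') (y \<otimes> y') (z \<otimes> z')) t)"
    if "t \<in> carrier (ktensor3 K H)" for t
    unfolding lift3_def by (assumption | rule hopf_lin that)+
  have "lift3 H ?\<beta> (mult3 c' a) = tensor_lift H (\<lambda>p q. lift3 H (\<lambda>x' y' z'. ?\<beta> (\<one> \<otimes> x') (p \<otimes> y') (q \<otimes> z')) a) G"
    unfolding H3.lift3_mult[OF abcd_closed(7,1) tri0] unfolding c'_def
    by (rule lift3_tensor_left[OF triG]) auto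
  also have "\<dots> = tensor_lift H (\<lambda>p q. tensor_lift H (\<lambda>x' y'. ?\<beta> (\<one> \<otimes> x') (p \<otimes> y') (q \<otimes> \<one>)) F) G"
    unfolding a_def by (intro liftH_cong lift3_kpure tri) auto
  \<comment> \<open>Antimultiplicativity separates the legs of \<open>F\<close> from those of
    \<open>G\<close>, so that the double sum factors as \<open>chi\<close> times
    \<open>chi'\<close>.\<close>
  also have "\<dots> = tensor_lift H (\<lambda>p q. tensor_lift H (\<lambda>x y. (x \<otimes> (\<one> \<otimes> antipode H y)) \<otimes> (antipode H p \<otimes> (\<one> \<otimes> q))) F) G"
    by (intro liftH_cong F_closed G_closed) (simp add: antipode_closed antipode_mult m_assoc)
  also have "\<dots> = tensor_lift H (\<lambda>x y. tensor_lift H (\<lambda>p q. (x \<otimes> (\<one> \<otimes> antipode H y)) \<otimes> (antipode H p \<otimes> (\<one> \<otimes> q))) G) F"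
    by (rule lift_swap) (assumption | rule hopf_lin F_closed G_closed)+
  also have "\<dots> = tensor_lift H (\<lambda>x y. (x \<otimes> (\<one> \<otimes> antipode H y)) \<otimes> chi') F"
    unfolding chi'_def adr_def
    by (intro liftH_cong F_closed G_closed lift_hom[symmetric]) (assumption | rule hopf_lin G_closed)+
  also have "\<dots> = chi \<otimes> chi'"
    unfolding chi_def adl_def
    by (rule lift_hom[symmetric]) (assumption | rule hopf_lin F_closed chi_closed)+
  finally have 1: "lift3 H ?\<beta> (mult3 c' a) = chi \<otimes> chi'" .
  \<comment> \<open>Here the coproduct of the first leg of \<open>G\<close> meets the antipode and
    becomes a counit, which the normalisation of \<open>G\<close> absorbs; the same then happens to
    the coproduct of the second leg of \<open>F\<close>.\<close>
  have "lift3 H ?\<beta> (mult3 d b') = tensor_lift H (\<lambda>x y. tensor_lift H (\<lambda>p q.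
      lift3 H (\<lambda>x' y' z'. ?\<beta> (x \<otimes> x') (p \<otimes> y') (q \<otimes> z')) b') (comult H y)) F"
    unfolding H3.lift3_mult[OF abcd_closed(4,6) tri0] unfolding d_def
    by (rule lift3_right_comult[OF comult_klinear triG]) auto
  also have "\<dots> = tensor_lift H (\<lambda>x y. tensor_lift H (\<lambda>p q. tensor_lift H (\<lambda>r s. tensor_lift H (\<lambda>u v.
      ?\<beta> (x \<otimes> u) (p \<otimes> v) (q \<otimes> s)) (comult H r)) G) (comult H y)) F"
    unfolding b'_def
    by (intro liftH_cong F_closed comult_closed lift3_left_comult comult_klinear G_closed tri)
  also have "\<dots> = tensor_lift H (\<lambda>x y. tensor_lift H (\<lambda>p q. tensor_lift H (\<lambda>r s.
      counit H r \<odot> (x \<otimes> (\<one> \<otimes> (antipode H p \<otimes> (q \<otimes> s))))) G) (comult H y)) F"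
  proof (intro liftH_cong F_closed G_closed comult_closed)
    fix x y p q r s
    assume xs: "x \<in> carrier H" "y \<in> carrier H" "p \<in> carrier H" "q \<in> carrier H" "r \<in> carrier H" "s \<in> carrier H"
    have "tensor_lift H (\<lambda>u v. ?\<beta> (x \<otimes> u) (p \<otimes> v) (q \<otimes> s)) (comult H r) =
      tensor_lift H (\<lambda>u v. x \<otimes> ((u \<otimes> antipode H v) \<otimes> (antipode H p \<otimes> (q \<otimes> s)))) (comult H r)"
      using xs by (intro liftH_cong comult_closed) (simp_all add: antipode_closed antipode_mult m_assoc)
    also have "\<dots> = counit H r \<odot> (x \<otimes> (\<one> \<otimes> (antipode H p \<otimes> (q \<otimes> s))))"
      by (rule lift_antipode_right) (assumption | rule hopf_lin xs)+
    finally show "tensor_lift H (\<lambda>u v. ?\<beta> (x \<otimes> u) (p \<otimes> v) (q \<otimes> s)) (comult H r) =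
      counit H r \<odot> (x \<otimes> (\<one> \<otimes> (antipode H p \<otimes> (q \<otimes> s))))" .
  qed
  also have "\<dots> = tensor_lift H (\<lambda>x y. tensor_lift H (\<lambda>p q. x \<otimes> (antipode H p \<otimes> q)) (comult H y)) F"
  proof (intro liftH_cong F_closed comult_closed)
    fix x y p q
    assume xs: "x \<in> carrier H" "y \<in> carrier H" "p \<in> carrier H" "q \<in> carrier H"
    have "klinear K H H (\<lambda>s. x \<otimes> (\<one> \<otimes> (antipode H p \<otimes> (q \<otimes> s))))" by (assumption | rule hopf_lin xs)+
    from lift_counit_hom(1)[OF G_closed this] show
      "tensor_lift H (\<lambda>r s. counit H r \<odot> (x \<otimes> (\<one> \<otimes> (antipode H p \<otimes> (q \<otimes> s))))) G = x \<otimes> (antipode H p \<otimes> q)"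
      using xs by (simp add: counit_G antipode_closed)
  qed
  also have "\<dots> = tensor_lift H (\<lambda>x y. counit H y \<odot> (x \<otimes> \<one>)) F"
    by (intro liftH_cong F_closed lift_antipode_left) (assumption | rule hopf_lin)+
  also have "\<dots> = \<one>"
    using lift_counit_hom(2)[OF F_closed, of H "\<lambda>x. x \<otimes> \<one>"] klinear_id[OF module_axioms]
    by (simp add: counit_F klinear_mult_left[OF K_algebra_axioms])
  finally show ?thesis using 1 cocycle'(1) by simp
qed

lemma chi'_chi: "chi' \<otimes> chi = \<one>"
proof -
  \<comment> \<open>Apply \<open>x \<otimes> y \<otimes> z \<mapsto> S(x) y S(z)\<close> to \<open>a' c = b d'\<close>.\<close>
  let ?\<beta> = "\<lambda>x y z. antipode H x \<otimes> (y \<otimes> antipode H z)"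
  have tri: "ktrilinear K H H H H (\<lambda>x' y' z'. ?\<beta> (x \<otimes> x') (y \<otimes> y') (z \<otimes> z'))"
    if "x \<in> carrier H" "y \<in> carrier H" "z \<in> carrier H" for x y z
    by (assumption | rule hopf_lin that)+
  have tri0: "ktrilinear K H H H H ?\<beta>"
    by (assumption | rule hopf_lin)+
  have triG: "ktrilinear K H H H H (\<lambda>x y z. lift3 H (\<lambda>x' y' z'. ?\<beta> (x \<otimes> x') (y \<otimes> y') (z \<otimes> z')) t)"
    if "t \<in> carrier (ktensor3 K H)" for t
    unfolding lift3_def by (assumption | rule hopf_lin that)+
  have "lift3 H ?\<beta> (mult3 a' c) = tensor_lift H (\<lambda>x y. lift3 H (\<lambda>x' y' z'. ?\<beta> (x \<otimes> x') (y \<otimes> y') (\<one> \<otimes> z')) c) G"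
    unfolding H3.lift3_mult[OF abcd_closed(5,3) tri0] unfolding a'_def
    by (rule lift3_kpure[OF triG]) auto
  also have "\<dots> = tensor_lift H (\<lambda>x y. tensor_lift H (\<lambda>p q. ?\<beta> (x \<otimes> \<one>) (y \<otimes> p) (\<one> \<otimes> q)) F) G"
    unfolding c_def by (intro liftH_cong lift3_tensor_left tri) auto
  also have "\<dots> = tensor_lift H (\<lambda>x y. tensor_lift H (\<lambda>p q. (antipode H x \<otimes> (\<one> \<otimes> y)) \<otimes> (p \<otimes> (\<one> \<otimes> antipode H q))) F) G"
    by (intro liftH_cong F_closed G_closed) (simp add: antipode_closed m_assoc)
  also have "\<dots> = tensor_lift H (\<lambda>x y. (antipode H x \<otimes> (\<one> \<otimes> y)) \<otimes> chi) G"
    unfolding chi_def adl_def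
    by (intro liftH_cong F_closed G_closed lift_hom[symmetric]) (assumption | rule hopf_lin F_closed)+
  also have "\<dots> = chi' \<otimes> chi"
    unfolding chi'_def adr_def
    by (rule lift_hom[symmetric]) (assumption | rule hopf_lin G_closed chi_closed)+
  finally have 1: "lift3 H ?\<beta> (mult3 a' c) = chi' \<otimes> chi" .
  \<comment> \<open>Mirror image of the previous computation: now the second leg of \<open>G\<close>
    and the first leg of \<open>F\<close> carry the coproducts that collapse.\<close>
  have "lift3 H ?\<beta> (mult3 b d') = tensor_lift H (\<lambda>x y. tensor_lift H (\<lambda>p q.
      lift3 H (\<lambda>x' y' z'. ?\<beta> (p \<otimes> x') (q \<otimes> y') (y \<otimes> z')) d') (comult H x)) F"
    unfolding H3.lift3_mult[OF abcd_closed(2,8) tri0] unfolding b_def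
    by (rule lift3_left_comult[OF comult_klinear triG]) auto
  also have "\<dots> = tensor_lift H (\<lambda>x y. tensor_lift H (\<lambda>p q. tensor_lift H (\<lambda>r s. tensor_lift H (\<lambda>u v.
      ?\<beta> (p \<otimes> r) (q \<otimes> u) (y \<otimes> v)) (comult H s)) G) (comult H x)) F"
    unfolding d'_def
    by (intro liftH_cong F_closed comult_closed lift3_right_comult comult_klinear G_closed tri)
  also have "\<dots> = tensor_lift H (\<lambda>x y. tensor_lift H (\<lambda>p q. tensor_lift H (\<lambda>r s.
      counit H s \<odot> (antipode H r \<otimes> ((antipode H p \<otimes> q) \<otimes> (\<one> \<otimes> antipode H y)))) G) (comult H x)) F"
  proof (intro liftH_cong F_closed G_closed comult_closed)
    fix x y p q r s
    assume xs: "x \<in> carrier H" "y \<in> carrier H" "p \<in> carrier H" "q \<in> carrier H" "r \<in> carrier H" "s \<in> carrier H"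
    have "tensor_lift H (\<lambda>u v. ?\<beta> (p \<otimes> r) (q \<otimes> u) (y \<otimes> v)) (comult H s) =
      tensor_lift H (\<lambda>u v. antipode H r \<otimes> ((antipode H p \<otimes> q) \<otimes> ((u \<otimes> antipode H v) \<otimes> antipode H y))) (comult H s)"
      using xs by (intro liftH_cong comult_closed) (simp_all add: antipode_closed antipode_mult m_assoc)
    also have "\<dots> = counit H s \<odot> (antipode H r \<otimes> ((antipode H p \<otimes> q) \<otimes> (\<one> \<otimes> antipode H y)))"
      by (rule lift_antipode_right) (assumption | rule hopf_lin xs)+
    finally show "tensor_lift H (\<lambda>u v. ?\<beta> (p \<otimes> r) (q \<otimes> u) (y \<otimes> v)) (comult H s) =
      counit H s \<odot> (antipode H r \<otimes> ((antipode H p \<otimes> q) \<otimes> (\<one> \<otimes> antipode H y)))" .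
  qed
  also have "\<dots> = tensor_lift H (\<lambda>x y. tensor_lift H (\<lambda>p q. (antipode H p \<otimes> q) \<otimes> antipode H y) (comult H x)) F"
  proof (intro liftH_cong F_closed comult_closed)
    fix x y p q
    assume xs: "x \<in> carrier H" "y \<in> carrier H" "p \<in> carrier H" "q \<in> carrier H"
    have "klinear K H H (\<lambda>r. antipode H r \<otimes> ((antipode H p \<otimes> q) \<otimes> (\<one> \<otimes> antipode H y)))"
      by (assumption | rule hopf_lin xs)+
    from lift_counit_hom(2)[OF G_closed this] show
      "tensor_lift H (\<lambda>r s. counit H s \<odot> (antipode H r \<otimes> ((antipode H p \<otimes> q) \<otimes> (\<one> \<otimes> antipode H y)))) G =
        (antipode H p \<otimes> q) \<otimes> antipode H y"
      using xs by (simp add: counit_G antipode_closed antipode_one)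
  qed
  also have "\<dots> = tensor_lift H (\<lambda>x y. counit H x \<odot> (\<one> \<otimes> antipode H y)) F"
    by (intro liftH_cong F_closed lift_antipode_left) (assumption | rule hopf_lin)+
  also have "\<dots> = \<one> \<otimes> antipode H (tensor_lift H (\<lambda>x y. counit H x \<odot> y) F)"
    by (rule lift_counit_hom(1)) (assumption | rule hopf_lin F_closed)+
  also have "\<dots> = \<one> \<otimes> antipode H \<one>"
    unfolding counit_F ..
  finally show ?thesis using 1 cocycle'(2) by (simp add: antipode_one)
qed

lemma twist_chi_eq: "twist_chi H F = chi"
  unfolding twist_chi_def chi_def adl_def by (intro liftH_cong F_closed) (simp add: antipode_closed)

lemma inv_chi: "inv chi = chi'"
  using chi_chi' chi'_chi by (intro inv_char) auto

abbreviation "HF \<equiv> twisted_hopf K H F"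

lemma HF_sel [simp]: "carrier HF = carrier H" "mult HF = mult H" "one HF = one H" "\<zero>\<^bsub>HF\<^esub> = \<zero>\<^bsub>H\<^esub>"
  "add HF = add H" "smult HF = smult H" "counit HF = counit H" "comult HF = comultF"
  by (simp_all add: twisted_hopf_def comultF_def[abs_def] G_def)

lemma antipode_HF: "antipode HF \<xi> = chi \<otimes> antipode H \<xi> \<otimes> chi'"
  by (simp add: twisted_hopf_def twist_chi_eq inv_chi)

lemma HF_tensor [simp]: "ktensor K HF HF = H2" "kpure K HF HF = kpure K H H" "ktensor K H2 HF = ktensor3 K H"
  "kpure K H2 HF = kpure K H2 H" "tensor_lift HF = tensor_lift H"
proof -
  show 1: "ktensor K HF HF = H2" "kpure K HF HF = kpure K H H"
    by (intro ktensor_cong kpure_cong HF_sel)+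
  show "ktensor K H2 HF = ktensor3 K H" by (intro ktensor_cong HF_sel refl)
  show "kpure K H2 HF = kpure K H2 H" by (intro kpure_cong HF_sel refl)
  show "tensor_lift HF = tensor_lift H" by (intro tensor_lift_cong_group HF_sel)
qed

lemma HF_module: "module K V = module K (V\<lparr>comult := x, antipode := y\<rparr>)" for V :: "('k, 'h, 'm) hopf_algebra_scheme"
  unfolding module_def abelian_group_def abelian_monoid_def abelian_group_axioms_def module_axioms_def by simp

lemma HF_K_algebra: "K_algebra K HF"
proof -
  have "module K HF" using module_axioms unfolding twisted_hopf_def HF_module[symmetric] .
  moreover have "ring HF"
    using ring_axioms unfolding ring_def abelian_group_def abelian_monoid_def abelian_group_axioms_def
      monoid_def ring_axioms_def by (simp add: twisted_hopf_def)
  ultimately show ?thesis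
    unfolding K_algebra_def K_algebra_axioms_def by (simp add: smult_mult_left smult_mult_right)
qed

text \<open>As the antipode is conjugated by \<chi>, the first sum is \<open>chi\<close> times
  \<open>adr\<close> of the twisted coproduct at \<open>chi'\<close>. Since \<open>chi'\<close> is
  itself \<open>adr G \<one>\<close>, the factor \<open>G\<close> is absorbed by the action and
  passes through the coproduct, after which the original antipode axiom applies to \<one>. The
  second identity is the mirror image with \<open>adl\<close> and \<open>F\<close>.\<close>

lemma HF_antipode:
  assumes "\<xi> \<in> carrier H"
  shows "tensor_lift H (\<lambda>x y. antipode HF x \<otimes> y) (comultF \<xi>) = counit H \<xi> \<odot> \<one>"
    and "tensor_lift H (\<lambda>x y. x \<otimes> antipode HF y) (comultF \<xi>) = counit H \<xi> \<odot> \<one>"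
proof -
  note cl = kbilinear_closed[OF kbilinear_adl] kbilinear_closed[OF kbilinear_adr] comult_closed[OF assms]
  have cF: "comultF \<xi> \<in> carrier H2" using comultF_klinear assms by (rule klinear_closed)
  have "tensor_lift H (\<lambda>x y. antipode HF x \<otimes> y) (comultF \<xi>) =
      tensor_lift H (\<lambda>x y. chi \<otimes> (antipode H x \<otimes> (chi' \<otimes> y))) (comultF \<xi>)"
    by (intro liftH_cong cF) (simp add: antipode_HF antipode_closed m_assoc)
  also have "\<dots> = chi \<otimes> adr (comultF \<xi>) chi'"
    unfolding adr_def by (rule lift_hom[symmetric]) (assumption | rule hopf_lin cF chi_closed)+
  also have "adr (comultF \<xi>) chi' = adr (mult2 G (comultF \<xi>)) \<one>"
    unfolding chi'_def by (rule adr_mult[symmetric]) (auto intro: cF)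
  also have "mult2 G (comultF \<xi>) = mult2 (comult H \<xi>) G"
    unfolding comultF_def using cl by (simp add: HH_alg.m_assoc GFr)
  also have "adr (mult2 (comult H \<xi>) G) \<one> = adr G (adr (comult H \<xi>) \<one>)"
    by (rule adr_mult) (auto intro: cl)
  also have "\<dots> = counit H \<xi> \<odot> chi'"
    unfolding adr_comult_one[OF assms] chi'_def
    by (rule klinear_smult[OF kbilinear_right[OF kbilinear_adr]]) (auto intro: counit_closed assms)
  finally show "tensor_lift H (\<lambda>x y. antipode HF x \<otimes> y) (comultF \<xi>) = counit H \<xi> \<odot> \<one>"
    by (simp add: smult_mult_right counit_closed assms chi_chi')
  have "tensor_lift H (\<lambda>x y. x \<otimes> antipode HF y) (comultF \<xi>) =
      tensor_lift H (\<lambda>x y. (x \<otimes> (chi \<otimes> antipode H y)) \<otimes> chi') (comultF \<xi>)"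
    by (intro liftH_cong cF) (simp add: antipode_HF antipode_closed m_assoc)
  also have "\<dots> = adl (comultF \<xi>) chi \<otimes> chi'"
    unfolding adl_def by (rule lift_hom[symmetric]) (assumption | rule hopf_lin cF chi_closed)+
  also have "adl (comultF \<xi>) chi = adl (mult2 (comultF \<xi>) F) \<one>"
    unfolding chi_def by (rule adl_mult[symmetric]) (auto intro: cF)
  also have "mult2 (comultF \<xi>) F = mult2 F (comult H \<xi>)"
    unfolding comultF_def using cl by (simp add: HH_alg.m_assoc GF)
  also have "adl (mult2 F (comult H \<xi>)) \<one> = adl F (adl (comult H \<xi>) \<one>)"
    by (rule adl_mult) (auto intro: cl)
  also have "\<dots> = counit H \<xi> \<odot> chi"
    unfolding adl_comult_one[OF assms] chi_def
    by (rule klinear_smult[OF kbilinear_right[OF kbilinear_adl]]) (auto intro: counit_closed assms)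
  finally show "tensor_lift H (\<lambda>x y. x \<otimes> antipode HF y) (comultF \<xi>) = counit H \<xi> \<odot> \<one>"
    by (simp add: smult_mult_left counit_closed assms chi_chi')
qed

lemma hopf_algebra_HF: "hopf_algebra K HF"
proof -
  interpret HF: K_algebra K HF by (rule HF_K_algebra)
  have cl: "comult H \<xi> \<in> carrier H2" "comultF \<xi> \<in> carrier H2" if "\<xi> \<in> carrier H" for \<xi>
    using that comult_closed klinear_closed[OF comultF_klinear] by auto
  have ce: "tensor_lift H (\<lambda>x y. counit H x \<odot> y) (comultF \<xi>) = \<xi>"
     "tensor_lift H (\<lambda>x y. counit H y \<odot> x) (comultF \<xi>) = \<xi>" if "\<xi> \<in> carrier H" for \<xi>
    using that unfolding comultF_def
    by (simp_all add: lift_counit_mult_hom cl counit_F counit_G counit_left counit_right)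
  have "klinear K H H (\<lambda>\<xi>. chi \<otimes> antipode H \<xi> \<otimes> chi')"
    by (assumption | rule hopf_lin chi_closed)+
  then have al: "linear_map K HF HF (antipode HF)"
    unfolding klinear_def linear_map_def by (simp add: antipode_HF[abs_def] antipode_HF Pi_iff)
  have clin: "linear_map K HF H2 comultF"
    using comultF_klinear unfolding klinear_def linear_map_def by simp
  show ?thesis
    unfolding hopf_algebra_def hopf_algebra_axioms_def HF_sel HF_tensor
    using coassoc_comultF unfolding left_comult_def right_comult_def tensor_left_def
    by (auto simp: HF_K_algebra clin al comultF_mult comultF_one counit_closed counit_add counit_smult counit_mult
        counit_one ce HF_antipode)
qed

lemma twist_pair_HF: "twist_pair K H HF F G"
proof -
  interpret HF: hopf_algebra K HF by (rule hopf_algebra_HF)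
  have cl: "comult H \<xi> \<in> carrier H2" if "\<xi> \<in> carrier H" for \<xi>
    using that comult_closed by auto
  \<comment> \<open>Conjugation by \<open>a\<close> followed by multiplication with \<open>a\<close>
    leaves \<open>a b\<close>. With its analogue \<open>d\<close>, the condition required of the
    twisted coproduct becomes the original cocycle condition.\<close>
  have b: "mult3 (left_comult K H comultF F) a = mult3 a b"
    using left_comultF[OF F_closed] by (simp add: b_def[symmetric] H3_alg.m_assoc abcd_inverse)
  have d: "mult3 (right_comult K H comultF F) c = mult3 c d"
    using right_comultF[OF F_closed] by (simp add: d_def[symmetric] H3_alg.m_assoc abcd_inverse)
  show ?thesis
  proof unfold_locales
    show "mult3 (left_comult K H (comult H) G) (kpure K (ktensor K H H) H G \<one>) =
       mult3 (right_comult K H (comult H) G) (tensor_left K H \<one> G)"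
      using cocycle'(3) unfolding b'_def a'_def c'_def d'_def .
    show "mult3 (left_comult K H (comult HF) F) (kpure K (ktensor K H H) H F \<one>) =
       mult3 (right_comult K H (comult HF) F) (tensor_left K H \<one> F)"
      using b d cocycle unfolding a_def c_def by simp
    show "mult2 (comult HF \<xi>) F = mult2 F (comult H \<xi>)" if "\<xi> \<in> carrier H" for \<xi>
      using cl[OF that] by (simp add: comultF_def HH_alg.m_assoc GF)
  qed (simp_all add: FG GF counit_F counit_G)
qed

end


section \<open>Equivariant bilinear maps and their deformation\<close>

lemmas kbilinear_rules = kbilinear_comp_left kbilinear_comp_right kbilinear_closed kbilinear_module

text \<open>A morphism of \<open>H\<close>-modules out of the tensor product of \<open>X\<close> and
  \<open>Y\<close>, kept as a bilinear map so that products, actions, evaluation and pure tensors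
  all fit one pattern.\<close>

definition equivariant ::
    "'k ring \<Rightarrow> ('k, 'h, 'm) hopf_algebra_scheme \<Rightarrow> ('k, 'x, 'h, 'n) hmodule_scheme \<Rightarrow>
     ('k, 'y, 'h, 'o) hmodule_scheme \<Rightarrow> ('k, 'z, 'h, 'p) hmodule_scheme \<Rightarrow> ('x \<Rightarrow> 'y \<Rightarrow> 'z) \<Rightarrow> bool" where
  "equivariant K H X Y Z B \<longleftrightarrow>
     H_module K H X \<and> H_module K H Y \<and> H_module K H Z \<and> kbilinear K X Y Z B \<and>
     (\<forall>\<xi>\<in>carrier H. \<forall>x\<in>carrier X. \<forall>y\<in>carrier Y.
        act Z \<xi> (B x y) = tensor_lift Z (\<lambda>p q. B (act X p x) (act Y q y)) (comult H \<xi>))"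

definition star_op ::
    "('h, 'h) tensor \<Rightarrow> ('k, 'x, 'h, 'n) hmodule_scheme \<Rightarrow> ('k, 'y, 'h, 'o) hmodule_scheme \<Rightarrow>
     ('k, 'z, 'h, 'p) hmodule_scheme \<Rightarrow> ('x \<Rightarrow> 'y \<Rightarrow> 'z) \<Rightarrow> 'x \<Rightarrow> 'y \<Rightarrow> 'z" where
  "star_op G X Y Z B x y = tensor_lift Z (\<lambda>p q. B (act X p x) (act Y q y)) G"

text \<open>Collects what a deformation leaves untouched; it is enough for the two records to have
  the same lift.\<close>

definition same_hmodule ::
    "('k, 'v, 'h, 'm) hmodule_scheme \<Rightarrow> ('k, 'v, 'h, 'n) hmodule_scheme \<Rightarrow> bool" where
  "same_hmodule V V' \<longleftrightarrow> carrier V' = carrier V \<and> \<zero>\<^bsub>V'\<^esub> = \<zero>\<^bsub>V\<^esub> \<and> add V' = add V \<and>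
     smult V' = smult V \<and> act V' = act V"

lemma same_hmodule_sym: "same_hmodule V V' \<Longrightarrow> same_hmodule V' V"
  unfolding same_hmodule_def by simp

lemma same_hmoduleD:
  assumes "same_hmodule V V'"
  shows "carrier V' = carrier V" "\<zero>\<^bsub>V'\<^esub> = \<zero>\<^bsub>V\<^esub>" "add V' = add V" "smult V' = smult V" "act V' = act V"
    "tensor_lift V' = tensor_lift V"
  using assms unfolding same_hmodule_def by (auto intro: tensor_lift_cong_group)

lemma module_cong:
  assumes "module K V" "carrier V' = carrier V" "\<zero>\<^bsub>V'\<^esub> = \<zero>\<^bsub>V\<^esub>" "add V' = add V" "smult V' = smult V"
  shows "module K V'"
proof -
  interpret V: module K V by fact
  have "abelian_group V'"
    using V.M.l_neg V.M.a_assoc V.M.a_comm assms(2-5)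
    by (intro abelian_groupI) (auto intro!: bexI[of _ "\<ominus>\<^bsub>V\<^esub> _"])
  then show ?thesis
    using assms(2-5) V.R.cring_axioms
    by (intro moduleI) (auto simp: V.smult_l_distr V.smult_r_distr V.smult_assoc1)
qed

lemma H_module_cong:
  assumes "H_module K H V" "same_hmodule V V'" shows "H_module K H V'"
proof -
  have "module K V'"
    using assms module_cong[of K V V'] same_hmoduleD[OF assms(2)] by (simp add: H_module_def)
  moreover have "H_module_axioms K H V'"
    using H_module.axioms(2)[OF assms(1)]
    unfolding H_module_axioms_def same_hmoduleD[OF assms(2)] .
  ultimately show ?thesis by (rule H_module.intro)
qed

lemma equivariant_module:
  assumes "equivariant K H X Y Z B"
  shows "H_module K H X" "H_module K H Y" "H_module K H Z"
  using assms unfolding equivariant_def by auto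

lemma equivariant_kbilinear: "equivariant K H X Y Z B \<Longrightarrow> kbilinear K X Y Z B"
  unfolding equivariant_def by auto

lemma equivariant_act:
  "\<lbrakk>equivariant K H X Y Z B; \<xi> \<in> carrier H; x \<in> carrier X; y \<in> carrier Y\<rbrakk> \<Longrightarrow>
   act Z \<xi> (B x y) = tensor_lift Z (\<lambda>p q. B (act X p x) (act Y q y)) (comult H \<xi>)"
  unfolding equivariant_def by blast

lemma kbilinear_cong:
  assumes "kbilinear K X Y Z B" "same_hmodule X X'" "same_hmodule Y Y'" "same_hmodule Z Z'"
    "\<And>x y. \<lbrakk>x \<in> carrier X; y \<in> carrier Y\<rbrakk> \<Longrightarrow> B' x y = B x y"
  shows "kbilinear K X' Y' Z' B'"
proof -
  note s = same_hmoduleD[OF assms(2)] same_hmoduleD[OF assms(3)] same_hmoduleD[OF assms(4)]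
  interpret X: module K X by (rule kbilinear_module[OF assms(1)])
  interpret Y: module K Y by (rule kbilinear_module[OF assms(1)])
  have "module K X'" "module K Y'" "module K Z'"
    using kbilinear_module[OF assms(1)] module_cong s by metis+
  then show ?thesis
    using kbilinear_closed[OF assms(1)] klinear_add[OF kbilinear_left[OF assms(1)]]
      klinear_add[OF kbilinear_right[OF assms(1)]] klinear_smult[OF kbilinear_left[OF assms(1)]]
      klinear_smult[OF kbilinear_right[OF assms(1)]]
    by (intro kbilinearI klinearI) (simp_all add: s assms(5))
qed

context hopf_algebra
begin

lemmas liftH_swap = lift_swap[OF _ _ module_axioms module_axioms module_axioms module_axioms]

lemma kbilinear_act: "H_module K H V \<Longrightarrow> kbilinear K H V V (act V)"
proof -
  assume V: "H_module K H V"
  interpret V: H_module K H V by fact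
  show ?thesis
    by (intro kbilinearI klinearI module_axioms V.module_axioms)
      (simp_all add: V.act_closed V.act_add_left V.act_smult_left V.act_add_right V.act_smult_right)
qed

lemmas act_rules = kbilinear_rules[OF kbilinear_act]

lemma equivariant_cong:
  assumes "equivariant K H X Y Z B" "same_hmodule X X'" "same_hmodule Y Y'" "same_hmodule Z Z'"
    "\<And>x y. \<lbrakk>x \<in> carrier X; y \<in> carrier Y\<rbrakk> \<Longrightarrow> B' x y = B x y"
  shows "equivariant K H X' Y' Z' B'"
proof -
  note s = same_hmoduleD[OF assms(2)] same_hmoduleD[OF assms(3)] same_hmoduleD[OF assms(4)]
  note m = equivariant_module[OF assms(1)]
  have "act Z' \<xi> (B' x y) = tensor_lift Z' (\<lambda>p q. B' (act X' p x) (act Y' q y)) (comult H \<xi>)"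
    if "\<xi> \<in> carrier H" "x \<in> carrier X" "y \<in> carrier Y" for \<xi> x y
    unfolding s assms(5)[OF that(2,3)] equivariant_act[OF assms(1) that]
    using that by (intro liftH_cong comult_closed)
      (simp_all add: assms(5) H_module.act_closed[OF m(1)] H_module.act_closed[OF m(2)])
  moreover have "kbilinear K X' Y' Z' B'"
    using kbilinear_cong[OF equivariant_kbilinear[OF assms(1)] assms(2-5)] .
  ultimately show ?thesis
    unfolding equivariant_def
    using H_module_cong[OF m(1) assms(2)] H_module_cong[OF m(2) assms(3)] H_module_cong[OF m(3) assms(4)] s
    by simp
qed

end

context twist_pair
begin

abbreviation "mult2 \<equiv> mult (ktensor K H H)"
abbreviation "mult3 \<equiv> mult (ktensor3 K H)"

lemma H_module_same_iff: "H_module K H' V \<longleftrightarrow> H_module K H V"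
  unfolding H_module_def H_module_axioms_def same ..

lemmas H_module_same = H_module_same_iff[THEN iffD2]

text \<open>Equal, by \<open>cocycle_G\<close>, to the element with the other bracketing,
  \<open>(id \<otimes> \<Delta>)(G) (1 \<otimes> G)\<close>.\<close>

definition "Phi = mult3 (left_comult K H (comult H) G) (kpure K (ktensor K H H) H G \<one>\<^bsub>H\<^esub>)"

lemma Phi_closed: "Phi \<in> carrier (ktensor3 K H)"
  unfolding Phi_def by (rule H.lin3 H.comult_klinear G_closed H.module_axioms)+

lemma comult'_closed: "\<xi> \<in> carrier H \<Longrightarrow> comult H' \<xi> \<in> carrier (ktensor K H H)"
  using H'.comult_closed[of \<xi>] by (simp add: same same_tensor)

lemma kbilinear_star_op:
  assumes "H_module K H X" "H_module K H Y" "kbilinear K X Y Z B"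
  shows "kbilinear K X Y Z (star_op G X Y Z B)"
  unfolding star_op_def
  by (assumption | rule kbilinear_rules[OF assms(3)] H.act_rules[OF assms(1)] H.act_rules[OF assms(2)] H.hopf_lin G_closed)+

text \<open>The algebra \<open>H \<otimes> H\<close> acts on pairs, so acting twice is acting by the
  product. This turns identities between tensors into identities between deformed
  operations.\<close>

lemma star_op_act_assoc:
  assumes X: "H_module K H X" and Y: "H_module K H Y" and B: "kbilinear K X Y Z B"
    and xy: "x \<in> carrier X" "y \<in> carrier Y"
    and s: "s \<in> carrier (ktensor K H H)" and t: "t \<in> carrier (ktensor K H H)"
  shows "tensor_lift Z (\<lambda>p q. B (act X p x) (act Y q y)) (mult2 s t) =
    tensor_lift Z (\<lambda>p q. tensor_lift Z (\<lambda>p' q'. B (act X p (act X p' x)) (act Y q (act Y q' y))) t) s"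
proof -
  note r = kbilinear_rules[OF B] H.act_rules[OF X] H.act_rules[OF Y] H.hopf_lin
  have "kbilinear K H H Z (\<lambda>p q. B (act X p x) (act Y q y))" by (assumption | rule r xy)+
  from H.HH.lift_mult[OF s t this] show ?thesis
    by (simp only:) (intro H.liftH_cong s t,
      simp add: H_module.act_assoc[OF X] H_module.act_assoc[OF Y] xy)
qed

text \<open>The outer deformation acts first on the arguments and the inner one on the result, so
  together they act by \<open>G F\<close>, which is the unit.\<close>

lemma star_star:
  assumes X: "H_module K H X" and Y: "H_module K H Y" and B: "kbilinear K X Y Z B"
    and xy: "x \<in> carrier X" "y \<in> carrier Y"
  shows "star_op F X Y Z (star_op G X Y Z B) x y = B x y"
proof -
  note r = kbilinear_rules[OF B] H.act_rules[OF X] H.act_rules[OF Y] H.hopf_lin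
  have b: "kbilinear K H H Z (\<lambda>p q. B (act X p x) (act Y q y))" by (assumption | rule r xy)+
  have "star_op F X Y Z (star_op G X Y Z B) x y =
      tensor_lift Z (\<lambda>p q. tensor_lift Z (\<lambda>p' q'. B (act X p' (act X p x)) (act Y q' (act Y q y))) G) F"
    unfolding star_op_def ..
  also have "\<dots> = tensor_lift Z (\<lambda>p' q'. tensor_lift Z (\<lambda>p q. B (act X p' (act X p x)) (act Y q' (act Y q y))) F) G"
    by (rule lift_swap) (assumption | rule r xy F_closed G_closed)+
  also have "\<dots> = B x y"
    unfolding star_op_act_assoc[OF X Y B xy G_closed F_closed, symmetric] GF ktensor_one
    using lift_kpure[OF b, of "\<one>\<^bsub>H\<^esub>" "\<one>\<^bsub>H\<^esub>"] xy
    by (simp add: H_module.act_unit[OF X] H_module.act_unit[OF Y])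
  finally show ?thesis .
qed

text \<open>Acting after deforming evaluates on \<open>\<Delta>(\<xi>) G\<close>, deforming after
  acting evaluates on \<open>G \<Delta>'(\<xi>)\<close>, with \<open>\<Delta>'\<close> the coproduct
  of \<open>H'\<close>; these agree by \<open>comult_twist'\<close>.\<close>

lemma star_equivariant:
  assumes B: "equivariant K H X Y Z B"
  shows "equivariant K H' X Y Z (star_op G X Y Z B)"
proof -
  note X = equivariant_module(1)[OF B] and Y = equivariant_module(2)[OF B] and Z = equivariant_module(3)[OF B]
  note Bk = equivariant_kbilinear[OF B]
  note r = kbilinear_rules[OF Bk] H.act_rules[OF X] H.act_rules[OF Y] H.act_rules[OF Z] H.hopf_lin
  have "act Z \<xi> (star_op G X Y Z B x y) = tensor_lift Z (\<lambda>p q. star_op G X Y Z B (act X p x) (act Y q y)) (comult H' \<xi>)"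
    if xi: "\<xi> \<in> carrier H" and xy: "x \<in> carrier X" "y \<in> carrier Y" for \<xi> x y
  proof -
    have "act Z \<xi> (star_op G X Y Z B x y) = tensor_lift Z (\<lambda>p q. act Z \<xi> (B (act X p x) (act Y q y))) G"
      unfolding star_op_def
      by (rule lift_hom) (assumption | rule r xi xy G_closed)+
    also have "\<dots> = tensor_lift Z (\<lambda>p q. tensor_lift Z (\<lambda>u v. B (act X u (act X p x)) (act Y v (act Y q y))) (comult H \<xi>)) G"
      by (intro H.liftH_cong G_closed equivariant_act[OF B xi] H.act_rules(3)[OF X] H.act_rules(3)[OF Y] xy)
    also have "\<dots> = tensor_lift Z (\<lambda>u v. tensor_lift Z (\<lambda>p q. B (act X u (act X p x)) (act Y v (act Y q y))) G) (comult H \<xi>)"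
      by (rule lift_swap) (assumption | rule r xi xy G_closed)+
    also have "\<dots> = tensor_lift Z (\<lambda>p q. B (act X p x) (act Y q y)) (mult2 (comult H \<xi>) G)"
      by (rule star_op_act_assoc[OF X Y Bk xy H.comult_closed[OF xi] G_closed, symmetric])
    also have "\<dots> = tensor_lift Z (\<lambda>p q. tensor_lift Z (\<lambda>u v. B (act X p (act X u x)) (act Y q (act Y v y))) (comult H' \<xi>)) G"
      unfolding comult_twist'[OF xi]
      by (rule star_op_act_assoc[OF X Y Bk xy G_closed comult'_closed[OF xi]])
    also have "\<dots> = tensor_lift Z (\<lambda>u v. tensor_lift Z (\<lambda>p q. B (act X p (act X u x)) (act Y q (act Y v y))) G) (comult H' \<xi>)"
      by (rule lift_swap) (assumption | rule r comult'_closed xi xy G_closed)+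
    finally show ?thesis unfolding star_op_def .
  qed
  then show ?thesis
    unfolding equivariant_def
    by (simp add: H_module_same X Y Z same kbilinear_star_op[OF X Y Bk])
qed

text \<open>
  Both ways of bracketing a deformed double product are the undeformed one evaluated on \<open>Phi\<close>;
  hence any identity between the two undeformed bracketings is inherited.
\<close>

lemma star_left:
  assumes B1: "equivariant K H X Y U B1" and B2: "kbilinear K U Z R B2" and Z: "H_module K H Z"
    and xyz: "x \<in> carrier X" "y \<in> carrier Y" "z \<in> carrier Z"
  shows "star_op G U Z R B2 (star_op G X Y U B1 x y) z =
    lift3 R (\<lambda>p q r. B2 (B1 (act X p x) (act Y q y)) (act Z r z)) Phi"
proof -
  note X = equivariant_module(1)[OF B1] and Y = equivariant_module(2)[OF B1] and U = equivariant_module(3)[OF B1]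
  note B1k = equivariant_kbilinear[OF B1]
  note r = kbilinear_rules[OF B1k] kbilinear_rules[OF B2] H.act_rules[OF X] H.act_rules[OF Y]
    H.act_rules[OF U] H.act_rules[OF Z] H.hopf_lin
  let ?b = "\<lambda>p q r. B2 (B1 (act X p x) (act Y q y)) (act Z r z)"
  have tri: "ktrilinear K H H H R (\<lambda>p' q' r'. ?b (p \<otimes>\<^bsub>H\<^esub> p') (q \<otimes>\<^bsub>H\<^esub> q') (r \<otimes>\<^bsub>H\<^esub> r'))"
    if "p \<in> carrier H" "q \<in> carrier H" "r \<in> carrier H" for p q r
    by (assumption | rule r xyz that)+
  have tri0: "ktrilinear K H H H R ?b"
    by (assumption | rule r xyz)+
  have g1: "kpure K (ktensor K H H) H G \<one>\<^bsub>H\<^esub> \<in> carrier (ktensor3 K H)"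
    "left_comult K H (comult H) G \<in> carrier (ktensor3 K H)"
    by (rule H.lin3 H.comult_klinear G_closed H.module_axioms)+
  have triG: "ktrilinear K H H H R (\<lambda>p q r. lift3 R (\<lambda>p' q' r'. ?b (p \<otimes>\<^bsub>H\<^esub> p') (q \<otimes>\<^bsub>H\<^esub> q') (r \<otimes>\<^bsub>H\<^esub> r'))
     (kpure K (ktensor K H H) H G \<one>\<^bsub>H\<^esub>))"
    unfolding lift3_def by (assumption | rule r xyz g1)+
  have "lift3 R ?b Phi = tensor_lift R (\<lambda>p q. tensor_lift R (\<lambda>u v.
      lift3 R (\<lambda>p' q' r'. ?b (u \<otimes>\<^bsub>H\<^esub> p') (v \<otimes>\<^bsub>H\<^esub> q') (q \<otimes>\<^bsub>H\<^esub> r'))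
     (kpure K (ktensor K H H) H G \<one>\<^bsub>H\<^esub>)) (comult H p)) G"
    unfolding Phi_def H.H3.lift3_mult[OF g1(2,1) tri0]
    by (rule H.lift3_left_comult[OF H.comult_klinear triG G_closed])
  also have "\<dots> = tensor_lift R (\<lambda>p q. tensor_lift R (\<lambda>u v. tensor_lift R (\<lambda>p' q'.
      ?b (u \<otimes>\<^bsub>H\<^esub> p') (v \<otimes>\<^bsub>H\<^esub> q') (q \<otimes>\<^bsub>H\<^esub> \<one>\<^bsub>H\<^esub>)) G) (comult H p)) G"
    by (intro H.liftH_cong G_closed H.comult_closed lift3_kpure tri H.one_closed)
  also have "\<dots> = tensor_lift R (\<lambda>p q. tensor_lift R (\<lambda>u v. tensor_lift R (\<lambda>p' q'.
      B2 (B1 (act X u (act X p' x)) (act Y v (act Y q' y))) (act Z q z)) G) (comult H p)) G"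
    by (intro H.liftH_cong G_closed H.comult_closed)
      (simp_all add: H_module.act_assoc[OF X] H_module.act_assoc[OF Y] xyz)
  also have "\<dots> = tensor_lift R (\<lambda>p q. tensor_lift R (\<lambda>p' q'. tensor_lift R (\<lambda>u v.
      B2 (B1 (act X u (act X p' x)) (act Y v (act Y q' y))) (act Z q z)) (comult H p)) G) G"
    by (intro H.liftH_cong G_closed H.comult_closed H.liftH_swap) (assumption | rule r xyz)+
  \<comment> \<open>Equivariance of \<open>B1\<close> reassembles the coproduct of \<open>p\<close>
    into the action of \<open>p\<close> on the inner product.\<close>
  also have "\<dots> = tensor_lift R (\<lambda>p q. tensor_lift R (\<lambda>p' q'.
      B2 (act U p (B1 (act X p' x) (act Y q' y))) (act Z q z)) G) G"
  proof (intro H.liftH_cong G_closed)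
    fix p q p' q' assume ps: "p \<in> carrier H" "q \<in> carrier H" "p' \<in> carrier H" "q' \<in> carrier H"
    have xy: "act X p' x \<in> carrier X" "act Y q' y \<in> carrier Y" by (rule r xyz ps)+
    show "tensor_lift R (\<lambda>u v. B2 (B1 (act X u (act X p' x)) (act Y v (act Y q' y))) (act Z q z)) (comult H p) =
      B2 (act U p (B1 (act X p' x) (act Y q' y))) (act Z q z)"
      unfolding equivariant_act[OF B1 ps(1) xy]
      by (rule lift_hom[where f="\<lambda>u. B2 u (act Z q z)", symmetric]) (assumption | rule r xyz ps)+
  qed
  also have "\<dots> = tensor_lift R (\<lambda>p q. B2 (act U p (star_op G X Y U B1 x y)) (act Z q z)) G"
    unfolding star_op_def
    by (intro H.liftH_cong G_closed lift_hom[where f="\<lambda>u. B2 (act U p u) (act Z q z)" for p q, symmetric])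
      (assumption | rule r xyz G_closed)+
  finally show ?thesis unfolding star_op_def by simp
qed

lemma star_right:
  assumes B3: "equivariant K H Y Z U B3" and B4: "kbilinear K X U R B4" and X: "H_module K H X"
    and xyz: "x \<in> carrier X" "y \<in> carrier Y" "z \<in> carrier Z"
  shows "star_op G X U R B4 x (star_op G Y Z U B3 y z) =
    lift3 R (\<lambda>p q r. B4 (act X p x) (B3 (act Y q y) (act Z r z))) Phi"
proof -
  note Y = equivariant_module(1)[OF B3] and Z = equivariant_module(2)[OF B3] and U = equivariant_module(3)[OF B3]
  note B3k = equivariant_kbilinear[OF B3]
  note r = kbilinear_rules[OF B3k] kbilinear_rules[OF B4] H.act_rules[OF X] H.act_rules[OF Y]
    H.act_rules[OF U] H.act_rules[OF Z] H.hopf_lin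
  let ?b = "\<lambda>p q r. B4 (act X p x) (B3 (act Y q y) (act Z r z))"
  have tri: "ktrilinear K H H H R (\<lambda>p' q' r'. ?b (p \<otimes>\<^bsub>H\<^esub> p') (q \<otimes>\<^bsub>H\<^esub> q') (r \<otimes>\<^bsub>H\<^esub> r'))"
    if "p \<in> carrier H" "q \<in> carrier H" "r \<in> carrier H" for p q r
    by (assumption | rule r xyz that)+
  have tri0: "ktrilinear K H H H R ?b"
    by (assumption | rule r xyz)+
  have g1: "tensor_left K H \<one>\<^bsub>H\<^esub> G \<in> carrier (ktensor3 K H)"
    "right_comult K H (comult H) G \<in> carrier (ktensor3 K H)"
    by (rule H.lin3 H.comult_klinear G_closed H.module_axioms)+
  have triG: "ktrilinear K H H H R (\<lambda>p q r. lift3 R (\<lambda>p' q' r'. ?b (p \<otimes>\<^bsub>H\<^esub> p') (q \<otimes>\<^bsub>H\<^esub> q') (r \<otimes>\<^bsub>H\<^esub> r'))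
     (tensor_left K H \<one>\<^bsub>H\<^esub> G))"
    unfolding lift3_def by (assumption | rule r xyz g1)+
  have "lift3 R ?b Phi = tensor_lift R (\<lambda>p q. tensor_lift R (\<lambda>u v.
      lift3 R (\<lambda>p' q' r'. ?b (p \<otimes>\<^bsub>H\<^esub> p') (u \<otimes>\<^bsub>H\<^esub> q') (v \<otimes>\<^bsub>H\<^esub> r')) (tensor_left K H \<one>\<^bsub>H\<^esub> G)) (comult H q)) G"
    unfolding Phi_def cocycle_G H.H3.lift3_mult[OF g1(2,1) tri0]
    by (rule H.lift3_right_comult[OF H.comult_klinear triG G_closed])
  also have "\<dots> = tensor_lift R (\<lambda>p q. tensor_lift R (\<lambda>u v. tensor_lift R (\<lambda>p' q'.
      ?b (p \<otimes>\<^bsub>H\<^esub> \<one>\<^bsub>H\<^esub>) (u \<otimes>\<^bsub>H\<^esub> p') (v \<otimes>\<^bsub>H\<^esub> q')) G) (comult H q)) G"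
    by (intro H.liftH_cong G_closed H.comult_closed H.lift3_tensor_left tri H.one_closed)
  also have "\<dots> = tensor_lift R (\<lambda>p q. tensor_lift R (\<lambda>u v. tensor_lift R (\<lambda>p' q'.
      B4 (act X p x) (B3 (act Y u (act Y p' y)) (act Z v (act Z q' z)))) G) (comult H q)) G"
    by (intro H.liftH_cong G_closed H.comult_closed)
      (simp_all add: H_module.act_assoc[OF Y] H_module.act_assoc[OF Z] xyz)
  also have "\<dots> = tensor_lift R (\<lambda>p q. tensor_lift R (\<lambda>p' q'. tensor_lift R (\<lambda>u v.
      B4 (act X p x) (B3 (act Y u (act Y p' y)) (act Z v (act Z q' z)))) (comult H q)) G) G"
    by (intro H.liftH_cong G_closed H.comult_closed H.liftH_swap) (assumption | rule r xyz)+
  also have "\<dots> = tensor_lift R (\<lambda>p q. tensor_lift R (\<lambda>p' q'.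
      B4 (act X p x) (act U q (B3 (act Y p' y) (act Z q' z)))) G) G"
  proof (intro H.liftH_cong G_closed)
    fix p q p' q' assume ps: "p \<in> carrier H" "q \<in> carrier H" "p' \<in> carrier H" "q' \<in> carrier H"
    have yz: "act Y p' y \<in> carrier Y" "act Z q' z \<in> carrier Z" by (rule r xyz ps)+
    show "tensor_lift R (\<lambda>u v. B4 (act X p x) (B3 (act Y u (act Y p' y)) (act Z v (act Z q' z)))) (comult H q) =
      B4 (act X p x) (act U q (B3 (act Y p' y) (act Z q' z)))"
      unfolding equivariant_act[OF B3 ps(2) yz]
      by (rule lift_hom[where f="\<lambda>u. B4 (act X p x) u", symmetric]) (assumption | rule r xyz ps)+
  qed
  also have "\<dots> = tensor_lift R (\<lambda>p q. B4 (act X p x) (act U q (star_op G Y Z U B3 y z))) G"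
    unfolding star_op_def
    by (intro H.liftH_cong G_closed lift_hom[where f="\<lambda>u. B4 (act X p x) (act U q u)" for p q, symmetric])
      (assumption | rule r xyz G_closed)+
  finally show ?thesis unfolding star_op_def by simp
qed

lemma lift3_Phi_cong:
  assumes "\<And>p q r. \<lbrakk>p \<in> carrier H; q \<in> carrier H; r \<in> carrier H\<rbrakk> \<Longrightarrow> b p q r = b' p q r"
  shows "lift3 R b Phi = lift3 R b' Phi"
  unfolding lift3_def using Phi_closed assms
  by (intro lift_cong[OF H.HH.modules(3) H.module_axioms] H.liftH_cong)

text \<open>Stated for four independent maps and two intermediate modules, because it is applied to
  products, to the actions of the algebra, to evaluation of linear maps and to pure tensors
  alike.\<close>

lemma star_assoc:
  assumes "equivariant K H X Y U B1" "kbilinear K U Z R B2" "equivariant K H Y Z U' B3" "kbilinear K X U' R B4"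
    and eq: "\<And>x y z. \<lbrakk>x \<in> carrier X; y \<in> carrier Y; z \<in> carrier Z\<rbrakk> \<Longrightarrow> B2 (B1 x y) z = B4 x (B3 y z)"
    and xyz: "x \<in> carrier X" "y \<in> carrier Y" "z \<in> carrier Z"
  shows "star_op G U Z R B2 (star_op G X Y U B1 x y) z = star_op G X U' R B4 x (star_op G Y Z U' B3 y z)"
proof -
  note m = equivariant_module[OF assms(1)] equivariant_module[OF assms(3)]
  show ?thesis
    unfolding star_left[OF assms(1,2) m(5) xyz] star_right[OF assms(3,4) m(1) xyz]
    by (intro lift3_Phi_cong eq H_module.act_closed[OF m(1)] H_module.act_closed[OF m(2)]
        H_module.act_closed[OF m(5)] xyz)
qed

text \<open>On an element that \<open>H\<close> multiplies by the counit, the left leg of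
  \<open>G\<close> contributes only its counit, and the normalisation of \<open>G\<close> leaves the
  identity on the other argument. Besides algebra units this covers the unit of the ground ring with
  the counit action.\<close>

lemma star_unit_left:
  assumes X: "H_module K H X" and Y: "H_module K H Y" and B: "kbilinear K X Y Z B"
    and u: "u \<in> carrier X" "\<And>p. p \<in> carrier H \<Longrightarrow> act X p u = counit H p \<odot>\<^bsub>X\<^esub> u" and y: "y \<in> carrier Y"
  shows "star_op G X Y Z B u y = B u y"
proof -
  note r = kbilinear_rules[OF B] H.act_rules[OF X] H.act_rules[OF Y] H.hopf_lin
  have "star_op G X Y Z B u y = tensor_lift Z (\<lambda>p q. counit H p \<odot>\<^bsub>Z\<^esub> B u (act Y q y)) G"
    unfolding star_op_def
    by (intro H.liftH_cong G_closed)
      (simp add: u klinear_smult[OF kbilinear_left[OF B]] H.counit_closed H_module.act_closed[OF Y] y)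
  also have "\<dots> = B u (act Y (tensor_lift H (\<lambda>x y. counit H x \<odot>\<^bsub>H\<^esub> y) G) y)"
    by (rule H.lift_counit_hom(1)) (assumption | rule r u y G_closed)+
  finally show ?thesis by (simp add: counit_G H_module.act_unit[OF Y] y)
qed

lemma star_unit_right:
  assumes X: "H_module K H X" and Y: "H_module K H Y" and B: "kbilinear K X Y Z B"
    and u: "u \<in> carrier Y" "\<And>p. p \<in> carrier H \<Longrightarrow> act Y p u = counit H p \<odot>\<^bsub>Y\<^esub> u" and x: "x \<in> carrier X"
  shows "star_op G X Y Z B x u = B x u"
proof -
  note r = kbilinear_rules[OF B] H.act_rules[OF X] H.act_rules[OF Y] H.hopf_lin
  have "star_op G X Y Z B x u = tensor_lift Z (\<lambda>p q. counit H q \<odot>\<^bsub>Z\<^esub> B (act X p x) u) G"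
    unfolding star_op_def
    by (intro H.liftH_cong G_closed)
      (simp add: u klinear_smult[OF kbilinear_right[OF B]] H.counit_closed H_module.act_closed[OF X] x)
  also have "\<dots> = B (act X (tensor_lift H (\<lambda>x y. counit H y \<odot>\<^bsub>H\<^esub> x) G) x) u"
    by (rule H.lift_counit_hom(2)) (assumption | rule r u x G_closed)+
  finally show ?thesis by (simp add: counit_G H_module.act_unit[OF X] x)
qed

end


section \<open>Deformed bimodules\<close>

definition star_related_algebra ::
    "('h, 'h) tensor \<Rightarrow> ('k, 'a, 'h, 'l) hmodule_scheme \<Rightarrow> ('k, 'a, 'h, 'm) hmodule_scheme \<Rightarrow> bool" where
  "star_related_algebra G A A' \<longleftrightarrow> same_hmodule A A' \<and> \<one>\<^bsub>A'\<^esub> = \<one>\<^bsub>A\<^esub> \<and>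
     (\<forall>a\<in>carrier A. \<forall>b\<in>carrier A. a \<otimes>\<^bsub>A'\<^esub> b = star_op G A A A (mult A) a b)"

text \<open>Only values on the carriers are prescribed. A record deformed and deformed back agrees
  with the original there but may differ elsewhere; a relation makes the two directions
  symmetric.\<close>

definition star_related ::
    "('h, 'h) tensor \<Rightarrow> ('k, 'a, 'h, 'l) hmodule_scheme \<Rightarrow> ('k, 'v, 'h, 'a, 'm) hbimodule_scheme \<Rightarrow>
     ('k, 'v, 'h, 'a, 'n) hbimodule_scheme \<Rightarrow> bool" where
  "star_related G A V V' \<longleftrightarrow> same_hmodule V V' \<and>
     (\<forall>a\<in>carrier A. \<forall>v\<in>carrier V. lact V' a v = star_op G A V V (lact V) a v) \<and>
     (\<forall>a\<in>carrier A. \<forall>v\<in>carrier V. ract V' v a = star_op G V A V (ract V) v a)"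

lemma same_hmodule_refl: "same_hmodule V V"
  unfolding same_hmodule_def by simp

lemma star_relatedD:
  assumes "star_related G A V V'"
  shows "same_hmodule V V'"
    "\<lbrakk>a \<in> carrier A; v \<in> carrier V\<rbrakk> \<Longrightarrow> lact V' a v = star_op G A V V (lact V) a v"
    "\<lbrakk>a \<in> carrier A; v \<in> carrier V\<rbrakk> \<Longrightarrow> ract V' v a = star_op G V A V (ract V) v a"
  using assms unfolding star_related_def by auto

lemma star_related_algebraD:
  assumes "star_related_algebra G A A'"
  shows "same_hmodule A A'" "\<one>\<^bsub>A'\<^esub> = \<one>\<^bsub>A\<^esub>"
    "\<lbrakk>a \<in> carrier A; b \<in> carrier A\<rbrakk> \<Longrightarrow> a \<otimes>\<^bsub>A'\<^esub> b = star_op G A A A (mult A) a b"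
  using assms unfolding star_related_algebra_def by auto

lemma star_related_star_algebra: "star_related_algebra (twist_inv K H F) A (star_algebra K H F A)"
  unfolding star_related_algebra_def same_hmodule_def star_algebra_def star_op_def by simp

lemma star_related_star_bimodule: "star_related (twist_inv K H F) A V (star_bimodule K H F A V)"
  unfolding star_related_def same_hmodule_def star_bimodule_def star_op_def by simp

context hopf_algebra
begin

lemma module_algebra_equivariant: "H_module_algebra K H A \<Longrightarrow> equivariant K H A A A (mult A)"
proof -
  assume "H_module_algebra K H A"
  then interpret A: H_module_algebra K H A .
  have "kbilinear K A A A (mult A)"
    by (intro kbilinearI A.module_axioms klinear_mult_left klinear_mult_right A.K_algebra_axioms klinear_id)
  then show ?thesis
    unfolding equivariant_def using A.H_module_axioms A.act_mult by simp
qed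

lemma H_module_algebraI:
  assumes eq: "equivariant K H A A A (mult A)" and one: "\<one>\<^bsub>A\<^esub> \<in> carrier A"
    and assoc: "\<And>a b c. \<lbrakk>a \<in> carrier A; b \<in> carrier A; c \<in> carrier A\<rbrakk> \<Longrightarrow>
      (a \<otimes>\<^bsub>A\<^esub> b) \<otimes>\<^bsub>A\<^esub> c = a \<otimes>\<^bsub>A\<^esub> (b \<otimes>\<^bsub>A\<^esub> c)"
    and unit: "\<And>a. a \<in> carrier A \<Longrightarrow> \<one>\<^bsub>A\<^esub> \<otimes>\<^bsub>A\<^esub> a = a" "\<And>a. a \<in> carrier A \<Longrightarrow> a \<otimes>\<^bsub>A\<^esub> \<one>\<^bsub>A\<^esub> = a"
    and act_one: "\<And>\<xi>. \<xi> \<in> carrier H \<Longrightarrow> act A \<xi> \<one>\<^bsub>A\<^esub> = counit H \<xi> \<odot>\<^bsub>A\<^esub> \<one>\<^bsub>A\<^esub>"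
  shows "H_module_algebra K H A"
proof -
  interpret A: H_module K H A using equivariant_module[OF eq] by simp
  note b = equivariant_kbilinear[OF eq]
  note l = klinearD[OF kbilinear_left[OF b]] klinearD[OF kbilinear_right[OF b]]
  have "ring A"
    by (intro ringI A.M.abelian_group_axioms monoidI assoc unit one) (simp_all add: l)
  then have "K_algebra K A"
    unfolding K_algebra_def K_algebra_axioms_def using A.module_axioms l by simp
  then show ?thesis
    unfolding H_module_algebra_def H_module_algebra_axioms_def
    using A.H_module_axioms equivariant_act[OF eq] act_one by simp
qed

text \<open>Translates the bimodule axioms into equivariant bilinear maps, the language in which
  deformation is carried out; \<open>H_bimoduleI\<close> translates back.\<close>

lemma H_bimodule_equivariant:
  assumes A: "H_module_algebra K H A" and V: "H_bimodule K H A V"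
  shows "equivariant K H A V V (lact V)" "equivariant K H V A V (ract V)"
proof -
  interpret A: H_module_algebra K H A by fact
  interpret V: H_bimodule K H A V by fact
  have "kbilinear K A V V (lact V)"
    by (intro kbilinearI klinearI A.module_axioms V.module_axioms)
      (simp_all add: V.lact_closed V.lact_add_left V.lact_add_right V.lact_smult_left V.lact_smult_right)
  then show "equivariant K H A V V (lact V)"
    unfolding equivariant_def using A.H_module_axioms V.H_module_axioms V.act_lact by simp
  have "kbilinear K V A V (ract V)"
    by (intro kbilinearI klinearI A.module_axioms V.module_axioms)
      (simp_all add: V.ract_closed V.ract_add_left V.ract_add_right V.ract_smult_left V.ract_smult_right)
  then show "equivariant K H V A V (ract V)"
    unfolding equivariant_def using A.H_module_axioms V.H_module_axioms V.act_ract by simp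
qed

lemma H_bimoduleI:
  assumes l: "equivariant K H A V V (lact V)" and r: "equivariant K H V A V (ract V)"
    and lact_assoc: "\<And>a b v. \<lbrakk>a \<in> carrier A; b \<in> carrier A; v \<in> carrier V\<rbrakk> \<Longrightarrow>
      lact V (a \<otimes>\<^bsub>A\<^esub> b) v = lact V a (lact V b v)"
    and lact_unit: "\<And>v. v \<in> carrier V \<Longrightarrow> lact V \<one>\<^bsub>A\<^esub> v = v"
    and ract_assoc: "\<And>a b v. \<lbrakk>a \<in> carrier A; b \<in> carrier A; v \<in> carrier V\<rbrakk> \<Longrightarrow>
      ract V v (a \<otimes>\<^bsub>A\<^esub> b) = ract V (ract V v a) b"
    and ract_unit: "\<And>v. v \<in> carrier V \<Longrightarrow> ract V v \<one>\<^bsub>A\<^esub> = v"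
    and lact_ract: "\<And>a b v. \<lbrakk>a \<in> carrier A; b \<in> carrier A; v \<in> carrier V\<rbrakk> \<Longrightarrow>
      ract V (lact V a v) b = lact V a (ract V v b)"
  shows "H_bimodule K H A V"
proof -
  have V: "H_module K H V" using equivariant_module[OF l] by simp
  note bl = equivariant_kbilinear[OF l] and br = equivariant_kbilinear[OF r]
  note D = klinearD[OF kbilinear_left[OF bl]] klinearD[OF kbilinear_right[OF bl]]
    klinearD[OF kbilinear_left[OF br]] klinearD[OF kbilinear_right[OF br]]
  show ?thesis
    unfolding H_bimodule_def H_bimodule_axioms_def
    using V equivariant_act[OF l] equivariant_act[OF r]
    by (simp add: D assms(3-))
qed

end

section \<open>Deforming module algebras and bimodules, and deforming them back\<close>

context twist_pair
begin

text \<open>Supplies a hypothesis needed for reading later results with the swapped pair; it holds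
  because the two deformations cancel by \<open>star_star\<close>.\<close>

lemma star_related_algebra_sym:
  assumes A: "H_module_algebra K H A" and rel: "star_related_algebra G A A'"
  shows "star_related_algebra F A' A"
proof -
  note s = same_hmoduleD[OF star_related_algebraD(1)[OF rel]]
  note eq = H.module_algebra_equivariant[OF A]
  note m = equivariant_module(1)[OF eq]
  have "star_op F A' A' A' (mult A') a b = a \<otimes>\<^bsub>A\<^esub> b" if "a \<in> carrier A" "b \<in> carrier A" for a b
  proof -
    have "star_op F A' A' A' (mult A') a b = star_op F A A A (star_op G A A A (mult A)) a b"
      unfolding star_op_def[of F] s
      by (intro H.liftH_cong F_closed star_related_algebraD(3)[OF rel] H_module.act_closed[OF m] that)
    then show ?thesis
      using star_star[OF m m equivariant_kbilinear[OF eq] that] by simp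
  qed
  then show ?thesis
    unfolding star_related_algebra_def
    using same_hmodule_sym[OF star_related_algebraD(1)[OF rel]] star_related_algebraD(2)[OF rel] s by simp
qed

lemma star_module_algebra:
  assumes A: "H_module_algebra K H A" and rel: "star_related_algebra G A A'"
  shows "H_module_algebra K H' A'"
proof -
  interpret A: H_module_algebra K H A by fact
  note s = same_hmoduleD[OF star_related_algebraD(1)[OF rel]] star_related_algebraD(2)[OF rel]
  note eq = H.module_algebra_equivariant[OF A]
  note b = equivariant_kbilinear[OF eq]
  note m = equivariant_module(1)[OF eq]
  note st = star_related_algebraD(3)[OF rel]
  note bs = kbilinear_star_op[OF m m b]
  note cl = kbilinear_closed[OF bs]
  show ?thesis
  proof (rule H'.H_module_algebraI)
    show "equivariant K H' A' A' A' (mult A')"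
      by (rule H'.equivariant_cong[OF star_equivariant[OF eq]])
        (auto intro: star_related_algebraD[OF rel])
    fix a b c assume "a \<in> carrier A'" "b \<in> carrier A'" "c \<in> carrier A'"
    then have abc: "a \<in> carrier A" "b \<in> carrier A" "c \<in> carrier A" by (simp_all add: s)
    show "(a \<otimes>\<^bsub>A'\<^esub> b) \<otimes>\<^bsub>A'\<^esub> c = a \<otimes>\<^bsub>A'\<^esub> (b \<otimes>\<^bsub>A'\<^esub> c)"
      using star_assoc[OF eq equivariant_kbilinear[OF eq] eq equivariant_kbilinear[OF eq] A.m_assoc abc] abc
      by (simp add: st cl)
  next
    fix a assume "a \<in> carrier A'"
    then have a: "a \<in> carrier A" by (simp add: s)
    show "\<one>\<^bsub>A'\<^esub> \<otimes>\<^bsub>A'\<^esub> a = a"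
      using star_unit_left[OF m m b A.one_closed A.act_one a] a by (simp add: st s)
    show "a \<otimes>\<^bsub>A'\<^esub> \<one>\<^bsub>A'\<^esub> = a"
      using star_unit_right[OF m m b A.one_closed A.act_one a] a by (simp add: st s)
  next
    fix \<xi> assume "\<xi> \<in> carrier H'"
    then show "act A' \<xi> \<one>\<^bsub>A'\<^esub> = counit H' \<xi> \<odot>\<^bsub>A'\<^esub> \<one>\<^bsub>A'\<^esub>"
      using A.act_one by (simp add: s same)
  qed (simp add: s)
qed

lemma star_related_sym:
  assumes A: "H_module_algebra K H A" and relA: "star_related_algebra G A A'"
    and V: "H_bimodule K H A V" and rel: "star_related G A V V'"
  shows "star_related F A' V' V"
proof -
  note s = same_hmoduleD[OF star_related_algebraD(1)[OF relA]] same_hmoduleD[OF star_relatedD(1)[OF rel]]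
  note eq = H.H_bimodule_equivariant[OF A V]
  note b = equivariant_kbilinear[OF eq(1)] equivariant_kbilinear[OF eq(2)]
  note mA = equivariant_module(1)[OF eq(1)] and mV = equivariant_module(2)[OF eq(1)]
  have "star_op F A' V' V' (lact V') a v = lact V a v" if "a \<in> carrier A" "v \<in> carrier V" for a v
  proof -
    have "star_op F A' V' V' (lact V') a v = star_op F A V V (star_op G A V V (lact V)) a v"
      unfolding star_op_def[of F] s
      by (intro H.liftH_cong F_closed star_relatedD(2)[OF rel] H_module.act_closed[OF mA]
          H_module.act_closed[OF mV] that)
    then show ?thesis
      using star_star[OF mA mV b(1) that] by simp
  qed
  moreover have "star_op F V' A' V' (ract V') v a = ract V v a" if "a \<in> carrier A" "v \<in> carrier V" for a v
  proof -
    have "star_op F V' A' V' (ract V') v a = star_op F V A V (star_op G V A V (ract V)) v a"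
      unfolding star_op_def[of F] s
      by (intro H.liftH_cong F_closed star_relatedD(3)[OF rel] H_module.act_closed[OF mA]
          H_module.act_closed[OF mV] that)
    then show ?thesis
      using star_star[OF mV mA b(2) that(2,1)] by simp
  qed
  ultimately show ?thesis
    unfolding star_related_def
    using same_hmodule_sym[OF star_relatedD(1)[OF rel]] s by simp
qed

lemma star_H_bimodule:
  assumes A: "H_module_algebra K H A" and relA: "star_related_algebra G A A'"
    and V: "H_bimodule K H A V" and rel: "star_related G A V V'"
  shows "H_bimodule K H' A' V'"
proof -
  interpret A: H_module_algebra K H A by fact
  interpret V: H_bimodule K H A V by fact
  note s = same_hmoduleD[OF star_related_algebraD(1)[OF relA]] same_hmoduleD[OF star_relatedD(1)[OF rel]]
    star_related_algebraD(2)[OF relA]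
  note eq = H.H_bimodule_equivariant[OF A V]
  note b = equivariant_kbilinear[OF eq(1)] equivariant_kbilinear[OF eq(2)]
  note mA = equivariant_module(1)[OF eq(1)] and mV = equivariant_module(2)[OF eq(1)]
  note eqA = H.module_algebra_equivariant[OF A]
  note bA = equivariant_kbilinear[OF eqA]
  note st = star_related_algebraD(3)[OF relA] star_relatedD(2,3)[OF rel]
  note cl = kbilinear_closed[OF kbilinear_star_op[OF mA mA bA]] kbilinear_closed[OF kbilinear_star_op[OF mA mV b(1)]]
    kbilinear_closed[OF kbilinear_star_op[OF mV mA b(2)]]
  show ?thesis
  proof (rule H'.H_bimoduleI)
    show "equivariant K H' A' V' V' (lact V')"
      by (rule H'.equivariant_cong[OF star_equivariant[OF eq(1)]])
        (auto intro: star_related_algebraD[OF relA] star_relatedD[OF rel])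
    show "equivariant K H' V' A' V' (ract V')"
      by (rule H'.equivariant_cong[OF star_equivariant[OF eq(2)]])
        (auto intro: star_related_algebraD[OF relA] star_relatedD[OF rel])
    fix a c v assume "a \<in> carrier A'" "c \<in> carrier A'" "v \<in> carrier V'"
    then have acv: "a \<in> carrier A" "c \<in> carrier A" "v \<in> carrier V" by (simp_all add: s)
    show "lact V' (a \<otimes>\<^bsub>A'\<^esub> c) v = lact V' a (lact V' c v)"
      using star_assoc[OF eqA b(1) eq(1) b(1) V.lact_assoc acv] acv by (simp add: st cl)
    show "ract V' v (a \<otimes>\<^bsub>A'\<^esub> c) = ract V' (ract V' v a) c"
      using star_assoc[OF eq(2) b(2) eqA b(2) V.ract_assoc[symmetric] acv(3,1,2)] acv by (simp add: st cl)
    show "ract V' (lact V' a v) c = lact V' a (ract V' v c)"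
      using star_assoc[OF eq(1) b(2) eq(2) b(1) V.lact_ract acv(1,3,2)] acv by (simp add: st cl)
  next
    fix v assume "v \<in> carrier V'"
    then have v: "v \<in> carrier V" by (simp add: s)
    show "lact V' \<one>\<^bsub>A'\<^esub> v = v"
      using star_unit_left[OF mA mV b(1) A.one_closed A.act_one v] v by (simp add: st s V.lact_unit)
    show "ract V' v \<one>\<^bsub>A'\<^esub> = v"
      using star_unit_right[OF mV mA b(2) A.one_closed A.act_one v] v by (simp add: st s V.ract_unit)
  qed
qed

end


section \<open>The bimodule of linear maps\<close>

lemma hom_K_sel:
  "carrier (hom_K K H V W) = {P \<in> carrier V \<rightarrow>\<^sub>E carrier W. linear_map K V W P}"
  "\<zero>\<^bsub>hom_K K H V W\<^esub> = (\<lambda>v\<in>carrier V. \<zero>\<^bsub>W\<^esub>)"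
  "P \<oplus>\<^bsub>hom_K K H V W\<^esub> Q = (\<lambda>v\<in>carrier V. P v \<oplus>\<^bsub>W\<^esub> Q v)"
  "k \<odot>\<^bsub>hom_K K H V W\<^esub> P = (\<lambda>v\<in>carrier V. k \<odot>\<^bsub>W\<^esub> P v)"
  "act (hom_K K H V W) \<xi> P = (\<lambda>v\<in>carrier V.
     tensor_lift W (\<lambda>x y. act W x (P (act V (antipode H y) v))) (comult H \<xi>))"
  "lact (hom_K K H V W) a P = (\<lambda>v\<in>carrier V. lact W a (P v))"
  "ract (hom_K K H V W) P a = (\<lambda>v\<in>carrier V. P (lact V a v))"
  by (simp_all add: hom_K_def)

lemma hom_K_klinear:
  "\<lbrakk>P \<in> carrier (hom_K K H V W); module K V; module K W\<rbrakk> \<Longrightarrow> klinear K V W P"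
  by (simp add: hom_K_sel klinear_def)

lemma restrict_hom_K:
  "klinear K V W f \<Longrightarrow> (\<lambda>v\<in>carrier V. f v) \<in> carrier (hom_K K H V W)"
proof -
  assume f: "klinear K V W f"
  interpret V: module K V using klinear_module[OF f] by simp
  show ?thesis
    using klinearD[OF f] by (auto simp: hom_K_sel linear_map_def)
qed

lemma hom_K_eqI:
  assumes "P \<in> carrier (hom_K K H V W)" "Q \<in> carrier (hom_K K H V W)"
    "\<And>v. v \<in> carrier V \<Longrightarrow> P v = Q v"
  shows "P = Q"
  using assms by (intro PiE_ext[of P "carrier V" "\<lambda>_. carrier W"]) (auto simp: hom_K_sel)

lemma hom_K_module:
  assumes V: "module K V" and W: "module K W"
  shows "module K (hom_K K H V W)"
proof -
  let ?X = "hom_K K H V W"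
  interpret V: module K V by (rule V)
  interpret W: module K W by (rule W)
  note lin = hom_K_klinear[OF _ V W, where H=H]
  have cl: "P v \<in> carrier W" if "P \<in> carrier ?X" "v \<in> carrier V" for P v
    using klinear_closed[OF lin] that .
  have add: "P \<oplus>\<^bsub>?X\<^esub> Q \<in> carrier ?X" if "P \<in> carrier ?X" "Q \<in> carrier ?X" for P Q
    unfolding hom_K_sel(3) by (intro restrict_hom_K klinear_add_fun lin that)
  have smult: "k \<odot>\<^bsub>?X\<^esub> P \<in> carrier ?X" if "k \<in> carrier K" "P \<in> carrier ?X" for k P
    unfolding hom_K_sel(4) by (intro restrict_hom_K klinear_smult_fun lin that)
  have zero: "\<zero>\<^bsub>?X\<^esub> \<in> carrier ?X"
    unfolding hom_K_sel(2) by (intro restrict_hom_K klinear_zero_fun V W)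
  \<comment> \<open>The additive inverse is taken to be the multiple by minus one, whose linearity
    is already known.\<close>
  have neg: "\<exists>Q\<in>carrier ?X. Q \<oplus>\<^bsub>?X\<^esub> P = \<zero>\<^bsub>?X\<^esub>" if P: "P \<in> carrier ?X" for P
  proof (rule bexI[of _ "(\<ominus>\<^bsub>K\<^esub> \<one>\<^bsub>K\<^esub>) \<odot>\<^bsub>?X\<^esub> P"])
    show "(\<ominus>\<^bsub>K\<^esub> \<one>\<^bsub>K\<^esub>) \<odot>\<^bsub>?X\<^esub> P \<oplus>\<^bsub>?X\<^esub> P = \<zero>\<^bsub>?X\<^esub>"
      using cl[OF P] by (auto simp: hom_K_sel(2-4) W.smult_l_minus W.M.l_neg)
  qed (intro smult P V.R.a_inv_closed V.R.one_closed)
  note ext = hom_K_eqI[where K=K and H=H and V=V and W=W]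
  show ?thesis
  proof (rule moduleI)
    show "abelian_group ?X"
    proof (rule abelian_groupI)
      show "P \<oplus>\<^bsub>?X\<^esub> Q \<oplus>\<^bsub>?X\<^esub> R = P \<oplus>\<^bsub>?X\<^esub> (Q \<oplus>\<^bsub>?X\<^esub> R)"
        if "P \<in> carrier ?X" "Q \<in> carrier ?X" "R \<in> carrier ?X" for P Q R
        by (rule ext; (intro add that)?) (simp add: hom_K_sel(3) W.M.a_assoc cl that)
      show "P \<oplus>\<^bsub>?X\<^esub> Q = Q \<oplus>\<^bsub>?X\<^esub> P" if "P \<in> carrier ?X" "Q \<in> carrier ?X" for P Q
        by (rule ext; (intro add that)?) (simp add: hom_K_sel(3) W.M.a_comm cl that)
      show "\<zero>\<^bsub>?X\<^esub> \<oplus>\<^bsub>?X\<^esub> P = P" if "P \<in> carrier ?X" for P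
        by (rule ext; (intro add zero that)?) (simp add: hom_K_sel(2,3) cl that)
    qed (intro add zero neg; assumption)+
    show "(k \<oplus>\<^bsub>K\<^esub> l) \<odot>\<^bsub>?X\<^esub> P = k \<odot>\<^bsub>?X\<^esub> P \<oplus>\<^bsub>?X\<^esub> l \<odot>\<^bsub>?X\<^esub> P"
      if "k \<in> carrier K" "l \<in> carrier K" "P \<in> carrier ?X" for k l P
      by (rule ext; (intro add smult V.R.a_closed that)?) (simp add: hom_K_sel(3,4) W.smult_l_distr cl that)
    show "k \<odot>\<^bsub>?X\<^esub> (P \<oplus>\<^bsub>?X\<^esub> Q) = k \<odot>\<^bsub>?X\<^esub> P \<oplus>\<^bsub>?X\<^esub> k \<odot>\<^bsub>?X\<^esub> Q"
      if "k \<in> carrier K" "P \<in> carrier ?X" "Q \<in> carrier ?X" for k P Q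
      by (rule ext; (intro add smult that)?) (simp add: hom_K_sel(3,4) W.smult_r_distr cl that)
    show "(k \<otimes>\<^bsub>K\<^esub> l) \<odot>\<^bsub>?X\<^esub> P = k \<odot>\<^bsub>?X\<^esub> (l \<odot>\<^bsub>?X\<^esub> P)"
      if "k \<in> carrier K" "l \<in> carrier K" "P \<in> carrier ?X" for k l P
      by (rule ext; (intro smult V.R.m_closed that)?) (simp add: hom_K_sel(3,4) W.smult_assoc1 cl that)
    show "\<one>\<^bsub>K\<^esub> \<odot>\<^bsub>?X\<^esub> P = P" if "P \<in> carrier ?X" for P
      by (rule ext; (intro smult V.R.one_closed that)?) (simp add: hom_K_sel(3,4) cl that)
  qed (intro smult V.R.cring_axioms; assumption)+
qed

text \<open>Currying; the restriction makes the resulting maps extensional, as members of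
  \<open>hom_K\<close> have to be.\<close>

lemma kbilinear_hom_K:
  fixes X :: "('k, 'x, 'm) module_scheme"
  assumes V: "module K V" and W: "module K W" and b: "kbilinear K X V W b"
  shows "klinear K X (hom_K K H V W) (\<lambda>x. \<lambda>v\<in>carrier V. b x v)"
proof (rule klinearI[OF kbilinear_module(1)[OF b] hom_K_module[OF V W]])
  interpret X: module K X by (rule kbilinear_module[OF b])
  show cl: "(\<lambda>v\<in>carrier V. b x v) \<in> carrier (hom_K K H V W)" if "x \<in> carrier X" for x
    by (rule restrict_hom_K[OF kbilinear_right[OF b that]])
qed (auto simp: hom_K_sel klinear_add[OF kbilinear_left[OF b]] klinear_smult[OF kbilinear_left[OF b]])

lemma kbilinear_evaluation:
  assumes V: "module K V" and W: "module K W"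
  shows "kbilinear K (hom_K K H V W) V W (\<lambda>P v. P v)"
proof (intro kbilinearI hom_K_module V W)
  show "klinear K V W P" if "P \<in> carrier (hom_K K H V W)" for P
    by (rule hom_K_klinear[OF that V W])
  then show "klinear K (hom_K K H V W) W (\<lambda>P. P v)" if "v \<in> carrier V" for v
    using that by (intro klinearI hom_K_module V W) (auto simp: klinear_closed[OF hom_K_klinear[OF _ V W]] hom_K_sel(3,4))
qed

context hopf_algebra
begin

context
  fixes A :: "('k, 'a, 'h, 'l) hmodule_scheme"
    and V :: "('k, 'v, 'h, 'a, 'n) hbimodule_scheme" and W :: "('k, 'w, 'h, 'a, 'o) hbimodule_scheme"
  assumes V: "H_module K H V" and W: "H_module K H W"
begin

interpretation V: H_module K H V by (rule V)
interpretation W: H_module K H W by (rule W)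

lemmas hom_rules = kbilinear_rules[OF kbilinear_evaluation[OF V.module_axioms W.module_axioms, where H=H]]
  hom_K_module[OF V.module_axioms W.module_axioms] act_rules[OF V] act_rules[OF W] hopf_lin

lemma hom_act_apply:
  "v \<in> carrier V \<Longrightarrow> act (hom_K K H V W) \<xi> P v = tensor_lift W (\<lambda>x y. act W x (P (act V (antipode H y) v))) (comult H \<xi>)"
  by (simp add: hom_K_sel)

lemma kbilinear_hom_act: "kbilinear K H (hom_K K H V W) (hom_K K H V W) (act (hom_K K H V W))"
proof (intro kbilinearI module_axioms hom_K_module V.module_axioms W.module_axioms)
  fix \<xi> assume xi: "\<xi> \<in> carrier H"
  have "kbilinear K (hom_K K H V W) V W (\<lambda>P v. tensor_lift W (\<lambda>x y. act W x (P (act V (antipode H y) v))) (comult H \<xi>))"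
    by (assumption | rule hom_rules xi)+
  then show "klinear K (hom_K K H V W) (hom_K K H V W) (\<lambda>P. act (hom_K K H V W) \<xi> P)"
    unfolding hom_K_sel by (rule kbilinear_hom_K[OF V.module_axioms W.module_axioms])
next
  fix P assume P: "P \<in> carrier (hom_K K H V W)"
  have "kbilinear K H V W (\<lambda>\<xi> v. tensor_lift W (\<lambda>x y. act W x (P (act V (antipode H y) v))) (comult H \<xi>))"
    by (assumption | rule hom_rules P)+
  then show "klinear K H (hom_K K H V W) (\<lambda>\<xi>. act (hom_K K H V W) \<xi> P)"
    unfolding hom_K_sel by (rule kbilinear_hom_K[OF V.module_axioms W.module_axioms])
qed

lemmas hom_act_closed = kbilinear_closed[OF kbilinear_hom_act]

text \<open>Composing two conjugations nests the inner actions in the opposite order to the outer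
  ones, which is exactly what antimultiplicativity of the antipode provides.\<close>

lemma H_module_hom_K: "H_module K H (hom_K K H V W)"
proof -
  note bl = klinearD[OF kbilinear_left[OF kbilinear_hom_act]] klinearD[OF kbilinear_right[OF kbilinear_hom_act]]
  have "act (hom_K K H V W) (\<xi> \<otimes> \<zeta>) P = act (hom_K K H V W) \<xi> (act (hom_K K H V W) \<zeta> P)"
    if xz: "\<xi> \<in> carrier H" "\<zeta> \<in> carrier H" and P: "P \<in> carrier (hom_K K H V W)" for \<xi> \<zeta> P
  proof (rule hom_K_eqI[where K=K and H=H and V=V and W=W])
    fix v assume v: "v \<in> carrier V"
    have b: "kbilinear K H H W (\<lambda>x y. act W x (P (act V (antipode H y) v)))" by (assumption | rule hom_rules P v)+
    have "act (hom_K K H V W) (\<xi> \<otimes> \<zeta>) P v = tensor_lift W (\<lambda>x y. tensor_lift W (\<lambda>x' y'.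
        act W (x \<otimes> x') (P (act V (antipode H (y \<otimes> y')) v))) (comult H \<zeta>)) (comult H \<xi>)"
      unfolding hom_act_apply[OF v] comult_mult[OF xz]
      by (rule HH.lift_mult[OF comult_closed[OF xz(1)] comult_closed[OF xz(2)] b])
    also have "\<dots> = tensor_lift W (\<lambda>x y. tensor_lift W (\<lambda>x' y'.
        act W x (act W x' (P (act V (antipode H y') (act V (antipode H y) v))))) (comult H \<zeta>)) (comult H \<xi>)"
      by (intro liftH_cong comult_closed xz)
        (simp add: antipode_mult antipode_closed W.act_assoc V.act_assoc V.act_closed v
          kbilinear_closed[OF kbilinear_evaluation[OF V.module_axioms W.module_axioms] P])
    also have "\<dots> = tensor_lift W (\<lambda>x y. act W x (tensor_lift W (\<lambda>x' y'.
        act W x' (P (act V (antipode H y') (act V (antipode H y) v)))) (comult H \<zeta>))) (comult H \<xi>)"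
      by (intro liftH_cong comult_closed xz lift_hom[where f="\<lambda>w. act W x w" for x, symmetric])
         (assumption | rule hom_rules P v xz)+
    also have "\<dots> = act (hom_K K H V W) \<xi> (act (hom_K K H V W) \<zeta> P) v"
      unfolding hom_act_apply[OF v]
      by (intro liftH_cong comult_closed xz) (simp add: hom_act_apply V.act_closed antipode_closed v)
    finally show "act (hom_K K H V W) (\<xi> \<otimes> \<zeta>) P v = act (hom_K K H V W) \<xi> (act (hom_K K H V W) \<zeta> P) v" .
  qed (intro hom_act_closed m_closed xz P)+
  moreover have "act (hom_K K H V W) \<one> P = P" if P: "P \<in> carrier (hom_K K H V W)" for P
  proof (rule hom_K_eqI[where K=K and H=H and V=V and W=W])
    fix v assume v: "v \<in> carrier V"
    have b: "kbilinear K H H W (\<lambda>x y. act W x (P (act V (antipode H y) v)))" by (assumption | rule hom_rules P v)+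
    show "act (hom_K K H V W) \<one> P v = P v"
      unfolding hom_act_apply[OF v] comult_one ktensor_one
      by (simp add: lift_kpure[OF b] antipode_one V.act_unit W.act_unit v
          kbilinear_closed[OF kbilinear_evaluation[OF V.module_axioms W.module_axioms] P])
  qed (intro hom_act_closed P one_closed)+
  ultimately show ?thesis
    unfolding H_module_def H_module_axioms_def
    by (simp add: hom_K_module V.module_axioms W.module_axioms bl)
qed

text \<open>In suppressed notation, \<open>\<xi>\<^sub>1 P(S(\<xi>\<^sub>2) \<xi>\<^sub>3 v)\<close>
  collapses to \<open>\<xi> P(v)\<close>: coassociativity places the antipode next to its
  partner.\<close>

lemma equivariant_evaluation: "equivariant K H (hom_K K H V W) V W (\<lambda>P v. P v)"
proof -
  note ev = kbilinear_evaluation[OF V.module_axioms W.module_axioms]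
  have "act W \<xi> (P v) = tensor_lift W (\<lambda>p q. act (hom_K K H V W) p P (act V q v)) (comult H \<xi>)"
    if xi: "\<xi> \<in> carrier H" and P: "P \<in> carrier (hom_K K H V W)" and v: "v \<in> carrier V" for \<xi> P v
  proof -
    have "tensor_lift W (\<lambda>p q. act (hom_K K H V W) p P (act V q v)) (comult H \<xi>) =
      tensor_lift W (\<lambda>p q. tensor_lift W (\<lambda>x y. act W x (P (act V (antipode H y) (act V q v)))) (comult H p)) (comult H \<xi>)"
      by (intro liftH_cong comult_closed xi) (simp add: hom_act_apply V.act_closed v)
    also have "\<dots> = tensor_lift W (\<lambda>p q. tensor_lift W (\<lambda>x y. act W p (P (act V (antipode H x) (act V y v)))) (comult H q)) (comult H \<xi>)"
      by (rule lift_coassoc[OF xi]) (assumption | rule hom_rules P v)+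
    also have "\<dots> = tensor_lift W (\<lambda>p q. tensor_lift W (\<lambda>x y. act W p (P (act V (antipode H x \<otimes> y) v))) (comult H q)) (comult H \<xi>)"
      by (intro liftH_cong comult_closed xi) (simp_all add: V.act_assoc antipode_closed v)
    also have "\<dots> = tensor_lift W (\<lambda>p q. counit H q \<odot>\<^bsub>W\<^esub> act W p (P (act V \<one> v))) (comult H \<xi>)"
      by (intro liftH_cong comult_closed xi lift_antipode_left) (assumption | rule hom_rules P v)+
    also have "\<dots> = act W \<xi> (P (act V \<one> v))"
      by (rule lift_counit_right[OF xi]) (assumption | rule hom_rules P v)+
    finally show ?thesis by (simp add: V.act_unit v)
  qed
  then show ?thesis
    unfolding equivariant_def using H_module_hom_K V W ev by simp
qed

text \<open>This replaces all arguments that would need the anticomultiplicativity of the antipode.\<close>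

lemma hom_act_unique:
  assumes P: "P \<in> carrier (hom_K K H V W)" and R: "kbilinear K H V W R"
    and eq: "\<And>\<xi> v. \<lbrakk>\<xi> \<in> carrier H; v \<in> carrier V\<rbrakk> \<Longrightarrow>
      act W \<xi> (P v) = tensor_lift W (\<lambda>p q. R p (act V q v)) (comult H \<xi>)"
    and xi: "\<xi> \<in> carrier H" and v: "v \<in> carrier V"
  shows "act (hom_K K H V W) \<xi> P v = R \<xi> v"
proof (rule lift_cancel[where R="\<lambda>\<xi> v. act (hom_K K H V W) \<xi> P v", OF _ R kbilinear_act[OF V] V.act_assoc V.act_unit _ xi v])
  show "kbilinear K H V W (\<lambda>\<xi> v. act (hom_K K H V W) \<xi> P v)"
    by (assumption | rule hom_rules act_rules[OF H_module_hom_K] P)+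
  show "tensor_lift W (\<lambda>x x'. act (hom_K K H V W) x P (act V x' y)) (comult H \<xi>) =
    tensor_lift W (\<lambda>x x'. R x (act V x' y)) (comult H \<xi>)" if "\<xi> \<in> carrier H" "y \<in> carrier V" for \<xi> y
    using equivariant_act[OF equivariant_evaluation that(1) P that(2)] eq[OF that] by simp
qed

end

end


section \<open>Sub-bimodules\<close>

lemma carrier_update_sel:
  fixes X :: "('k, 'v, 'h, 'a, 'm) hbimodule_scheme"
  shows "carrier (X\<lparr>carrier := S\<rparr>) = S" "add (X\<lparr>carrier := S\<rparr>) = add X" "\<zero>\<^bsub>X\<lparr>carrier := S\<rparr>\<^esub> = \<zero>\<^bsub>X\<^esub>"
    "smult (X\<lparr>carrier := S\<rparr>) = smult X" "act (X\<lparr>carrier := S\<rparr>) = act X"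
    "lact (X\<lparr>carrier := S\<rparr>) = lact X" "ract (X\<lparr>carrier := S\<rparr>) = ract X"
  by simp_all

text \<open>Finite sums refer to the carrier, so the two lifts are different expressions; linearity
  of the inclusion identifies them.\<close>

lemma lift_sub:
  fixes X :: "('k, 'v, 'h, 'a, 'm) hbimodule_scheme"
  assumes S: "S \<subseteq> carrier X" and X: "module K X" and b: "kbilinear K Y Z (X\<lparr>carrier := S\<rparr>) b"
    and t: "t \<in> carrier (ktensor K Y Z)"
  shows "tensor_lift (X\<lparr>carrier := S\<rparr>) b t = tensor_lift X b t"
proof -
  have "klinear K (X\<lparr>carrier := S\<rparr>) X (\<lambda>x. x)"
    using S X kbilinear_module[OF b] by (intro klinearI) auto
  from lift_hom[OF this b t] show ?thesis .
qed

lemma kbilinear_sub: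
  fixes X :: "('k, 'v, 'h, 'a, 'm) hbimodule_scheme"
  assumes b: "kbilinear K Y Z X b" and X: "module K (X\<lparr>carrier := S\<rparr>)"
    and cl: "\<And>y z. \<lbrakk>y \<in> carrier Y; z \<in> carrier Z\<rbrakk> \<Longrightarrow> b y z \<in> S"
  shows "kbilinear K Y Z (X\<lparr>carrier := S\<rparr>) b"
  using X kbilinear_module[OF b] klinear_add[OF kbilinear_left[OF b]] klinear_add[OF kbilinear_right[OF b]]
    klinear_smult[OF kbilinear_left[OF b]] klinear_smult[OF kbilinear_right[OF b]]
  by (intro kbilinearI klinearI) (simp_all add: cl)

context hopf_algebra
begin

text \<open>Most axioms restrict verbatim. The two equivariance axioms contain a lift into the
  record itself, whose carrier has changed, and go through \<open>lift_sub\<close>.\<close>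

lemma sub_H_bimodule:
  fixes X :: "('k, 'v, 'h, 'a, 'n) hbimodule_scheme"
  assumes A: "H_module_algebra K H A" and X: "H_bimodule K H A X" and S: "S \<subseteq> carrier X" and zero: "\<zero>\<^bsub>X\<^esub> \<in> S"
    and add: "\<And>x y. \<lbrakk>x \<in> S; y \<in> S\<rbrakk> \<Longrightarrow> x \<oplus>\<^bsub>X\<^esub> y \<in> S"
    and smult: "\<And>k x. \<lbrakk>k \<in> carrier K; x \<in> S\<rbrakk> \<Longrightarrow> k \<odot>\<^bsub>X\<^esub> x \<in> S"
    and act: "\<And>\<xi> x. \<lbrakk>\<xi> \<in> carrier H; x \<in> S\<rbrakk> \<Longrightarrow> act X \<xi> x \<in> S"
    and lact: "\<And>a x. \<lbrakk>a \<in> carrier A; x \<in> S\<rbrakk> \<Longrightarrow> lact X a x \<in> S"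
    and ract: "\<And>a x. \<lbrakk>a \<in> carrier A; x \<in> S\<rbrakk> \<Longrightarrow> ract X x a \<in> S"
  shows "H_bimodule K H A (X\<lparr>carrier := S\<rparr>)"
proof -
  interpret A: H_module_algebra K H A by fact
  interpret X: H_bimodule K H A X by fact
  let ?S = "X\<lparr>carrier := S\<rparr>"
  have sub: "x \<in> carrier X" if "x \<in> S" for x using that S by auto
  have "\<ominus>\<^bsub>X\<^esub> x \<in> S" if "x \<in> S" for x
    using smult[of "\<ominus>\<^bsub>K\<^esub> \<one>\<^bsub>K\<^esub>", OF _ that] sub[OF that] by (simp add: X.smult_l_minus)
  then have M: "module K ?S"
    using zero add smult S by (intro submodule.submodule_is_module X.submoduleI X.module_axioms) auto
  note eq = H_bimodule_equivariant[OF A X]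
  note b = equivariant_kbilinear[OF eq(1)] equivariant_kbilinear[OF eq(2)]
  have HM: "H_module K H ?S"
    unfolding H_module_def H_module_axioms_def carrier_update_sel
    using M act sub by (auto simp: X.act_add_left X.act_smult_left X.act_add_right X.act_smult_right
        X.act_assoc X.act_unit)
  have l: "act X \<xi> (lact X a x) = tensor_lift ?S (\<lambda>p q. lact X (act A p a) (act X q x)) (comult H \<xi>)"
    if "\<xi> \<in> carrier H" "a \<in> carrier A" "x \<in> S" for \<xi> a x
  proof -
    have "kbilinear K H H X (\<lambda>p q. lact X (act A p a) (act X q x))"
      by (assumption | rule kbilinear_rules[OF b(1)] act_rules[OF A.H_module_axioms] act_rules[OF X.H_module_axioms]
          hopf_lin that sub)+
    then have "kbilinear K H H ?S (\<lambda>p q. lact X (act A p a) (act X q x))"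
      using that by (intro kbilinear_sub M) (auto intro: lact act A.act_closed)
    from lift_sub[OF S X.module_axioms this comult_closed[OF that(1)]] show ?thesis
      using X.act_lact[OF that(1,2) sub[OF that(3)]] by simp
  qed
  have r: "act X \<xi> (ract X x a) = tensor_lift ?S (\<lambda>p q. ract X (act X p x) (act A q a)) (comult H \<xi>)"
    if "\<xi> \<in> carrier H" "a \<in> carrier A" "x \<in> S" for \<xi> a x
  proof -
    have "kbilinear K H H X (\<lambda>p q. ract X (act X p x) (act A q a))"
      by (assumption | rule kbilinear_rules[OF b(2)] act_rules[OF A.H_module_axioms] act_rules[OF X.H_module_axioms]
          hopf_lin that sub)+
    then have "kbilinear K H H ?S (\<lambda>p q. ract X (act X p x) (act A q a))"
      using that by (intro kbilinear_sub M) (auto intro: ract act A.act_closed)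
    from lift_sub[OF S X.module_axioms this comult_closed[OF that(1)]] show ?thesis
      using X.act_ract[OF that(1,2) sub[OF that(3)]] by simp
  qed
  show ?thesis
    unfolding H_bimodule_def H_bimodule_axioms_def carrier_update_sel
    using HM l r
    by (simp add: sub lact ract X.lact_add_left X.lact_smult_left X.lact_add_right X.lact_smult_right
        X.ract_add_left X.ract_smult_left X.ract_add_right X.ract_smult_right X.lact_assoc X.lact_unit
        X.ract_assoc X.ract_unit X.lact_ract)
qed

text \<open>Cancels the diagonal action on a pair. The inverse transformation acts on
  \<open>v\<close> and \<open>a\<close> by the coproduct of \<open>antipode H y\<close>;
  multiplicativity of the coproduct merges this with the second leg into the coproduct of
  \<open>x2 \<otimes> antipode H y\<close>, and coassociativity with the antipode axiom then reduces
  the latter product to \<one>.\<close>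

lemma lift_cancel2:
  assumes E: "ktrilinear K H V A W E" and E': "ktrilinear K H V A W E'"
    and V: "H_module K H V" and A: "H_module K H A"
    and eq: "\<And>\<xi> v a. \<lbrakk>\<xi> \<in> carrier H; v \<in> carrier V; a \<in> carrier A\<rbrakk> \<Longrightarrow>
      tensor_lift W (\<lambda>x y. tensor_lift W (\<lambda>p q. E x (act V p v) (act A q a)) (comult H y)) (comult H \<xi>) =
      tensor_lift W (\<lambda>x y. tensor_lift W (\<lambda>p q. E' x (act V p v) (act A q a)) (comult H y)) (comult H \<xi>)"
    and xi: "\<xi> \<in> carrier H" and v: "v \<in> carrier V" and a: "a \<in> carrier A"
  shows "E \<xi> v a = E' \<xi> v a"
proof -
  interpret V: H_module K H V by fact
  interpret A: H_module K H A by fact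
  let ?D = "\<lambda>E x h v a. tensor_lift W (\<lambda>p q. E x (act V p v) (act A q a)) (comult H h)"
  let ?I = "\<lambda>E. tensor_lift W (\<lambda>x y. tensor_lift W (\<lambda>r s. tensor_lift W (\<lambda>x1 x2.
      ?D E x1 x2 (act V r v) (act A s a)) (comult H x)) (comult H (antipode H y))) (comult H \<xi>)"
  have inv: "?I E = E \<xi> v a" if E: "ktrilinear K H V A W E" for E
  proof -
    note er = klinear_comp[OF ktrilinearD(1)[OF E]] klinear_comp[OF ktrilinearD(2)[OF E]]
      klinear_comp[OF ktrilinearD(3)[OF E]] ktrilinear_module[OF E]
    note r = er act_rules[OF V] act_rules[OF A] hopf_lin v a
    have W: "module K W" using ktrilinear_module[OF E] by simp
    have D: "tensor_lift W (\<lambda>r s. ?D E x h (act V r v) (act A s a)) (comult H h') = ?D E x (h \<otimes> h') v a"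
      if "x \<in> carrier H" "h \<in> carrier H" "h' \<in> carrier H" for x h h'
    proof -
      have b: "kbilinear K H H W (\<lambda>p q. E x (act V p v) (act A q a))" by (assumption | rule r that)+
      have "tensor_lift W (\<lambda>r s. ?D E x h (act V r v) (act A s a)) (comult H h') =
        tensor_lift W (\<lambda>p q. tensor_lift W (\<lambda>r s. E x (act V p (act V r v)) (act A q (act A s a))) (comult H h')) (comult H h)"
        by (rule lift_swap) (assumption | rule r that)+
      also have "\<dots> = tensor_lift W (\<lambda>p q. tensor_lift W (\<lambda>r s. E x (act V (p \<otimes> r) v) (act A (q \<otimes> s) a)) (comult H h')) (comult H h)"
        using that by (intro liftH_cong comult_closed) (simp_all add: V.act_assoc A.act_assoc v a)
      also have "\<dots> = ?D E x (h \<otimes> h') v a"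
        unfolding comult_mult[OF that(2,3)]
        by (rule HH.lift_mult[symmetric, OF comult_closed comult_closed b]) (rule that)+
      finally show ?thesis .
    qed
    have "?I E = tensor_lift W (\<lambda>x y. tensor_lift W (\<lambda>x1 x2. tensor_lift W (\<lambda>r s.
      ?D E x1 x2 (act V r v) (act A s a)) (comult H (antipode H y))) (comult H x)) (comult H \<xi>)"
      by (intro liftH_cong comult_closed xi liftH_swap) (assumption | rule r xi)+
    also have "\<dots> = tensor_lift W (\<lambda>x y. tensor_lift W (\<lambda>x1 x2. ?D E x1 (x2 \<otimes> antipode H y) v a) (comult H x)) (comult H \<xi>)"
      by (intro liftH_cong comult_closed xi D antipode_closed)
    also have "\<dots> = tensor_lift W (\<lambda>x y. tensor_lift W (\<lambda>x1 x2. ?D E x (x1 \<otimes> antipode H x2) v a) (comult H y)) (comult H \<xi>)"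
      by (rule lift_coassoc[OF xi]) (assumption | rule r)+
    also have "\<dots> = tensor_lift W (\<lambda>x y. counit H y \<odot>\<^bsub>W\<^esub> ?D E x \<one> v a) (comult H \<xi>)"
      by (intro liftH_cong comult_closed xi lift_antipode_right[where g="\<lambda>h. ?D E x h v a" for x])
        (assumption | rule r)+
    also have "\<dots> = ?D E \<xi> \<one> v a"
      by (rule lift_counit_right[OF xi]) (assumption | rule r)+
    also have "\<dots> = E \<xi> v a"
    proof -
      have b: "kbilinear K H H W (\<lambda>p q. E \<xi> (act V p v) (act A q a))" by (assumption | rule r xi)+
      show ?thesis unfolding comult_one ktensor_one using v a by (simp add: lift_kpure[OF b] V.act_unit A.act_unit)
    qed
    finally show ?thesis .
  qed
  have "?I E = ?I E'"
    by (intro liftH_cong comult_closed xi antipode_closed eq V.act_closed A.act_closed v a)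
  then show ?thesis by (simp add: inv[OF E] inv[OF E'])
qed

section \<open>The algebra acting on linear maps from both sides\<close>

context
  fixes A :: "('k, 'a, 'h, 'l) hmodule_scheme"
    and V :: "('k, 'v, 'h, 'a, 'n) hbimodule_scheme" and W :: "('k, 'w, 'h, 'a, 'o) hbimodule_scheme"
  assumes A: "H_module_algebra K H A" and V: "H_bimodule K H A V" and W: "H_bimodule K H A W"
begin

interpretation A: H_module_algebra K H A by (rule A)
interpretation V: H_bimodule K H A V by (rule V)
interpretation W: H_bimodule K H A W by (rule W)

lemmas eqV = H_bimodule_equivariant[OF A V] and eqW = H_bimodule_equivariant[OF A W]

lemmas hom_rules' = kbilinear_rules[OF equivariant_kbilinear[OF eqV(1)]] kbilinear_rules[OF equivariant_kbilinear[OF eqV(2)]]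
  kbilinear_rules[OF equivariant_kbilinear[OF eqW(1)]] kbilinear_rules[OF equivariant_kbilinear[OF eqW(2)]]
  act_rules[OF A.H_module_axioms] act_rules[OF H_module_hom_K[OF V.H_module_axioms W.H_module_axioms]]
  hom_rules[OF V.H_module_axioms W.H_module_axioms]

lemma kbilinear_hom_lact: "kbilinear K A (hom_K K H V W) (hom_K K H V W) (lact (hom_K K H V W))"
proof (intro kbilinearI A.module_axioms hom_K_module V.module_axioms W.module_axioms)
  fix a assume a: "a \<in> carrier A"
  have "kbilinear K (hom_K K H V W) V W (\<lambda>P v. lact W a (P v))" by (assumption | rule hom_rules' a)+
  then show "klinear K (hom_K K H V W) (hom_K K H V W) (\<lambda>P. lact (hom_K K H V W) a P)"
    unfolding hom_K_sel by (rule kbilinear_hom_K[OF V.module_axioms W.module_axioms])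
next
  fix P assume P: "P \<in> carrier (hom_K K H V W)"
  have "kbilinear K A V W (\<lambda>a v. lact W a (P v))" by (assumption | rule hom_rules' P)+
  then show "klinear K A (hom_K K H V W) (\<lambda>a. lact (hom_K K H V W) a P)"
    unfolding hom_K_sel by (rule kbilinear_hom_K[OF V.module_axioms W.module_axioms])
qed

lemma kbilinear_hom_ract: "kbilinear K (hom_K K H V W) A (hom_K K H V W) (ract (hom_K K H V W))"
proof (intro kbilinearI A.module_axioms hom_K_module V.module_axioms W.module_axioms)
  fix a assume a: "a \<in> carrier A"
  have "kbilinear K (hom_K K H V W) V W (\<lambda>P v. P (lact V a v))" by (assumption | rule hom_rules' a)+
  then show "klinear K (hom_K K H V W) (hom_K K H V W) (\<lambda>P. ract (hom_K K H V W) P a)"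
    unfolding hom_K_sel by (rule kbilinear_hom_K[OF V.module_axioms W.module_axioms])
next
  fix P assume P: "P \<in> carrier (hom_K K H V W)"
  have "kbilinear K A V W (\<lambda>a v. P (lact V a v))" by (assumption | rule hom_rules' P)+
  then show "klinear K A (hom_K K H V W) (\<lambda>a. ract (hom_K K H V W) P a)"
    unfolding hom_K_sel by (rule kbilinear_hom_K[OF V.module_axioms W.module_axioms])
qed

lemma hom_lact_apply: "v \<in> carrier V \<Longrightarrow> lact (hom_K K H V W) a P v = lact W a (P v)"
  and hom_ract_apply: "v \<in> carrier V \<Longrightarrow> ract (hom_K K H V W) P a v = P (lact V a v)"
  by (simp_all add: hom_K_sel)

lemmas evaluation = equivariant_evaluation[OF V.H_module_axioms W.H_module_axioms]
lemmas bim_rules = kbilinear_rules[OF kbilinear_hom_lact] kbilinear_rules[OF kbilinear_hom_ract] hom_rules'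

lemma klinear_at: "v \<in> carrier V \<Longrightarrow> klinear K (hom_K K H V W) W (\<lambda>P. P v)"
  by (rule kbilinear_left[OF kbilinear_evaluation[OF V.module_axioms W.module_axioms]])

text \<open>Checked after evaluation at \<open>v\<close>. By \<open>hom_act_unique\<close> it is
  enough that \<open>?R\<close> is compatible with evaluating \<open>lact a P\<close>; this combines
  equivariance of the action on \<open>W\<close> and of evaluation, rebracketed by coassociativity.
  Then \<open>klinear_at\<close> moves evaluation out of the sum.\<close>

lemma equivariant_hom_lact: "equivariant K H A (hom_K K H V W) (hom_K K H V W) (lact (hom_K K H V W))"
proof -
  have "act (hom_K K H V W) \<xi> (lact (hom_K K H V W) a P) = tensor_lift (hom_K K H V W) (\<lambda>p q. lact (hom_K K H V W) (act A p a) (act (hom_K K H V W) q P)) (comult H \<xi>)"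
    if xi: "\<xi> \<in> carrier H" and a: "a \<in> carrier A" and P: "P \<in> carrier (hom_K K H V W)" for \<xi> a P
  proof (rule hom_K_eqI[where K=K and H=H and V=V and W=W])
    fix v assume v: "v \<in> carrier V"
    let ?R = "\<lambda>\<xi> v. tensor_lift W (\<lambda>p q. lact W (act A p a) (act (hom_K K H V W) q P v)) (comult H \<xi>)"
    have "act (hom_K K H V W) \<xi> (lact (hom_K K H V W) a P) v = ?R \<xi> v"
    proof (rule hom_act_unique[OF V.H_module_axioms W.H_module_axioms _ _ _ xi v])
      show "kbilinear K H V W ?R" by (assumption | rule bim_rules P a)+
      fix \<xi> v assume xi: "\<xi> \<in> carrier H" and v: "v \<in> carrier V"
      have "act W \<xi> (lact (hom_K K H V W) a P v) = tensor_lift W (\<lambda>p q. lact W (act A p a) (act W q (P v))) (comult H \<xi>)"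
        unfolding hom_lact_apply[OF v]
        by (rule W.act_lact[OF xi a]) (rule bim_rules P v)+
      also have "\<dots> = tensor_lift W (\<lambda>p q. tensor_lift W (\<lambda>r s. lact W (act A p a) (act (hom_K K H V W) r P (act V s v))) (comult H q)) (comult H \<xi>)"
      proof (rule liftH_cong[OF comult_closed[OF xi]])
        fix p q assume pq: "p \<in> carrier H" "q \<in> carrier H"
        show "lact W (act A p a) (act W q (P v)) =
          tensor_lift W (\<lambda>r s. lact W (act A p a) (act (hom_K K H V W) r P (act V s v))) (comult H q)"
          unfolding equivariant_act[OF evaluation pq(2) P v]
          by (rule lift_hom[where f="\<lambda>w. lact W (act A p a) w"]) (assumption | rule bim_rules P a v pq)+
      qed
      also have "\<dots> = tensor_lift W (\<lambda>p q. tensor_lift W (\<lambda>r s. lact W (act A r a) (act (hom_K K H V W) s P (act V q v))) (comult H p)) (comult H \<xi>)"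
        by (rule lift_coassoc[symmetric, OF xi]) (assumption | rule bim_rules P a v)+
      finally show "act W \<xi> (lact (hom_K K H V W) a P v) = tensor_lift W (\<lambda>p q. ?R p (act V q v)) (comult H \<xi>)" .
    qed (rule bim_rules P a)+
    also have "\<dots> = tensor_lift W (\<lambda>p q. lact (hom_K K H V W) (act A p a) (act (hom_K K H V W) q P) v) (comult H \<xi>)"
      by (simp add: hom_lact_apply[OF v])
    also have "\<dots> = tensor_lift (hom_K K H V W) (\<lambda>p q. lact (hom_K K H V W) (act A p a) (act (hom_K K H V W) q P)) (comult H \<xi>) v"
      by (rule lift_hom[OF klinear_at[OF v], symmetric]) (assumption | rule bim_rules P a xi)+
    finally show "act (hom_K K H V W) \<xi> (lact (hom_K K H V W) a P) v = tensor_lift (hom_K K H V W) (\<lambda>p q. lact (hom_K K H V W) (act A p a) (act (hom_K K H V W) q P)) (comult H \<xi>) v" .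
  next
    have "kbilinear K H H (hom_K K H V W) (\<lambda>p q. lact (hom_K K H V W) (act A p a) (act (hom_K K H V W) q P))" by (assumption | rule bim_rules P a)+
    then show "tensor_lift (hom_K K H V W) (\<lambda>p q. lact (hom_K K H V W) (act A p a) (act (hom_K K H V W) q P)) (comult H \<xi>) \<in> carrier (hom_K K H V W)"
      by (rule lift_closed) (rule bim_rules xi)+
  qed (rule bim_rules P a xi)+
  then show ?thesis
    unfolding equivariant_def
    using A.H_module_axioms H_module_hom_K[OF V.H_module_axioms W.H_module_axioms] kbilinear_hom_lact by simp
qed

text \<open>As for the left action, except that equivariance of evaluation is used first and that of
  the action on \<open>V\<close> second.\<close>

lemma equivariant_hom_ract: "equivariant K H (hom_K K H V W) A (hom_K K H V W) (ract (hom_K K H V W))"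
proof -
  have "act (hom_K K H V W) \<xi> (ract (hom_K K H V W) P a) = tensor_lift (hom_K K H V W) (\<lambda>p q. ract (hom_K K H V W) (act (hom_K K H V W) p P) (act A q a)) (comult H \<xi>)"
    if xi: "\<xi> \<in> carrier H" and a: "a \<in> carrier A" and P: "P \<in> carrier (hom_K K H V W)" for \<xi> a P
  proof (rule hom_K_eqI[where K=K and H=H and V=V and W=W])
    fix v assume v: "v \<in> carrier V"
    let ?R = "\<lambda>\<xi> v. tensor_lift W (\<lambda>p q. act (hom_K K H V W) p P (lact V (act A q a) v)) (comult H \<xi>)"
    have "act (hom_K K H V W) \<xi> (ract (hom_K K H V W) P a) v = ?R \<xi> v"
    proof (rule hom_act_unique[OF V.H_module_axioms W.H_module_axioms _ _ _ xi v])
      show "kbilinear K H V W ?R" by (assumption | rule bim_rules P a)+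
      fix \<xi> v assume xi: "\<xi> \<in> carrier H" and v: "v \<in> carrier V"
      have av: "lact V a v \<in> carrier V" by (rule bim_rules a v)+
      have "act W \<xi> (ract (hom_K K H V W) P a v) = tensor_lift W (\<lambda>p q. act (hom_K K H V W) p P (act V q (lact V a v))) (comult H \<xi>)"
        unfolding hom_ract_apply[OF v] by (rule equivariant_act[OF evaluation xi P av])
      also have "\<dots> = tensor_lift W (\<lambda>p q. tensor_lift W (\<lambda>r s. act (hom_K K H V W) p P (lact V (act A r a) (act V s v))) (comult H q)) (comult H \<xi>)"
      proof (rule liftH_cong[OF comult_closed[OF xi]])
        fix p q assume pq: "p \<in> carrier H" "q \<in> carrier H"
        show "act (hom_K K H V W) p P (act V q (lact V a v)) =
          tensor_lift W (\<lambda>r s. act (hom_K K H V W) p P (lact V (act A r a) (act V s v))) (comult H q)"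
          unfolding V.act_lact[OF pq(2) a v]
          by (rule lift_hom[where f="\<lambda>w. act (hom_K K H V W) p P w"]) (assumption | rule bim_rules P a v pq)+
      qed
      also have "\<dots> = tensor_lift W (\<lambda>p q. tensor_lift W (\<lambda>r s. act (hom_K K H V W) r P (lact V (act A s a) (act V q v))) (comult H p)) (comult H \<xi>)"
        by (rule lift_coassoc[symmetric, OF xi]) (assumption | rule bim_rules P a v)+
      finally show "act W \<xi> (ract (hom_K K H V W) P a v) = tensor_lift W (\<lambda>p q. ?R p (act V q v)) (comult H \<xi>)" .
    qed (rule bim_rules P a)+
    also have "\<dots> = tensor_lift W (\<lambda>p q. ract (hom_K K H V W) (act (hom_K K H V W) p P) (act A q a) v) (comult H \<xi>)"
      by (simp add: hom_ract_apply[OF v])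
    also have "\<dots> = tensor_lift (hom_K K H V W) (\<lambda>p q. ract (hom_K K H V W) (act (hom_K K H V W) p P) (act A q a)) (comult H \<xi>) v"
      by (rule lift_hom[OF klinear_at[OF v], symmetric]) (assumption | rule bim_rules P a xi)+
    finally show "act (hom_K K H V W) \<xi> (ract (hom_K K H V W) P a) v = tensor_lift (hom_K K H V W) (\<lambda>p q. ract (hom_K K H V W) (act (hom_K K H V W) p P) (act A q a)) (comult H \<xi>) v" .
  next
    have "kbilinear K H H (hom_K K H V W) (\<lambda>p q. ract (hom_K K H V W) (act (hom_K K H V W) p P) (act A q a))" by (assumption | rule bim_rules P a)+
    then show "tensor_lift (hom_K K H V W) (\<lambda>p q. ract (hom_K K H V W) (act (hom_K K H V W) p P) (act A q a)) (comult H \<xi>) \<in> carrier (hom_K K H V W)"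
      by (rule lift_closed) (rule bim_rules xi)+
  qed (rule bim_rules P a xi)+
  then show ?thesis
    unfolding equivariant_def
    using A.H_module_axioms H_module_hom_K[OF V.H_module_axioms W.H_module_axioms] kbilinear_hom_ract by simp
qed

lemma H_bimodule_hom_K: "H_bimodule K H A (hom_K K H V W)"
proof (rule H_bimoduleI[OF equivariant_hom_lact equivariant_hom_ract])
  note ext = hom_K_eqI[where K=K and H=H and V=V and W=W]
  have cl: "P v \<in> carrier W" if "P \<in> carrier (hom_K K H V W)" "v \<in> carrier V" for P v by (rule bim_rules that)+
  fix P assume P: "P \<in> carrier (hom_K K H V W)"
  show "lact (hom_K K H V W) \<one>\<^bsub>A\<^esub> P = P"
    by (rule ext; ((rule bim_rules P A.one_closed)+)?) (simp add: hom_lact_apply W.lact_unit cl P)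
  show "ract (hom_K K H V W) P \<one>\<^bsub>A\<^esub> = P"
    by (rule ext; ((rule bim_rules P A.one_closed)+)?) (simp add: hom_ract_apply V.lact_unit P)
  fix a b assume ab: "a \<in> carrier A" "b \<in> carrier A"
  show "lact (hom_K K H V W) (a \<otimes>\<^bsub>A\<^esub> b) P = lact (hom_K K H V W) a (lact (hom_K K H V W) b P)"
    by (rule ext; ((rule bim_rules P ab A.m_closed)+)?) (simp add: hom_lact_apply W.lact_assoc cl P ab)
  show "ract (hom_K K H V W) P (a \<otimes>\<^bsub>A\<^esub> b) = ract (hom_K K H V W) (ract (hom_K K H V W) P a) b"
    by (rule ext; ((rule bim_rules P ab A.m_closed)+)?) (simp add: hom_ract_apply V.lact_assoc V.lact_closed P ab)
  show "ract (hom_K K H V W) (lact (hom_K K H V W) a P) b = lact (hom_K K H V W) a (ract (hom_K K H V W) P b)"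
    by (rule ext; ((rule bim_rules P ab A.m_closed)+)?) (simp add: hom_ract_apply hom_lact_apply V.lact_closed P ab)
qed

text \<open>By \<open>lift_cancel2\<close> both sides may be tested with the remaining legs of the
  coproduct acting on \<open>v\<close> and \<open>a\<close>. Then each becomes \<open>\<xi>\<close>
  acting on \<open>P (v a)\<close>: the left one because the right action and evaluation are
  equivariant, the right one after splitting \<open>P (v a)\<close> by \<open>defect\<close>. The
  counit records that the equivariant map \<open>B\<close> is not conjugated by the action on
  \<open>P\<close>.\<close>

lemma defect_act:
  assumes B: "equivariant K H V A W B" and P: "P \<in> carrier (hom_K K H V W)"
    and defect: "\<And>v a. \<lbrakk>v \<in> carrier V; a \<in> carrier A\<rbrakk> \<Longrightarrow> P (ract V v a) = ract W (P v) a \<oplus>\<^bsub>W\<^esub> B v a"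
    and xi: "\<xi> \<in> carrier H" and v: "v \<in> carrier V" and a: "a \<in> carrier A"
  shows "act (hom_K K H V W) \<xi> P (ract V v a) = ract W (act (hom_K K H V W) \<xi> P v) a \<oplus>\<^bsub>W\<^esub> counit H \<xi> \<odot>\<^bsub>W\<^esub> B v a"
proof (rule lift_cancel2[where E="\<lambda>\<xi> v a. act (hom_K K H V W) \<xi> P (ract V v a)"
      and E'="\<lambda>\<xi> v a. ract W (act (hom_K K H V W) \<xi> P v) a \<oplus>\<^bsub>W\<^esub> counit H \<xi> \<odot>\<^bsub>W\<^esub> B v a",
      OF _ _ V.H_module_axioms A.H_module_axioms _ xi v a])
  note r = kbilinear_rules[OF equivariant_kbilinear[OF B]] bim_rules P
  show "ktrilinear K H V A W (\<lambda>\<xi> v a. act (hom_K K H V W) \<xi> P (ract V v a))" by (assumption | rule r)+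
  show "ktrilinear K H V A W (\<lambda>\<xi> v a. ract W (act (hom_K K H V W) \<xi> P v) a \<oplus>\<^bsub>W\<^esub> counit H \<xi> \<odot>\<^bsub>W\<^esub> B v a)"
    by (assumption | rule r)+
  fix \<xi> v a assume xi: "\<xi> \<in> carrier H" and v: "v \<in> carrier V" and a: "a \<in> carrier A"
  note s = r xi v a
  have va: "ract V v a \<in> carrier V" and Pv: "P v \<in> carrier W" and Bva: "B v a \<in> carrier W" by (rule s)+
  have "tensor_lift W (\<lambda>x y. tensor_lift W (\<lambda>p q. act (hom_K K H V W) x P (ract V (act V p v) (act A q a))) (comult H y)) (comult H \<xi>) =
     tensor_lift W (\<lambda>x y. act (hom_K K H V W) x P (act V y (ract V v a))) (comult H \<xi>)"
  proof (rule liftH_cong[OF comult_closed[OF xi]])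
    fix x y assume xy: "x \<in> carrier H" "y \<in> carrier H"
    show "tensor_lift W (\<lambda>p q. act (hom_K K H V W) x P (ract V (act V p v) (act A q a))) (comult H y) =
      act (hom_K K H V W) x P (act V y (ract V v a))"
      unfolding V.act_ract[OF xy(2) a v]
      by (rule lift_hom[where f="\<lambda>v. act (hom_K K H V W) x P v", symmetric]) (assumption | rule s xy)+
  qed
  also have "\<dots> = act W \<xi> (P (ract V v a))"
    by (rule equivariant_act[OF evaluation xi P va, symmetric])
  also have "\<dots> = act W \<xi> (ract W (P v) a) \<oplus>\<^bsub>W\<^esub> act W \<xi> (B v a)"
    unfolding defect[OF v a] by (rule W.act_add_right[OF xi _ Bva]) (rule s)+
  also have "act W \<xi> (ract W (P v) a) = tensor_lift W (\<lambda>x y. tensor_lift W (\<lambda>p q. ract W (act (hom_K K H V W) p P (act V q v)) (act A y a)) (comult H x)) (comult H \<xi>)"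
    unfolding W.act_ract[OF xi a Pv]
  proof (rule liftH_cong[OF comult_closed[OF xi]])
    fix x y assume xy: "x \<in> carrier H" "y \<in> carrier H"
    show "ract W (act W x (P v)) (act A y a) = tensor_lift W (\<lambda>p q. ract W (act (hom_K K H V W) p P (act V q v)) (act A y a)) (comult H x)"
      unfolding equivariant_act[OF evaluation xy(1) P v]
      by (rule lift_hom[where f="\<lambda>w. ract W w (act A y a)"]) (assumption | rule s xy)+
  qed
  also have "\<dots> = tensor_lift W (\<lambda>x y. tensor_lift W (\<lambda>p q. ract W (act (hom_K K H V W) x P (act V p v)) (act A q a)) (comult H y)) (comult H \<xi>)"
    by (rule lift_coassoc[OF xi]) (assumption | rule s)+
  \<comment> \<open>The counit is inserted so that the defect term, too, becomes a sum over a
    threefold coproduct and can be added to the other one under the same sum.\<close>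
  also have "act W \<xi> (B v a) = tensor_lift W (\<lambda>x y. counit H x \<odot>\<^bsub>W\<^esub> act W y (B v a)) (comult H \<xi>)"
    by (rule lift_counit_left[OF xi, symmetric]) (assumption | rule s Bva)+
  also have "\<dots> = tensor_lift W (\<lambda>x y. tensor_lift W (\<lambda>p q. counit H x \<odot>\<^bsub>W\<^esub> B (act V p v) (act A q a)) (comult H y)) (comult H \<xi>)"
  proof (rule liftH_cong[OF comult_closed[OF xi]])
    fix x y assume xy: "x \<in> carrier H" "y \<in> carrier H"
    show "counit H x \<odot>\<^bsub>W\<^esub> act W y (B v a) =
      tensor_lift W (\<lambda>p q. counit H x \<odot>\<^bsub>W\<^esub> B (act V p v) (act A q a)) (comult H y)"
      unfolding equivariant_act[OF B xy(2) v a]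
      by (rule lift_smult_fun[symmetric]) (assumption | rule s xy)+
  qed
  also have "tensor_lift W (\<lambda>x y. tensor_lift W (\<lambda>p q. ract W (act (hom_K K H V W) x P (act V p v)) (act A q a)) (comult H y)) (comult H \<xi>) \<oplus>\<^bsub>W\<^esub>
      tensor_lift W (\<lambda>x y. tensor_lift W (\<lambda>p q. counit H x \<odot>\<^bsub>W\<^esub> B (act V p v) (act A q a)) (comult H y)) (comult H \<xi>) =
    tensor_lift W (\<lambda>x y. tensor_lift W (\<lambda>p q. ract W (act (hom_K K H V W) x P (act V p v)) (act A q a)) (comult H y) \<oplus>\<^bsub>W\<^esub>
      tensor_lift W (\<lambda>p q. counit H x \<odot>\<^bsub>W\<^esub> B (act V p v) (act A q a)) (comult H y)) (comult H \<xi>)"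
    by (rule lift_add_fun[symmetric]) (assumption | rule s)+
  also have "\<dots> = tensor_lift W (\<lambda>x y. tensor_lift W (\<lambda>p q. ract W (act (hom_K K H V W) x P (act V p v)) (act A q a) \<oplus>\<^bsub>W\<^esub>
      counit H x \<odot>\<^bsub>W\<^esub> B (act V p v) (act A q a)) (comult H y)) (comult H \<xi>)"
    by (intro liftH_cong comult_closed xi lift_add_fun[symmetric]) (assumption | rule s)+
  finally show "tensor_lift W (\<lambda>x y. tensor_lift W (\<lambda>p q. act (hom_K K H V W) x P (ract V (act V p v) (act A q a))) (comult H y)) (comult H \<xi>) =
    tensor_lift W (\<lambda>x y. tensor_lift W (\<lambda>p q. ract W (act (hom_K K H V W) x P (act V p v)) (act A q a) \<oplus>\<^bsub>W\<^esub>
      counit H x \<odot>\<^bsub>W\<^esub> B (act V p v) (act A q a)) (comult H y)) (comult H \<xi>)" .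
qed

lemma equivariant_zero: "equivariant K H V A W (\<lambda>v a. \<zero>\<^bsub>W\<^esub>)"
proof -
  have "act W \<xi> \<zero>\<^bsub>W\<^esub> = tensor_lift W (\<lambda>p q. \<zero>\<^bsub>W\<^esub>) (comult H \<xi>)" if "\<xi> \<in> carrier H" for \<xi>
    using that klinear_zero[OF kbilinear_right[OF kbilinear_act[OF W.H_module_axioms] that]]
      lift_zero_fun[OF module_axioms module_axioms W.module_axioms comult_closed]
    by simp
  moreover have "kbilinear K V A W (\<lambda>v a. \<zero>\<^bsub>W\<^esub>)"
    by (intro kbilinearI klinear_zero_fun V.module_axioms A.module_axioms W.module_axioms)
  ultimately show ?thesis
    unfolding equivariant_def using V.H_module_axioms A.H_module_axioms W.H_module_axioms by simp
qed

lemma hom_A_sel: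
  "carrier (hom_A K H A V W) = {P \<in> carrier (hom_K K H V W). \<forall>v\<in>carrier V. \<forall>a\<in>carrier A. P (ract V v a) = ract W (P v) a}"
  "hom_A K H A V W = (hom_K K H V W)\<lparr>carrier := carrier (hom_A K H A V W)\<rparr>"
  by (simp_all add: hom_A_def)

lemma H_bimodule_hom_A: "H_bimodule K H A (hom_A K H A V W)"
proof (subst hom_A_sel(2), rule sub_H_bimodule[OF A H_bimodule_hom_K])
  let ?S = "carrier (hom_A K H A V W)"
  have S: "P \<in> ?S" if "P \<in> carrier (hom_K K H V W)" "\<And>v a. \<lbrakk>v \<in> carrier V; a \<in> carrier A\<rbrakk> \<Longrightarrow> P (ract V v a) = ract W (P v) a" for P
    using that by (simp add: hom_A_sel(1))
  show sub: "?S \<subseteq> carrier (hom_K K H V W)" by (auto simp: hom_A_sel(1))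
  have SD: "P (ract V v a) = ract W (P v) a" if "P \<in> ?S" "v \<in> carrier V" "a \<in> carrier A" for P v a
    using that by (auto simp: hom_A_sel(1))
  have cl: "P v \<in> carrier W" if "P \<in> ?S" "v \<in> carrier V" for P v
    using that sub klinear_closed[OF hom_K_klinear[OF _ V.module_axioms W.module_axioms]] by blast
  note br = equivariant_kbilinear[OF eqW(2)]
  interpret X: H_bimodule K H A "hom_K K H V W" by (rule H_bimodule_hom_K)
  show "\<zero>\<^bsub>hom_K K H V W\<^esub> \<in> ?S"
    by (rule S, rule X.M.zero_closed)
      (use klinear_zero[OF kbilinear_left[OF br]] in \<open>simp add: hom_K_sel(2) V.ract_closed\<close>)
  show "P \<oplus>\<^bsub>hom_K K H V W\<^esub> Q \<in> ?S" if "P \<in> ?S" "Q \<in> ?S" for P Q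
    by (rule S, rule X.M.a_closed) (use that sub in \<open>auto simp: hom_K_sel(3) V.ract_closed SD cl W.ract_add_left\<close>)
  show "k \<odot>\<^bsub>hom_K K H V W\<^esub> P \<in> ?S" if "k \<in> carrier K" "P \<in> ?S" for P k
    by (rule S, rule X.smult_closed) (use that sub in \<open>auto simp: hom_K_sel(4) V.ract_closed SD cl W.ract_smult_left\<close>)
  show "lact (hom_K K H V W) a P \<in> ?S" if "a \<in> carrier A" "P \<in> ?S" for P a
    by (rule S) (use that sub X.lact_closed in \<open>auto simp: hom_lact_apply V.ract_closed SD cl W.lact_ract\<close>)
  show "ract (hom_K K H V W) P a \<in> ?S" if "a \<in> carrier A" "P \<in> ?S" for P a
    by (rule S) (use that sub X.ract_closed in \<open>auto simp: hom_ract_apply V.ract_closed V.lact_closed SD cl V.lact_ract[symmetric]\<close>)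
  show "act (hom_K K H V W) \<xi> P \<in> ?S" if "\<xi> \<in> carrier H" "P \<in> ?S" for P \<xi>
  proof (rule S)
    show P: "act (hom_K K H V W) \<xi> P \<in> carrier (hom_K K H V W)" using that sub X.act_closed by auto
    have PX: "P \<in> carrier (hom_K K H V W)" using that sub by auto
    fix v a assume va: "v \<in> carrier V" "a \<in> carrier A"
    \<comment> \<open>Right linearity is the defect rule with zero defect, so its stability under
      the action is an instance of \<open>defect_act\<close>.\<close>
    have "act (hom_K K H V W) \<xi> P (ract V v a) = ract W (act (hom_K K H V W) \<xi> P v) a \<oplus>\<^bsub>W\<^esub> counit H \<xi> \<odot>\<^bsub>W\<^esub> \<zero>\<^bsub>W\<^esub>"
      by (rule defect_act[OF equivariant_zero PX _ that(1) va])
        (simp add: SD[OF that(2)] W.ract_closed cl[OF that(2)])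
    moreover have "act (hom_K K H V W) \<xi> P v \<in> carrier W"
      using klinear_closed[OF hom_K_klinear[OF P V.module_axioms W.module_axioms] va(1)] .
    ultimately show "act (hom_K K H V W) \<xi> P (ract V v a) = ract W (act (hom_K K H V W) \<xi> P v) a"
      using that va by (simp add: counit_closed W.ract_closed)
  qed
qed

end

end


section \<open>Tensor products over a module algebra\<close>

definition abilinear ::
    "'k ring \<Rightarrow> ('k, 'a, 'h, 'l) hmodule_scheme \<Rightarrow> ('k, 'v, 'h, 'a, 'm) hbimodule_scheme \<Rightarrow>
     ('k, 'w, 'h, 'a, 'n) hbimodule_scheme \<Rightarrow> ('k, 'u, 'o) module_scheme \<Rightarrow> ('v \<Rightarrow> 'w \<Rightarrow> 'u) \<Rightarrow> bool" where
  "abilinear K A V W G b \<longleftrightarrow> kbilinear K V W G b \<and>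
     (\<forall>v\<in>carrier V. \<forall>a\<in>carrier A. \<forall>w\<in>carrier W. b (ract V v a) w = b v (lact W a w))"

lemma abilinear_kbilinear: "abilinear K A V W G b \<Longrightarrow> kbilinear K V W G b"
  unfolding abilinear_def by simp

lemma atensor_sel:
  "carrier (atensor H A V W) = carrier (tensor_group (carrier A) (ract V) (lact W) V W)"
  "add (atensor H A V W) = add (tensor_group (carrier A) (ract V) (lact W) V W)"
  "\<zero>\<^bsub>atensor H A V W\<^esub> = \<zero>\<^bsub>tensor_group (carrier A) (ract V) (lact W) V W\<^esub>"
  by (simp_all add: atensor_def Let_def)

lemma tensor_lift_atensor:
  "tensor_lift (tensor_group (carrier A) (ract V) (lact W) V W) = tensor_lift (atensor H A V W)"
  by (rule tensor_lift_cong_group) (simp_all add: atensor_sel)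

lemma atensor_ops:
  "k \<odot>\<^bsub>atensor H A V W\<^esub> t = tensor_lift (atensor H A V W) (\<lambda>v w. apure A V W (k \<odot>\<^bsub>V\<^esub> v) w) t"
  "act (atensor H A V W) \<xi> t = tensor_lift (atensor H A V W) (\<lambda>v w.
     tensor_lift (atensor H A V W) (\<lambda>x y. apure A V W (act V x v) (act W y w)) (comult H \<xi>)) t"
  "lact (atensor H A V W) a t = tensor_lift (atensor H A V W) (\<lambda>v w. apure A V W (lact V a v) w) t"
  "ract (atensor H A V W) t a = tensor_lift (atensor H A V W) (\<lambda>v w. apure A V W v (ract W w a)) t"
  unfolding tensor_lift_atensor[symmetric, where H=H] by (simp_all add: atensor_def Let_def)

context hopf_algebra
begin

context
  fixes A :: "('k, 'a, 'h, 'l) hmodule_scheme"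
    and V :: "('k, 'v, 'h, 'a, 'n) hbimodule_scheme" and W :: "('k, 'w, 'h, 'a, 'o) hbimodule_scheme"
  assumes A: "H_module_algebra K H A" and V: "H_bimodule K H A V" and W: "H_bimodule K H A W"
begin

interpretation A: H_module_algebra K H A by (rule A)
interpretation V: H_bimodule K H A V by (rule V)
interpretation W: H_bimodule K H A W by (rule W)
interpretation bp: balanced_pair "carrier A" "ract V" "lact W" V W
  by unfold_locales (auto intro: V.ract_closed W.lact_closed)

lemma apure_closed: "\<lbrakk>v \<in> carrier V; w \<in> carrier W\<rbrakk> \<Longrightarrow> apure A V W v w \<in> carrier (atensor H A V W)"
  unfolding apure_def atensor_sel by (rule bp.pure_closed)

lemma apure_add_left:
  "\<lbrakk>v \<in> carrier V; v' \<in> carrier V; w \<in> carrier W\<rbrakk> \<Longrightarrow>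
   apure A V W (v \<oplus>\<^bsub>V\<^esub> v') w = apure A V W v w \<oplus>\<^bsub>atensor H A V W\<^esub> apure A V W v' w"
  unfolding apure_def atensor_sel by (rule bp.pure_add_left)

lemma apure_add_right:
  "\<lbrakk>v \<in> carrier V; w \<in> carrier W; w' \<in> carrier W\<rbrakk> \<Longrightarrow>
   apure A V W v (w \<oplus>\<^bsub>W\<^esub> w') = apure A V W v w \<oplus>\<^bsub>atensor H A V W\<^esub> apure A V W v w'"
  unfolding apure_def atensor_sel by (rule bp.pure_add_right)

lemma apure_balanced:
  "\<lbrakk>v \<in> carrier V; a \<in> carrier A; w \<in> carrier W\<rbrakk> \<Longrightarrow> apure A V W (ract V v a) w = apure A V W v (lact W a w)"
  unfolding apure_def by (rule bp.pure_balanced)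

lemma atensor_induct [consumes 1, case_names pure add]:
  assumes "t \<in> carrier (atensor H A V W)"
    and "\<And>v w. \<lbrakk>v \<in> carrier V; w \<in> carrier W\<rbrakk> \<Longrightarrow> P (apure A V W v w)"
    and "\<And>s t. \<lbrakk>s \<in> carrier (atensor H A V W); t \<in> carrier (atensor H A V W); P s; P t\<rbrakk> \<Longrightarrow>
      P (s \<oplus>\<^bsub>atensor H A V W\<^esub> t)"
  shows "P t"
  using bp.tensor_induct[of t P] assms unfolding apure_def atensor_sel by blast

lemma balanced_abilinear:
  assumes "abilinear K A V W G b"
  shows "balanced (carrier A) (ract V) (lact W) V W G b"
proof -
  note b = abilinear_kbilinear[OF assms]
  show ?thesis
    using assms klinear_add[OF kbilinear_left[OF b]] klinear_add[OF kbilinear_right[OF b]]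
    unfolding balanced_def abilinear_def by (simp add: kbilinear_closed[OF b])
qed

lemma atensor_abelian_group: "abelian_group (atensor H A V W)"
proof -
  have "\<exists>y\<in>carrier bp.T. y \<oplus>\<^bsub>bp.T\<^esub> x = \<zero>\<^bsub>bp.T\<^esub>" if "x \<in> carrier bp.T" for x
    using that bp.T.l_neg by (intro bexI[of _ "\<ominus>\<^bsub>bp.T\<^esub> x"]) auto
  then show ?thesis
    by (intro abelian_groupI) (simp_all add: atensor_sel bp.T.a_ac)
qed

lemma K_balanced_apure:
  assumes "k \<in> carrier K" "v \<in> carrier V" "w \<in> carrier W"
  shows "apure A V W (k \<odot>\<^bsub>V\<^esub> v) w = apure A V W v (k \<odot>\<^bsub>W\<^esub> w)"
proof -
  \<comment> \<open>Scalars of \<open>K\<close> act through their multiples of the unit of the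
    algebra, to which balancing over the algebra applies.\<close>
  have "k \<odot>\<^bsub>V\<^esub> v = ract V v (k \<odot>\<^bsub>A\<^esub> \<one>\<^bsub>A\<^esub>)" "k \<odot>\<^bsub>W\<^esub> w = lact W (k \<odot>\<^bsub>A\<^esub> \<one>\<^bsub>A\<^esub>) w"
    using assms by (simp_all add: V.ract_smult_right W.lact_smult_left V.ract_unit W.lact_unit)
  then show ?thesis using apure_balanced[of v "k \<odot>\<^bsub>A\<^esub> \<one>\<^bsub>A\<^esub>" w] assms by simp
qed

lemma balanced_apure_smult:
  assumes "k \<in> carrier K"
  shows "balanced (carrier A) (ract V) (lact W) V W (atensor H A V W) (\<lambda>v w. apure A V W (k \<odot>\<^bsub>V\<^esub> v) w)"
  unfolding balanced_def using assms
  by (simp add: apure_closed V.smult_r_distr apure_add_left apure_add_right apure_balanced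
      V.ract_smult_left[symmetric])

lemma atensor_smult_apure:
  "\<lbrakk>k \<in> carrier K; v \<in> carrier V; w \<in> carrier W\<rbrakk> \<Longrightarrow>
   k \<odot>\<^bsub>atensor H A V W\<^esub> apure A V W v w = apure A V W (k \<odot>\<^bsub>V\<^esub> v) w"
  unfolding atensor_ops(1)
  using bp.tensor_lift_pure[OF atensor_abelian_group balanced_apure_smult, folded apure_def] by simp

lemma module_atensor: "module K (atensor H A V W)"
proof -
  let ?T = "atensor H A V W"
  interpret T: abelian_group ?T by (rule atensor_abelian_group)
  have cl: "k \<odot>\<^bsub>?T\<^esub> t \<in> carrier ?T" if "k \<in> carrier K" "t \<in> carrier ?T" for k t
    using bp.tensor_lift_closed[OF atensor_abelian_group balanced_apure_smult[OF that(1)]] that(2)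
    unfolding atensor_ops(1) atensor_sel by simp
  have ad: "k \<odot>\<^bsub>?T\<^esub> (s \<oplus>\<^bsub>?T\<^esub> t) = k \<odot>\<^bsub>?T\<^esub> s \<oplus>\<^bsub>?T\<^esub> k \<odot>\<^bsub>?T\<^esub> t"
    if "k \<in> carrier K" "s \<in> carrier ?T" "t \<in> carrier ?T" for k s t
    using bp.tensor_lift_add[OF atensor_abelian_group balanced_apure_smult[OF that(1)]] that(2,3)
    unfolding atensor_ops(1) atensor_sel by simp
  note pu = atensor_smult_apure
  show ?thesis
  proof (rule moduleI)
    fix k l t assume kl: "k \<in> carrier K" "l \<in> carrier K" and t: "t \<in> carrier ?T"
    show "(k \<oplus>\<^bsub>K\<^esub> l) \<odot>\<^bsub>?T\<^esub> t = k \<odot>\<^bsub>?T\<^esub> t \<oplus>\<^bsub>?T\<^esub> l \<odot>\<^bsub>?T\<^esub> t"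
      using t
    proof (induction t rule: atensor_induct)
      case (pure v w)
      then show ?case using kl by (simp add: pu V.smult_l_distr apure_add_left)
    next
      case (add s t)
      have "(k \<oplus>\<^bsub>K\<^esub> l) \<odot>\<^bsub>?T\<^esub> (s \<oplus>\<^bsub>?T\<^esub> t) = (k \<odot>\<^bsub>?T\<^esub> s \<oplus>\<^bsub>?T\<^esub> l \<odot>\<^bsub>?T\<^esub> s) \<oplus>\<^bsub>?T\<^esub> (k \<odot>\<^bsub>?T\<^esub> t \<oplus>\<^bsub>?T\<^esub> l \<odot>\<^bsub>?T\<^esub> t)"
        using add kl by (simp add: ad)
      then show ?case using add kl by (simp add: ad cl T.a_ac)
    qed
    show "(k \<otimes>\<^bsub>K\<^esub> l) \<odot>\<^bsub>?T\<^esub> t = k \<odot>\<^bsub>?T\<^esub> (l \<odot>\<^bsub>?T\<^esub> t)"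
      using t
    proof (induction t rule: atensor_induct)
      case (pure v w)
      then show ?case using kl by (simp add: pu V.smult_assoc1)
    next
      case (add s t)
      then show ?case using kl by (simp add: ad cl)
    qed
  next
    show "\<one>\<^bsub>K\<^esub> \<odot>\<^bsub>?T\<^esub> t = t" if "t \<in> carrier ?T" for t
      using that
    proof (induction t rule: atensor_induct)
      case (pure v w)
      then show ?case by (simp add: pu)
    next
      case (add s t)
      then show ?case by (simp add: ad)
    qed
  qed (rule R.cring_axioms T.abelian_group_axioms cl ad; assumption?)+
qed

lemma abilinear_apure: "abilinear K A V W (atensor H A V W) (apure A V W)"
  unfolding abilinear_def
  by (intro conjI kbilinearI klinearI module_atensor V.module_axioms W.module_axioms ballI apure_balanced)
    (simp_all add: apure_closed apure_add_left apure_add_right atensor_smult_apure K_balanced_apure)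

lemma alift_apure:
  "\<lbrakk>abilinear K A V W G b; v \<in> carrier V; w \<in> carrier W\<rbrakk> \<Longrightarrow> tensor_lift G b (apure A V W v w) = b v w"
  unfolding apure_def
  by (rule bp.tensor_lift_pure) (auto intro: balanced_abilinear module_abelian kbilinear_module[OF abilinear_kbilinear])

lemma klinear_alift:
  assumes b: "abilinear K A V W G b"
  shows "klinear K (atensor H A V W) G (tensor_lift G b)"
proof -
  note bk = abilinear_kbilinear[OF b]
  interpret T: module K "atensor H A V W" by (rule module_atensor)
  interpret G: module K G by (rule kbilinear_module[OF bk])
  have cl: "tensor_lift G b t \<in> carrier G" if "t \<in> carrier (atensor H A V W)" for t
    using bp.tensor_lift_closed[OF G.M.abelian_group_axioms balanced_abilinear[OF b]] that
    unfolding atensor_sel by simp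
  have ad: "tensor_lift G b (s \<oplus>\<^bsub>atensor H A V W\<^esub> t) = tensor_lift G b s \<oplus>\<^bsub>G\<^esub> tensor_lift G b t"
    if "s \<in> carrier (atensor H A V W)" "t \<in> carrier (atensor H A V W)" for s t
    using bp.tensor_lift_add[OF G.M.abelian_group_axioms balanced_abilinear[OF b]] that
    unfolding atensor_sel by simp
  have "tensor_lift G b (k \<odot>\<^bsub>atensor H A V W\<^esub> t) = k \<odot>\<^bsub>G\<^esub> tensor_lift G b t"
    if k: "k \<in> carrier K" and t: "t \<in> carrier (atensor H A V W)" for k t
    using t
  proof (induction t rule: atensor_induct)
    case (pure v w)
    then show ?case
      using k klinear_smult[OF kbilinear_left[OF bk]] by (simp add: atensor_smult_apure alift_apure[OF b])
  next
    case (add s t)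
    then show ?case using k by (simp add: T.smult_r_distr ad cl G.smult_r_distr)
  qed
  then show ?thesis by (intro klinearI T.module_axioms G.module_axioms cl ad)
qed

lemma klinear_atensor_eqI:
  assumes f: "klinear K (atensor H A V W) G f" and g: "klinear K (atensor H A V W) G g"
    and eq: "\<And>v w. \<lbrakk>v \<in> carrier V; w \<in> carrier W\<rbrakk> \<Longrightarrow> f (apure A V W v w) = g (apure A V W v w)"
    and t: "t \<in> carrier (atensor H A V W)"
  shows "f t = g t"
  using t by (induction t rule: atensor_induct) (simp_all add: eq klinear_add[OF f] klinear_add[OF g])

text \<open>Linearity in the parameter need only be checked at pure tensors, since a pointwise sum
  of linear maps is linear.\<close>

lemma kbilinear_atensorI:
  assumes Y: "module K Y" and f: "\<And>y. y \<in> carrier Y \<Longrightarrow> klinear K (atensor H A V W) G (f y)"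
    and pure: "\<And>v w. \<lbrakk>v \<in> carrier V; w \<in> carrier W\<rbrakk> \<Longrightarrow> klinear K Y G (\<lambda>y. f y (apure A V W v w))"
  shows "kbilinear K Y (atensor H A V W) G f"
proof -
  interpret Y: module K Y by (rule Y)
  interpret G: module K G by (rule klinear_module(2)[OF f[OF Y.M.zero_closed]])
  have "klinear K Y G (\<lambda>y. f y t)" if "t \<in> carrier (atensor H A V W)" for t
    using that
  proof (induction t rule: atensor_induct)
    case (pure v w)
    then show ?case by (rule assms(3))
  next
    case (add s t)
    have "klinear K Y G (\<lambda>y. f y s \<oplus>\<^bsub>G\<^esub> f y t)" by (rule klinear_add_fun[OF add(3,4)])
    then show ?case
      using klinear_add[OF f] add(1,2) unfolding klinear_def linear_map_def
      by (simp add: Pi_iff)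
  qed
  then show ?thesis by (intro kbilinearI Y module_atensor G.module_axioms f)
qed

lemmas apure_rules = kbilinear_rules[OF abilinear_kbilinear[OF abilinear_apure]]
lemmas aeqV = H_bimodule_equivariant[OF A V] and aeqW = H_bimodule_equivariant[OF A W]
lemmas at_rules = apure_rules kbilinear_rules[OF equivariant_kbilinear[OF aeqV(1)]]
  kbilinear_rules[OF equivariant_kbilinear[OF aeqV(2)]]
  kbilinear_rules[OF equivariant_kbilinear[OF aeqW(1)]] kbilinear_rules[OF equivariant_kbilinear[OF aeqW(2)]]
  act_rules[OF V.H_module_axioms] act_rules[OF W.H_module_axioms] act_rules[OF A.H_module_axioms]
  module_atensor hopf_lin

text \<open>This makes the diagonal action well defined: coassociativity lets the leg of the
  coproduct that acts on \<open>a\<close> pass from the left factor to the right one.\<close>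

lemma abilinear_act:
  assumes xi: "\<xi> \<in> carrier H"
  shows "abilinear K A V W (atensor H A V W)
    (\<lambda>v w. tensor_lift (atensor H A V W) (\<lambda>x y. apure A V W (act V x v) (act W y w)) (comult H \<xi>))"
  unfolding abilinear_def
proof (intro conjI ballI)
  let ?T = "atensor H A V W"
  show "kbilinear K V W ?T (\<lambda>v w. tensor_lift ?T (\<lambda>x y. apure A V W (act V x v) (act W y w)) (comult H \<xi>))"
    by (assumption | rule at_rules xi)+
  fix v a w assume v: "v \<in> carrier V" and a: "a \<in> carrier A" and w: "w \<in> carrier W"
  have "tensor_lift ?T (\<lambda>x y. apure A V W (act V x (ract V v a)) (act W y w)) (comult H \<xi>) =
    tensor_lift ?T (\<lambda>x y. tensor_lift ?T (\<lambda>p q. apure A V W (ract V (act V p v) (act A q a)) (act W y w)) (comult H x)) (comult H \<xi>)"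
  proof (rule liftH_cong[OF comult_closed[OF xi]])
    fix x y assume xy: "x \<in> carrier H" "y \<in> carrier H"
    show "apure A V W (act V x (ract V v a)) (act W y w) =
      tensor_lift ?T (\<lambda>p q. apure A V W (ract V (act V p v) (act A q a)) (act W y w)) (comult H x)"
      unfolding V.act_ract[OF xy(1) a v]
      by (rule lift_hom[where f="\<lambda>v. apure A V W v (act W y w)"]) (assumption | rule at_rules xi v a w xy)+
  qed
  also have "\<dots> = tensor_lift ?T (\<lambda>x y. tensor_lift ?T (\<lambda>p q. apure A V W (act V p v) (lact W (act A q a) (act W y w))) (comult H x)) (comult H \<xi>)"
    by (intro liftH_cong comult_closed xi apure_balanced V.act_closed W.act_closed A.act_closed v a w)
  also have "\<dots> = tensor_lift ?T (\<lambda>x y. tensor_lift ?T (\<lambda>p q. apure A V W (act V x v) (lact W (act A p a) (act W q w))) (comult H y)) (comult H \<xi>)"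
    by (rule lift_coassoc[OF xi]) (assumption | rule at_rules v a w)+
  also have "\<dots> = tensor_lift ?T (\<lambda>x y. apure A V W (act V x v) (act W y (lact W a w))) (comult H \<xi>)"
  proof (rule liftH_cong[OF comult_closed[OF xi]])
    fix x y assume xy: "x \<in> carrier H" "y \<in> carrier H"
    show "tensor_lift ?T (\<lambda>p q. apure A V W (act V x v) (lact W (act A p a) (act W q w))) (comult H y) =
       apure A V W (act V x v) (act W y (lact W a w))"
      unfolding W.act_lact[OF xy(2) a w]
      by (rule lift_hom[where f="\<lambda>w. apure A V W (act V x v) w", symmetric]) (assumption | rule at_rules xi v a w xy)+
  qed
  finally show "tensor_lift ?T (\<lambda>x y. apure A V W (act V x (ract V v a)) (act W y w)) (comult H \<xi>) =
    tensor_lift ?T (\<lambda>x y. apure A V W (act V x v) (act W y (lact W a w))) (comult H \<xi>)" .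
qed

lemma abilinear_lact:
  assumes "a \<in> carrier A"
  shows "abilinear K A V W (atensor H A V W) (\<lambda>v w. apure A V W (lact V a v) w)"
proof -
  have "kbilinear K V W (atensor H A V W) (\<lambda>v w. apure A V W (lact V a v) w)"
    by (assumption | rule at_rules assms)+
  then show ?thesis
    unfolding abilinear_def using assms by (simp add: V.lact_ract[symmetric] apure_balanced V.lact_closed)
qed

lemma abilinear_ract:
  assumes "a \<in> carrier A"
  shows "abilinear K A V W (atensor H A V W) (\<lambda>v w. apure A V W v (ract W w a))"
proof -
  have "kbilinear K V W (atensor H A V W) (\<lambda>v w. apure A V W v (ract W w a))"
    by (assumption | rule at_rules assms)+
  then show ?thesis
    unfolding abilinear_def using assms by (simp add: W.lact_ract apure_balanced W.ract_closed)
qed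

lemma act_apure:
  "\<lbrakk>\<xi> \<in> carrier H; v \<in> carrier V; w \<in> carrier W\<rbrakk> \<Longrightarrow> act (atensor H A V W) \<xi> (apure A V W v w) =
    tensor_lift (atensor H A V W) (\<lambda>x y. apure A V W (act V x v) (act W y w)) (comult H \<xi>)"
  unfolding atensor_ops by (rule alift_apure[OF abilinear_act])

lemma lact_apure:
  "\<lbrakk>a \<in> carrier A; v \<in> carrier V; w \<in> carrier W\<rbrakk> \<Longrightarrow>
   lact (atensor H A V W) a (apure A V W v w) = apure A V W (lact V a v) w"
  unfolding atensor_ops by (rule alift_apure[OF abilinear_lact])

lemma ract_apure:
  "\<lbrakk>a \<in> carrier A; v \<in> carrier V; w \<in> carrier W\<rbrakk> \<Longrightarrow>
   ract (atensor H A V W) (apure A V W v w) a = apure A V W v (ract W w a)"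
  unfolding atensor_ops by (rule alift_apure[OF abilinear_ract])

lemma kbilinear_atensor_act: "kbilinear K H (atensor H A V W) (atensor H A V W) (act (atensor H A V W))"
proof (rule kbilinear_atensorI[OF module_axioms])
  show "klinear K (atensor H A V W) (atensor H A V W) (act (atensor H A V W) \<xi>)" if "\<xi> \<in> carrier H" for \<xi>
    unfolding atensor_ops[abs_def] by (rule klinear_alift[OF abilinear_act[OF that]])
  fix v w assume vw: "v \<in> carrier V" "w \<in> carrier W"
  have "klinear K H (atensor H A V W)
      (\<lambda>\<xi>. tensor_lift (atensor H A V W) (\<lambda>x y. apure A V W (act V x v) (act W y w)) (comult H \<xi>))"
    by (assumption | rule at_rules vw)+
  then show "klinear K H (atensor H A V W) (\<lambda>\<xi>. act (atensor H A V W) \<xi> (apure A V W v w))"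
    unfolding klinear_def linear_map_def by (simp add: act_apure vw Pi_iff)
qed

lemma kbilinear_atensor_lact: "kbilinear K A (atensor H A V W) (atensor H A V W) (lact (atensor H A V W))"
proof (rule kbilinear_atensorI[OF A.module_axioms])
  show "klinear K (atensor H A V W) (atensor H A V W) (lact (atensor H A V W) a)" if "a \<in> carrier A" for a
    unfolding atensor_ops[abs_def] by (rule klinear_alift[OF abilinear_lact[OF that]])
  fix v w assume vw: "v \<in> carrier V" "w \<in> carrier W"
  have "klinear K A (atensor H A V W) (\<lambda>a. apure A V W (lact V a v) w)"
    by (assumption | rule at_rules vw)+
  then show "klinear K A (atensor H A V W) (\<lambda>a. lact (atensor H A V W) a (apure A V W v w))"
    unfolding klinear_def linear_map_def by (simp add: lact_apure vw Pi_iff)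
qed

lemma kbilinear_atensor_ract: "kbilinear K (atensor H A V W) A (atensor H A V W) (ract (atensor H A V W))"
proof -
  have "kbilinear K A (atensor H A V W) (atensor H A V W) (\<lambda>a t. ract (atensor H A V W) t a)"
  proof (rule kbilinear_atensorI[OF A.module_axioms])
    show "klinear K (atensor H A V W) (atensor H A V W) (\<lambda>t. ract (atensor H A V W) t a)" if "a \<in> carrier A" for a
      unfolding atensor_ops[abs_def] by (rule klinear_alift[OF abilinear_ract[OF that]])
    fix v w assume vw: "v \<in> carrier V" "w \<in> carrier W"
    have "klinear K A (atensor H A V W) (\<lambda>a. apure A V W v (ract W w a))"
      by (assumption | rule at_rules vw)+
    then show "klinear K A (atensor H A V W) (\<lambda>a. ract (atensor H A V W) (apure A V W v w) a)"
      unfolding klinear_def linear_map_def by (simp add: ract_apure vw Pi_iff)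
  qed
  then show ?thesis unfolding kbilinear_def by simp
qed

lemmas atensor_rules = kbilinear_rules[OF kbilinear_atensor_act] kbilinear_rules[OF kbilinear_atensor_lact]
  kbilinear_rules[OF kbilinear_atensor_ract] at_rules

text \<open>Multiplicativity of the coproduct yields a double sum with \<open>\<xi>\<close> outside,
  whereas the composite action has \<open>\<zeta>\<close> outside; hence the exchange of
  summations.\<close>

lemma H_module_atensor: "H_module K H (atensor H A V W)"
proof -
  let ?T = "atensor H A V W"
  note D = klinearD[OF kbilinear_left[OF kbilinear_atensor_act]] klinearD[OF kbilinear_right[OF kbilinear_atensor_act]]
  have "act ?T (\<xi> \<otimes> \<zeta>) t = act ?T \<xi> (act ?T \<zeta> t)"
    if xz: "\<xi> \<in> carrier H" "\<zeta> \<in> carrier H" and t: "t \<in> carrier ?T" for \<xi> \<zeta> t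
  proof (rule klinear_atensor_eqI[OF _ _ _ t, where f="\<lambda>t. act ?T (\<xi> \<otimes> \<zeta>) t" and g="\<lambda>t. act ?T \<xi> (act ?T \<zeta> t)"])
    fix v w assume vw: "v \<in> carrier V" "w \<in> carrier W"
    have b: "kbilinear K H H ?T (\<lambda>x y. apure A V W (act V x v) (act W y w))" by (assumption | rule at_rules vw)+
    have "act ?T (\<xi> \<otimes> \<zeta>) (apure A V W v w) = tensor_lift ?T (\<lambda>x y. tensor_lift ?T (\<lambda>x' y'.
        apure A V W (act V (x \<otimes> x') v) (act W (y \<otimes> y') w)) (comult H \<zeta>)) (comult H \<xi>)"
      unfolding act_apure[OF m_closed[OF xz] vw] comult_mult[OF xz]
      by (rule HH.lift_mult[OF comult_closed comult_closed b]) (rule xz)+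
    also have "\<dots> = tensor_lift ?T (\<lambda>x y. tensor_lift ?T (\<lambda>x' y'.
        apure A V W (act V x (act V x' v)) (act W y (act W y' w))) (comult H \<zeta>)) (comult H \<xi>)"
      by (intro liftH_cong comult_closed xz) (simp_all add: V.act_assoc W.act_assoc vw)
    also have "\<dots> = tensor_lift ?T (\<lambda>x' y'. tensor_lift ?T (\<lambda>x y.
        apure A V W (act V x (act V x' v)) (act W y (act W y' w))) (comult H \<xi>)) (comult H \<zeta>)"
      by (rule lift_swap) (assumption | rule at_rules vw xz)+
    also have "\<dots> = tensor_lift ?T (\<lambda>x' y'. act ?T \<xi> (apure A V W (act V x' v) (act W y' w))) (comult H \<zeta>)"
      by (intro liftH_cong comult_closed xz) (simp_all add: act_apure V.act_closed W.act_closed vw xz)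
    also have "\<dots> = act ?T \<xi> (act ?T \<zeta> (apure A V W v w))"
      unfolding act_apure[OF xz(2) vw]
      by (rule lift_hom[where f="\<lambda>t. act ?T \<xi> t", symmetric]) (assumption | rule atensor_rules vw xz)+
    finally show "act ?T (\<xi> \<otimes> \<zeta>) (apure A V W v w) = act ?T \<xi> (act ?T \<zeta> (apure A V W v w))" .
  qed (assumption | rule atensor_rules xz)+
  moreover have "act ?T \<one> t = t" if t: "t \<in> carrier ?T" for t
  proof (rule klinear_atensor_eqI[OF _ _ _ t, where f="\<lambda>t. act ?T \<one> t" and g="\<lambda>t. t"])
    fix v w assume vw: "v \<in> carrier V" "w \<in> carrier W"
    have b: "kbilinear K H H ?T (\<lambda>x y. apure A V W (act V x v) (act W y w))" by (assumption | rule at_rules vw)+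
    show "act ?T \<one> (apure A V W v w) = apure A V W v w"
      unfolding act_apure[OF one_closed vw] comult_one ktensor_one
      by (simp add: lift_kpure[OF b] V.act_unit W.act_unit vw)
  qed (assumption | rule atensor_rules)+
  ultimately show ?thesis
    unfolding H_module_def H_module_axioms_def using module_atensor D by simp
qed

lemma equivariant_apure: "equivariant K H V W (atensor H A V W) (apure A V W)"
  unfolding equivariant_def
  using V.H_module_axioms W.H_module_axioms H_module_atensor act_apure
    abilinear_kbilinear[OF abilinear_apure] by simp

text \<open>On one side \<open>a\<close> and \<open>v\<close> share the first leg of the coproduct,
  on the other side \<open>v\<close> and \<open>w\<close> share the second; coassociativity
  identifies the two splittings.\<close>

lemma equivariant_atensor_lact: "equivariant K H A (atensor H A V W) (atensor H A V W) (lact (atensor H A V W))"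
proof -
  let ?T = "atensor H A V W"
  have "act ?T \<xi> (lact ?T a t) = tensor_lift ?T (\<lambda>p q. lact ?T (act A p a) (act ?T q t)) (comult H \<xi>)"
    if xi: "\<xi> \<in> carrier H" and a: "a \<in> carrier A" and t: "t \<in> carrier ?T" for \<xi> a t
  proof (rule klinear_atensor_eqI[OF _ _ _ t, where f="\<lambda>t. act ?T \<xi> (lact ?T a t)"
        and g="\<lambda>t. tensor_lift ?T (\<lambda>p q. lact ?T (act A p a) (act ?T q t)) (comult H \<xi>)"])
    fix v w assume v: "v \<in> carrier V" and w: "w \<in> carrier W"
    have "act ?T \<xi> (lact ?T a (apure A V W v w)) =
        tensor_lift ?T (\<lambda>x y. apure A V W (act V x (lact V a v)) (act W y w)) (comult H \<xi>)"
      by (simp add: lact_apure a v w act_apure xi V.lact_closed)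
    also have "\<dots> = tensor_lift ?T (\<lambda>x y. tensor_lift ?T (\<lambda>p q. apure A V W (lact V (act A p a) (act V q v)) (act W y w)) (comult H x)) (comult H \<xi>)"
    proof (rule liftH_cong[OF comult_closed[OF xi]])
      fix x y assume xy: "x \<in> carrier H" "y \<in> carrier H"
      show "apure A V W (act V x (lact V a v)) (act W y w) =
        tensor_lift ?T (\<lambda>p q. apure A V W (lact V (act A p a) (act V q v)) (act W y w)) (comult H x)"
        unfolding V.act_lact[OF xy(1) a v]
        by (rule lift_hom[where f="\<lambda>v. apure A V W v (act W y w)"]) (assumption | rule at_rules v a w xy)+
    qed
    also have "\<dots> = tensor_lift ?T (\<lambda>x y. tensor_lift ?T (\<lambda>p q. apure A V W (lact V (act A x a) (act V p v)) (act W q w)) (comult H y)) (comult H \<xi>)"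
      by (rule lift_coassoc[OF xi]) (assumption | rule at_rules v a w)+
    also have "\<dots> = tensor_lift ?T (\<lambda>x y. lact ?T (act A x a) (act ?T y (apure A V W v w))) (comult H \<xi>)"
    proof (rule liftH_cong[OF comult_closed[OF xi]])
      fix x y assume xy: "x \<in> carrier H" "y \<in> carrier H"
      have "lact ?T (act A x a) (act ?T y (apure A V W v w)) =
        tensor_lift ?T (\<lambda>p q. lact ?T (act A x a) (apure A V W (act V p v) (act W q w))) (comult H y)"
        unfolding act_apure[OF xy(2) v w]
        by (rule lift_hom[where f="\<lambda>t. lact ?T (act A x a) t"]) (assumption | rule atensor_rules v a w xy)+
      also have "\<dots> = tensor_lift ?T (\<lambda>p q. apure A V W (lact V (act A x a) (act V p v)) (act W q w)) (comult H y)"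
        by (intro liftH_cong comult_closed lact_apure V.act_closed W.act_closed A.act_closed xy a v w)
      finally show "tensor_lift ?T (\<lambda>p q. apure A V W (lact V (act A x a) (act V p v)) (act W q w)) (comult H y) =
        lact ?T (act A x a) (act ?T y (apure A V W v w))" ..
    qed
    finally show "act ?T \<xi> (lact ?T a (apure A V W v w)) =
      tensor_lift ?T (\<lambda>p q. lact ?T (act A p a) (act ?T q (apure A V W v w))) (comult H \<xi>)" .
  qed (assumption | rule atensor_rules xi a)+
  then show ?thesis
    unfolding equivariant_def using A.H_module_axioms H_module_atensor kbilinear_atensor_lact by simp
qed

lemma equivariant_atensor_ract: "equivariant K H (atensor H A V W) A (atensor H A V W) (ract (atensor H A V W))"
proof -
  let ?T = "atensor H A V W"
  have "act ?T \<xi> (ract ?T t a) = tensor_lift ?T (\<lambda>p q. ract ?T (act ?T p t) (act A q a)) (comult H \<xi>)"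
    if xi: "\<xi> \<in> carrier H" and a: "a \<in> carrier A" and t: "t \<in> carrier ?T" for \<xi> a t
  proof (rule klinear_atensor_eqI[OF _ _ _ t, where f="\<lambda>t. act ?T \<xi> (ract ?T t a)"
        and g="\<lambda>t. tensor_lift ?T (\<lambda>p q. ract ?T (act ?T p t) (act A q a)) (comult H \<xi>)"])
    fix v w assume v: "v \<in> carrier V" and w: "w \<in> carrier W"
    have "act ?T \<xi> (ract ?T (apure A V W v w) a) =
        tensor_lift ?T (\<lambda>x y. apure A V W (act V x v) (act W y (ract W w a))) (comult H \<xi>)"
      by (simp add: ract_apure a v w act_apure xi W.ract_closed)
    also have "\<dots> = tensor_lift ?T (\<lambda>x y. tensor_lift ?T (\<lambda>p q. apure A V W (act V x v) (ract W (act W p w) (act A q a))) (comult H y)) (comult H \<xi>)"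
    proof (rule liftH_cong[OF comult_closed[OF xi]])
      fix x y assume xy: "x \<in> carrier H" "y \<in> carrier H"
      show "apure A V W (act V x v) (act W y (ract W w a)) =
        tensor_lift ?T (\<lambda>p q. apure A V W (act V x v) (ract W (act W p w) (act A q a))) (comult H y)"
        unfolding W.act_ract[OF xy(2) a w]
        by (rule lift_hom[where f="\<lambda>w. apure A V W (act V x v) w"]) (assumption | rule at_rules v a w xy)+
    qed
    also have "\<dots> = tensor_lift ?T (\<lambda>x y. tensor_lift ?T (\<lambda>p q. apure A V W (act V p v) (ract W (act W q w) (act A y a))) (comult H x)) (comult H \<xi>)"
      by (rule lift_coassoc[OF xi, symmetric]) (assumption | rule at_rules v a w)+
    also have "\<dots> = tensor_lift ?T (\<lambda>x y. ract ?T (act ?T x (apure A V W v w)) (act A y a)) (comult H \<xi>)"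
    proof (rule liftH_cong[OF comult_closed[OF xi]])
      fix x y assume xy: "x \<in> carrier H" "y \<in> carrier H"
      have "ract ?T (act ?T x (apure A V W v w)) (act A y a) =
        tensor_lift ?T (\<lambda>p q. ract ?T (apure A V W (act V p v) (act W q w)) (act A y a)) (comult H x)"
        unfolding act_apure[OF xy(1) v w]
        by (rule lift_hom[where f="\<lambda>t. ract ?T t (act A y a)"]) (assumption | rule atensor_rules v a w xy)+
      also have "\<dots> = tensor_lift ?T (\<lambda>p q. apure A V W (act V p v) (ract W (act W q w) (act A y a))) (comult H x)"
        by (intro liftH_cong comult_closed ract_apure V.act_closed W.act_closed A.act_closed xy a v w)
      finally show "tensor_lift ?T (\<lambda>p q. apure A V W (act V p v) (ract W (act W q w) (act A y a))) (comult H x) =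
        ract ?T (act ?T x (apure A V W v w)) (act A y a)" ..
    qed
    finally show "act ?T \<xi> (ract ?T (apure A V W v w) a) =
      tensor_lift ?T (\<lambda>p q. ract ?T (act ?T p (apure A V W v w)) (act A q a)) (comult H \<xi>)" .
  qed (assumption | rule atensor_rules xi a)+
  then show ?thesis
    unfolding equivariant_def using A.H_module_axioms H_module_atensor kbilinear_atensor_ract by simp
qed

lemma H_bimodule_atensor: "H_bimodule K H A (atensor H A V W)"
proof (rule H_bimoduleI[OF equivariant_atensor_lact equivariant_atensor_ract])
  let ?T = "atensor H A V W"
  fix t assume t: "t \<in> carrier ?T"
  note eqI = klinear_atensor_eqI[OF _ _ _ t, where G="?T"]
  show "lact ?T \<one>\<^bsub>A\<^esub> t = t"
    by (rule eqI[where f="\<lambda>t. lact ?T \<one>\<^bsub>A\<^esub> t" and g="\<lambda>t. t"])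
      (simp add: lact_apure V.lact_unit | (assumption | rule atensor_rules A.one_closed)+)+
  show "ract ?T t \<one>\<^bsub>A\<^esub> = t"
    by (rule eqI[where f="\<lambda>t. ract ?T t \<one>\<^bsub>A\<^esub>" and g="\<lambda>t. t"])
      (simp add: ract_apure W.ract_unit | (assumption | rule atensor_rules A.one_closed)+)+
  fix a b assume ab: "a \<in> carrier A" "b \<in> carrier A"
  show "lact ?T (a \<otimes>\<^bsub>A\<^esub> b) t = lact ?T a (lact ?T b t)"
    by (rule eqI[where f="\<lambda>t. lact ?T (a \<otimes>\<^bsub>A\<^esub> b) t" and g="\<lambda>t. lact ?T a (lact ?T b t)"])
      (simp add: lact_apure V.lact_assoc V.lact_closed ab | (assumption | rule atensor_rules A.m_closed ab)+)+
  show "ract ?T t (a \<otimes>\<^bsub>A\<^esub> b) = ract ?T (ract ?T t a) b"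
    by (rule eqI[where f="\<lambda>t. ract ?T t (a \<otimes>\<^bsub>A\<^esub> b)" and g="\<lambda>t. ract ?T (ract ?T t a) b"])
      (simp add: ract_apure W.ract_assoc W.ract_closed ab | (assumption | rule atensor_rules A.m_closed ab)+)+
  show "ract ?T (lact ?T a t) b = lact ?T a (ract ?T t b)"
    by (rule eqI[where f="\<lambda>t. ract ?T (lact ?T a t) b" and g="\<lambda>t. lact ?T a (ract ?T t b)"])
      (simp add: ract_apure lact_apure V.lact_closed W.ract_closed ab | (assumption | rule atensor_rules ab)+)+
qed

end

end


section \<open>The quantization maps\<close>

text \<open>The deforming tensor is a parameter, instead of being the inverse of a given twist, so
  that the map in the opposite direction is an instance as well.\<close>

definition qmap ::
    "'k ring \<Rightarrow> ('k, 'h, 'o) hopf_algebra_scheme \<Rightarrow> ('h, 'h) tensor \<Rightarrow>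
     ('k, 'v, 'h, 'a, 'm) hbimodule_scheme \<Rightarrow> ('k, 'w, 'h, 'a, 'n) hbimodule_scheme \<Rightarrow>
     ('v \<Rightarrow> 'w) \<Rightarrow> ('v \<Rightarrow> 'w)" where
  "qmap K H G V W P = (\<lambda>v\<in>carrier V. star_op G (hom_K K H V W) V W (\<lambda>P. P) P v)"

definition phimap ::
    "('k, 'h, 'o) hopf_algebra_scheme \<Rightarrow> ('h, 'h) tensor \<Rightarrow>
     ('k, 'a, 'h, 'l) hmodule_scheme \<Rightarrow> ('k, 'v, 'h, 'a, 'm) hbimodule_scheme \<Rightarrow>
     ('k, 'w, 'h, 'a, 'n) hbimodule_scheme \<Rightarrow> ('v, 'w) tensor \<Rightarrow> ('v, 'w) tensor" where
  "phimap H G A V W = tensor_lift (atensor H A V W) (star_op G V W (atensor H A V W) (apure A V W))"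

lemma quant_map_qmap: "quant_map K H F V W = qmap K H (twist_inv K H F) V W"
  unfolding quant_map_def[abs_def] qmap_def[abs_def] star_op_def ..

lemma phi_phimap: "phi K H F A V W = phimap H (twist_inv K H F) A V W"
  unfolding phi_def phimap_def star_op_def ..

lemma lift3_add_fun:
  assumes b: "ktrilinear K X Y Z G b" and b': "ktrilinear K X Y Z G b'"
    and t: "t \<in> carrier (ktensor K (ktensor K X Y) Z)"
  shows "lift3 G (\<lambda>x y z. b x y z \<oplus>\<^bsub>G\<^esub> b' x y z) t = lift3 G b t \<oplus>\<^bsub>G\<^esub> lift3 G b' t"
proof -
  note m = ktrilinear_module[OF b]
  have "lift3 G (\<lambda>x y z. b x y z \<oplus>\<^bsub>G\<^esub> b' x y z) t =
    tensor_lift G (\<lambda>s z. tensor_lift G (\<lambda>x y. b x y z) s \<oplus>\<^bsub>G\<^esub> tensor_lift G (\<lambda>x y. b' x y z) s) t"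
    unfolding lift3_def
    by (intro lift_cong[OF ktensor_module[OF m(1,2)] m(3) t] lift_add_fun)
      (assumption | rule ktrilinear_kbilinear(1)[OF b] ktrilinear_kbilinear(1)[OF b'])+
  also have "\<dots> = lift3 G b t \<oplus>\<^bsub>G\<^esub> lift3 G b' t"
    unfolding lift3_def by (rule lift_add_fun[OF kbilinear_lift3[OF b] kbilinear_lift3[OF b'] t])
  finally show ?thesis .
qed

definition trivial_hmodule :: "'k ring \<Rightarrow> ('k, 'h, 'm) hopf_algebra_scheme \<Rightarrow> ('k, 'k, 'h) hmodule" where
  "trivial_hmodule K H = \<lparr>carrier = carrier K, mult = undefined, one = undefined, ring.zero = \<zero>\<^bsub>K\<^esub>,
     add = add K, smult = mult K, act = (\<lambda>\<xi> k. counit H \<xi> \<otimes>\<^bsub>K\<^esub> k)\<rparr>"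

context hopf_algebra
begin

lemma H_module_trivial: "H_module K H (trivial_hmodule K H)"
proof -
  have "abelian_group (trivial_hmodule K H)"
    using R.l_neg by (intro abelian_groupI) (auto simp: trivial_hmodule_def R.a_ac intro!: bexI[of _ "\<ominus>\<^bsub>K\<^esub> _"])
  then have "module K (trivial_hmodule K H)"
    by (intro moduleI R.cring_axioms) (simp_all add: trivial_hmodule_def R.l_distr R.r_distr R.m_assoc)
  then show ?thesis
    unfolding H_module_def H_module_axioms_def
    by (simp add: trivial_hmodule_def counit_closed counit_add counit_smult counit_mult counit_one
        R.l_distr R.r_distr R.m_ac)
qed

lemma kbilinear_smult:
  assumes "module K W" shows "kbilinear K (trivial_hmodule K H) W W (smult W)"
proof -
  interpret W: module K W by fact
  interpret T: H_module K H "trivial_hmodule K H" by (rule H_module_trivial)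
  show ?thesis
    by (intro kbilinearI klinearI T.module_axioms W.module_axioms)
      (simp_all add: trivial_hmodule_def W.smult_l_distr W.smult_r_distr W.smult_assoc1[symmetric] R.m_comm)
qed

end

context twist_pair
begin

text \<open>The factor \<open>\<epsilon>(p)\<close> is regarded as the action of \<open>p\<close> on \<open>1\<close> in the trivial module.\<close>

lemma star_op_smult:
  assumes B: "equivariant K H Y Z W B" and yz: "y \<in> carrier Y" "z \<in> carrier Z"
  shows "lift3 W (\<lambda>p q r. counit H p \<odot>\<^bsub>W\<^esub> B (act Y q y) (act Z r z)) Phi = star_op G Y Z W B y z"
proof -
  let ?K = "trivial_hmodule K H"
  interpret W: H_module K H W by (rule equivariant_module[OF B])
  note sm = H.kbilinear_smult[OF W.module_axioms]
  have one: "\<one>\<^bsub>K\<^esub> \<in> carrier ?K" by (simp add: trivial_hmodule_def)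
  have "star_op G ?K W W (smult W) \<one>\<^bsub>K\<^esub> (star_op G Y Z W B y z) =
    lift3 W (\<lambda>p q r. act ?K p \<one>\<^bsub>K\<^esub> \<odot>\<^bsub>W\<^esub> B (act Y q y) (act Z r z)) Phi"
    by (rule star_right[OF B sm H.H_module_trivial one yz])
  also have "\<dots> = lift3 W (\<lambda>p q r. counit H p \<odot>\<^bsub>W\<^esub> B (act Y q y) (act Z r z)) Phi"
    by (rule lift3_Phi_cong) (simp add: trivial_hmodule_def H.counit_closed)
  also have "star_op G ?K W W (smult W) \<one>\<^bsub>K\<^esub> (star_op G Y Z W B y z) =
      \<one>\<^bsub>K\<^esub> \<odot>\<^bsub>W\<^esub> star_op G Y Z W B y z"
    using kbilinear_closed[OF kbilinear_star_op[OF equivariant_module(1,2)[OF B] equivariant_kbilinear[OF B]] yz]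
    by (intro star_unit_left[OF H.H_module_trivial W.H_module_axioms sm one])
      (simp_all add: trivial_hmodule_def H.counit_closed)
  finally show ?thesis
    using kbilinear_closed[OF kbilinear_star_op[OF equivariant_module(1,2)[OF B] equivariant_kbilinear[OF B]] yz]
    by simp
qed

context
  fixes A A' :: "('k, 'a, 'h, 'l) hmodule_scheme"
    and V V' :: "('k, 'v, 'h, 'a, 'n) hbimodule_scheme" and W W' :: "('k, 'w, 'h, 'a, 'o) hbimodule_scheme"
  assumes A: "H_module_algebra K H A" and V: "H_bimodule K H A V" and W: "H_bimodule K H A W"
    and relA: "star_related_algebra G A A'" and relV: "star_related G A V V'" and relW: "star_related G A W W'"
begin

interpretation A: H_module_algebra K H A by (rule A)
interpretation V: H_bimodule K H A V by (rule V)
interpretation W: H_bimodule K H A W by (rule W)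

lemmas A' = star_module_algebra[OF A relA]
lemmas V' = star_H_bimodule[OF A relA V relV]
lemmas W' = star_H_bimodule[OF A relA W relW]
lemmas sameA = same_hmoduleD[OF star_related_algebraD(1)[OF relA]]
lemmas sameV = same_hmoduleD[OF star_relatedD(1)[OF relV]]
lemmas sameW = same_hmoduleD[OF star_relatedD(1)[OF relW]]

interpretation V': H_bimodule K H' A' V' by (rule V')
interpretation W': H_bimodule K H' A' W' by (rule W')

lemmas ev = H.equivariant_evaluation[OF V.H_module_axioms W.H_module_axioms]
lemmas ev_star = star_equivariant[OF ev]
lemmas homX = H.H_bimodule_hom_K[OF A V W]

interpretation X: H_bimodule K H A "hom_K K H V W" by (rule homX)

lemma qmap_apply:
  "v \<in> carrier V \<Longrightarrow> qmap K H G V W P v = star_op G (hom_K K H V W) V W (\<lambda>P. P) P v"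
  unfolding qmap_def by simp

lemma klinear_qmap: "klinear K (hom_K K H V W) (hom_K K H' V' W') (qmap K H G V W)"
proof -
  have "kbilinear K (hom_K K H V W) V' W' (star_op G (hom_K K H V W) V W (\<lambda>P. P))"
    by (rule kbilinear_cong[OF equivariant_kbilinear[OF ev_star] same_hmodule_refl
          star_relatedD(1)[OF relV] star_relatedD(1)[OF relW]]) simp
  from kbilinear_hom_K[OF V'.module_axioms W'.module_axioms this, where H=H'] show ?thesis
    unfolding qmap_def[abs_def] sameV .
qed

lemma qmap_closed: "P \<in> carrier (hom_K K H V W) \<Longrightarrow> qmap K H G V W P \<in> carrier (hom_K K H' V' W')"
  by (rule klinear_closed[OF klinear_qmap])

text \<open>Deformed evaluation is equivariant over \<open>H'\<close>, so \<open>?R\<close> has the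
  property that characterises the action of \<open>H'\<close> on linear maps. The comparison
  therefore goes through \<open>hom_act_unique\<close> instead of a computation with the twisted
  antipode.\<close>

lemma qmap_act:
  assumes xi: "\<xi> \<in> carrier H" and P: "P \<in> carrier (hom_K K H V W)"
  shows "qmap K H G V W (act (hom_K K H V W) \<xi> P) = act (hom_K K H' V' W') \<xi> (qmap K H G V W P)"
proof (rule hom_K_eqI[where K=K and H=H' and V=V' and W=W'])
  let ?X = "hom_K K H V W"
  show "qmap K H G V W (act ?X \<xi> P) \<in> carrier (hom_K K H' V' W')"
    by (intro qmap_closed X.act_closed xi P)
  show "act (hom_K K H' V' W') \<xi> (qmap K H G V W P) \<in> carrier (hom_K K H' V' W')"
    by (rule H'.hom_act_closed[OF V'.H_module_axioms W'.H_module_axioms _ qmap_closed[OF P]]) (simp add: xi same)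
  fix v assume "v \<in> carrier V'"
  then have v: "v \<in> carrier V" by (simp add: sameV)
  note r = kbilinear_rules[OF kbilinear_star_op[OF X.H_module_axioms V.H_module_axioms equivariant_kbilinear[OF ev]]]
    H.act_rules[OF X.H_module_axioms] H.hopf_lin
  let ?R = "\<lambda>\<xi> v. star_op G ?X V W (\<lambda>P. P) (act ?X \<xi> P) v"
  have R: "kbilinear K H V W ?R" by (assumption | rule r P)+
  have "kbilinear K H' V' W' ?R"
    using R unfolding kbilinear_def klinear_def linear_map_def sameV sameW same
    using H'.module_axioms V'.module_axioms W'.module_axioms by simp
  then have "act (hom_K K H' V' W') \<xi> (qmap K H G V W P) v = ?R \<xi> v"
  proof (rule H'.hom_act_unique[OF V'.H_module_axioms W'.H_module_axioms qmap_closed[OF P]])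
    show "\<xi> \<in> carrier H'" "v \<in> carrier V'" using xi v by (simp_all add: same sameV)
    fix \<xi> v assume "\<xi> \<in> carrier H'" "v \<in> carrier V'"
    then have xv: "\<xi> \<in> carrier H'" "v \<in> carrier V" by (simp_all add: sameV)
    show "act W' \<xi> (qmap K H G V W P v) = tensor_lift W' (\<lambda>p q. ?R p (act V' q v)) (comult H' \<xi>)"
      using equivariant_act[OF ev_star xv(1) P xv(2)] xv by (simp add: qmap_apply sameV sameW)
  qed
  then show "qmap K H G V W (act ?X \<xi> P) v = act (hom_K K H' V' W') \<xi> (qmap K H G V W P) v"
    by (simp add: qmap_apply v)
qed

text \<open>Since \<open>qmap\<close> commutes with the actions, the second deformation may act on
  \<open>P\<close> itself; the two deformations of evaluation then cancel by
  \<open>star_star\<close>.\<close>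

lemma qmap_inverse:
  assumes P: "P \<in> carrier (hom_K K H V W)"
  shows "qmap K H' F V' W' (qmap K H G V W P) = P"
proof (rule ext)
  fix v
  show "qmap K H' F V' W' (qmap K H G V W P) v = P v"
  proof (cases "v \<in> carrier V")
    case v: True
    let ?X = "hom_K K H V W"
    have "qmap K H' F V' W' (qmap K H G V W P) v =
      tensor_lift W (\<lambda>p q. act (hom_K K H' V' W') p (qmap K H G V W P) (act V q v)) F"
      unfolding qmap_def[of K H'] star_op_def[of F] using v by (simp add: sameV sameW)
    also have "\<dots> = star_op F ?X V W (star_op G ?X V W (\<lambda>P. P)) P v"
      unfolding star_op_def[of F]
      by (intro H.liftH_cong F_closed) (simp add: qmap_act[OF _ P, symmetric] qmap_apply V.act_closed v)
    also have "\<dots> = P v"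
      by (rule star_star[OF X.H_module_axioms V.H_module_axioms equivariant_kbilinear[OF ev] P v])
    finally show ?thesis .
  next
    case False
    then have "qmap K H' F V' W' (qmap K H G V W P) v = undefined"
      unfolding qmap_def[of K H'] sameV by simp
    moreover have "P \<in> carrier V \<rightarrow>\<^sub>E carrier W" using P unfolding hom_K_sel(1) by blast
    then have "P v = undefined" using False by (rule PiE_arb)
    ultimately show ?thesis by simp
  qed
qed

lemma qmap_lact:
  assumes a: "a \<in> carrier A" and P: "P \<in> carrier (hom_K K H V W)"
  shows "qmap K H G V W (star_op G A (hom_K K H V W) (hom_K K H V W) (lact (hom_K K H V W)) a P) =
    lact (hom_K K H' V' W') a (qmap K H G V W P)"
proof (rule ext)
  let ?X = "hom_K K H V W"
  fix v
  show "qmap K H G V W (star_op G A ?X ?X (lact ?X) a P) v = lact (hom_K K H' V' W') a (qmap K H G V W P) v"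
  proof (cases "v \<in> carrier V")
    case v: True
    have "star_op G ?X V W (\<lambda>P. P) (star_op G A ?X ?X (lact ?X) a P) v =
      star_op G A W W (lact W) a (star_op G ?X V W (\<lambda>P. P) P v)"
      by (rule star_assoc[OF H.equivariant_hom_lact[OF A V W] equivariant_kbilinear[OF ev] ev
            equivariant_kbilinear[OF H.H_bimodule_equivariant(1)[OF A W]] _ a P v])
        (simp add: H.hom_lact_apply[OF A V W])
    also have "\<dots> = lact W' a (star_op G ?X V W (\<lambda>P. P) P v)"
      using kbilinear_closed[OF equivariant_kbilinear[OF ev_star] P v] a
      by (simp add: star_relatedD(2)[OF relW])
    finally show ?thesis using v by (simp add: qmap_apply hom_K_sel(6) sameV)
  next
    case False
    then show ?thesis unfolding qmap_def hom_K_sel(6,7) sameV by simp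
  qed
qed

lemma qmap_ract:
  assumes a: "a \<in> carrier A" and P: "P \<in> carrier (hom_K K H V W)"
  shows "qmap K H G V W (star_op G (hom_K K H V W) A (hom_K K H V W) (ract (hom_K K H V W)) P a) =
    ract (hom_K K H' V' W') (qmap K H G V W P) a"
proof (rule ext)
  let ?X = "hom_K K H V W"
  fix v
  show "qmap K H G V W (star_op G ?X A ?X (ract ?X) P a) v = ract (hom_K K H' V' W') (qmap K H G V W P) a v"
  proof (cases "v \<in> carrier V")
    case v: True
    have "star_op G ?X V W (\<lambda>P. P) (star_op G ?X A ?X (ract ?X) P a) v =
      star_op G ?X V W (\<lambda>P. P) P (star_op G A V V (lact V) a v)"
      by (rule star_assoc[OF H.equivariant_hom_ract[OF A V W] equivariant_kbilinear[OF ev]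
            H.H_bimodule_equivariant(1)[OF A V] equivariant_kbilinear[OF ev] _ P a v])
        (simp add: H.hom_ract_apply[OF A V W])
    moreover have "lact V' a v \<in> carrier V"
      using V'.lact_closed[of a v] a v by (simp add: sameA sameV)
    ultimately show ?thesis
      using v a by (simp add: qmap_apply hom_K_sel(7) sameV star_relatedD(2)[OF relV])
  next
    case False
    then show ?thesis unfolding qmap_def hom_K_sel(6,7) sameV by simp
  qed
qed

text \<open>
  With \<open>B = 0\<close> this says that deformation preserves right linearity, with \<open>B v a = v \<otimes> d a\<close> that it
  preserves the Leibniz rule of connections.
\<close>

lemma qmap_defect:
  assumes B: "equivariant K H V A W B" and P: "P \<in> carrier (hom_K K H V W)"
    and defect: "\<And>v a. \<lbrakk>v \<in> carrier V; a \<in> carrier A\<rbrakk> \<Longrightarrow> P (ract V v a) = ract W (P v) a \<oplus>\<^bsub>W\<^esub> B v a"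
    and v: "v \<in> carrier V" and a: "a \<in> carrier A"
  shows "qmap K H G V W P (ract V' v a) = ract W' (qmap K H G V W P v) a \<oplus>\<^bsub>W'\<^esub> star_op G V A W B v a"
proof -
  let ?X = "hom_K K H V W"
  note eqV = H.H_bimodule_equivariant[OF A V] and eqW = H.H_bimodule_equivariant[OF A W]
  note evk = equivariant_kbilinear[OF ev]
  note r = kbilinear_rules[OF evk] kbilinear_rules[OF equivariant_kbilinear[OF B]]
    kbilinear_rules[OF equivariant_kbilinear[OF eqW(2)]]
    H.act_rules[OF X.H_module_axioms] H.act_rules[OF V.H_module_axioms] H.act_rules[OF A.H_module_axioms] H.hopf_lin
  have va: "ract V' v a \<in> carrier V" using V'.ract_closed[of a v] a v by (simp add: sameA sameV)
  have Pv: "star_op G ?X V W (\<lambda>P. P) P v \<in> carrier W"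
    by (rule kbilinear_closed[OF equivariant_kbilinear[OF ev_star] P v])
  have "qmap K H G V W P (ract V' v a) = star_op G ?X V W (\<lambda>P. P) P (star_op G V A V (ract V) v a)"
    using va v a by (simp add: qmap_apply star_relatedD(3)[OF relV])
  also have "\<dots> = lift3 W (\<lambda>p q r. act ?X p P (ract V (act V q v) (act A r a))) Phi"
    by (rule star_right[OF eqV(2) evk X.H_module_axioms P v a])
  \<comment> \<open>The leg \<open>p\<close> acts on \<open>P\<close>, so by
    \<open>defect_act\<close> the defect acquires the factor \<open>counit H p\<close>, which
    \<open>star_op_smult\<close> removes below.\<close>
  also have "\<dots> = lift3 W (\<lambda>p q r. ract W (act ?X p P (act V q v)) (act A r a) \<oplus>\<^bsub>W\<^esub>
      counit H p \<odot>\<^bsub>W\<^esub> B (act V q v) (act A r a)) Phi"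
    by (intro lift3_Phi_cong H.defect_act[OF A V W B P defect] V.act_closed A.act_closed v a)
  also have "\<dots> = lift3 W (\<lambda>p q r. ract W (act ?X p P (act V q v)) (act A r a)) Phi \<oplus>\<^bsub>W\<^esub>
      lift3 W (\<lambda>p q r. counit H p \<odot>\<^bsub>W\<^esub> B (act V q v) (act A r a)) Phi"
    by (rule lift3_add_fun) (assumption | rule r P v a Phi_closed)+
  also have "lift3 W (\<lambda>p q r. counit H p \<odot>\<^bsub>W\<^esub> B (act V q v) (act A r a)) Phi = star_op G V A W B v a"
    by (rule star_op_smult[OF B v a])
  also have "lift3 W (\<lambda>p q r. ract W (act ?X p P (act V q v)) (act A r a)) Phi =
      star_op G W A W (ract W) (star_op G ?X V W (\<lambda>P. P) P v) a"
    by (rule star_left[OF ev equivariant_kbilinear[OF eqW(2)] A.H_module_axioms P v a, symmetric])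
  also have "\<dots> = ract W' (qmap K H G V W P v) a"
    using v a Pv by (simp add: qmap_apply star_relatedD(3)[OF relW])
  finally show ?thesis by (simp add: sameW)
qed


section \<open>The comparison map between tensor products over the two algebras\<close>

abbreviation (input) "T \<equiv> atensor H A V W"
abbreviation (input) "Ts \<equiv> atensor H' A' V' W'"

lemmas apure_eq = H.equivariant_apure[OF A V W]
lemmas apure_star = star_equivariant[OF apure_eq]

interpretation T: H_bimodule K H A T by (rule H.H_bimodule_atensor[OF A V W])
interpretation Ts: H_bimodule K H' A' Ts by (rule H'.H_bimodule_atensor[OF A' V' W'])

lemma abilinear_star_apure: "abilinear K A' V' W' T (star_op G V W T (apure A V W))"
  unfolding abilinear_def
proof (intro conjI ballI)
  show "kbilinear K V' W' T (star_op G V W T (apure A V W))"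
    by (rule kbilinear_cong[OF equivariant_kbilinear[OF apure_star] star_relatedD(1)[OF relV]
          star_relatedD(1)[OF relW] same_hmodule_refl]) simp
  fix v a w assume "v \<in> carrier V'" "a \<in> carrier A'" "w \<in> carrier W'"
  then have vaw: "v \<in> carrier V" "a \<in> carrier A" "w \<in> carrier W" by (simp_all add: sameA sameV sameW)
  show "star_op G V W T (apure A V W) (ract V' v a) w = star_op G V W T (apure A V W) v (lact W' a w)"
    using star_assoc[OF H.H_bimodule_equivariant(2)[OF A V] equivariant_kbilinear[OF apure_eq]
        H.H_bimodule_equivariant(1)[OF A W] equivariant_kbilinear[OF apure_eq] H.apure_balanced[OF A V W] vaw] vaw
    by (simp add: star_relatedD[OF relV] star_relatedD[OF relW])
qed

lemma klinear_phimap: "klinear K Ts T (phimap H G A V W)"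
  unfolding phimap_def by (rule H'.klinear_alift[OF A' V' W' abilinear_star_apure])

lemma phimap_apure:
  "\<lbrakk>v \<in> carrier V; w \<in> carrier W\<rbrakk> \<Longrightarrow>
   phimap H G A V W (apure A' V' W' v w) = star_op G V W T (apure A V W) v w"
  unfolding phimap_def by (rule H'.alift_apure[OF A' V' W' abilinear_star_apure]) (simp_all add: sameV sameW)

lemma phimap_act:
  assumes xi: "\<xi> \<in> carrier H" and t: "t \<in> carrier Ts"
  shows "phimap H G A V W (act Ts \<xi> t) = act T \<xi> (phimap H G A V W t)"
proof (rule H'.klinear_atensor_eqI[OF A' V' W' _ _ _ t, where f="\<lambda>t. phimap H G A V W (act Ts \<xi> t)"
      and g="\<lambda>t. act T \<xi> (phimap H G A V W t)"])
  have xi': "\<xi> \<in> carrier H'" using xi by (simp add: same)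
  show "klinear K Ts T (\<lambda>t. phimap H G A V W (act Ts \<xi> t))"
    by (rule klinear_comp[OF klinear_phimap kbilinear_right[OF H'.kbilinear_act[OF Ts.H_module_axioms] xi']])
  show "klinear K Ts T (\<lambda>t. act T \<xi> (phimap H G A V W t))"
    by (rule klinear_comp[OF kbilinear_right[OF H.kbilinear_act[OF T.H_module_axioms] xi] klinear_phimap])
  fix v w assume vw': "v \<in> carrier V'" "w \<in> carrier W'"
  then have vw: "v \<in> carrier V" "w \<in> carrier W" by (simp_all add: sameV sameW)
  note r = kbilinear_rules[OF equivariant_kbilinear[OF H'.equivariant_apure[OF A' V' W']]]
    H'.act_rules[OF V'.H_module_axioms] H'.act_rules[OF W'.H_module_axioms] H'.hopf_lin
  have "phimap H G A V W (act Ts \<xi> (apure A' V' W' v w)) =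
    tensor_lift T (\<lambda>x y. phimap H G A V W (apure A' V' W' (act V' x v) (act W' y w))) (comult H' \<xi>)"
    unfolding H'.act_apure[OF A' V' W' xi' vw']
    by (rule lift_hom[OF klinear_phimap]) (assumption | rule r vw' xi')+
  also have "\<dots> = tensor_lift T (\<lambda>x y. star_op G V W T (apure A V W) (act V x v) (act W y w)) (comult H' \<xi>)"
    unfolding sameV sameW
    by (intro H.liftH_cong comult'_closed xi phimap_apure V.act_closed W.act_closed vw)
  also have "\<dots> = act T \<xi> (phimap H G A V W (apure A' V' W' v w))"
    using equivariant_act[OF apure_star xi' vw] by (simp add: phimap_apure vw)
  finally show "phimap H G A V W (act Ts \<xi> (apure A' V' W' v w)) = act T \<xi> (phimap H G A V W (apure A' V' W' v w))" .
qed

lemma phimap_lact: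
  assumes a: "a \<in> carrier A" and t: "t \<in> carrier Ts"
  shows "phimap H G A V W (lact Ts a t) = star_op G A T T (lact T) a (phimap H G A V W t)"
proof (rule H'.klinear_atensor_eqI[OF A' V' W' _ _ _ t, where f="\<lambda>t. phimap H G A V W (lact Ts a t)"
      and g="\<lambda>t. star_op G A T T (lact T) a (phimap H G A V W t)"])
  have a': "a \<in> carrier A'" using a by (simp add: sameA)
  note eqT = H.H_bimodule_equivariant[OF A T.H_bimodule_axioms]
  show "klinear K Ts T (\<lambda>t. phimap H G A V W (lact Ts a t))"
    by (rule klinear_comp[OF klinear_phimap kbilinear_right[OF H'.kbilinear_atensor_lact[OF A' V' W'] a']])
  show "klinear K Ts T (\<lambda>t. star_op G A T T (lact T) a (phimap H G A V W t))"
    by (rule klinear_comp[OF kbilinear_right[OF kbilinear_star_op[OF A.H_module_axioms T.H_module_axioms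
              equivariant_kbilinear[OF eqT(1)]] a] klinear_phimap])
  fix v w assume vw': "v \<in> carrier V'" "w \<in> carrier W'"
  then have vw: "v \<in> carrier V" "w \<in> carrier W" by (simp_all add: sameV sameW)
  have av: "lact V' a v \<in> carrier V" using V'.lact_closed[OF a' vw'(1)] by (simp add: sameV)
  show "phimap H G A V W (lact Ts a (apure A' V' W' v w)) = star_op G A T T (lact T) a (phimap H G A V W (apure A' V' W' v w))"
    using star_assoc[OF H.H_bimodule_equivariant(1)[OF A V] equivariant_kbilinear[OF apure_eq] apure_eq
        equivariant_kbilinear[OF eqT(1)] H.lact_apure[OF A V W, symmetric] a vw] a av vw
    by (simp add: H'.lact_apure[OF A' V' W' a' vw'] phimap_apure star_relatedD(2)[OF relV])
qed

lemma phimap_ract: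
  assumes a: "a \<in> carrier A" and t: "t \<in> carrier Ts"
  shows "phimap H G A V W (ract Ts t a) = star_op G T A T (ract T) (phimap H G A V W t) a"
proof (rule H'.klinear_atensor_eqI[OF A' V' W' _ _ _ t, where f="\<lambda>t. phimap H G A V W (ract Ts t a)"
      and g="\<lambda>t. star_op G T A T (ract T) (phimap H G A V W t) a"])
  have a': "a \<in> carrier A'" using a by (simp add: sameA)
  note eqT = H.H_bimodule_equivariant[OF A T.H_bimodule_axioms]
  show "klinear K Ts T (\<lambda>t. phimap H G A V W (ract Ts t a))"
    by (rule klinear_comp[OF klinear_phimap kbilinear_left[OF H'.kbilinear_atensor_ract[OF A' V' W'] a']])
  show "klinear K Ts T (\<lambda>t. star_op G T A T (ract T) (phimap H G A V W t) a)"
    by (rule klinear_comp[OF kbilinear_left[OF kbilinear_star_op[OF T.H_module_axioms A.H_module_axioms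
              equivariant_kbilinear[OF eqT(2)]] a] klinear_phimap])
  fix v w assume vw': "v \<in> carrier V'" "w \<in> carrier W'"
  then have vw: "v \<in> carrier V" "w \<in> carrier W" by (simp_all add: sameV sameW)
  have wa: "ract W' w a \<in> carrier W" using W'.ract_closed[OF a' vw'(2)] by (simp add: sameW)
  show "phimap H G A V W (ract Ts (apure A' V' W' v w) a) = star_op G T A T (ract T) (phimap H G A V W (apure A' V' W' v w)) a"
    using star_assoc[OF apure_eq equivariant_kbilinear[OF eqT(2)] H.H_bimodule_equivariant(2)[OF A W]
        equivariant_kbilinear[OF apure_eq] H.ract_apure[OF A V W] vw a] a wa vw
    by (simp add: H'.ract_apure[OF A' V' W' a' vw'] phimap_apure star_relatedD(3)[OF relW])
qed

end

end


section \<open>Isomorphisms of bimodules\<close>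

lemma H_bimodule_isoD:
  assumes "H_bimodule_iso K H A V W f"
  shows "H_bimodule K H A V" "H_bimodule K H A W" "bij_betw f (carrier V) (carrier W)" "klinear K V W f"
    "\<lbrakk>\<xi> \<in> carrier H; v \<in> carrier V\<rbrakk> \<Longrightarrow> f (act V \<xi> v) = act W \<xi> (f v)"
    "\<lbrakk>a \<in> carrier A; v \<in> carrier V\<rbrakk> \<Longrightarrow> f (lact V a v) = lact W a (f v)"
    "\<lbrakk>a \<in> carrier A; v \<in> carrier V\<rbrakk> \<Longrightarrow> f (ract V v a) = ract W (f v) a"
  using assms unfolding H_bimodule_iso_def klinear_def H_bimodule_def H_module_def by auto

lemma H_bimodule_isoI:
  assumes "H_bimodule K H A V" "H_bimodule K H A W" "bij_betw f (carrier V) (carrier W)" "klinear K V W f"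
    "\<And>\<xi> v. \<lbrakk>\<xi> \<in> carrier H; v \<in> carrier V\<rbrakk> \<Longrightarrow> f (act V \<xi> v) = act W \<xi> (f v)"
    "\<And>a v. \<lbrakk>a \<in> carrier A; v \<in> carrier V\<rbrakk> \<Longrightarrow> f (lact V a v) = lact W a (f v)"
    "\<And>a v. \<lbrakk>a \<in> carrier A; v \<in> carrier V\<rbrakk> \<Longrightarrow> f (ract V v a) = ract W (f v) a"
  shows "H_bimodule_iso K H A V W f"
  using assms unfolding H_bimodule_iso_def klinear_def by auto

lemma H_bimodule_module: "H_bimodule K H A V \<Longrightarrow> module K V"
  unfolding H_bimodule_def H_module_def by simp

lemma H_bimodule_iso_inv:
  assumes f: "H_bimodule_iso K H A V W f"
  shows "H_bimodule_iso K H A W V (inv_into (carrier V) f)"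
proof -
  let ?g = "inv_into (carrier V) f"
  note D = H_bimodule_isoD[OF f]
  interpret V: H_bimodule K H A V by (rule D)
  interpret W: H_bimodule K H A W by (rule D)
  have bij: "bij_betw ?g (carrier W) (carrier V)" using D(3) by (rule bij_betw_inv_into)
  have g: "?g w \<in> carrier V" "f (?g w) = w" if "w \<in> carrier W" for w
    using that bij_betwE[OF bij] bij_betw_inv_into_right[OF D(3)] by auto
  have eqI: "?g w = v" if "v \<in> carrier V" "f v = w" for v w
    using bij_betw_inv_into_left[OF D(3)] that by auto
  show ?thesis
  proof (rule H_bimodule_isoI[OF D(2,1) bij])
    show "klinear K W V ?g"
    proof (rule klinearI[OF W.module_axioms V.module_axioms])
      show "?g (w \<oplus>\<^bsub>W\<^esub> w') = ?g w \<oplus>\<^bsub>V\<^esub> ?g w'" if "w \<in> carrier W" "w' \<in> carrier W" for w w'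
        by (rule eqI) (simp_all add: that g klinear_add[OF D(4)])
      show "?g (k \<odot>\<^bsub>W\<^esub> w) = k \<odot>\<^bsub>V\<^esub> ?g w" if "k \<in> carrier K" "w \<in> carrier W" for k w
        by (rule eqI) (simp_all add: that g klinear_smult[OF D(4)])
    qed (rule g)
    show "?g (act W \<xi> w) = act V \<xi> (?g w)" if "\<xi> \<in> carrier H" "w \<in> carrier W" for \<xi> w
      by (rule eqI) (simp_all add: that g D(5) V.act_closed)
    show "?g (lact W a w) = lact V a (?g w)" if "a \<in> carrier A" "w \<in> carrier W" for a w
      by (rule eqI) (simp_all add: that g D(6) V.lact_closed)
    show "?g (ract W w a) = ract V (?g w) a" if "a \<in> carrier A" "w \<in> carrier W" for a w
      by (rule eqI) (simp_all add: that g D(7) V.ract_closed)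
  qed
qed

lemma H_bimodule_iso_trans:
  assumes f: "H_bimodule_iso K H A U V f" and g: "H_bimodule_iso K H A V W g"
  shows "H_bimodule_iso K H A U W (\<lambda>u. g (f u))"
proof -
  note F = H_bimodule_isoD[OF f] and G = H_bimodule_isoD[OF g]
  have cl: "f u \<in> carrier V" if "u \<in> carrier U" for u by (rule klinear_closed[OF F(4) that])
  show ?thesis
  proof (rule H_bimodule_isoI[OF F(1) G(2) _ klinear_comp[OF G(4) F(4)]])
    show "bij_betw (\<lambda>u. g (f u)) (carrier U) (carrier W)"
      using bij_betw_trans[OF F(3) G(3)] by (simp add: comp_def)
  qed (simp_all add: F(5-7) G(5-7) cl)
qed

text \<open>The equivalence \<open>iff\<close> is what gives surjectivity onto \<open>Y0\<close>.
  The actions on \<open>X0\<close> are compared pointwise because deformed actions on a sub-bimodule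
  are sums formed in the smaller record and agree with the ambient ones only on its carrier.\<close>

lemma H_bimodule_iso_restrict:
  assumes f: "H_bimodule_iso K H A X Y f" and X0: "H_bimodule K H A X0" and Y0: "H_bimodule K H A Y0"
    and sub: "carrier X0 \<subseteq> carrier X" "carrier Y0 \<subseteq> carrier Y"
    and iff: "\<And>x. x \<in> carrier X \<Longrightarrow> f x \<in> carrier Y0 \<longleftrightarrow> x \<in> carrier X0"
    and same: "add X0 = add X" "smult X0 = smult X" "act X0 = act X"
      "add Y0 = add Y" "smult Y0 = smult Y" "act Y0 = act Y"
    and lX: "\<And>a x. \<lbrakk>a \<in> carrier A; x \<in> carrier X0\<rbrakk> \<Longrightarrow> lact X0 a x = lact X a x"
    and rX: "\<And>a x. \<lbrakk>a \<in> carrier A; x \<in> carrier X0\<rbrakk> \<Longrightarrow> ract X0 x a = ract X x a"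
    and lY: "lact Y0 = lact Y" and rY: "ract Y0 = ract Y"
  shows "H_bimodule_iso K H A X0 Y0 f"
proof -
  note D = H_bimodule_isoD[OF f]
  have x: "x \<in> carrier X" "f x \<in> carrier Y0" if "x \<in> carrier X0" for x
    using that sub iff by auto
  have "f ` carrier X0 = carrier Y0"
  proof
    show "carrier Y0 \<subseteq> f ` carrier X0"
    proof
      fix y assume y: "y \<in> carrier Y0"
      then obtain x where "x \<in> carrier X" "y = f x" using D(3) sub unfolding bij_betw_def by blast
      then show "y \<in> f ` carrier X0" using y iff by auto
    qed
  qed (use x in auto)
  then have bij: "bij_betw f (carrier X0) (carrier Y0)"
    using D(3) sub unfolding bij_betw_def by (auto intro: inj_on_subset)
  show ?thesis
  proof (rule H_bimodule_isoI[OF X0 Y0 bij])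
    show "klinear K X0 Y0 f"
      by (rule klinearI[OF H_bimodule_module[OF X0] H_bimodule_module[OF Y0]])
        (simp_all add: same x klinear_add[OF D(4)] klinear_smult[OF D(4)])
  qed (simp_all add: same x D(5-7) lX rX lY rY)
qed

lemma (in hopf_algebra) H_bimodule_iso_hom_K:
  fixes U :: "('k, 'u, 'h, 'a, 'n) hbimodule_scheme"
  assumes A: "H_module_algebra K H A" and U: "H_bimodule K H A U" and f: "H_bimodule_iso K H A V W f"
  shows "H_bimodule_iso K H A (hom_K K H U V) (hom_K K H U W) (compose (carrier U) f)"
proof -
  note D = H_bimodule_isoD[OF f] and D' = H_bimodule_isoD[OF H_bimodule_iso_inv[OF f]]
  let ?g = "inv_into (carrier V) f"
  interpret U: H_bimodule K H A U by (rule U)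
  interpret V: H_bimodule K H A V by (rule D)
  interpret W: H_bimodule K H A W by (rule D)
  have cl: "P u \<in> carrier V" if "P \<in> carrier (hom_K K H U V)" "u \<in> carrier U" for P u
    using klinear_closed[OF hom_K_klinear[OF that(1) U.module_axioms V.module_axioms] that(2)] .
  have cl': "P u \<in> carrier W" if "P \<in> carrier (hom_K K H U W)" "u \<in> carrier U" for P u
    using klinear_closed[OF hom_K_klinear[OF that(1) U.module_axioms W.module_axioms] that(2)] .
  have fc: "compose (carrier U) f P \<in> carrier (hom_K K H U W)" if "P \<in> carrier (hom_K K H U V)" for P
    unfolding compose_def
    by (rule restrict_hom_K[OF klinear_comp[OF D(4) hom_K_klinear[OF that U.module_axioms V.module_axioms]]])
  have gc: "compose (carrier U) ?g P \<in> carrier (hom_K K H U V)" if "P \<in> carrier (hom_K K H U W)" for P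
    unfolding compose_def
    by (rule restrict_hom_K[OF klinear_comp[OF D'(4) hom_K_klinear[OF that U.module_axioms W.module_axioms]]])
  note ext = hom_K_eqI[where K=K and H=H and V=U and W=V] and ext' = hom_K_eqI[where K=K and H=H and V=U and W=W]
  note HV = H_bimodule_hom_K[OF A U D(1)] and HW = H_bimodule_hom_K[OF A U D(2)]
  interpret HV: H_bimodule K H A "hom_K K H U V" by (rule HV)
  interpret HW: H_bimodule K H A "hom_K K H U W" by (rule HW)
  show ?thesis
  proof (rule H_bimodule_isoI[OF HV HW])
    show "bij_betw (compose (carrier U) f) (carrier (hom_K K H U V)) (carrier (hom_K K H U W))"
    proof (rule bij_betw_byWitness[where f'="compose (carrier U) ?g"])
      show "\<forall>P\<in>carrier (hom_K K H U V). compose (carrier U) ?g (compose (carrier U) f P) = P"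
        by (intro ballI ext gc fc) (simp_all add: compose_eq cl bij_betw_inv_into_left[OF D(3)])
      show "\<forall>P\<in>carrier (hom_K K H U W). compose (carrier U) f (compose (carrier U) ?g P) = P"
        by (intro ballI ext' gc fc) (simp_all add: compose_eq cl' bij_betw_inv_into_right[OF D(3)])
    qed (auto intro: fc gc)
    show "klinear K (hom_K K H U V) (hom_K K H U W) (compose (carrier U) f)"
    proof (rule klinearI[OF HV.module_axioms HW.module_axioms fc])
      show "compose (carrier U) f (P \<oplus>\<^bsub>hom_K K H U V\<^esub> Q) = compose (carrier U) f P \<oplus>\<^bsub>hom_K K H U W\<^esub> compose (carrier U) f Q"
        if "P \<in> carrier (hom_K K H U V)" "Q \<in> carrier (hom_K K H U V)" for P Q
        by (rule ext'; (intro fc HV.M.a_closed HW.M.a_closed that)?)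
          (simp add: compose_eq hom_K_sel(3) klinear_add[OF D(4)] cl that)
      show "compose (carrier U) f (k \<odot>\<^bsub>hom_K K H U V\<^esub> P) = k \<odot>\<^bsub>hom_K K H U W\<^esub> compose (carrier U) f P"
        if "k \<in> carrier K" "P \<in> carrier (hom_K K H U V)" for k P
        by (rule ext'; (intro fc HV.smult_closed HW.smult_closed that)?)
          (simp add: compose_eq hom_K_sel(4) klinear_smult[OF D(4)] cl that)
    qed
    show "compose (carrier U) f (act (hom_K K H U V) \<xi> P) = act (hom_K K H U W) \<xi> (compose (carrier U) f P)"
      if xi: "\<xi> \<in> carrier H" and P: "P \<in> carrier (hom_K K H U V)" for \<xi> P
    proof (rule ext')
      fix u assume u: "u \<in> carrier U"
      have "f (act (hom_K K H U V) \<xi> P u) =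
        tensor_lift W (\<lambda>x y. f (act V x (P (act U (antipode H y) u)))) (comult H \<xi>)"
        unfolding hom_act_apply[OF U.H_module_axioms V.H_module_axioms u]
        by (rule lift_hom[OF D(4)])
          (assumption | rule hom_rules[OF U.H_module_axioms V.H_module_axioms] xi P u)+
      also have "\<dots> = act (hom_K K H U W) \<xi> (compose (carrier U) f P) u"
        unfolding hom_act_apply[OF U.H_module_axioms W.H_module_axioms u]
        by (intro liftH_cong comult_closed xi)
          (simp_all add: compose_eq U.act_closed antipode_closed u D(5) cl P)
      finally show "compose (carrier U) f (act (hom_K K H U V) \<xi> P) u = act (hom_K K H U W) \<xi> (compose (carrier U) f P) u"
        using u by (simp add: compose_eq)
    qed (intro fc HV.act_closed HW.act_closed xi P)+
    show "compose (carrier U) f (lact (hom_K K H U V) a P) = lact (hom_K K H U W) a (compose (carrier U) f P)"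
      if "a \<in> carrier A" "P \<in> carrier (hom_K K H U V)" for a P
      by (rule ext'; (intro fc HV.lact_closed HW.lact_closed that)?)
        (simp add: compose_eq hom_K_sel(6) D(6) cl that)
    show "compose (carrier U) f (ract (hom_K K H U V) P a) = ract (hom_K K H U W) (compose (carrier U) f P) a"
      if "a \<in> carrier A" "P \<in> carrier (hom_K K H U V)" for a P
      by (rule ext'; (intro fc HV.ract_closed HW.ract_closed that)?)
        (simp add: compose_eq hom_K_sel(7) U.lact_closed cl that)
  qed
qed


context twist_pair
begin

context
  fixes A A' :: "('k, 'a, 'h, 'l) hmodule_scheme"
    and V V' :: "('k, 'v, 'h, 'a, 'n) hbimodule_scheme" and W W' :: "('k, 'w, 'h, 'a, 'o) hbimodule_scheme"
  assumes A: "H_module_algebra K H A" and V: "H_bimodule K H A V" and W: "H_bimodule K H A W"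
    and relA: "star_related_algebra G A A'" and relV: "star_related G A V V'" and relW: "star_related G A W W'"
begin

interpretation A: H_module_algebra K H A by (rule A)
interpretation V: H_bimodule K H A V by (rule V)
interpretation W: H_bimodule K H A W by (rule W)

lemmas deformation = star_module_algebra[OF A relA] star_H_bimodule[OF A relA V relV] star_H_bimodule[OF A relA W relW]
lemmas deformation_rel = star_related_algebra_sym[OF A relA] star_related_sym[OF A relA V relV] star_related_sym[OF A relA W relW]
lemmas deformation_same = same_hmoduleD[OF star_related_algebraD(1)[OF relA]] same_hmoduleD[OF star_relatedD(1)[OF relV]]
  same_hmoduleD[OF star_relatedD(1)[OF relW]]

lemma qmap_bij:
  "bij_betw (qmap K H G V W) (carrier (hom_K K H V W)) (carrier (hom_K K H' V' W'))"
proof (rule bij_betw_byWitness[where f'="qmap K H' F V' W'"])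
  show "\<forall>P\<in>carrier (hom_K K H V W). qmap K H' F V' W' (qmap K H G V W P) = P"
    using qmap_inverse[OF A V W relA relV relW] by blast
  show "\<forall>P\<in>carrier (hom_K K H' V' W'). qmap K H G V W (qmap K H' F V' W' P) = P"
    using twist_pair.qmap_inverse[OF swap deformation deformation_rel] by blast
  show "qmap K H G V W ` carrier (hom_K K H V W) \<subseteq> carrier (hom_K K H' V' W')"
    using qmap_closed[OF A V W relA relV relW] by blast
  show "qmap K H' F V' W' ` carrier (hom_K K H' V' W') \<subseteq> carrier (hom_K K H V W)"
    using twist_pair.qmap_closed[OF swap deformation deformation_rel] by blast
qed

lemma qmap_iso:
  assumes relX: "star_related G A (hom_K K H V W) X"
  shows "H_bimodule_iso K H' A' X (hom_K K H' V' W') (qmap K H G V W)"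
proof -
  note s = same_hmoduleD[OF star_relatedD(1)[OF relX]]
  note HX = star_H_bimodule[OF A relA H.H_bimodule_hom_K[OF A V W] relX]
  note HX' = H'.H_bimodule_hom_K[OF deformation]
  note kq = klinear_qmap[OF A V W relA relV relW]
  show ?thesis
  proof (rule H_bimodule_isoI[OF HX HX'])
    show "bij_betw (qmap K H G V W) (carrier X) (carrier (hom_K K H' V' W'))"
      unfolding s by (rule qmap_bij)
    show "klinear K X (hom_K K H' V' W') (qmap K H G V W)"
      using kq H_bimodule_module[OF HX] unfolding klinear_def linear_map_def s by simp
  qed (simp_all add: s same deformation_same qmap_act[OF A V W relA relV relW] star_relatedD(2,3)[OF relX]
      qmap_lact[OF A V W relA relV relW] qmap_ract[OF A V W relA relV relW])
qed

text \<open>The converse is the direct implication for the swapped pair, applied to the deformed map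
  and the deformed defect; both deform back to the originals.\<close>

lemma qmap_defect_iff:
  assumes B: "equivariant K H V A W B" and P: "P \<in> carrier (hom_K K H V W)"
  shows "(\<forall>v\<in>carrier V'. \<forall>a\<in>carrier A'. qmap K H G V W P (ract V' v a) =
      ract W' (qmap K H G V W P v) a \<oplus>\<^bsub>W'\<^esub> star_op G V A W B v a) \<longleftrightarrow>
    (\<forall>v\<in>carrier V. \<forall>a\<in>carrier A. P (ract V v a) = ract W (P v) a \<oplus>\<^bsub>W\<^esub> B v a)"
proof
  assume "\<forall>v\<in>carrier V. \<forall>a\<in>carrier A. P (ract V v a) = ract W (P v) a \<oplus>\<^bsub>W\<^esub> B v a"
  then show "\<forall>v\<in>carrier V'. \<forall>a\<in>carrier A'. qmap K H G V W P (ract V' v a) =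
      ract W' (qmap K H G V W P v) a \<oplus>\<^bsub>W'\<^esub> star_op G V A W B v a"
    using qmap_defect[OF A V W relA relV relW B P] by (simp add: deformation_same)
next
  let ?Q = "qmap K H G V W P"
  assume *: "\<forall>v\<in>carrier V'. \<forall>a\<in>carrier A'. ?Q (ract V' v a) = ract W' (?Q v) a \<oplus>\<^bsub>W'\<^esub> star_op G V A W B v a"
  have B': "equivariant K H' V' A' W' (star_op G V A W B)"
    by (rule H'.equivariant_cong[OF star_equivariant[OF B]])
      (auto intro: star_relatedD[OF relV] star_relatedD[OF relW] star_related_algebraD[OF relA])
  have "P (ract V v a) = ract W (P v) a \<oplus>\<^bsub>W\<^esub> B v a" if v: "v \<in> carrier V" and a: "a \<in> carrier A" for v a
  proof -
    have va: "v \<in> carrier V'" "a \<in> carrier A'" using v a by (simp_all add: deformation_same)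
    have "qmap K H' F V' W' ?Q (ract V v a) =
      ract W (qmap K H' F V' W' ?Q v) a \<oplus>\<^bsub>W\<^esub> star_op F V' A' W' (star_op G V A W B) v a"
      by (rule twist_pair.qmap_defect[OF swap deformation deformation_rel B' qmap_closed[OF A V W relA relV relW P] _ va])
        (use * in blast)
    also have "star_op F V' A' W' (star_op G V A W B) v a = B v a"
      using star_star[OF V.H_module_axioms A.H_module_axioms equivariant_kbilinear[OF B] v a]
      unfolding star_op_def[of F] deformation_same .
    finally show ?thesis unfolding qmap_inverse[OF A V W relA relV relW P] .
  qed
  then show "\<forall>v\<in>carrier V. \<forall>a\<in>carrier A. P (ract V v a) = ract W (P v) a \<oplus>\<^bsub>W\<^esub> B v a" by blast
qed

text \<open>Linearity moves the second map inside the sum over \<open>G\<close>, where it sends pure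
  tensors to deformed ones; the two deformations of \<open>apure A' V' W'\<close> cancel by
  \<open>star_star\<close> for the swapped pair.\<close>

lemma phimap_inverse:
  assumes t: "t \<in> carrier (atensor H' A' V' W')"
  shows "phimap H' F A' V' W' (phimap H G A V W t) = t"
proof (rule H'.klinear_atensor_eqI[OF deformation _ _ _ t, where f="\<lambda>t. phimap H' F A' V' W' (phimap H G A V W t)" and g="\<lambda>t. t"])
  let ?T = "atensor H A V W" and ?Ts = "atensor H' A' V' W'"
  interpret T: H_bimodule K H A ?T by (rule H.H_bimodule_atensor[OF A V W])
  interpret Ts: H_bimodule K H' A' ?Ts by (rule H'.H_bimodule_atensor[OF deformation])
  note k = klinear_phimap[OF A V W relA relV relW]
  note k' = twist_pair.klinear_phimap[OF swap deformation deformation_rel]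
  show "klinear K ?Ts ?Ts (\<lambda>t. phimap H' F A' V' W' (phimap H G A V W t))"
    by (rule klinear_comp[OF k' k])
  show "klinear K ?Ts ?Ts (\<lambda>t. t)" by (rule klinear_id[OF Ts.module_axioms])
  fix v w assume vw': "v \<in> carrier V'" "w \<in> carrier W'"
  then have vw: "v \<in> carrier V" "w \<in> carrier W" by (simp_all add: deformation_same)
  note ap = equivariant_kbilinear[OF H.equivariant_apure[OF A V W]]
  note r = kbilinear_rules[OF ap] H.act_rules[OF V.H_module_axioms] H.act_rules[OF W.H_module_axioms] H.hopf_lin
  have "phimap H' F A' V' W' (phimap H G A V W (apure A' V' W' v w)) =
    tensor_lift ?Ts (\<lambda>p q. phimap H' F A' V' W' (apure A V W (act V p v) (act W q w))) G"
    unfolding phimap_apure[OF A V W relA relV relW vw] star_op_def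
    by (rule lift_hom[OF k']) (assumption | rule r vw G_closed)+
  also have "\<dots> = tensor_lift ?Ts (\<lambda>p q. star_op F V' W' ?Ts (apure A' V' W') (act V p v) (act W q w)) G"
    by (intro H.liftH_cong G_closed twist_pair.phimap_apure[OF swap deformation deformation_rel])
      (simp_all add: deformation_same V.act_closed W.act_closed vw)
  also have "\<dots> = star_op G V' W' ?Ts (star_op F V' W' ?Ts (apure A' V' W')) v w"
    unfolding star_op_def[of G] deformation_same ..
  also have "\<dots> = apure A' V' W' v w"
    using twist_pair.star_star[OF swap _ _ equivariant_kbilinear[OF H'.equivariant_apure[OF deformation]] vw']
      H_bimodule.axioms(1)[OF deformation(2)] H_bimodule.axioms(1)[OF deformation(3)] by blast
  finally show "phimap H' F A' V' W' (phimap H G A V W (apure A' V' W' v w)) = apure A' V' W' v w" .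
qed

end

lemma phimap_iso:
  fixes A A' :: "('k, 'a, 'h, 'l) hmodule_scheme"
    and V V' :: "('k, 'v, 'h, 'a, 'n) hbimodule_scheme" and W W' :: "('k, 'w, 'h, 'a, 'o) hbimodule_scheme"
  assumes A: "H_module_algebra K H A" and V: "H_bimodule K H A V" and W: "H_bimodule K H A W"
    and relA: "star_related_algebra G A A'" and relV: "star_related G A V V'" and relW: "star_related G A W W'"
    and relT: "star_related G A (atensor H A V W) T'"
  shows "H_bimodule_iso K H' A' (atensor H' A' V' W') T' (phimap H G A V W)"
proof -
  note hyps = A V W relA relV relW
  note deformed = deformation[OF hyps] and deformed_rel = deformation_rel[OF hyps] and deformed_same = deformation_same[OF hyps]
  let ?T = "atensor H A V W" and ?Ts = "atensor H' A' V' W'"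
  note s = same_hmoduleD[OF star_relatedD(1)[OF relT]]
  note HT = star_H_bimodule[OF A relA H.H_bimodule_atensor[OF A V W] relT]
  note HTs = H'.H_bimodule_atensor[OF deformed]
  note k = klinear_phimap[OF A V W relA relV relW]
  note k' = twist_pair.klinear_phimap[OF swap deformed deformed_rel]
  \<comment> \<open>The remaining composite is the one already treated, read for the swapped
    pair.\<close>
  have inverse: "phimap H G A V W (phimap H' F A' V' W' t) = t" if "t \<in> carrier ?T" for t
    by (rule twist_pair.phimap_inverse[OF swap deformed deformed_rel that])
  show ?thesis
  proof (rule H_bimodule_isoI[OF HTs HT])
    show "bij_betw (phimap H G A V W) (carrier ?Ts) (carrier T')"
      unfolding s
      by (rule bij_betw_byWitness[where f'="phimap H' F A' V' W'"])
        (auto simp: phimap_inverse[OF A V W relA relV relW] inverse klinear_closed[OF k] klinear_closed[OF k'])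
    show "klinear K ?Ts T' (phimap H G A V W)"
      using k H_bimodule_module[OF HT] unfolding klinear_def linear_map_def s by simp
  qed (simp_all add: s same deformed_same klinear_closed[OF k] phimap_act[OF A V W relA relV relW]
      phimap_lact[OF A V W relA relV relW] phimap_ract[OF A V W relA relV relW]
      star_relatedD(2,3)[OF relT])
qed

end


section \<open>Connections\<close>

lemma (in abelian_group) a_left_cancel:
  "\<lbrakk>x \<in> carrier G; y \<in> carrier G; z \<in> carrier G\<rbrakk> \<Longrightarrow> x \<oplus> y = x \<oplus> z \<longleftrightarrow> y = z"
  using add.Units_l_cancel[of x y z] add.Units_eq by simp

lemma one_forms_sel:
  "carrier (one_forms C) = grade C 1" "\<zero>\<^bsub>one_forms C\<^esub> = \<zero>\<^bsub>C\<^esub>" "add (one_forms C) = add C"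
  "smult (one_forms C) = smult C" "act (one_forms C) = act C" "lact (one_forms C) = mult C" "ract (one_forms C) = mult C"
  by (simp_all add: one_forms_def)

lemma star_algebra_calculus_sel:
  fixes C :: "('k, 'w, 'h) calculus"
  shows "grade (star_algebra K H F C) = grade C" "differential (star_algebra K H F C) = differential C"
  by (simp_all add: star_algebra_def)

context hopf_algebra
begin

context
  fixes A :: "('k, 'w, 'h, 'l) hmodule_scheme" and C :: "('k, 'w, 'h, 'o) calculus_scheme"
  assumes C: "H_covariant_calculus K H A C"
begin

interpretation C: H_covariant_calculus K H A C by (rule C)

lemma module_one_forms: "module K (one_forms C)"
proof -
  have "module K (C\<lparr>carrier := grade C 1\<rparr>)"
    by (rule submodule.submodule_is_module[OF C.grade_submodule C.module_axioms])
  then show ?thesis by (rule module_cong) (simp_all add: one_forms_sel)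
qed

lemma grade_subset: "\<theta> \<in> grade C n \<Longrightarrow> \<theta> \<in> carrier C"
  using C.submoduleE(1)[OF C.grade_submodule] by blast

lemma base_subset: "a \<in> carrier A \<Longrightarrow> a \<in> carrier C"
  using grade_subset[of a 0] C.grade_0 by simp

lemma base_mult_closed:
  assumes "a \<in> carrier A" "\<theta> \<in> grade C 1"
  shows "a \<otimes>\<^bsub>C\<^esub> \<theta> \<in> grade C 1" "\<theta> \<otimes>\<^bsub>C\<^esub> a \<in> grade C 1"
  using C.grade_mult[of a 0 \<theta> 1] C.grade_mult[of \<theta> 1 a 0] assms C.grade_0 by simp_all

lemma klinear_inclusion: "klinear K (one_forms C) C (\<lambda>\<theta>. \<theta>)"
  by (intro klinearI module_one_forms C.module_axioms) (simp_all add: one_forms_sel grade_subset)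

lemma kbilinear_one_forms_mult:
  "kbilinear K A (one_forms C) (one_forms C) (mult C)" "kbilinear K (one_forms C) A (one_forms C) (mult C)"
  by (intro kbilinearI klinearI module_one_forms C.A.module_axioms;
      simp add: one_forms_sel base_mult_closed base_subset grade_subset C.l_distr C.r_distr
        C.smult_mult_left C.smult_mult_right C.grade_0_add[symmetric] C.grade_0_smult[symmetric] del: One_nat_def)+

lemma H_module_one_forms: "H_module K H (one_forms C)"
  unfolding H_module_def H_module_axioms_def one_forms_sel
  by (simp add: module_one_forms C.act_grade grade_subset C.act_add_left C.act_add_right C.act_smult_left
      C.act_smult_right C.act_assoc C.act_unit)

text \<open>A deformed calculus forms its products as sums in the whole graded algebra, a deformed
  bimodule of one-forms as sums among one-forms; linearity of the inclusion identifies them. The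
  tensor is arbitrary, so that the statement applies to coproducts as well as to the inverse
  twist.\<close>

lemma star_op_one_forms:
  assumes t: "t \<in> carrier (ktensor K H H)" and a: "a \<in> carrier A" and th: "\<theta> \<in> grade C 1"
  shows "star_op t A (one_forms C) (one_forms C) (mult C) a \<theta> = tensor_lift C (\<lambda>p q. act C p a \<otimes>\<^bsub>C\<^esub> act C q \<theta>) t"
    and "star_op t (one_forms C) A (one_forms C) (mult C) \<theta> a = tensor_lift C (\<lambda>p q. act C p \<theta> \<otimes>\<^bsub>C\<^esub> act C q a) t"
proof -
  have th': "\<theta> \<in> carrier (one_forms C)" using th by (simp add: one_forms_sel)
  note r = kbilinear_rules[OF kbilinear_one_forms_mult(1)] kbilinear_rules[OF kbilinear_one_forms_mult(2)]
    act_rules[OF C.A.H_module_axioms] act_rules[OF H_module_one_forms] hopf_lin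
  have "star_op t A (one_forms C) (one_forms C) (mult C) a \<theta> =
      tensor_lift C (\<lambda>p q. act A p a \<otimes>\<^bsub>C\<^esub> act (one_forms C) q \<theta>) t"
    unfolding star_op_def by (rule lift_hom[OF klinear_inclusion _ t]) (assumption | rule r a th')+
  also have "\<dots> = tensor_lift C (\<lambda>p q. act C p a \<otimes>\<^bsub>C\<^esub> act C q \<theta>) t"
    by (rule liftH_cong[OF t]) (simp add: one_forms_sel C.act_grade_0 a)
  finally show "star_op t A (one_forms C) (one_forms C) (mult C) a \<theta> = tensor_lift C (\<lambda>p q. act C p a \<otimes>\<^bsub>C\<^esub> act C q \<theta>) t" .
  have "star_op t (one_forms C) A (one_forms C) (mult C) \<theta> a =
      tensor_lift C (\<lambda>p q. act (one_forms C) p \<theta> \<otimes>\<^bsub>C\<^esub> act A q a) t"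
    unfolding star_op_def by (rule lift_hom[OF klinear_inclusion _ t]) (assumption | rule r a th')+
  also have "\<dots> = tensor_lift C (\<lambda>p q. act C p \<theta> \<otimes>\<^bsub>C\<^esub> act C q a) t"
    by (rule liftH_cong[OF t]) (simp add: one_forms_sel C.act_grade_0 a)
  finally show "star_op t (one_forms C) A (one_forms C) (mult C) \<theta> a = tensor_lift C (\<lambda>p q. act C p \<theta> \<otimes>\<^bsub>C\<^esub> act C q a) t" .
qed

lemma H_bimodule_one_forms: "H_bimodule K H A (one_forms C)"
proof (rule H_bimoduleI)
  show "equivariant K H A (one_forms C) (one_forms C) (lact (one_forms C))"
    unfolding equivariant_def
    using C.A.H_module_axioms H_module_one_forms kbilinear_one_forms_mult(1)
      star_op_one_forms(1)[OF comult_closed, unfolded star_op_def]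
    by (simp add: one_forms_sel C.act_mult base_subset grade_subset)
  show "equivariant K H (one_forms C) A (one_forms C) (ract (one_forms C))"
    unfolding equivariant_def
    using C.A.H_module_axioms H_module_one_forms kbilinear_one_forms_mult(2)
      star_op_one_forms(2)[OF comult_closed, unfolded star_op_def]
    by (simp add: one_forms_sel C.act_mult base_subset grade_subset)
qed (simp_all add: one_forms_sel base_subset grade_subset C.m_assoc C.grade_0_mult[symmetric] C.grade_0_one[symmetric])

lemma klinear_differential: "klinear K A (one_forms C) (differential C)"
  using C.differential_linear[of 0] module_one_forms C.A.module_axioms
  unfolding klinear_def linear_map_def
  by (simp add: one_forms_sel C.grade_0 C.grade_0_add[symmetric] C.grade_0_smult[symmetric])

text \<open>Shows that the Leibniz term qualifies as a defect: pure tensors are equivariant and the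
  differential commutes with the action.\<close>

lemma equivariant_differential:
  assumes V: "H_bimodule K H A V"
  shows "equivariant K H V A (atensor H A V (one_forms C)) (\<lambda>v a. apure A V (one_forms C) v (differential C a))"
proof -
  interpret V: H_bimodule K H A V by (rule V)
  note eq = equivariant_apure[OF C.A.H_module_algebra_axioms V H_bimodule_one_forms]
  note b = equivariant_kbilinear[OF eq]
  note r = kbilinear_rules[OF b] klinear_comp[OF klinear_differential] klinear_closed[OF klinear_differential]
    act_rules[OF V.H_module_axioms] act_rules[OF C.A.H_module_axioms] V.module_axioms C.A.module_axioms hopf_lin
  have "act (atensor H A V (one_forms C)) \<xi> (apure A V (one_forms C) v (differential C a)) =
    tensor_lift (atensor H A V (one_forms C)) (\<lambda>p q. apure A V (one_forms C) (act V p v) (differential C (act A q a))) (comult H \<xi>)"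
    if "\<xi> \<in> carrier H" "v \<in> carrier V" "a \<in> carrier A" for \<xi> v a
  proof -
    have "differential C a \<in> carrier (one_forms C)" by (rule r that)+
    note equivariant_act[OF eq that(1,2) this]
    also have "tensor_lift (atensor H A V (one_forms C)) (\<lambda>p q. apure A V (one_forms C) (act V p v) (act (one_forms C) q (differential C a))) (comult H \<xi>) =
      tensor_lift (atensor H A V (one_forms C)) (\<lambda>p q. apure A V (one_forms C) (act V p v) (differential C (act A q a))) (comult H \<xi>)"
      using that C.grade_0 C.act_grade_0
      by (intro liftH_cong comult_closed) (simp_all add: one_forms_sel C.act_differential[of _ a 0])
    finally show ?thesis .
  qed
  moreover have "kbilinear K V A (atensor H A V (one_forms C)) (\<lambda>v a. apure A V (one_forms C) v (differential C a))"
    by (assumption | rule r)+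
  ultimately show ?thesis
    using V.H_module_axioms C.A.H_module_axioms equivariant_module(3)[OF eq] unfolding equivariant_def by simp
qed

end

text \<open>The defect cancels in the difference of two solutions, which is therefore right linear.
  The module of translations is specified only through its carrier, addition and zero, so that it
  may be the deformed bimodule or the bimodule of right linear maps itself.\<close>

lemma affine_space_defect:
  assumes A: "H_module_algebra K H A" and V: "H_bimodule K H A V" and W: "H_bimodule K H A W"
    and B: "\<And>v a. \<lbrakk>v \<in> carrier V; a \<in> carrier A\<rbrakk> \<Longrightarrow> B v a \<in> carrier W"
    and M: "module K M" "carrier M = carrier (hom_A K H A V W)" "add M = add (hom_K K H V W)"
      "\<zero>\<^bsub>M\<^esub> = \<zero>\<^bsub>hom_K K H V W\<^esub>"
  shows "affine_space_over K M {N \<in> carrier (hom_K K H V W). \<forall>v\<in>carrier V. \<forall>a\<in>carrier A.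
      N (ract V v a) = ract W (N v) a \<oplus>\<^bsub>W\<^esub> B v a} (\<lambda>N P. N \<oplus>\<^bsub>hom_K K H V W\<^esub> P)"
proof -
  let ?X = "hom_K K H V W"
  let ?C = "{N \<in> carrier ?X. \<forall>v\<in>carrier V. \<forall>a\<in>carrier A. N (ract V v a) = ract W (N v) a \<oplus>\<^bsub>W\<^esub> B v a}"
  interpret V: H_bimodule K H A V by (rule V)
  interpret W: H_bimodule K H A W by (rule W)
  interpret X: H_bimodule K H A ?X by (rule H_bimodule_hom_K[OF A V W])
  note sel = hom_A_sel[OF A V W]
  have cl: "P v \<in> carrier W" if "P \<in> carrier ?X" "v \<in> carrier V" for P v
    using klinear_closed[OF hom_K_klinear[OF that(1) V.module_axioms W.module_axioms] that(2)] .
  have hX: "P \<in> carrier ?X" if "P \<in> carrier (hom_A K H A V W)" for P using that by (simp add: sel(1))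
  have plus: "N \<oplus>\<^bsub>?X\<^esub> P \<in> ?C" if N: "N \<in> ?C" and P: "P \<in> carrier (hom_A K H A V W)" for N P
  proof -
    have "(N \<oplus>\<^bsub>?X\<^esub> P) (ract V v a) = ract W ((N \<oplus>\<^bsub>?X\<^esub> P) v) a \<oplus>\<^bsub>W\<^esub> B v a"
      if va: "v \<in> carrier V" "a \<in> carrier A" for v a
    proof -
      have c: "N v \<in> carrier W" "P v \<in> carrier W" using N hX[OF P] va cl by auto
      have "(N \<oplus>\<^bsub>?X\<^esub> P) (ract V v a) = (ract W (N v) a \<oplus>\<^bsub>W\<^esub> B v a) \<oplus>\<^bsub>W\<^esub> ract W (P v) a"
        using N P va by (simp add: hom_K_sel(3) V.ract_closed sel(1))
      also have "\<dots> = (ract W (N v) a \<oplus>\<^bsub>W\<^esub> ract W (P v) a) \<oplus>\<^bsub>W\<^esub> B v a"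
        using c va B[OF va] by (simp add: W.M.a_ac W.ract_closed)
      finally show ?thesis using c va by (simp add: hom_K_sel(3) W.ract_add_left)
    qed
    then show ?thesis using N hX[OF P] X.M.a_closed by simp
  qed
  have ex1: "\<exists>!P. P \<in> carrier (hom_A K H A V W) \<and> N \<oplus>\<^bsub>?X\<^esub> P = N'" if N: "N \<in> ?C" and N': "N' \<in> ?C" for N N'
  proof -
    have NX: "N \<in> carrier ?X" "N' \<in> carrier ?X" using N N' by auto
    let ?P = "N' \<ominus>\<^bsub>?X\<^esub> N"
    have PX: "?P \<in> carrier ?X" using NX by simp
    have NP: "N \<oplus>\<^bsub>?X\<^esub> ?P = N'" using NX by (simp add: X.M.minus_eq X.M.a_lcomm X.M.r_neg)
    have sum: "N v \<oplus>\<^bsub>W\<^esub> ?P v = N' v" if "v \<in> carrier V" for v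
      using fun_cong[OF NP, of v] that by (simp add: hom_K_sel(3))
    have "?P (ract V v a) = ract W (?P v) a" if va: "v \<in> carrier V" "a \<in> carrier A" for v a
    proof -
      have vr: "ract V v a \<in> carrier V" using va by (simp add: V.ract_closed)
      have c: "N v \<in> carrier W" "?P v \<in> carrier W" "?P (ract V v a) \<in> carrier W"
        using NX PX va vr cl by auto
      note c' = c W.ract_closed[OF va(2) c(1)] W.ract_closed[OF va(2) c(2)] B[OF va]
      have "(ract W (N v) a \<oplus>\<^bsub>W\<^esub> B v a) \<oplus>\<^bsub>W\<^esub> ?P (ract V v a) = N' (ract V v a)"
        using sum[OF vr] N va by simp
      also have "\<dots> = ract W (N v \<oplus>\<^bsub>W\<^esub> ?P v) a \<oplus>\<^bsub>W\<^esub> B v a"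
        using N' va sum[OF va(1)] by simp
      also have "\<dots> = (ract W (N v) a \<oplus>\<^bsub>W\<^esub> B v a) \<oplus>\<^bsub>W\<^esub> ract W (?P v) a"
        using c' va by (simp add: W.ract_add_left W.M.a_ac)
      finally show ?thesis using c' by (simp add: W.M.a_left_cancel)
    qed
    then have PA: "?P \<in> carrier (hom_A K H A V W)" using PX by (simp add: sel(1))
    show ?thesis
    proof (rule ex1I[of _ ?P])
      fix Q assume Q: "Q \<in> carrier (hom_A K H A V W) \<and> N \<oplus>\<^bsub>?X\<^esub> Q = N'"
      then have "N \<oplus>\<^bsub>?X\<^esub> Q = N \<oplus>\<^bsub>?X\<^esub> ?P" using NP by simp
      then show "Q = ?P" using X.M.a_left_cancel[OF _ _ PX, of N Q] NX hX Q by blast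
    qed (use PA NP in simp)
  qed
  show ?thesis
    unfolding affine_space_over_def M(2-4)
    using M(1) plus ex1 X.M.r_zero X.M.a_assoc hX by auto
qed

end


theorem theorem4p1:
  fixes K :: "'k ring"
    and H :: "('k, 'h) hopf_algebra"
    and F :: "('h, 'h) tensor"
    and A :: "('k, 'w, 'h) hmodule"
    and C :: "('k, 'w, 'h) calculus"
    and V :: "('k, 'v, 'h, 'w) hbimodule"
  assumes "cring K"
    and "hopf_algebra K H"
    and "twist K H F"
    and "H_module_algebra K H A"
    and "H_covariant_calculus K H A C"
    and "H_bimodule K H A V"
  shows
    "let HF = twisted_hopf K H F;
         As = star_algebra K H F A;
         Cs = star_algebra K H F C;
         Vs = star_bimodule K H F A V;
         W = atensor H A V (one_forms C);
         Ws = atensor HF As Vs (one_forms Cs);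
         D = quant_map_tilde K H F A C V
     in H_bimodule_iso K HF As
          (star_bimodule K H F A (hom_K K H V W)) (hom_K K HF Vs Ws) D \<and>
        H_bimodule_iso K HF As
          (star_bimodule K H F A (hom_A K H A V W)) (hom_A K HF As Vs Ws) D \<and>
        affine_iso K
          (star_bimodule K H F A (hom_A K H A V W))
          (connections K H A C V) (\<lambda>N P. N \<oplus>\<^bsub>hom_K K H V W\<^esub> P)
          (hom_A K HF As Vs Ws)
          (connections K HF As Cs Vs) (\<lambda>N P. N \<oplus>\<^bsub>hom_K K HF Vs Ws\<^esub> P)
          D D"
proof -
  interpret tw: hopf_twist K H F
    by (intro hopf_twist.intro hopf_twist_axioms.intro assms)
  define HF where "HF = twisted_hopf K H F"
  define G where "G = twist_inv K H F"
  interpret P: twist_pair K H HF F G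
    using tw.twist_pair_HF unfolding HF_def G_def tw.G_def .
  define As where "As = star_algebra K H F A"
  define Cs where "Cs = star_algebra K H F C"
  define Vs where "Vs = star_bimodule K H F A V"
  define \<Omega> where "\<Omega> = one_forms C"
  define \<Omega>s where "\<Omega>s = one_forms Cs"
  define W where "W = atensor H A V \<Omega>"
  define Ws where "Ws = atensor HF As Vs \<Omega>s"
  \<comment> \<open>\<open>D\<close> factors through the linear maps from \<open>Vs\<close> into
    \<open>W'\<close>, the deformation of \<open>V \<otimes> \<Omega>\<close>; the module
    \<open>Ws\<close> of the theorem is identified with \<open>W'\<close> by
    \<open>\<phi>\<close>.\<close>
  define W' where "W' = star_bimodule K H F A W"
  define D where "D = quant_map_tilde K H F A C V"
  define X where "X = hom_K K H V W"
  define Xs where "Xs = hom_K K HF Vs Ws"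
  note A = \<open>H_module_algebra K H A\<close> and V = \<open>H_bimodule K H A V\<close> and C = \<open>H_covariant_calculus K H A C\<close>
  interpret A: H_module_algebra K H A by (rule A)
  interpret V: H_bimodule K H A V by (rule V)
  interpret C: H_covariant_calculus K H A C by (rule C)
  have \<Omega>: "H_bimodule K H A \<Omega>" unfolding \<Omega>_def by (rule tw.H_bimodule_one_forms[OF C])
  interpret \<Omega>: H_bimodule K H A \<Omega> by (rule \<Omega>)
  have W: "H_bimodule K H A W" unfolding W_def by (rule tw.H_bimodule_atensor[OF A V \<Omega>])
  interpret W: H_bimodule K H A W by (rule W)
  have relA: "star_related_algebra G A As" unfolding As_def G_def by (rule star_related_star_algebra)
  have relV: "star_related G A V Vs" unfolding Vs_def G_def by (rule star_related_star_bimodule)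
  have relW: "star_related G A W W'" unfolding W'_def G_def by (rule star_related_star_bimodule)
  \<comment> \<open>One-forms of the deformed calculus are a deformation of the bimodule of
    one-forms: their actions are products in the deformed graded algebra, to which
    \<open>star_op_one_forms\<close> applies.\<close>
  have rel\<Omega>: "star_related G A \<Omega> \<Omega>s"
    unfolding star_related_def same_hmodule_def \<Omega>_def \<Omega>s_def one_forms_sel
    using tw.star_op_one_forms[OF C P.G_closed]
    by (simp add: Cs_def star_algebra_def G_def)
  note sameA = same_hmoduleD[OF star_related_algebraD(1)[OF relA]]
    and sameV = same_hmoduleD[OF star_relatedD(1)[OF relV]]
    and sameW = same_hmoduleD[OF star_relatedD(1)[OF relW]]
  note As = P.star_module_algebra[OF A relA] and Vs = P.star_H_bimodule[OF A relA V relV]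
    and \<Omega>s = P.star_H_bimodule[OF A relA \<Omega> rel\<Omega>] and W' = P.star_H_bimodule[OF A relA W relW]
  have Ws: "H_bimodule K HF As Ws" unfolding Ws_def by (rule P.H'.H_bimodule_atensor[OF As Vs \<Omega>s])
  interpret Ws: H_bimodule K HF As Ws by (rule Ws)
  interpret Vs: H_bimodule K HF As Vs by (rule Vs)
  interpret W': H_bimodule K HF As W' by (rule W')

  define \<phi> where "\<phi> = phimap H G A V \<Omega>"
  define \<psi> where "\<psi> = inv_into (carrier Ws) \<phi>"
  define Q where "Q = qmap K H G V W"
  \<comment> \<open>The definition composes over the carrier of \<open>V\<close>, which is also that
    of \<open>Vs\<close>.\<close>
  have D: "D = (\<lambda>N. compose (carrier Vs) \<psi> (Q N))"
    unfolding D_def quant_map_tilde_def[abs_def] Let_def phi_phimap quant_map_qmap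
    by (simp add: \<psi>_def \<phi>_def Q_def W_def Ws_def HF_def As_def Vs_def Cs_def \<Omega>_def \<Omega>s_def G_def
        sameV(1)[unfolded Vs_def])
  have \<phi>: "H_bimodule_iso K HF As Ws W' \<phi>"
    unfolding \<phi>_def Ws_def by (rule P.phimap_iso[OF A V \<Omega> relA relV rel\<Omega> relW[unfolded W_def]])
  note \<phi>D = H_bimodule_isoD[OF \<phi>]
  have \<psi>: "H_bimodule_iso K HF As W' Ws \<psi>" unfolding \<psi>_def by (rule H_bimodule_iso_inv[OF \<phi>])
  note \<psi>D = H_bimodule_isoD[OF \<psi>]
  \<comment> \<open>Deformation of evaluation comes first, postcomposition with the inverse of
    \<open>\<phi>\<close> second; each is an isomorphism of bimodules.\<close>
  have iso: "H_bimodule_iso K HF As (star_bimodule K H F A X) Xs D"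
    unfolding D Xs_def
  proof (rule H_bimodule_iso_trans[OF _ P.H'.H_bimodule_iso_hom_K[OF As Vs \<psi>]])
    show "H_bimodule_iso K HF As (star_bimodule K H F A X) (hom_K K HF Vs W') Q"
      unfolding Q_def X_def
      by (rule P.qmap_iso[OF A V W relA relV relW]) (simp add: G_def star_related_star_bimodule)
  qed
  note isoD = H_bimodule_isoD[OF iso]
  have carX: "carrier (star_bimodule K H F A X) = carrier X"
    by (simp add: star_bimodule_def)
  have Q_closed: "Q N \<in> carrier (hom_K K HF Vs W')" if "N \<in> carrier X" for N
    unfolding Q_def using that unfolding X_def by (rule P.qmap_closed[OF A V W relA relV relW])
  have D_closed: "D N \<in> carrier Xs" if "N \<in> carrier X" for N
    using klinear_closed[OF isoD(4)] that carX by simp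

  \<comment> \<open>One equivalence for both restrictions: zero defect gives right linear maps, the
    defect \<open>v \<otimes> d a\<close> gives connections. Being an equivalence, it yields
    surjectivity onto the restricted targets as well.\<close>
  have defect: "(\<forall>v\<in>carrier Vs. \<forall>a\<in>carrier As. D N (ract Vs v a) = ract Ws (D N v) a \<oplus>\<^bsub>Ws\<^esub> Bs v a) \<longleftrightarrow>
      (\<forall>v\<in>carrier V. \<forall>a\<in>carrier A. N (ract V v a) = ract W (N v) a \<oplus>\<^bsub>W\<^esub> B v a)"
    if N: "N \<in> carrier X" and B: "equivariant K H V A W B"
      and Bs: "\<And>v a. \<lbrakk>v \<in> carrier V; a \<in> carrier A\<rbrakk> \<Longrightarrow> Bs v a = \<psi> (star_op G V A W B v a)" for N B Bs
  proof -
    \<comment> \<open>The map \<open>\<psi>\<close> is injective, additive and compatible with the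
      right action, so the identity may be tested in \<open>W'\<close>, where
      \<open>qmap_defect_iff\<close> applies.\<close>
    have "D N (ract Vs v a) = ract Ws (D N v) a \<oplus>\<^bsub>Ws\<^esub> Bs v a \<longleftrightarrow>
      Q N (ract Vs v a) = ract W' (Q N v) a \<oplus>\<^bsub>W'\<^esub> star_op G V A W B v a"
      if v: "v \<in> carrier Vs" and a: "a \<in> carrier As" for v a
    proof -
      have va: "ract Vs v a \<in> carrier Vs" by (rule Vs.ract_closed[OF a v])
      have va': "v \<in> carrier V" "a \<in> carrier A" using v a by (simp_all add: sameV sameA)
      have QN: "Q N u \<in> carrier W'" if "u \<in> carrier Vs" for u
        using klinear_closed[OF hom_K_klinear[OF Q_closed[OF N] Vs.module_axioms W'.module_axioms] that] .
      have st: "star_op G V A W B v a \<in> carrier W'"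
        using kbilinear_closed[OF P.kbilinear_star_op[OF V.H_module_axioms A.H_module_axioms
              equivariant_kbilinear[OF B]] va'] by (simp add: sameW)
      have "ract Ws (D N v) a \<oplus>\<^bsub>Ws\<^esub> Bs v a = \<psi> (ract W' (Q N v) a \<oplus>\<^bsub>W'\<^esub> star_op G V A W B v a)"
        using QN[OF v] st W'.ract_closed[OF a QN[OF v]] v a
        by (simp add: D compose_eq Bs[OF va'] klinear_add[OF \<psi>D(4)] \<psi>D(7))
      moreover have "D N (ract Vs v a) = \<psi> (Q N (ract Vs v a))"
        using va by (simp add: D compose_eq)
      moreover have "ract W' (Q N v) a \<oplus>\<^bsub>W'\<^esub> star_op G V A W B v a \<in> carrier W'"
        using W'.ract_closed[OF a QN[OF v]] st by simp
      ultimately show ?thesis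
        using inj_on_eq_iff[OF bij_betw_imp_inj_on[OF \<psi>D(3)] QN[OF va]] by simp
    qed
    then have "(\<forall>v\<in>carrier Vs. \<forall>a\<in>carrier As. D N (ract Vs v a) = ract Ws (D N v) a \<oplus>\<^bsub>Ws\<^esub> Bs v a) \<longleftrightarrow>
      (\<forall>v\<in>carrier Vs. \<forall>a\<in>carrier As. Q N (ract Vs v a) = ract W' (Q N v) a \<oplus>\<^bsub>W'\<^esub> star_op G V A W B v a)"
      by blast
    also have "\<dots> \<longleftrightarrow> (\<forall>v\<in>carrier V. \<forall>a\<in>carrier A. N (ract V v a) = ract W (N v) a \<oplus>\<^bsub>W\<^esub> B v a)"
      unfolding Q_def by (rule P.qmap_defect_iff[OF A V W relA relV relW B N[unfolded X_def]])
    finally show ?thesis .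
  qed

  \<comment> \<open>The zero defect deforms to zero, which brings right linear maps under
    \<open>defect\<close>.\<close>
  have zero: "\<zero>\<^bsub>Ws\<^esub> = \<psi> (star_op G V A W (\<lambda>v a. \<zero>\<^bsub>W\<^esub>) v a)" for v a
    using lift_zero_fun[OF tw.module_axioms tw.module_axioms W.module_axioms P.G_closed] klinear_zero[OF \<psi>D(4)]
    by (simp add: star_op_def sameW)
  have hom_A_iff: "D N \<in> carrier (hom_A K HF As Vs Ws) \<longleftrightarrow> N \<in> carrier (hom_A K H A V W)"
    if N: "N \<in> carrier X" for N
  proof -
    have cl: "N v \<in> carrier W" if "v \<in> carrier V" for v
      using klinear_closed[OF hom_K_klinear[OF N[unfolded X_def] V.module_axioms W.module_axioms] that] .
    have cls: "D N v \<in> carrier Ws" if "v \<in> carrier Vs" for v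
      using klinear_closed[OF hom_K_klinear[OF D_closed[OF N, unfolded Xs_def] Vs.module_axioms Ws.module_axioms] that] .
    show ?thesis
      using defect[OF N tw.equivariant_zero[OF A V W] zero] N D_closed[OF N]
      unfolding tw.hom_A_sel(1)[OF A V W] P.H'.hom_A_sel(1)[OF As Vs Ws] X_def Xs_def
      by (simp add: cl cls W.ract_closed Ws.ract_closed)
  qed
  \<comment> \<open>Since the differential commutes with the action, deforming
    \<open>v \<otimes> d a\<close> with respect to the form \<open>d a\<close> is the same as
    deforming it with respect to \<open>a\<close>. Hence the Leibniz term of the deformed calculus
    is the deformed Leibniz term.\<close>
  have diff: "apure As Vs \<Omega>s v (differential Cs a) =
      \<psi> (star_op G V A W (\<lambda>v a. apure A V \<Omega> v (differential C a)) v a)"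
    if va: "v \<in> carrier V" "a \<in> carrier A" for v a
  proof -
    have da: "differential C a \<in> carrier \<Omega>"
      unfolding \<Omega>_def by (rule klinear_closed[OF tw.klinear_differential[OF C] va(2)])
    have "\<phi> (apure As Vs \<Omega>s v (differential C a)) = star_op G V \<Omega> W (apure A V \<Omega>) v (differential C a)"
      unfolding \<phi>_def W_def by (rule P.phimap_apure[OF A V \<Omega> relA relV rel\<Omega> va(1) da])
    also have "\<dots> = star_op G V A W (\<lambda>v a. apure A V \<Omega> v (differential C a)) v a"
      unfolding star_op_def using va C.grade_0 C.act_grade_0
      by (intro tw.liftH_cong P.G_closed) (simp add: \<Omega>_def one_forms_sel C.act_differential[of _ a 0])
    finally have eq: "\<phi> (apure As Vs \<Omega>s v (differential C a)) = star_op G V A W (\<lambda>v a. apure A V \<Omega> v (differential C a)) v a" .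
    have "apure As Vs \<Omega>s v (differential C a) \<in> carrier Ws"
      unfolding Ws_def using va da
      by (intro P.H'.apure_closed[OF As Vs \<Omega>s]) (simp_all add: sameV same_hmoduleD[OF star_relatedD(1)[OF rel\<Omega>]])
    then show ?thesis
      using bij_betw_inv_into_left[OF \<phi>D(3)] unfolding eq[symmetric] \<psi>_def Cs_def star_algebra_calculus_sel by simp
  qed
  note Beq = tw.equivariant_differential[OF C V, folded \<Omega>_def, folded W_def]
  have con: "connections K H A C V = {N \<in> carrier X. \<forall>v\<in>carrier V. \<forall>a\<in>carrier A.
      N (ract V v a) = ract W (N v) a \<oplus>\<^bsub>W\<^esub> apure A V \<Omega> v (differential C a)}"
    unfolding connections_def Let_def X_def W_def \<Omega>_def ..
  have cons: "connections K HF As Cs Vs = {N \<in> carrier Xs. \<forall>v\<in>carrier Vs. \<forall>a\<in>carrier As.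
      N (ract Vs v a) = ract Ws (N v) a \<oplus>\<^bsub>Ws\<^esub> apure As Vs \<Omega>s v (differential Cs a)}"
    unfolding connections_def Let_def Xs_def Ws_def \<Omega>s_def ..
  have con_iff: "D N \<in> connections K HF As Cs Vs \<longleftrightarrow> N \<in> connections K H A C V" if N: "N \<in> carrier X" for N
    unfolding con cons using defect[OF N Beq diff] N D_closed[OF N] by simp

  have HA: "H_bimodule K H A (hom_A K H A V W)" by (rule tw.H_bimodule_hom_A[OF A V W])
  have HAs: "H_bimodule K HF As (hom_A K HF As Vs Ws)" by (rule P.H'.H_bimodule_hom_A[OF As Vs Ws])
  interpret X: H_bimodule K H A X unfolding X_def by (rule tw.H_bimodule_hom_K[OF A V W])
  interpret HA: H_bimodule K H A "hom_A K H A V W" by (rule HA)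
  let ?SA = "star_bimodule K H F A (hom_A K H A V W)"
  have SA: "H_bimodule K HF As ?SA"
    by (rule P.star_H_bimodule[OF A relA HA]) (simp add: G_def star_related_star_bimodule)
  note sel = tw.hom_A_sel[OF A V W, folded X_def] and sels = P.H'.hom_A_sel[OF As Vs Ws, folded Xs_def]
  have sub: "carrier (hom_A K H A V W) \<subseteq> carrier X" "carrier (hom_A K HF As Vs Ws) \<subseteq> carrier Xs"
    unfolding sel(1) sels(1) by auto
  have hom_A_fields: "add (hom_A K H A V W) = add X" "smult (hom_A K H A V W) = smult X" "act (hom_A K H A V W) = act X"
    "lact (hom_A K H A V W) = lact X" "ract (hom_A K H A V W) = ract X" "\<zero>\<^bsub>hom_A K H A V W\<^esub> = \<zero>\<^bsub>X\<^esub>"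
    "add (hom_A K HF As Vs Ws) = add Xs" "smult (hom_A K HF As Vs Ws) = smult Xs" "act (hom_A K HF As Vs Ws) = act Xs"
    "lact (hom_A K HF As Vs Ws) = lact Xs" "ract (hom_A K HF As Vs Ws) = ract Xs" "\<zero>\<^bsub>hom_A K HF As Vs Ws\<^esub> = \<zero>\<^bsub>Xs\<^esub>"
    by (simp_all add: hom_A_def X_def Xs_def)
  \<comment> \<open>The deformed actions on right linear maps are sums formed in the smaller module;
    this identifies them with sums formed among all linear maps.\<close>
  have lift_hom_A: "tensor_lift (hom_A K H A V W) b G = tensor_lift X b G" if "kbilinear K H H (hom_A K H A V W) b" for b
  proof -
    have "klinear K (hom_A K H A V W) X (\<lambda>x. x)"
      using sub by (intro klinearI HA.module_axioms X.module_axioms) (auto simp: hom_A_fields)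
    from lift_hom[OF this that P.G_closed] show ?thesis .
  qed
  note eqHA = tw.H_bimodule_equivariant[OF A HA]
  note rHA = kbilinear_rules[OF equivariant_kbilinear[OF eqHA(1)]] kbilinear_rules[OF equivariant_kbilinear[OF eqHA(2)]]
    tw.act_rules[OF HA.H_module_axioms] tw.act_rules[OF A.H_module_axioms] tw.hopf_lin
  have lSA: "lact ?SA a N = lact (star_bimodule K H F A X) a N"
    if "a \<in> carrier A" "N \<in> carrier (hom_A K H A V W)" for a N
  proof -
    have "kbilinear K H H (hom_A K H A V W) (\<lambda>p q. lact (hom_A K H A V W) (act A p a) (act (hom_A K H A V W) q N))"
      by (assumption | rule rHA that)+
    from lift_hom_A[OF this] show ?thesis by (simp add: star_bimodule_def G_def hom_A_fields)
  qed
  have rSA: "ract ?SA N a = ract (star_bimodule K H F A X) N a"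
    if "a \<in> carrier A" "N \<in> carrier (hom_A K H A V W)" for a N
  proof -
    have "kbilinear K H H (hom_A K H A V W) (\<lambda>p q. ract (hom_A K H A V W) (act (hom_A K H A V W) p N) (act A q a))"
      by (assumption | rule rHA that)+
    from lift_hom_A[OF this] show ?thesis by (simp add: star_bimodule_def G_def hom_A_fields)
  qed
  have SA_fields: "carrier ?SA = carrier (hom_A K H A V W)" "add ?SA = add X" "smult ?SA = smult X" "act ?SA = act X"
    "\<zero>\<^bsub>?SA\<^esub> = \<zero>\<^bsub>X\<^esub>"
    "add (star_bimodule K H F A X) = add X" "smult (star_bimodule K H F A X) = smult X" "act (star_bimodule K H F A X) = act X"
    by (simp_all add: star_bimodule_def hom_A_fields)
  have iso_A: "H_bimodule_iso K HF As ?SA (hom_A K HF As Vs Ws) D"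
    by (rule H_bimodule_iso_restrict[OF iso SA HAs])
      (use sub lSA rSA hom_A_iff in \<open>auto simp: carX SA_fields hom_A_fields sameA\<close>)
  note iso_AD = H_bimodule_isoD[OF iso_A]

  \<comment> \<open>The translations enter in their deformed form, whose addition is still pointwise
    addition of linear maps.\<close>
  have aff: "affine_space_over K ?SA (connections K H A C V) (\<lambda>N P. N \<oplus>\<^bsub>X\<^esub> P)"
    unfolding con X_def
    by (rule tw.affine_space_defect[OF A V W])
      (auto simp: SA_fields X_def[symmetric] H_bimodule_module[OF SA] intro: kbilinear_closed[OF equivariant_kbilinear[OF Beq]])
  have Bs_closed: "apure As Vs \<Omega>s v (differential Cs a) \<in> carrier Ws" if "v \<in> carrier Vs" "a \<in> carrier As" for v a
  proof -
    have va: "v \<in> carrier V" "a \<in> carrier A" using that by (simp_all add: sameV sameA)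
    show ?thesis
      unfolding diff[OF va]
      using kbilinear_closed[OF P.kbilinear_star_op[OF V.H_module_axioms A.H_module_axioms
          equivariant_kbilinear[OF Beq]] va]
      by (intro klinear_closed[OF \<psi>D(4)]) (simp add: sameW)
  qed
  have affs: "affine_space_over K (hom_A K HF As Vs Ws) (connections K HF As Cs Vs) (\<lambda>N P. N \<oplus>\<^bsub>Xs\<^esub> P)"
    unfolding cons Xs_def
    by (rule P.H'.affine_space_defect[OF As Vs Ws])
      (auto simp: hom_A_fields Xs_def[symmetric] H_bimodule_module[OF HAs] intro: Bs_closed)
  have bij_con: "bij_betw D (connections K H A C V) (connections K HF As Cs Vs)"
  proof -
    have bij: "bij_betw D (carrier X) (carrier Xs)" using isoD(3) carX by simp
    have subc: "connections K H A C V \<subseteq> carrier X" "connections K HF As Cs Vs \<subseteq> carrier Xs"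
      unfolding con cons by auto
    have "D ` connections K H A C V = connections K HF As Cs Vs"
    proof
      show "D ` connections K H A C V \<subseteq> connections K HF As Cs Vs" using con_iff subc by auto
      show "connections K HF As Cs Vs \<subseteq> D ` connections K H A C V"
      proof
        fix N assume N: "N \<in> connections K HF As Cs Vs"
        then obtain M where "M \<in> carrier X" "N = D M" using bij subc unfolding bij_betw_def by blast
        then show "N \<in> D ` connections K H A C V" using N con_iff by auto
      qed
    qed
    then show ?thesis using bij subc unfolding bij_betw_def by (auto intro: inj_on_subset)
  qed
  \<comment> \<open>The linear part of \<open>D\<close> on connections is again \<open>D\<close>,
    because both are restrictions of one additive map on all linear maps.\<close>
  have "affine_iso K ?SA (connections K H A C V) (\<lambda>N P. N \<oplus>\<^bsub>X\<^esub> P)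
      (hom_A K HF As Vs Ws) (connections K HF As Cs Vs) (\<lambda>N P. N \<oplus>\<^bsub>Xs\<^esub> P) D D"
    unfolding affine_iso_def
  proof (intro conjI aff affs bij_con iso_AD(3) ballI)
    show "linear_map K ?SA (hom_A K HF As Vs Ws) D" using iso_AD(4) unfolding klinear_def by simp
    fix N P assume "N \<in> connections K H A C V" "P \<in> carrier ?SA"
    then have "N \<in> carrier X" "P \<in> carrier X" using sub by (auto simp: con SA_fields)
    then show "D (N \<oplus>\<^bsub>X\<^esub> P) = D N \<oplus>\<^bsub>Xs\<^esub> D P"
      using klinear_add[OF isoD(4)] by (simp add: carX SA_fields)
  qed
  with iso iso_A show ?thesis
    unfolding Let_def X_def Xs_def W_def Ws_def D_def HF_def As_def Vs_def Cs_def \<Omega>_def \<Omega>s_def by simp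
qed

end
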